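(* Let $(\mathcal R,\mathcal{NC})$ be an admissible pair, $n\ge0$, and let $G_n$ be the set of monodromy maps of depth $n$ balanced $(\mathcal R,\mathcal{NC})$-admissible polycycles (the monodromy map being based at a point $\gamma(0)$ for a parametrization $\gamma$ with $D(\gamma,t)\le0$ for all $t$). With $G_n^{\log}=\{\Delta^{\log}:\Delta\in G_n\}$ we have $$G_n^{\log}\subset\langle\mathcal{A}ff,\,A^i\mathcal R^0,\,A^j\mathcal{NC}\mid 0\le i\le n,\ 0\le j\le n-1\rangle.$$
   Context: Notation. Germs are germs at $+\infty$ of real functions; $f^k$ is $k$-fold composition; composition of sets is elementwise. $\mathcal{A}ff=\{\zeta\mapsto\alpha\zeta+\beta:\alpha,\beta\in\mathbb R,\alpha>0\}$; $A(h)=\ln\circ h\circ\exp$ and $A^n$ is its $n$-th iterate; $\langle\cdot\rangle$ is the group generated under composition; $g^{\log}(\zeta)=-\ln(g(e^{-\zeta}))$. Admissible pair. Sets of germs $\mathcal R,\mathcal{NC}$ such that: (1) $f^{\log}\in\mathcal R$ for each real analytic germ $f$ at $0$ with $f(0)=0$, $f(x)>0$ for small $x>0$; (2) $\mathcal{A}ff\subset\mathcal R$; (3) for each $\beta\in\mathbb R$, $\zeta\mapsto\zeta+\ln(1+\beta e^{-\zeta})$ is in $\mathcal R$; (4) each $f\in\mathcal R$ is either in $\mathcal{A}ff$ or there are $\lambda>\mu>0$ and $a\in\mathcal{A}ff$ with $e^{-\lambda x}<|f(x)-a(x)|<e^{-\mu x}$ for all large $x$; $\mathcal R^0$ denotes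 the set of those $f$ for which $a=\mathrm{id}$, together with $\mathrm{id}$; (5) the same dichotomy holds for $\mathcal{NC}$ but with $a$ always the identity, and $\mathcal{NC}\cap\mathcal{A}ff=\{\mathrm{id}\}$; (6) $\mathcal R$ is a group under composition. Polycycles. A polycycle $\Gamma$ of a real analytic vector field on a real analytic $2$-manifold consists of a finite cyclically ordered collection of equilibria together with trajectories joining consecutive equilibria in the compatible direction. It is assumed homeomorphic to a circle, with all equilibria elementary (at least one nonzero eigenvalue) and with a monodromy (first return) map $\Delta$ on one side, taken as a germ at $0$ in an analytic coordinate $z\ge0$ on an analytic half-transversal at a non-equilibrium point. On that side each equilibrium is a hyperbolic or semihyperbolic (one zero eigenvalue) saddle; the latter is passed either from the centre direction (leaving along the hyperbolic direction) or from the hyperbolic direction (leaving along the centre direction). A hyperbolic saddle is $(\mathcal R,\mathcal{NC})$-admissible along a quadrant if for some analytic sections its Dulac (transit) map in the logarithmic chart is in $\mathcal R$; a semihyperbolic saddle is admissible along a quadrant if for some analytic sections its Dulac map from the hyperbolic to the centre direction (the transit in the other direction being its inverse) is, in the logarithmic chart, in $\mathcal R^0\circ\exp\circ\mathcal R^0\circ\mathcal{NC}\circ\mathcal{A}ff$. A polycycle is admissible if all its saddles are. Balanced, depth. Let $\gamma:[0,1]\to\Gamma$ parametrize $\Gamma$ in the direction of the flow, starting and ending at a non-equilibrium point, injective on $(0,1)$. $D(\gamma,t)=\#\{$semihyperbolic saddles in $\gamma((0,t])$ passed from the centre direction$\}-\#\{$those passed from the hyperbolic direction$\}$. $\Gamma$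 is balanced if $D(\gamma,1)=0$; then $\gamma$ can be chosen with $D(\gamma,t)\le0$ for all $t$, and the depth of $\Gamma$ is $-\min_tD(\gamma,t)$ for such $\gamma$. *)

theory Defs
  imports "HOL-Analysis.Analysis" "HOL-Algebra.Coset" "HOL-Algebra.Generated_Groups"
begin

section \<open>Germs at infinity\<close>

text \<open>
  Only germs tending to \<open>+\<infinity>\<close> are represented: they are the ones that can be composed, and all
  germs occurring below (those allowed in an admissible pair and \<open>exp\<close>) are of this kind.
  \<open>germ_of f\<close> is unspecified when \<open>f\<close> does not tend to \<open>+\<infinity>\<close>.
\<close>

definition germ_rel :: "(real \<Rightarrow> real) \<Rightarrow> (real \<Rightarrow> real) \<Rightarrow> bool" where
  "germ_rel f g \<longleftrightarrow> filterlim f at_top at_top \<and> filterlim g at_top at_top \<and>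
     eventually (\<lambda>x. f x = g x) at_top"

quotient_type germ = "real \<Rightarrow> real" / partial: germ_rel
  morphisms rep_germ germ_of
proof (rule part_equivpI)
  show "\<exists>f. germ_rel f f"
    by (intro exI[of _ "\<lambda>x. x"]) (simp add: germ_rel_def filterlim_ident)
  show "symp germ_rel"
    by (rule sympI) (simp add: germ_rel_def eq_commute)
  show "transp germ_rel"
    by (rule transpI) (auto simp: germ_rel_def elim: eventually_elim2)
qed

lift_definition germ_id :: germ is "\<lambda>x. x"
  by (simp add: germ_rel_def filterlim_ident)

lift_definition germ_comp :: "germ \<Rightarrow> germ \<Rightarrow> germ" is "\<lambda>f g x. f (g x)"
proof -
  fix f f' g g' :: "real \<Rightarrow> real"
  assume f: "germ_rel f f'" and g: "germ_rel g g'"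
  have "eventually (\<lambda>x. f (g x) = f' (g x)) at_top"
    using f g eventually_compose_filterlim[of "\<lambda>y. f y = f' y" at_top g at_top]
    by (simp add: germ_rel_def)
  moreover have "eventually (\<lambda>x. g x = g' x) at_top"
    using g by (simp add: germ_rel_def)
  ultimately have "eventually (\<lambda>x. f (g x) = f' (g' x)) at_top"
    by eventually_elim simp
  then show "germ_rel (\<lambda>x. f (g x)) (\<lambda>x. f' (g' x))"
    using f g filterlim_compose[of f at_top at_top g at_top]
      filterlim_compose[of f' at_top at_top g' at_top]
    by (simp add: germ_rel_def)
qed

definition germ_monoid :: "germ monoid" where
  "germ_monoid = \<lparr>carrier = UNIV, mult = germ_comp, one = germ_id\<rparr>"

lemma monoid_germ_monoid: "monoid germ_monoid"
proof (rule monoidI; simp add: germ_monoid_def)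
  show "germ_comp (germ_comp f g) h = germ_comp f (germ_comp g h)" for f g h
    by transfer (auto simp: germ_rel_def intro: filterlim_compose)
  show "germ_comp germ_id f = f" "germ_comp f germ_id = f" for f
    by (transfer, simp add: germ_rel_def)+
qed

text \<open>The group of all germs that are invertible under composition.\<close>

definition germ_group :: "germ monoid" where
  "germ_group = units_of germ_monoid"

lemma group_germ_group: "Group.group germ_group"
  unfolding germ_group_def by (rule monoid.units_group[OF monoid_germ_monoid])

text \<open>
  The generated group only makes sense for invertible germs, and the axioms of an admissible pair do
  not literally say that the elements of \<open>NC\<close> are invertible; the intersection keeps this a
  subgroup of \<^const>\<open>germ_group\<close> in all cases and is vacuous if \<open>H\<close> consists of invertible germs.
\<close>

definition generated_group :: "germ set \<Rightarrow> germ set" where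
  "generated_group H = generate germ_group (H \<inter> carrier germ_group)"

lift_definition conj_exp :: "germ \<Rightarrow> germ" is "\<lambda>h x. ln (h (exp x))"
proof -
  fix f g :: "real \<Rightarrow> real"
  assume *: "germ_rel f g"
  have "eventually (\<lambda>x. f (exp x) = g (exp x)) at_top"
    using * eventually_compose_filterlim[OF _ exp_at_top, of "\<lambda>y. f y = g y"]
    by (simp add: germ_rel_def)
  then have "eventually (\<lambda>x. ln (f (exp x)) = ln (g (exp x))) at_top"
    by eventually_elim simp
  then show "germ_rel (\<lambda>x. ln (f (exp x))) (\<lambda>x. ln (g (exp x)))"
    using * filterlim_compose[OF ln_at_top filterlim_compose[OF _ exp_at_top]]
    by (simp add: germ_rel_def)
qed

definition Aff :: "germ set" where
  "Aff = {germ_of (\<lambda>x. \<alpha> * x + \<beta>) | \<alpha> \<beta>. \<alpha> > 0}"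

lift_definition exp_close :: "real \<Rightarrow> real \<Rightarrow> germ \<Rightarrow> germ \<Rightarrow> bool" is
  "\<lambda>\<nu> \<mu> f a. eventually (\<lambda>x. exp (- \<nu> * x) < \<bar>f x - a x\<bar> \<and> \<bar>f x - a x\<bar> < exp (- \<mu> * x)) at_top"
proof -
  fix l m :: real and f f' a a' :: "real \<Rightarrow> real"
  assume "germ_rel f f'" "germ_rel a a'"
  then have "eventually (\<lambda>x. f x = f' x \<and> a x = a' x) at_top"
    by (simp add: germ_rel_def eventually_conj)
  then show "eventually (\<lambda>x. exp (- l * x) < \<bar>f x - a x\<bar> \<and> \<bar>f x - a x\<bar> < exp (- m * x)) at_top =
    eventually (\<lambda>x. exp (- l * x) < \<bar>f' x - a' x\<bar> \<and> \<bar>f' x - a' x\<bar> < exp (- m * x)) at_top"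
    by (rule eventually_cong) simp
qed

text \<open>The chart \<open>\<zeta> = - ln z\<close> takes germs at \<open>0\<^sup>+\<close> to germs at \<open>+\<infinity>\<close>.\<close>

definition log_chart :: "(real \<Rightarrow> real) \<Rightarrow> real \<Rightarrow> real" where
  "log_chart g = (\<lambda>\<zeta>. - ln (g (exp (- \<zeta>))))"


section \<open>Real analyticity\<close>

definition real_analytic_at :: "(real \<Rightarrow> real) \<Rightarrow> real \<Rightarrow> bool" where
  "real_analytic_at f x \<longleftrightarrow>
     (\<exists>a r. r > 0 \<and> (\<forall>h. \<bar>h\<bar> < r \<longrightarrow> (\<lambda>n. a n * h ^ n) sums f (x + h)))"

definition real_analytic2_at :: "(real \<times> real \<Rightarrow> real) \<Rightarrow> real \<times> real \<Rightarrow> bool" where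
  "real_analytic2_at f x \<longleftrightarrow>
     (\<exists>(a :: nat \<Rightarrow> nat \<Rightarrow> real) r. r > 0 \<and> (\<forall>h k. \<bar>h\<bar> < r \<and> \<bar>k\<bar> < r \<longrightarrow>
        ((\<lambda>(i, j). a i j * h ^ i * k ^ j) has_sum f (x + (h, k))) UNIV))"

definition real_analytic_map_on :: "(real \<times> real \<Rightarrow> real \<times> real) \<Rightarrow> (real \<times> real) set \<Rightarrow> bool" where
  "real_analytic_map_on F S \<longleftrightarrow>
     (\<forall>x\<in>S. real_analytic2_at (fst \<circ> F) x \<and> real_analytic2_at (snd \<circ> F) x)"

definition real_analytic_curve_at :: "(real \<Rightarrow> real \<times> real) \<Rightarrow> real \<Rightarrow> bool" where
  "real_analytic_curve_at c t \<longleftrightarrow> real_analytic_at (fst \<circ> c) t \<and> real_analytic_at (snd \<circ> c) t"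


section \<open>Admissible pairs\<close>

definition R0 :: "germ set \<Rightarrow> germ set" where
  "R0 R = {f \<in> R. f = germ_id \<or> (\<exists>\<nu> \<mu>. \<nu> > \<mu> \<and> \<mu> > 0 \<and> exp_close \<nu> \<mu> f germ_id)}"

definition admissible_pair :: "germ set \<Rightarrow> germ set \<Rightarrow> bool" where
  "admissible_pair R NC \<longleftrightarrow>
     (\<forall>f. real_analytic_at f 0 \<and> f 0 = 0 \<and> eventually (\<lambda>x. f x > 0) (at_right 0) \<longrightarrow>
        germ_of (log_chart f) \<in> R) \<and>
     Aff \<subseteq> R \<and>
     (\<forall>\<beta>. germ_of (\<lambda>\<zeta>. \<zeta> + ln (1 + \<beta> * exp (- \<zeta>))) \<in> R) \<and>
     (\<forall>f\<in>R. f \<in> Aff \<or>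
        (\<exists>\<nu> \<mu>. \<nu> > \<mu> \<and> \<mu> > 0 \<and> (\<exists>a\<in>Aff. exp_close \<nu> \<mu> f a))) \<and>
     (\<forall>f\<in>NC. f \<in> Aff \<or> (\<exists>\<nu> \<mu>. \<nu> > \<mu> \<and> \<mu> > 0 \<and> exp_close \<nu> \<mu> f germ_id)) \<and>
     NC \<inter> Aff = {germ_id} \<and>
     subgroup R germ_group"


section \<open>Analytic vector fields on analytic surfaces\<close>

type_synonym 'm chart = "'m set \<times> ('m \<Rightarrow> real \<times> real)"

text \<open>
  A vector field is given by its coordinate expressions: \<open>vfield S C\<close> is the expression in the
  chart \<open>C\<close>, a map on the image of \<open>C\<close>.
\<close>

record 'm surface_field =
  surf :: "'m topology"
  charts :: "'m chart set"
  vfield :: "'m chart \<Rightarrow> real \<times> real \<Rightarrow> real \<times> real"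

definition transition :: "'m chart \<Rightarrow> 'm chart \<Rightarrow> real \<times> real \<Rightarrow> real \<times> real" where
  "transition C C' = snd C' \<circ> inv_into (fst C) (snd C)"

definition analytic_surface :: "('m, 'z) surface_field_scheme \<Rightarrow> bool" where
  "analytic_surface S \<longleftrightarrow>
     Hausdorff_space (surf S) \<and> second_countable (surf S) \<and>
     topspace (surf S) = (\<Union>C\<in>charts S. fst C) \<and>
     (\<forall>C\<in>charts S. openin (surf S) (fst C) \<and> open (snd C ` fst C) \<and>
        homeomorphic_map (subtopology (surf S) (fst C)) (top_of_set (snd C ` fst C)) (snd C)) \<and>
     (\<forall>C\<in>charts S. \<forall>C'\<in>charts S.
        real_analytic_map_on (transition C C') (snd C ` (fst C \<inter> fst C')))"

definition analytic_vector_field :: "('m, 'z) surface_field_scheme \<Rightarrow> bool" where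
  "analytic_vector_field S \<longleftrightarrow>
     (\<forall>C\<in>charts S. real_analytic_map_on (vfield S C) (snd C ` fst C)) \<and>
     (\<forall>C\<in>charts S. \<forall>C'\<in>charts S. \<forall>p\<in>fst C \<inter> fst C'.
        vfield S C' (snd C' p) =
          frechet_derivative (transition C C') (at (snd C p)) (vfield S C (snd C p)))"

definition equilibrium :: "('m, 'z) surface_field_scheme \<Rightarrow> 'm \<Rightarrow> bool" where
  "equilibrium S p \<longleftrightarrow> (\<exists>C\<in>charts S. p \<in> fst C \<and> vfield S C (snd C p) = 0)"

definition integral_curve ::
  "('m, 'z) surface_field_scheme \<Rightarrow> (real \<Rightarrow> 'm) \<Rightarrow> real set \<Rightarrow> bool" where
  "integral_curve S u I \<longleftrightarrow>
     continuous_map (top_of_set I) (surf S) u \<and>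
     (\<forall>t\<in>I. \<exists>C\<in>charts S. u t \<in> fst C \<and>
        ((snd C \<circ> u) has_vector_derivative vfield S C (snd C (u t))) (at t within I))"

text \<open>
  \<open>c\<close>, restricted to \<open>[a,b]\<close>, is an increasing continuous reparametrization of a piece of
  trajectory.
\<close>

definition orbit_segment ::
  "('m, 'z) surface_field_scheme \<Rightarrow> (real \<Rightarrow> 'm) \<Rightarrow> real \<Rightarrow> real \<Rightarrow> bool" where
  "orbit_segment S c a b \<longleftrightarrow>
     (\<exists>u T h. integral_curve S u {0..T} \<and>
        continuous_on {a..b} h \<and> strict_mono_on {a..b} h \<and> h a = 0 \<and> h b = T \<and>
        (\<forall>s\<in>{a..b}. c s = u (h s)))"


section \<open>Equilibria\<close>

text \<open>
  Eigenvalues of the linear part do not depend on the chart, since the field vanishes at \<open>p\<close>.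
\<close>

definition eigenpair ::
  "('m, 'z) surface_field_scheme \<Rightarrow> 'm chart \<Rightarrow> 'm \<Rightarrow> real \<Rightarrow> real \<times> real \<Rightarrow> bool" where
  "eigenpair S C p \<nu> v \<longleftrightarrow>
     v \<noteq> 0 \<and> frechet_derivative (vfield S C) (at (snd C p)) v = \<nu> *\<^sub>R v"

definition hyperbolic_saddle :: "('m, 'z) surface_field_scheme \<Rightarrow> 'm \<Rightarrow> bool" where
  "hyperbolic_saddle S p \<longleftrightarrow> equilibrium S p \<and>
     (\<exists>C\<in>charts S. p \<in> fst C \<and>
        (\<exists>\<nu> \<mu> v w. \<nu> < 0 \<and> 0 < \<mu> \<and> eigenpair S C p \<nu> v \<and> eigenpair S C p \<mu> w))"

text \<open>
  \<open>\<gamma>\<close> arrives at (leaves from) \<open>\<gamma> s\<close> tangentially to the vector \<open>v\<close>, in the coordinates \<open>C\<close>, when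
  \<open>F\<close> is the filter of left (right) neighbourhoods of \<open>s\<close>.
\<close>

definition tangent_to ::
  "'m chart \<Rightarrow> (real \<Rightarrow> 'm) \<Rightarrow> real \<Rightarrow> real filter \<Rightarrow> real \<times> real \<Rightarrow> bool" where
  "tangent_to C \<gamma> s F v \<longleftrightarrow> ((\<lambda>t. sgn (snd C (\<gamma> t) - snd C (\<gamma> s))) \<longlongrightarrow> sgn v) F"

text \<open>
  The centre direction is the kernel of the linear part.  That a semihyperbolic equilibrium is of
  saddle type in the quadrant under consideration is expressed by the existence of the Dulac map in
  the notion of admissibility below.
\<close>

definition passes_from_centre ::
  "('m, 'z) surface_field_scheme \<Rightarrow> (real \<Rightarrow> 'm) \<Rightarrow> real \<Rightarrow> bool" where
  "passes_from_centre S \<gamma> s \<longleftrightarrow> equilibrium S (\<gamma> s) \<and>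
     (\<exists>C\<in>charts S. \<gamma> s \<in> fst C \<and>
        (\<exists>\<nu> v w. \<nu> \<noteq> 0 \<and> eigenpair S C (\<gamma> s) 0 v \<and> eigenpair S C (\<gamma> s) \<nu> w \<and>
           tangent_to C \<gamma> s (at_left s) v \<and> tangent_to C \<gamma> s (at_right s) w))"

definition passes_from_hyperbolic ::
  "('m, 'z) surface_field_scheme \<Rightarrow> (real \<Rightarrow> 'm) \<Rightarrow> real \<Rightarrow> bool" where
  "passes_from_hyperbolic S \<gamma> s \<longleftrightarrow> equilibrium S (\<gamma> s) \<and>
     (\<exists>C\<in>charts S. \<gamma> s \<in> fst C \<and>
        (\<exists>\<nu> v w. \<nu> \<noteq> 0 \<and> eigenpair S C (\<gamma> s) 0 v \<and> eigenpair S C (\<gamma> s) \<nu> w \<and>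
           tangent_to C \<gamma> s (at_left s) w \<and> tangent_to C \<gamma> s (at_right s) v))"


section \<open>Transit maps\<close>

text \<open>
  The half-transversal is \<open>\<sigma> z\<close> for small \<open>z \<ge> 0\<close>, with \<open>z\<close> as analytic coordinate; the values at
  small \<open>z < 0\<close> merely express analyticity up to the end point.
\<close>

definition half_transversal :: "('m, 'z) surface_field_scheme \<Rightarrow> (real \<Rightarrow> 'm) \<Rightarrow> bool" where
  "half_transversal S \<sigma> \<longleftrightarrow>
     (\<exists>C\<in>charts S. eventually (\<lambda>z. \<sigma> z \<in> fst C) (nhds 0) \<and>
        real_analytic_curve_at (snd C \<circ> \<sigma>) 0 \<and>
        (\<exists>w. ((snd C \<circ> \<sigma>) has_vector_derivative w) (at 0) \<and>
           \<not> collinear {0, w, vfield S C (snd C (\<sigma> 0))}))"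

text \<open>
  \<open>D\<close> is (as a germ at \<open>0\<^sup>+\<close>) the transit map from \<open>\<sigma>\<close> to \<open>\<tau>\<close> along the part \<open>\<gamma>|[a,b]\<close> of a curve
  composed of trajectories and equilibria: for small \<open>z > 0\<close> the trajectory from \<open>\<sigma> z\<close> to \<open>\<tau> (D z)\<close>,
  suitably parametrized as \<open>c z\<close>, converges to \<open>\<gamma>\<close> uniformly on \<open>[a,b]\<close> as \<open>z \<rightarrow> 0\<close>.  Uniform
  convergence is expressed topologically, by neighbourhoods of the graph of \<open>\<gamma>\<close>.
\<close>

definition follows ::
  "('m, 'z) surface_field_scheme \<Rightarrow> (real \<Rightarrow> 'm) \<Rightarrow> real \<Rightarrow> real \<Rightarrow> (real \<Rightarrow> 'm) \<Rightarrow> (real \<Rightarrow> 'm) \<Rightarrow>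
     (real \<Rightarrow> real) \<Rightarrow> (real \<Rightarrow> real \<Rightarrow> 'm) \<Rightarrow> bool" where
  "follows S \<gamma> a b \<sigma> \<tau> D c \<longleftrightarrow>
     eventually (\<lambda>z. orbit_segment S (c z) a b \<and> c z a = \<sigma> z \<and> c z b = \<tau> (D z)) (at_right 0) \<and>
     (\<forall>W. openin (prod_topology euclidean (surf S)) W \<and> (\<forall>s\<in>{a..b}. (s, \<gamma> s) \<in> W) \<longrightarrow>
        eventually (\<lambda>z. \<forall>s\<in>{a..b}. (s, c z s) \<in> W) (at_right 0))"

definition transit_map ::
  "('m, 'z) surface_field_scheme \<Rightarrow> (real \<Rightarrow> 'm) \<Rightarrow> real \<Rightarrow> real \<Rightarrow> (real \<Rightarrow> 'm) \<Rightarrow> (real \<Rightarrow> 'm) \<Rightarrow>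
     (real \<Rightarrow> real) \<Rightarrow> bool" where
  "transit_map S \<gamma> a b \<sigma> \<tau> D \<longleftrightarrow>
     half_transversal S \<sigma> \<and> \<sigma> 0 = \<gamma> a \<and> half_transversal S \<tau> \<and> \<tau> 0 = \<gamma> b \<and>
     filterlim D (at_right 0) (at_right 0) \<and> (\<exists>c. follows S \<gamma> a b \<sigma> \<tau> D c)"


section \<open>Polycycles\<close>

definition polycycle :: "('m, 'z) surface_field_scheme \<Rightarrow> 'm set \<Rightarrow> bool" where
  "polycycle S \<Gamma> \<longleftrightarrow>
     (\<exists>(m::nat) p u. m \<ge> 1 \<and> inj_on p {..<m} \<and>
        (\<forall>i<m. equilibrium S (p i) \<and>
           integral_curve S (u i) UNIV \<and> (\<forall>t. \<not> equilibrium S (u i t)) \<and>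
           limitin (surf S) (u i) (p i) at_bot \<and>
           limitin (surf S) (u i) (p (Suc i mod m)) at_top) \<and>
        \<Gamma> = (\<Union>i<m. insert (p i) (range (u i)))) \<and>
     subtopology (surf S) \<Gamma> homeomorphic_space top_of_set (sphere (0::complex) 1)"

definition flow_parametrization ::
  "('m, 'z) surface_field_scheme \<Rightarrow> 'm set \<Rightarrow> (real \<Rightarrow> 'm) \<Rightarrow> bool" where
  "flow_parametrization S \<Gamma> \<gamma> \<longleftrightarrow>
     continuous_map (top_of_set {0..1}) (surf S) \<gamma> \<and> \<gamma> ` {0..1} = \<Gamma> \<and>
     \<gamma> 0 = \<gamma> 1 \<and> \<not> equilibrium S (\<gamma> 0) \<and> inj_on \<gamma> {0<..<1} \<and>
     (\<forall>a b. 0 \<le> a \<and> a < b \<and> b \<le> 1 \<and> (\<forall>t\<in>{a..b}. \<not> equilibrium S (\<gamma> t)) \<longrightarrow>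
        orbit_segment S \<gamma> a b)"

text \<open>
  \<open>\<Delta>\<close> is the monodromy map, on the side of the half-transversal \<open>\<sigma>\<close> at \<open>\<gamma> 0\<close>: following the
  polycycle once leads back to \<open>\<sigma>\<close>, and this is the first return.
\<close>

definition monodromy_map ::
  "('m, 'z) surface_field_scheme \<Rightarrow> (real \<Rightarrow> 'm) \<Rightarrow> (real \<Rightarrow> 'm) \<Rightarrow> (real \<Rightarrow> real) \<Rightarrow> bool" where
  "monodromy_map S \<gamma> \<sigma> \<Delta> \<longleftrightarrow>
     half_transversal S \<sigma> \<and> \<sigma> 0 = \<gamma> 0 \<and> filterlim \<Delta> (at_right 0) (at_right 0) \<and>
     (\<exists>c. follows S \<gamma> 0 1 \<sigma> \<sigma> \<Delta> c \<and>
        (\<exists>\<epsilon>>0. eventually (\<lambda>z. \<forall>s\<in>{0<..<1}. c z s \<notin> \<sigma> ` {0<..<\<epsilon>}) (at_right 0)))"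

text \<open>
  \<open>D\<close> is the transit map, in the direction of the flow, for some analytic sections before and after
  the equilibrium \<open>\<gamma> s\<close>, in the quadrant lying on the same side of the polycycle as \<open>\<sigma>\<close>.  The side is
  fixed by asking that the trajectories starting on \<open>\<sigma>\<close> follow \<open>\<gamma>\<close> up to the half-transversal \<open>\<tau>\<close>.
  Taking the sections on \<open>\<gamma> ` {0<..<1}\<close> is no restriction, as the flow carries sections to
  sections without changing the transit map.
\<close>

definition transit_at_equilibrium ::
  "('m, 'z) surface_field_scheme \<Rightarrow> (real \<Rightarrow> 'm) \<Rightarrow> (real \<Rightarrow> 'm) \<Rightarrow> real \<Rightarrow> (real \<Rightarrow> real) \<Rightarrow> bool" where
  "transit_at_equilibrium S \<gamma> \<sigma> s D \<longleftrightarrow>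
     (\<exists>a b \<tau> \<tau>'. 0 < a \<and> a < s \<and> s < b \<and> b < 1 \<and>
        (\<forall>t\<in>{a..b}. equilibrium S (\<gamma> t) \<longrightarrow> t = s) \<and>
        (\<exists>E. transit_map S \<gamma> 0 a \<sigma> \<tau> E) \<and> transit_map S \<gamma> a b \<tau> \<tau>' D)"

definition inverse_germs_at_0 :: "(real \<Rightarrow> real) \<Rightarrow> (real \<Rightarrow> real) \<Rightarrow> bool" where
  "inverse_germs_at_0 D E \<longleftrightarrow>
     filterlim D (at_right 0) (at_right 0) \<and> filterlim E (at_right 0) (at_right 0) \<and>
     eventually (\<lambda>z. E (D z) = z \<and> D (E z) = z) (at_right 0)"

definition semihyperbolic_germs :: "germ set \<Rightarrow> germ set \<Rightarrow> germ set" where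
  "semihyperbolic_germs R NC =
     R0 R <#>\<^bsub>germ_monoid\<^esub> ({germ_of exp} <#>\<^bsub>germ_monoid\<^esub>
       (R0 R <#>\<^bsub>germ_monoid\<^esub> (NC <#>\<^bsub>germ_monoid\<^esub> Aff)))"

text \<open>
  For a semihyperbolic saddle the Dulac map goes from the hyperbolic to the centre direction, so it
  is the inverse of the transit along the polycycle when the saddle is passed from the centre
  direction.
\<close>

definition admissible_saddle ::
  "germ set \<Rightarrow> germ set \<Rightarrow> ('m, 'z) surface_field_scheme \<Rightarrow> (real \<Rightarrow> 'm) \<Rightarrow> (real \<Rightarrow> 'm) \<Rightarrow> real \<Rightarrow>
     bool" where
  "admissible_saddle R NC S \<gamma> \<sigma> s \<longleftrightarrow>
     (hyperbolic_saddle S (\<gamma> s) \<and>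
        (\<exists>D. transit_at_equilibrium S \<gamma> \<sigma> s D \<and> germ_of (log_chart D) \<in> R)) \<or>
     (passes_from_hyperbolic S \<gamma> s \<and>
        (\<exists>D. transit_at_equilibrium S \<gamma> \<sigma> s D \<and>
           germ_of (log_chart D) \<in> semihyperbolic_germs R NC)) \<or>
     (passes_from_centre S \<gamma> s \<and>
        (\<exists>D E. transit_at_equilibrium S \<gamma> \<sigma> s E \<and> inverse_germs_at_0 D E \<and>
           germ_of (log_chart D) \<in> semihyperbolic_germs R NC))"

text \<open>
  In particular, all equilibria of an admissible polycycle have a nonzero eigenvalue.
\<close>

definition admissible_polycycle ::
  "germ set \<Rightarrow> germ set \<Rightarrow> ('m, 'z) surface_field_scheme \<Rightarrow> (real \<Rightarrow> 'm) \<Rightarrow> (real \<Rightarrow> 'm) \<Rightarrow>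
     bool" where
  "admissible_polycycle R NC S \<gamma> \<sigma> \<longleftrightarrow>
     (\<forall>s\<in>{0..1}. equilibrium S (\<gamma> s) \<longrightarrow> admissible_saddle R NC S \<gamma> \<sigma> s)"

definition centre_balance :: "('m, 'z) surface_field_scheme \<Rightarrow> (real \<Rightarrow> 'm) \<Rightarrow> real \<Rightarrow> int" where
  "centre_balance S \<gamma> t =
     int (card (\<gamma> ` {s. 0 < s \<and> s \<le> t \<and> passes_from_centre S \<gamma> s})) -
     int (card (\<gamma> ` {s. 0 < s \<and> s \<le> t \<and> passes_from_hyperbolic S \<gamma> s}))"

text \<open>
  The germs at \<open>0\<^sup>+\<close> of monodromy maps of balanced admissible polycycles of depth \<open>n\<close>, for fields on
  surfaces whose points belong to the type \<open>'m\<close>.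
\<close>

definition monodromy_maps ::
  "'m itself \<Rightarrow> germ set \<Rightarrow> germ set \<Rightarrow> nat \<Rightarrow> (real \<Rightarrow> real) set" where
  "monodromy_maps (_ :: 'm itself) R NC n =
     {\<Delta>. \<exists>(S :: 'm surface_field) \<Gamma> \<gamma> \<sigma>.
        analytic_surface S \<and> analytic_vector_field S \<and> polycycle S \<Gamma> \<and>
        flow_parametrization S \<Gamma> \<gamma> \<and> monodromy_map S \<gamma> \<sigma> \<Delta> \<and>
        admissible_polycycle R NC S \<gamma> \<sigma> \<and>
        centre_balance S \<gamma> 1 = 0 \<and> (\<forall>t\<in>{0..1}. centre_balance S \<gamma> t \<le> 0) \<and>
        int n = - Min (centre_balance S \<gamma> ` {0..1})}"

end

theory Submission
  imports Defs "HOL-Complex_Analysis.Complex_Analysis"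
begin

text \<open>
  Flow boxes, obtained from analytic dependence of solutions on initial values, show that transit
  along a regular piece of a trajectory is an analytic diffeomorphism between transversals, hence
  lies in \<open>\<R>\<close> in the logarithmic chart, and that germs of transit maps are unique.  A monodromy map
  is therefore a composition of such diffeomorphisms and of Dulac maps.  Reading the polycycle from
  \<open>\<gamma> 0\<close>, the partial transit up to \<open>\<gamma> t\<close> has the form \<open>exp\<^sup>k \<circ> g\<close>, where \<open>k = - D(\<gamma>,t)\<close>
  and \<open>g\<close> lies in the group on the right hand side: an element \<open>f\<close> of \<open>\<R>\<close> is moved through \<open>exp\<^sup>k\<close>
  by \<open>f \<circ> exp\<^sup>k = exp\<^sup>k \<circ> A\<^sup>k f\<close>, and a semihyperbolic saddle adds or removes one factor \<open>exp\<close>.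
  Elements of \<open>\<A>ff\<close> below an \<open>exp\<close> are absorbed by \<open>A(\<zeta> \<mapsto> \<alpha>\<zeta> + \<beta>) = (\<zeta> \<mapsto> \<zeta> + ln \<alpha>) \<circ> (\<zeta> \<mapsto> \<zeta> + ln (1 + \<beta>/\<alpha> e\<^sup>-\<^sup>\<zeta>))\<close>,
  whose second factor lies in \<open>\<R>\<^sup>0\<close>.
\<close>

section \<open>Real analytic functions and their complexifications\<close>

text \<open>A monodromy map is given only through some family of trajectories close to the
  polycycle, and the Dulac maps through sections chosen separately for each saddle. These data fit
  together only because a transit germ is determined by its two sections; this uniqueness is
  delicate for the full turn, where start and end of \<open>\<gamma>\<close> coincide. Another
  obstacle is that the group contains only invertible germs, whereas elements of \<open>NC\<close>
  are not assumed invertible. The factor from \<open>NC\<close> in a Dulac map is a unit because the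
  Dulac map is, and this is seen dynamically: at z > 0 the transit follows a regular orbit and has
  nonzero derivative. The ranges of i and j reflect when an element is moved through exp: with k
  exponentials in front, k \<le> n, elements of \<open>R\<close> contribute A^i with i \<le> n,
  while the \<open>NC\<close> factor of a Dulac map acts before that map adds its own exp, hence at
  height at most n - 1. For this count each equilibrium must have exactly one of the three types,
  although the defining eigenvectors may be given in different charts.\<close>

text \<open>
  Continuity together with holomorphy along holomorphic curves replaces joint holomorphy in two
  variables, which the library does not have.
\<close>

definition hol2_on :: "(complex \<times> complex \<Rightarrow> complex) \<Rightarrow> (complex \<times> complex) set \<Rightarrow> bool" where
  "hol2_on f U \<longleftrightarrow> continuous_on U f \<and>
     (\<forall>g1 g2 V. open V \<longrightarrow> g1 holomorphic_on V \<longrightarrow> g2 holomorphic_on V \<longrightarrow>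
        (\<forall>z\<in>V. (g1 z, g2 z) \<in> U) \<longrightarrow> (\<lambda>z. f (g1 z, g2 z)) holomorphic_on V)"

lemma hol2_on_continuous: "hol2_on f U \<Longrightarrow> continuous_on U f"
  by (simp add: hol2_on_def)

lemma hol2_on_compose:
  assumes "hol2_on f U" "open V" "g1 holomorphic_on V" "g2 holomorphic_on V"
    "\<And>z. z \<in> V \<Longrightarrow> (g1 z, g2 z) \<in> U"
  shows "(\<lambda>z. f (g1 z, g2 z)) holomorphic_on V"
  using assms unfolding hol2_on_def by blast

section \<open>Double power series and their complexification\<close>

lemma holomorphic_on_locally:
  assumes "\<And>z. z \<in> V \<Longrightarrow> \<exists>d>0. f holomorphic_on ball z d"
  shows "f holomorphic_on V"
proof -
  have "f field_differentiable at z" if "z \<in> V" for z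
    using assms[OF that] holomorphic_on_imp_differentiable_at by (metis centre_in_ball open_ball)
  then show ?thesis
    using field_differentiable_at_within holomorphic_on_def by blast
qed

text \<open>For real families summability already means absolute summability, so the value of the
  double series at the single point (s, s) controls all coefficients.\<close>

lemma abs_summable_coefficients:
  fixes a :: "nat \<Rightarrow> nat \<Rightarrow> real"
  assumes "0 < s" "s < r"
    and "\<And>h k. \<bar>h\<bar> < r \<Longrightarrow> \<bar>k\<bar> < r \<Longrightarrow> ((\<lambda>(i, j). a i j * h ^ i * k ^ j) has_sum f (x + (h, k))) UNIV"
  shows "(\<lambda>(i, j). \<bar>a i j\<bar> * s ^ i * s ^ j) summable_on UNIV"
proof -
  have "((\<lambda>(i, j). a i j * s ^ i * s ^ j) has_sum f (x + (s, s))) UNIV"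
    using assms by simp
  then have "(\<lambda>(i, j). a i j * s ^ i * s ^ j) summable_on UNIV"
    by (auto simp: summable_on_def)
  then have "(\<lambda>x. norm (case x of (i, j) \<Rightarrow> a i j * s ^ i * s ^ j)) summable_on UNIV"
    by (rule summable_on_iff_abs_summable_on_real[THEN iffD1])
  then show ?thesis
    using assms by (simp add: case_prod_unfold abs_mult)
qed

text \<open>The same coefficients define a complex series, dominated on the closed polydisc of half
  the radius by the absolute series and hence uniformly convergent there. Partial sums are
  polynomials, so continuity and holomorphy along curves pass to the limit.\<close>

lemma real_analytic2_complexify:
  assumes "real_analytic2_at f x"
  obtains F r where "r > 0" "hol2_on F (ball 0 r \<times> ball 0 r)"
    "\<And>h k. \<bar>h\<bar> < r \<Longrightarrow> \<bar>k\<bar> < r \<Longrightarrow> F (of_real h, of_real k) = of_real (f (x + (h, k)))"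
proof -
  obtain a r0 where r0: "r0 > 0" and a: "\<And>h k. \<bar>h\<bar> < r0 \<Longrightarrow> \<bar>k\<bar> < r0 \<Longrightarrow>
    ((\<lambda>(i::nat, j::nat). a i j * h ^ i * k ^ j) has_sum f (x + (h, k))) UNIV"
    using assms unfolding real_analytic2_at_def by blast
  define r where "r = r0 / 2"
  have r: "0 < r" "r < r0" using r0 by (auto simp: r_def)
  define T :: "nat \<times> nat \<Rightarrow> complex \<times> complex \<Rightarrow> complex"
    where "T = (\<lambda>(i, j) (z, w). of_real (a i j) * z ^ i * w ^ j)"
  define F where "F = (\<lambda>p. \<Sum>\<^sub>\<infinity>ij. T ij p)"
  have ul: "uniform_limit (cball 0 r \<times> cball 0 r) (\<lambda>X p. \<Sum>ij\<in>X. T ij p) F (finite_subsets_at_top UNIV)"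
    unfolding F_def
  proof (rule Weierstrass_m_test_general)
    show "(\<lambda>(i, j). \<bar>a i j\<bar> * r ^ i * r ^ j) summable_on UNIV"
      by (rule abs_summable_coefficients[OF r a])
    fix ij :: "nat \<times> nat" and p :: "complex \<times> complex"
    assume "p \<in> cball 0 r \<times> cball 0 r"
    then show "norm (T ij p) \<le> (case ij of (i, j) \<Rightarrow> \<bar>a i j\<bar> * r ^ i * r ^ j)"
      using r by (auto simp: T_def norm_mult norm_power case_prod_unfold intro!: mult_mono power_mono mult_nonneg_nonneg)
  qed
  have contT: "continuous_on UNIV (\<lambda>p. \<Sum>ij\<in>X. T ij p)" for X
    unfolding T_def case_prod_unfold by (intro continuous_intros)
  have cF: "continuous_on (cball 0 r \<times> cball 0 r) F"
    by (rule uniform_limit_theorem[OF _ ul])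
       (auto intro!: always_eventually continuous_on_subset[OF contT])
  have sub: "ball 0 r \<times> ball 0 r \<subseteq> cball 0 r \<times> cball (0::complex) r"
    by auto
  have "hol2_on F (ball 0 r \<times> ball 0 r)"
    unfolding hol2_on_def
  proof (intro conjI allI impI)
    show "continuous_on (ball 0 r \<times> ball 0 r) F"
      using cF sub continuous_on_subset by blast
    fix g1 g2 :: "complex \<Rightarrow> complex" and V
    assume V: "open V" and g: "g1 holomorphic_on V" "g2 holomorphic_on V"
      and in_U: "\<forall>z\<in>V. (g1 z, g2 z) \<in> ball 0 r \<times> ball 0 r"
    show "(\<lambda>z. F (g1 z, g2 z)) holomorphic_on V"
    proof (rule holomorphic_on_locally)
      fix z assume "z \<in> V"
      then obtain d where d: "d > 0" "cball z d \<subseteq> V"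
        using V open_contains_cball by blast
      have hX: "(\<lambda>w. \<Sum>ij\<in>X. T ij (g1 w, g2 w)) holomorphic_on V" for X
        unfolding T_def case_prod_unfold using g by (auto intro!: holomorphic_intros)
      have "uniform_limit (cball z d) (\<lambda>X w. \<Sum>ij\<in>X. T ij (g1 w, g2 w)) (\<lambda>w. F (g1 w, g2 w))
          (finite_subsets_at_top UNIV)"
        by (rule uniform_limit_compose'[OF ul, of "\<lambda>w. (g1 w, g2 w)"]) (use in_U d sub in fastforce)
      then have "(\<lambda>w. F (g1 w, g2 w)) holomorphic_on ball z d"
      proof (rule holomorphic_uniform_limit[rotated])
        show "\<forall>\<^sub>F X in finite_subsets_at_top UNIV.
            continuous_on (cball z d) (\<lambda>w. \<Sum>ij\<in>X. T ij (g1 w, g2 w)) \<and>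
            (\<lambda>w. \<Sum>ij\<in>X. T ij (g1 w, g2 w)) holomorphic_on ball z d"
          using holomorphic_on_subset[OF hX] d(2) order_trans[OF ball_subset_cball d(2)]
          by (auto intro!: always_eventually holomorphic_on_imp_continuous_on)
      qed simp
      then show "\<exists>d>0. (\<lambda>z. F (g1 z, g2 z)) holomorphic_on ball z d"
        using d by blast
    qed
  qed
  moreover have "F (of_real h, of_real k) = of_real (f (x + (h, k)))" if "\<bar>h\<bar> < r" "\<bar>k\<bar> < r" for h k
  proof -
    have "((\<lambda>ij. complex_of_real (case ij of (i, j) \<Rightarrow> a i j * h ^ i * k ^ j)) has_sum of_real (f (x + (h, k)))) UNIV"
      by (rule has_sum_of_real) (use a that r in auto)
    then show ?thesis
      unfolding F_def T_def by (simp add: case_prod_unfold infsumI)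
  qed
  ultimately show ?thesis using that r by blast
qed

text \<open>Once the constant and linear terms are removed, all monomials have degree at least two,
  and the remainder is bounded by a constant times the squared norm.\<close>

lemma real_analytic2_differentiable:
  assumes "real_analytic2_at f x"
  shows "f differentiable (at x)"
proof -
  obtain a r0 where r0: "r0 > 0" and a: "\<And>h k. \<bar>h\<bar> < r0 \<Longrightarrow> \<bar>k\<bar> < r0 \<Longrightarrow>
    ((\<lambda>(i::nat, j::nat). a i j * h ^ i * k ^ j) has_sum f (x + (h, k))) UNIV"
    using assms unfolding real_analytic2_at_def by blast
  define r where "r = r0 / 2"
  have r: "0 < r" "r < r0" using r0 by (auto simp: r_def)
  define D where "D = (\<lambda>p::real \<times> real. a 1 0 * fst p + a 0 1 * snd p)"
  define S :: "(nat \<times> nat) set" where "S = UNIV - {(0,0), (1,0), (0,1)}"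
  define M where "M = (\<lambda>(i, j). \<bar>a i j\<bar> * r ^ i * r ^ j)"
  have sM: "M summable_on S"
    unfolding M_def using abs_summable_coefficients[OF r a] summable_on_subset_banach by blast
  define K where "K = (\<Sum>\<^sub>\<infinity>ij\<in>S. M ij)"
  have f0: "f x = a 0 0"
  proof -
    have "((\<lambda>(i, j). a i j * 0 ^ i * 0 ^ j) has_sum f (x + (0, 0))) UNIV"
      using a r0 by simp
    moreover have "((\<lambda>(i, j). a i j * 0 ^ i * 0 ^ j) has_sum (a 0 0)) {(0::nat,0::nat)}"
      by (rule has_sum_finiteI) auto
    then have "((\<lambda>(i, j). a i j * 0 ^ i * 0 ^ j) has_sum (a 0 0)) UNIV"
      by (rule has_sum_cong_neutral[THEN iffD1, rotated -1]) (auto simp: power_0_left split: if_splits)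
    ultimately show ?thesis using has_sum_unique by (fastforce simp: zero_prod_def[symmetric])
  qed
  have est: "\<bar>f (x + p) - f x - D p\<bar> \<le> K / r\<^sup>2 * (norm p)\<^sup>2" if p: "norm p < r" for p
  proof -
    obtain h k where hk: "p = (h, k)" by force
    have "\<bar>h\<bar> \<le> norm p" "\<bar>k\<bar> \<le> norm p"
      using norm_fst_le[of h k] norm_snd_le[of k h] by (auto simp: hk)
    \<comment> \<open>Both |h| and |k| are at most t r with t \<le> 1, so a monomial of degree i + j
      is smaller by the factor t^(i + j) \<le> t^2 than its bound at (r, r).\<close>
    define t where "t = norm p / r"
    have t: "0 \<le> t" "t \<le> 1" "\<bar>h\<bar> \<le> t * r" "\<bar>k\<bar> \<le> t * r"
      using p r \<open>\<bar>h\<bar> \<le> norm p\<close> \<open>\<bar>k\<bar> \<le> norm p\<close> by (auto simp: t_def)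
    have "((\<lambda>(i, j). a i j * h ^ i * k ^ j) has_sum f (x + p)) UNIV"
      unfolding hk by (rule a) (use \<open>\<bar>h\<bar> \<le> norm p\<close> \<open>\<bar>k\<bar> \<le> norm p\<close> p r in auto)
    moreover have "((\<lambda>(i, j). a i j * h ^ i * k ^ j) has_sum (f x + D p)) {(0::nat,0::nat), (1,0), (0,1)}"
      by (rule has_sum_finiteI) (auto simp: f0 D_def hk)
    ultimately have hs: "((\<lambda>(i, j). a i j * h ^ i * k ^ j) has_sum (f (x + p) - (f x + D p))) S"
      unfolding S_def by (rule has_sum_Diff) auto
    have "norm (f (x + p) - (f x + D p)) \<le> t\<^sup>2 * K"
    proof (rule norm_infsum_le[OF hs])
      show "((\<lambda>ij. t\<^sup>2 * M ij) has_sum t\<^sup>2 * K) S"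
        unfolding K_def using sM by (intro has_sum_cmult_right has_sum_infsum)
      fix ij assume ij: "ij \<in> S"
      obtain i j where [simp]: "ij = (i, j)" by force
      have ge2: "2 \<le> i + j"
      proof (rule ccontr)
        assume "\<not> 2 \<le> i + j"
        then have "(i, j) \<in> {(0,0), (1,0), (0,1)}" by (cases i; cases j) auto
        then show False using ij by (simp add: S_def)
      qed
      have "\<bar>h\<bar> ^ i * \<bar>k\<bar> ^ j \<le> (t * r) ^ i * (t * r) ^ j"
        using t r by (intro mult_mono power_mono) auto
      also have "\<dots> = t ^ (i + j) * (r ^ i * r ^ j)"
        by (simp add: power_mult_distrib power_add)
      also have "\<dots> \<le> t\<^sup>2 * (r ^ i * r ^ j)"
        using t r power_decreasing[OF ge2, of t] by (intro mult_right_mono) auto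
      finally have "\<bar>a i j\<bar> * (\<bar>h\<bar> ^ i * \<bar>k\<bar> ^ j) \<le> \<bar>a i j\<bar> * (t\<^sup>2 * (r ^ i * r ^ j))"
        by (intro mult_left_mono) auto
      then show "norm (case ij of (i, j) \<Rightarrow> a i j * h ^ i * k ^ j) \<le> t\<^sup>2 * M ij"
        by (simp add: M_def abs_mult power_abs mult_ac)
    qed
    then show ?thesis by (simp add: t_def power_divide mult.commute diff_diff_eq)
  qed
  have bl: "bounded_linear D"
    unfolding D_def by (intro bounded_linear_intros)
  have "(f has_derivative D) (at x)"
    unfolding has_derivative_at
  proof (intro conjI bl)
    have "((\<lambda>p :: real \<times> real. K / r\<^sup>2 * norm p) \<longlongrightarrow> K / r\<^sup>2 * norm (0 :: real \<times> real)) (at 0)"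
      by (rule tendsto_mult[OF tendsto_const tendsto_norm[OF tendsto_ident_at]])
    then have lim: "((\<lambda>p :: real \<times> real. K / r\<^sup>2 * norm p) \<longlongrightarrow> 0) (at 0)"
      by simp
    show "(\<lambda>p. norm (f (x + p) - f x - D p) / norm p) \<midarrow>0\<rightarrow> 0"
    proof (rule tendsto_sandwich[OF _ _ tendsto_const lim])
      show "\<forall>\<^sub>F p in at 0. norm (f (x + p) - f x - D p) / norm p \<le> K / r\<^sup>2 * norm p"
      proof (rule eventually_at_ball'[OF r(1), THEN eventually_mono])
        fix p :: "real \<times> real" assume "p \<in> ball 0 r \<and> p \<noteq> 0 \<and> p \<in> UNIV"
        then show "norm (f (x + p) - f x - D p) / norm p \<le> K / r\<^sup>2 * norm p"
          using est[of p] by (simp add: divide_le_eq power2_eq_square mult.assoc)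
      qed
    qed auto
  qed
  then show ?thesis unfolding differentiable_def by blast
qed

text \<open>Discs of radius r/4 around points of the closed disc of radius r/4 stay in the disc of
  radius r/2, where F is bounded by M. Cauchy's inequality gives the bound 4 M / r for each partial
  derivative, and the variables are changed one at a time.\<close>

lemma hol2_on_Lipschitz:
  assumes F: "hol2_on F (ball 0 r \<times> ball 0 r)" and r: "r > 0"
  obtains L where "L \<ge> 0" "\<And>z w z' w'. z \<in> cball 0 (r/4) \<Longrightarrow> w \<in> cball 0 (r/4) \<Longrightarrow>
    z' \<in> cball 0 (r/4) \<Longrightarrow> w' \<in> cball 0 (r/4) \<Longrightarrow>
    norm (F (z, w) - F (z', w')) \<le> L * (norm (z - z') + norm (w - w'))"
proof -
  have sub: "cball 0 (r/2) \<times> cball 0 (r/2) \<subseteq> ball 0 r \<times> ball (0::complex) r"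
    using r by auto
  have "compact (F ` (cball 0 (r/2) \<times> cball 0 (r/2)))"
    by (intro compact_continuous_image continuous_on_subset[OF hol2_on_continuous[OF F] sub]
         compact_Times compact_cball)
  then have "bounded (F ` (cball 0 (r/2) \<times> cball 0 (r/2)))"
    by (rule compact_imp_bounded)
  then obtain M where M: "\<And>p. p \<in> F ` (cball 0 (r/2) \<times> cball 0 (r/2)) \<Longrightarrow> norm p \<le> M"
    unfolding bounded_iff by blast
  have M': "norm (F (z, w)) \<le> M" if "norm z \<le> r/2" "norm w \<le> r/2" for z w
    by (rule M, rule imageI) (use that in auto)
  have "M \<ge> 0" using M'[of 0 0] r norm_ge_zero[of "F (0, 0)"] by (simp del: norm_ge_zero)
  have one: "norm (g w - g w') \<le> M * 4 / r * norm (w - w')"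
    if g: "g holomorphic_on ball 0 r" and gM: "\<And>w. norm w \<le> r/2 \<Longrightarrow> norm (g w) \<le> M"
      and w: "w \<in> cball 0 (r/4)" "w' \<in> cball 0 (r/4)" for g :: "complex \<Rightarrow> complex" and w w'
  proof (rule field_differentiable_bound[OF convex_cball _ _ w])
    fix z :: complex assume z: "z \<in> cball 0 (r/4)"
    then have zr: "z \<in> ball 0 r" using r by auto
    show "(g has_field_derivative deriv g z) (at z within cball 0 (r/4))"
      by (rule has_field_derivative_at_within[OF holomorphic_derivI[OF g open_ball zr]])
    have s: "cball z (r/4) \<subseteq> cball 0 (r/2)"
    proof
      fix x assume "x \<in> cball z (r/4)"
      then show "x \<in> cball 0 (r/2)"
        using z norm_triangle_ineq[of z "x - z"] by (simp add: dist_norm norm_minus_commute)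
    qed
    then have s': "cball z (r/4) \<subseteq> ball 0 r" using r by auto
    have "norm ((deriv ^^ 1) g z) \<le> fact 1 * M / (r/4) ^ 1"
    proof (rule Cauchy_inequality)
      show "g holomorphic_on ball z (r / 4)"
        using g s' ball_subset_cball holomorphic_on_subset by blast
      show "continuous_on (cball z (r / 4)) g"
        using g s' holomorphic_on_imp_continuous_on continuous_on_subset by blast
      show "norm (g x) \<le> M" if "norm (z - x) = r / 4" for x
        using s that gM[of x] by (auto simp: dist_norm subset_iff)
    qed (use r in auto)
    then show "norm (deriv g z) \<le> M * 4 / r" by simp
  qed
  show ?thesis
  proof (rule that[of "M * 4 / r"])
    show "0 \<le> M * 4 / r" using \<open>M \<ge> 0\<close> r by simp
    fix z w z' w' :: complex
    assume *: "z \<in> cball 0 (r/4)" "w \<in> cball 0 (r/4)" "z' \<in> cball 0 (r/4)" "w' \<in> cball 0 (r/4)"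
    have b: "norm z \<le> r/2" "norm w \<le> r/2" "norm z' \<le> r/2" "norm w' \<le> r/2" and
       b': "z \<in> ball 0 r" "w' \<in> ball 0 r" using * r by auto
    have "norm (F (z, w) - F (z, w')) \<le> M * 4 / r * norm (w - w')"
      by (rule one[of "\<lambda>w. F (z, w)"]) (use * b b' M' in \<open>auto intro!: hol2_on_compose[OF F]\<close>)
    moreover have "norm (F (z, w') - F (z', w')) \<le> M * 4 / r * norm (z - z')"
      by (rule one[of "\<lambda>z. F (z, w')"]) (use * b b' M' in \<open>auto intro!: hol2_on_compose[OF F]\<close>)
    moreover have "norm (F (z, w) - F (z', w')) \<le> norm (F (z, w) - F (z, w')) + norm (F (z, w') - F (z', w'))"
      using norm_triangle_ineq[of "F (z, w) - F (z, w')" "F (z, w') - F (z', w')"] by simp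
    ultimately show "norm (F (z, w) - F (z', w')) \<le> M * 4 / r * (norm (z - z') + norm (w - w'))"
      unfolding distrib_left by linarith
  qed
qed

section \<open>One variable: complexification, Gronwall's inequality, composition and
  inversion\<close>

lemma real_analytic_complexify:
  assumes "real_analytic_at f x"
  obtains g r where "r > 0" "g holomorphic_on ball 0 r"
    "\<And>h. \<bar>h\<bar> < r \<Longrightarrow> g (of_real h) = of_real (f (x + h))"
proof -
  obtain a r where r: "r > 0" and a: "\<And>h. \<bar>h\<bar> < r \<Longrightarrow> (\<lambda>n. a n * h ^ n) sums f (x + h)"
    using assms unfolding real_analytic_at_def by blast
  define g where "g = (\<lambda>z::complex. \<Sum>n. of_real (a n) * z ^ n)"
  have S: "(\<lambda>n. of_real (a n) * z ^ n) sums g z" if "norm z < r" for z :: complex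
  proof -
    obtain s where s: "norm z < s" "s < r" using \<open>norm z < r\<close> dense by blast
    have "0 \<le> norm z" by simp
    then have "0 < s" using s by linarith
    have "summable (\<lambda>n. complex_of_real (a n * s ^ n))"
      using a[of s] \<open>0 < s\<close> s by (intro summable_of_real) (auto simp: sums_iff)
    then have "summable (\<lambda>n. complex_of_real (a n) * (of_real s) ^ n)" by simp
    then have "summable (\<lambda>n. complex_of_real (a n) * z ^ n)"
      by (rule powser_inside) (use s \<open>0 < s\<close> in simp)
    then show ?thesis unfolding g_def by (rule summable_sums)
  qed
  have "g holomorphic_on ball 0 r"
    by (rule power_series_holomorphic[of 0 r "\<lambda>n. of_real (a n)"]) (use S in simp)
  moreover have "g (of_real h) = of_real (f (x + h))" if "\<bar>h\<bar> < r" for h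
  proof -
    have "(\<lambda>n. complex_of_real (a n * h ^ n)) sums of_real (f (x + h))"
      using a[OF that] by (rule sums_of_real)
    with S[of "of_real h"] that show ?thesis by (simp add: sums_unique2)
  qed
  ultimately show ?thesis using that r by blast
qed

lemma Re_mult_real: "Re (z * of_real x) = Re z * x"
  by simp

text \<open>Taking real parts of the Taylor coefficients spares a proof that they are real: on the
  axis the sum is real and equals its own real part.\<close>

lemma real_analytic_atI:
  assumes r: "r > 0" and g: "g holomorphic_on ball 0 r"
    and f: "\<And>h. \<bar>h\<bar> < r \<Longrightarrow> g (of_real h) = of_real (f (x + h))"
  shows "real_analytic_at f x"
  unfolding real_analytic_at_def
proof (intro exI conjI allI impI)
  show "r > 0" by fact
  fix h assume h: "\<bar>h\<bar> < r"
  have "(\<lambda>n. (deriv ^^ n) g 0 / fact n * (of_real h - 0) ^ n) sums g (of_real h)"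
    by (rule holomorphic_power_series[OF g]) (use h in simp)
  then have "(\<lambda>n. Re ((deriv ^^ n) g 0 / fact n * of_real (h ^ n))) sums Re (g (of_real h))"
    by (intro sums_Re) simp
  then show "(\<lambda>n. Re ((deriv ^^ n) g 0 / fact n) * h ^ n) sums f (x + h)"
    by (simp only: f[OF h] Re_complex_of_real Re_mult_real)
qed

text \<open>The squared norm is nonincreasing after multiplication by exp(-2 L t) and nondecreasing
  after multiplication by exp(2 L t), which yields the bound forwards and backwards in time.
  Squaring avoids differentiating the norm at zeros of w.\<close>

lemma gronwall:
  fixes w w' :: "real \<Rightarrow> 'a::real_inner"
  assumes d: "\<And>t. t \<in> {a..b} \<Longrightarrow> (w has_vector_derivative w' t) (at t within {a..b})"
    and L: "\<And>t. t \<in> {a..b} \<Longrightarrow> norm (w' t) \<le> L * norm (w t)"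
    and st: "s \<in> {a..b}" "t \<in> {a..b}"
  shows "norm (w t) \<le> exp (L * \<bar>t - s\<bar>) * norm (w s)"
proof -
  define \<phi> where "\<phi> = (\<lambda>t. w t \<bullet> w t)"
  have d\<phi>: "(\<phi> has_real_derivative 2 * (w t \<bullet> w' t)) (at t within {a..b})" if "t \<in> {a..b}" for t
  proof -
    have "(\<phi> has_vector_derivative w t \<bullet> w' t + w' t \<bullet> w t) (at t within {a..b})"
      unfolding \<phi>_def by (rule bounded_bilinear.has_vector_derivative[OF bounded_bilinear_inner d[OF that] d[OF that]])
    then show ?thesis by (simp add: has_real_derivative_iff_has_vector_derivative inner_commute)
  qed
  have abs\<phi>: "\<bar>w t \<bullet> w' t\<bar> \<le> L * \<phi> t" if "t \<in> {a..b}" for t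
  proof -
    have "\<bar>w t \<bullet> w' t\<bar> \<le> norm (w t) * norm (w' t)" by (rule Cauchy_Schwarz_ineq2)
    also have "\<dots> \<le> norm (w t) * (L * norm (w t))" using L[OF that] by (intro mult_left_mono) auto
    finally show ?thesis by (simp add: \<phi>_def dot_square_norm power2_eq_square mult_ac)
  qed
  have dg: "((\<lambda>t. \<phi> t * exp (c * t)) has_real_derivative (2 * (w t \<bullet> w' t) + c * \<phi> t) * exp (c * t)) (at t within {a..b})"
    if "t \<in> {a..b}" for t c
    by (rule derivative_eq_intros d\<phi>[OF that] refl)+ (simp add: algebra_simps)
  have at_eq: "at t within {a..b} = at t" if "a < t" "t < b" for t
    using that by (rule at_within_Icc_at)
  have cont: "continuous_on {s..t} (\<lambda>t. \<phi> t * exp (c * t))" if "s \<in> {a..b}" "t \<in> {a..b}" for s t c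
  proof -
    have "continuous_on {a..b} (\<lambda>t. \<phi> t * exp (c * t))"
      by (rule DERIV_continuous_on[OF dg])
    then show ?thesis by (rule continuous_on_subset) (use that in auto)
  qed
  have "\<phi> t \<le> (exp (L * \<bar>t - s\<bar>))\<^sup>2 * \<phi> s"
  proof (cases "s \<le> t")
    case True
    have "\<phi> t * exp (- (2 * L) * t) \<le> \<phi> s * exp (- (2 * L) * s)"
    proof (rule DERIV_nonpos_imp_decreasing_open[OF True])
      show "\<exists>y. ((\<lambda>t. \<phi> t * exp (- (2 * L) * t)) has_real_derivative y) (at x) \<and> y \<le> 0" if "s < x" "x < t" for x
        using dg[of x "- (2 * L)"] abs\<phi>[of x] at_eq[of x] that st
        by (intro exI[of _ "(2 * (w x \<bullet> w' x) + - (2 * L) * \<phi> x) * exp (- (2 * L) * x)"])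
           (auto simp: mult_le_0_iff)
    qed (rule cont[OF st])
    then have "\<phi> t * exp (- (2 * L) * t) * exp (2 * L * t) \<le> \<phi> s * exp (- (2 * L) * s) * exp (2 * L * t)"
      by (intro mult_right_mono) auto
    then show ?thesis
      using True by (simp add: mult.assoc exp_add[symmetric] power2_eq_square algebra_simps)
  next
    case False
    then have le: "t \<le> s" by simp
    have "\<phi> t * exp (2 * L * t) \<le> \<phi> s * exp (2 * L * s)"
    proof (rule DERIV_nonneg_imp_increasing_open[OF le])
      show "\<exists>y. ((\<lambda>t. \<phi> t * exp (2 * L * t)) has_real_derivative y) (at x) \<and> 0 \<le> y" if "t < x" "x < s" for x
        using dg[of x "2 * L"] abs\<phi>[of x] at_eq[of x] that st
        by (intro exI[of _ "(2 * (w x \<bullet> w' x) + (2 * L) * \<phi> x) * exp ((2 * L) * x)"])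
           (auto simp: zero_le_mult_iff)
    qed (rule cont[OF st(2,1)])
    then have "\<phi> t * exp (2 * L * t) * exp (- (2 * L * t)) \<le> \<phi> s * exp (2 * L * s) * exp (- (2 * L * t))"
      by (intro mult_right_mono) auto
    then show ?thesis
      using False by (simp add: mult.assoc exp_add[symmetric] power2_eq_square algebra_simps)
  qed
  then have "(norm (w t))\<^sup>2 \<le> (exp (L * \<bar>t - s\<bar>) * norm (w s))\<^sup>2"
    by (simp add: \<phi>_def dot_square_norm power_mult_distrib)
  then show ?thesis by (rule power2_le_imp_le) simp
qed

lemma has_real_derivative_Re_of_real:
  assumes "(g has_field_derivative g') (at (complex_of_real x))"
  shows "((\<lambda>t. Re (g (of_real t))) has_real_derivative Re g') (at x)"
  using bounded_linear.has_vector_derivative[OF bounded_linear_Re has_vector_derivative_real_field[OF assms]]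
  by (simp add: has_real_derivative_iff_has_vector_derivative)

text \<open>Continuity of the derivative is what lets a nonzero determinant of velocity and field
  persist at nearby parameters of a transversal.\<close>

lemma real_analytic_continuous_derivative:
  assumes "real_analytic_at f x"
  obtains f' where "\<forall>\<^sub>F y in nhds x. (f has_real_derivative f' y) (at y)" "isCont f' x"
proof -
  obtain g r where r: "r > 0" and g: "g holomorphic_on ball 0 r"
    and f: "\<And>h. \<bar>h\<bar> < r \<Longrightarrow> g (of_real h) = of_real (f (x + h))"
    using real_analytic_complexify[OF assms] by metis
  define f' where "f' = (\<lambda>y. Re (deriv g (of_real (y - x))))"
  have d: "(f has_real_derivative f' y) (at y)" if "y \<in> ball x r" for y
  proof -
    have y: "complex_of_real (y - x) \<in> ball 0 r"
      using that by (simp add: dist_real_def norm_minus_commute del: of_real_diff)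
    have "((\<lambda>t. Re (g (of_real (t - x)))) has_real_derivative f' y) (at y)"
      using DERIV_shift[of "\<lambda>t. Re (g (of_real t))" "f' y" y "- x"]
        has_real_derivative_Re_of_real[OF holomorphic_derivI[OF g open_ball y]] by (simp add: f'_def)
    then show ?thesis
    proof (rule has_field_derivative_transform_within_open[OF _ open_ball that])
      fix z assume "z \<in> ball x r"
      then have "g (of_real (z - x)) = of_real (f z)"
        using f[of "z - x"] by (simp add: dist_real_def)
      then show "Re (g (of_real (z - x))) = f z" by simp
    qed
  qed
  have "isCont (deriv g) 0"
    using holomorphic_on_imp_continuous_on[OF holomorphic_deriv[OF g open_ball]] r
    by (simp add: continuous_on_eq_continuous_at)
  then have "isCont (\<lambda>y. deriv g (of_real (y - x))) x"
    by (intro isCont_o2[where g = "deriv g" and f = "\<lambda>y. of_real (y - x)"] isCont_of_real isCont_diff continuous_ident continuous_const) simp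
  then have "isCont f' x"
    unfolding f'_def isCont_def by (rule tendsto_Re)
  moreover have "\<forall>\<^sub>F y in nhds x. (f has_real_derivative f' y) (at y)"
    using eventually_nhds_in_open[OF open_ball, of x x r] r d by (auto elim: eventually_mono)
  ultimately show ?thesis using that by blast
qed

lemma real_analytic_at_eventually:
  assumes "real_analytic_at f x"
  shows "\<forall>\<^sub>F y in nhds x. real_analytic_at f y"
proof -
  obtain g r where r: "r > 0" and g: "g holomorphic_on ball 0 r"
    and f: "\<And>h. \<bar>h\<bar> < r \<Longrightarrow> g (of_real h) = of_real (f (x + h))"
    using real_analytic_complexify[OF assms] by metis
  have "real_analytic_at f y" if "y \<in> ball x r" for y
  proof (rule real_analytic_atI)
    show "r - \<bar>y - x\<bar> > 0" using that by (simp add: dist_real_def abs_minus_commute)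
    have "(g \<circ> (\<lambda>z. z + of_real (y - x))) holomorphic_on ball 0 (r - \<bar>y - x\<bar>)"
    proof (rule holomorphic_on_compose_gen[OF _ g])
      show "(\<lambda>z. z + complex_of_real (y - x)) ` ball 0 (r - \<bar>y - x\<bar>) \<subseteq> ball 0 r"
      proof (clarsimp simp del: of_real_diff)
        fix z :: complex assume "cmod z < r - \<bar>y - x\<bar>"
        then show "cmod (z + complex_of_real (y - x)) < r"
          using norm_triangle_ineq[of z "complex_of_real (y - x)"] by (simp del: of_real_diff)
      qed
    qed (intro holomorphic_intros)
    then show "(\<lambda>z. g (z + of_real (y - x))) holomorphic_on ball 0 (r - \<bar>y - x\<bar>)"
      by (simp add: o_def)
    show "g (of_real h + of_real (y - x)) = of_real (f (y + h))" if "\<bar>h\<bar> < r - \<bar>y - x\<bar>" for h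
      using f[of "h + (y - x)"] that by (simp add: algebra_simps)
  qed
  then show ?thesis
    using eventually_nhds_in_open[OF open_ball, of x x r] r by (auto elim: eventually_mono)
qed

lemma real_analytic_compose:
  assumes "real_analytic_at f x" "real_analytic_at g (f x)"
  shows "real_analytic_at (\<lambda>t. g (f t)) x"
proof -
  obtain F r where r: "r > 0" and F: "F holomorphic_on ball 0 r"
    and f: "\<And>h. \<bar>h\<bar> < r \<Longrightarrow> F (of_real h) = of_real (f (x + h))"
    using real_analytic_complexify[OF assms(1)] by metis
  obtain G s where s: "s > 0" and G: "G holomorphic_on ball 0 s"
    and g: "\<And>h. \<bar>h\<bar> < s \<Longrightarrow> G (of_real h) = of_real (g (f x + h))"
    using real_analytic_complexify[OF assms(2)] by metis
  have F0: "F 0 = of_real (f x)" using f[of 0] r by simp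
  have "isCont F 0"
    using holomorphic_on_imp_continuous_on[OF F] r by (simp add: continuous_on_eq_continuous_at)
  then obtain d where d: "d > 0" "\<And>z. dist z 0 < d \<Longrightarrow> dist (F z) (F 0) < s"
    using s unfolding continuous_at_eps_delta by metis
  define e where "e = min d r"
  have e: "e > 0" "e \<le> r" "e \<le> d" using d r by (auto simp: e_def)
  show ?thesis
  proof (rule real_analytic_atI[OF e(1)])
    have "(G \<circ> (\<lambda>z. F z - of_real (f x))) holomorphic_on ball 0 e"
    proof (rule holomorphic_on_compose_gen[OF _ G])
      show "(\<lambda>z. F z - of_real (f x)) holomorphic_on ball 0 e"
        using F e by (intro holomorphic_intros) (auto intro: holomorphic_on_subset)
      show "(\<lambda>z. F z - of_real (f x)) ` ball 0 e \<subseteq> ball 0 s"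
      proof (clarsimp)
        fix z :: complex assume "cmod z < e"
        then show "cmod (F z - of_real (f x)) < s" using d(2)[of z] e by (simp add: dist_norm F0)
      qed
    qed
    then show "(\<lambda>z. G (F z - of_real (f x))) holomorphic_on ball 0 e" by (simp add: o_def)
    fix h assume h: "\<bar>h\<bar> < e"
    have eq: "F (of_real h) - of_real (f x) = of_real (f (x + h) - f x)"
      using f[of h] h e by simp
    have "\<bar>f (x + h) - f x\<bar> < s"
      using d(2)[of "of_real h"] h e eq by (simp add: dist_norm F0 del: of_real_diff)
    then show "G (F (of_real h) - of_real (f x)) = of_real (g (f (x + h)))"
      unfolding eq using g[of "f (x + h) - f x"] by simp
  qed
qed

text \<open>The derivative of the complexification at 0 has real part D and is therefore nonzero, so
  a local holomorphic inverse exists. What remains is that this inverse is real at real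
  arguments.\<close>

lemma real_analytic_inverse:
  assumes f: "real_analytic_at f x" and D: "(f has_real_derivative D) (at x)" "D \<noteq> 0"
  obtains g where "real_analytic_at g (f x)" "g (f x) = x"
    "(g has_real_derivative inverse D) (at (f x))"
    "\<forall>\<^sub>F y in nhds (f x). f (g y) = y" "\<forall>\<^sub>F t in nhds x. g (f t) = t"
proof -
  obtain F r where r: "r > 0" and F: "F holomorphic_on ball 0 r"
    and fF: "\<And>h. \<bar>h\<bar> < r \<Longrightarrow> F (of_real h) = of_real (f (x + h))"
    using real_analytic_complexify[OF f] by metis
  have F0: "F 0 = of_real (f x)" using fF[of 0] r by simp
  have "((\<lambda>t. Re (F (of_real t))) has_real_derivative Re (deriv F 0)) (at 0)"
    by (rule has_real_derivative_Re_of_real) (use holomorphic_derivI[OF F open_ball] r in simp)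
  moreover have "((\<lambda>t. Re (F (of_real t))) has_real_derivative D) (at 0)"
  proof (rule has_field_derivative_transform_within_open[OF _ open_ball, of _ _ _ 0 r])
    show "((\<lambda>h. f (x + h)) has_real_derivative D) (at 0)"
      using D(1) DERIV_shift[of f D 0 x] by (simp add: add.commute)
    show "f (x + h) = Re (F (of_real h))" if "h \<in> ball 0 r" for h
      using fF[of h] that by simp
  qed (use r in simp)
  ultimately have "Re (deriv F 0) = D" by (rule DERIV_unique)
  then have dF: "deriv F 0 \<noteq> 0" using D by auto
  obtain s where s: "s > 0" "ball 0 s \<subseteq> ball (0::complex) r" "open (F ` ball 0 s)" "inj_on F (ball 0 s)"
  proof (rule has_complex_derivative_locally_invertible[OF F _ open_ball dF])
    show "0 \<in> ball 0 r" using r by simp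
  qed (rule that)
  have Fs: "F holomorphic_on ball 0 s" using F s holomorphic_on_subset by blast
  have sr: "s \<le> r" using s(1,2) by (simp add: ball_subset_ball_iff)
  obtain G where G: "G holomorphic_on F ` ball 0 s" and GF: "\<And>z. z \<in> ball 0 s \<Longrightarrow> G (F z) = z"
    using holomorphic_has_inverse[OF Fs open_ball s(4)] by metis
  have contf: "\<forall>t. \<bar>t\<bar> < r \<longrightarrow> isCont (\<lambda>h. Re (F (of_real h))) t"
  proof (intro allI impI)
    fix t assume "\<bar>t\<bar> < r"
    then show "isCont (\<lambda>h. Re (F (of_real h))) t"
      by (intro DERIV_isCont[OF has_real_derivative_Re_of_real[OF holomorphic_derivI[OF F open_ball]]]) simp
  qed
  have dRe: "((\<lambda>h. Re (F (of_real h))) has_real_derivative D) (at 0)" by fact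
  \<comment> \<open>By the intermediate value theorem all real values near \<open>f x\<close> are attained on the real axis, so
    the complex inverse is real there.\<close>
  have "\<exists>e>0. \<forall>y. \<bar>y - f x\<bar> < e \<longrightarrow> (\<exists>h. \<bar>h\<bar> < s \<and> f (x + h) = y)"
  proof -
    define k where "k = (\<lambda>h. Re (F (of_real h)))"
    have kf: "k h = f (x + h)" if "\<bar>h\<bar> < r" for h using fF[OF that] by (simp add: k_def)
    have k0: "k 0 = f x" using kf[of 0] r by simp
    \<comment> \<open>A nonzero derivative puts the values of k at some -h and h on opposite sides
      of \<open>k 0\<close>, in an order given by the sign of D.\<close>
    have "\<exists>h. 0 < h \<and> h < s \<and> (k (- h) < k 0 \<and> k 0 < k h \<or> k h < k 0 \<and> k 0 < k (- h))"
    proof (cases "D > 0")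
      case True
      obtain d1 where "d1 > 0" "\<And>h. 0 < h \<Longrightarrow> h < d1 \<Longrightarrow> k 0 < k (0 + h)"
        using DERIV_pos_inc_right[OF dRe True] unfolding k_def by auto
      moreover obtain d2 where "d2 > 0" "\<And>h. 0 < h \<Longrightarrow> h < d2 \<Longrightarrow> k (0 - h) < k 0"
        using DERIV_pos_inc_left[OF dRe True] unfolding k_def by auto
      ultimately show ?thesis using s(1)
        by (intro exI[of _ "min (min d1 d2) s / 2"]) auto
    next
      case False
      then have neg: "D < 0" using D by simp
      obtain d1 where "d1 > 0" "\<And>h. 0 < h \<Longrightarrow> h < d1 \<Longrightarrow> k (0 + h) < k 0"
        using DERIV_neg_dec_right[OF dRe neg] unfolding k_def by auto
      moreover obtain d2 where "d2 > 0" "\<And>h. 0 < h \<Longrightarrow> h < d2 \<Longrightarrow> k 0 < k (0 - h)"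
        using DERIV_neg_dec_left[OF dRe neg] unfolding k_def by auto
      ultimately show ?thesis using s(1)
        by (intro exI[of _ "min (min d1 d2) s / 2"]) auto
    qed
    then obtain h where h: "0 < h" "h < s"
      and or: "k (- h) < k 0 \<and> k 0 < k h \<or> k h < k 0 \<and> k 0 < k (- h)" by blast
    define e where "e = min \<bar>k h - k 0\<bar> \<bar>k (- h) - k 0\<bar>"
    have ck: "continuous_on {- h..h} k"
      unfolding k_def by (rule continuous_at_imp_continuous_on) (use contf h sr in auto)
    have "\<exists>t. \<bar>t\<bar> < s \<and> f (x + t) = y" if "\<bar>y - f x\<bar> < e" for y
    proof -
      have "\<exists>t\<ge>- h. t \<le> h \<and> k t = y"
        using or
      proof
        assume "k (- h) < k 0 \<and> k 0 < k h"
        then show ?thesis using that h ck by (intro IVT') (auto simp: e_def k0 split: if_splits)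
      next
        assume "k h < k 0 \<and> k 0 < k (- h)"
        then show ?thesis using that h ck by (intro IVT2') (auto simp: e_def k0 split: if_splits)
      qed
      then obtain t where "- h \<le> t" "t \<le> h" "k t = y" by blast
      then show ?thesis using kf[of t] h sr by (intro exI[of _ t]) auto
    qed
    moreover have "e > 0" using or by (auto simp: e_def)
    ultimately show ?thesis by blast
  qed
  then obtain e where e: "e > 0" and att: "\<And>y. \<bar>y - f x\<bar> < e \<Longrightarrow> \<exists>h. \<bar>h\<bar> < s \<and> f (x + h) = y"
    by blast
  define g where "g = (\<lambda>y. x + Re (G (of_real y)))"
  have Gy: "G (of_real y) = of_real (g y - x)" "f (g y) = y" "\<bar>g y - x\<bar> < s" if y: "\<bar>y - f x\<bar> < e" for y
  proof -
    obtain h where h: "\<bar>h\<bar> < s" "f (x + h) = y" using att[OF y] by blast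
    have "G (of_real y) = of_real h"
      using GF[of "of_real h"] fF[of h] h sr by simp
    then show "G (of_real y) = of_real (g y - x)" "f (g y) = y" "\<bar>g y - x\<bar> < s" using h by (auto simp: g_def)
  qed
  have gf: "g (f (x + h)) = x + h" if "\<bar>h\<bar> < s" for h
    using GF[of "of_real h"] fF[of h] that sr by (simp add: g_def)
  have "F 0 \<in> F ` ball 0 s" using s by auto
  then obtain d where d: "d > 0" "ball (F 0) d \<subseteq> F ` ball 0 s" using s(3) open_contains_ball by blast
  define \<epsilon> where "\<epsilon> = min d e"
  have \<epsilon>: "\<epsilon> > 0" "\<epsilon> \<le> d" "\<epsilon> \<le> e" using d e by (auto simp: \<epsilon>_def)
  have an: "real_analytic_at g (f x)"
  proof (rule real_analytic_atI[OF \<epsilon>(1)])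
    have "(G \<circ> (\<lambda>z. of_real (f x) + z)) holomorphic_on ball 0 \<epsilon>"
    proof (rule holomorphic_on_compose_gen[OF _ G])
      show "(\<lambda>z. of_real (f x) + z) ` ball 0 \<epsilon> \<subseteq> F ` ball 0 s"
        using d \<epsilon> by (force simp: F0 dist_norm)
    qed (intro holomorphic_intros)
    then show "(\<lambda>z. of_real x + G (of_real (f x) + z)) holomorphic_on ball 0 \<epsilon>"
      by (intro holomorphic_intros) (simp add: o_def)
    show "of_real x + G (of_real (f x) + of_real h) = of_real (g (f x + h))" if "\<bar>h\<bar> < \<epsilon>" for h
      using Gy(1)[of "f x + h"] that \<epsilon> by simp
  qed
  have gfx: "g (f x) = x" using gf[of 0] s by simp
  have ev1: "\<forall>\<^sub>F y in nhds (f x). f (g y) = y"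
  proof (rule eventually_mono[OF eventually_nhds_in_open[OF open_ball, of "f x" "f x" e]])
    show "f (g y) = y" if "y \<in> ball (f x) e" for y
      using Gy(2)[of y] that by (simp add: dist_real_def abs_minus_commute)
  qed (use e in simp)
  have ev2: "\<forall>\<^sub>F t in nhds x. g (f t) = t"
  proof (rule eventually_mono[OF eventually_nhds_in_open[OF open_ball, of x x s]])
    show "g (f t) = t" if "t \<in> ball x s" for t
      using gf[of "t - x"] that by (simp add: dist_real_def abs_minus_commute)
  qed (use s in simp)
  obtain g' where g': "\<forall>\<^sub>F y in nhds (f x). (g has_real_derivative g' y) (at y)"
    using real_analytic_continuous_derivative[OF an] by metis
  then have dg: "(g has_real_derivative g' (f x)) (at (f x))"
    by (rule eventually_nhds_x_imp_x)
  have "((\<lambda>t. g (f t)) has_real_derivative g' (f x) * D) (at x)"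
    by (rule DERIV_chain2[OF dg D(1)])
  moreover have "((\<lambda>t. g (f t)) has_real_derivative 1) (at x)"
    using ev2 DERIV_cong_ev[OF refl ev2 refl, of 1] by simp
  ultimately have "g' (f x) * D = 1" by (rule DERIV_unique)
  then have "g' (f x) = inverse D" using D(2) by (simp add: field_simps)
  with dg an gfx ev1 ev2 show ?thesis using that by metis
qed

section \<open>Analytic dependence of solutions on the initial value\<close>

text \<open>Leibniz' rule asks for a derivative in z that is jointly continuous in (z, r). Writing
  it as a Cauchy integral over a fixed circle reduces this to joint continuity of G.\<close>

lemma holomorphic_on_param_integral:
  fixes G :: "complex \<Rightarrow> real \<Rightarrow> complex"
  assumes Z: "open Z" and cont: "continuous_on (Z \<times> {0..1}) (\<lambda>(z, r). G z r)"
    and hol: "\<And>r. r \<in> {0..1} \<Longrightarrow> (\<lambda>z. G z r) holomorphic_on Z"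
  shows "(\<lambda>z. integral {0..1} (G z)) holomorphic_on Z"
proof (rule holomorphic_on_locally)
  fix z0 assume "z0 \<in> Z"
  then obtain d where d: "d > 0" "cball z0 d \<subseteq> Z"
    using Z open_contains_cball by blast
  \<comment> \<open>Half the radius keeps z off the circle, so the denominators u - z do not
    vanish.\<close>
  define U where "U = ball z0 (d/2)"
  have U: "U \<subseteq> ball z0 d" "U \<subseteq> Z" using d by (auto simp: U_def)
  define c where "c = circlepath z0 d"
  have c: "c t \<in> sphere z0 d" if "t \<in> {0..1}" for t
    using d that path_image_def[of c] by (auto simp: c_def path_image_circlepath_nonneg image_iff)
  define K where "K = (\<lambda>z r. 1 / (2 * of_real pi * \<i>) * contour_integral c (\<lambda>u. G u r / (u - z)\<^sup>2))"
  have "(\<lambda>z. integral (cbox 0 1) (G z)) holomorphic_on U"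
  proof (rule leibniz_rule_holomorphic[where fx = K])
    show "convex U" by (simp add: U_def)
    show "G z integrable_on cbox 0 1" if "z \<in> U" for z
      unfolding box_real by (intro integrable_continuous_real continuous_on_compose2[OF cont, of _ "\<lambda>r. (z, r)", simplified] continuous_intros)
        (use that U in auto)
    show "((\<lambda>z. G z r) has_field_derivative K z r) (at z within U)" if "z \<in> U" "r \<in> cbox 0 1" for z r
      unfolding K_def c_def
      by (rule has_field_derivative_at_within, rule Cauchy_derivative_integral_circlepath)
         (use that U d holomorphic_on_subset[OF hol[of r] d(2)]
            holomorphic_on_subset[OF hol[of r] order_trans[OF ball_subset_cball d(2)]]
           in \<open>auto intro!: holomorphic_on_imp_continuous_on\<close>)
    show "continuous_on (U \<times> cbox 0 1) (\<lambda>(z, r). K z r)"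
    proof -
      have eq: "contour_integral c (\<lambda>u. G u r / (u - z)\<^sup>2) = integral (cbox 0 1)
          (\<lambda>t. G (c t) r / (c t - z)\<^sup>2 * (2 * pi * \<i> * d * exp (2 * of_real pi * \<i> * t)))" for z r
        unfolding contour_integral_integral c_def box_real by (simp add: vector_derivative_circlepath)
      have cc: "continuous_on S c" for S
        unfolding c_def circlepath by (intro continuous_intros)
      have "continuous_on (U \<times> cbox 0 1) (\<lambda>p. integral (cbox 0 1)
          (\<lambda>t. G (c t) (snd p) / (c t - fst p)\<^sup>2 * (2 * pi * \<i> * d * exp (2 * of_real pi * \<i> * t))))"
      proof (rule integral_continuous_on_param)
        have ct: "c t \<in> Z" if "t \<in> {0..1}" for t using c[OF that] d by auto
        have ne: "c t \<noteq> z" if "t \<in> {0..1}" "z \<in> U" for t z using c[OF that(1)] that U by auto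
        have "continuous_on ((U \<times> {0..1}) \<times> {0..1}) (\<lambda>q. G (c (snd q)) (snd (fst q)))"
          by (rule continuous_on_compose2[OF cont, of _ "\<lambda>q. (c (snd q), snd (fst q))", simplified])
             (use ct in \<open>auto intro!: continuous_intros continuous_on_compose2[OF cc[of UNIV]]\<close>)
        then show "continuous_on ((U \<times> cbox 0 1) \<times> cbox 0 1) (\<lambda>(p, t). G (c t) (snd p) / (c t - fst p)\<^sup>2 *
              (2 * pi * \<i> * d * exp (2 * of_real pi * \<i> * t)))"
          unfolding case_prod_unfold box_real
          by (intro continuous_intros continuous_on_compose2[OF cc[of UNIV]]) (use ne in auto)
      qed
      then show ?thesis
        unfolding K_def eq case_prod_unfold by (intro continuous_intros)
    qed
  qed
  then show "\<exists>d>0. (\<lambda>z. integral {0..1} (G z)) holomorphic_on ball z0 d"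
    using d by (intro exI[of _ "d/2"]) (simp add: U_def)
qed

section \<open>Picard iteration over the complex numbers\<close>

lemma integral_in_Reals:
  fixes f :: "real \<Rightarrow> complex"
  assumes "continuous_on {0..1} f" "\<And>r. r \<in> {0..1} \<Longrightarrow> f r \<in> \<real>"
  shows "integral {0..1} f \<in> \<real>"
proof -
  have "Im (integral {0..1} f) = integral {0..1} (Im \<circ> f)"
    using integral_linear[OF integrable_continuous_real[OF assms(1)] bounded_linear_Im] by simp
  also have "\<dots> = 0"
    by (intro integral_unique has_integral_is_0) (use assms(2) in \<open>simp add: complex_is_Real_iff\<close>)
  finally show ?thesis by (simp add: complex_is_Real_iff)
qed

text \<open>On the closed polydisc of radius \<open>\<rho>\<close> the right-hand side is bounded by
  M and has Lipschitz constant L in the second variable. The conditions on \<open>\<delta>\<close>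
  say in turn that x + l stays there for |x| < \<delta> and |l| < 2 \<delta>, that iterates move by
  at most \<rho>/8, and that one Picard step contracts by 1/2. Reality of F at real points is what
  makes real initial data give real solutions.\<close>

locale complex_ode =
  fixes F :: "complex \<times> complex \<Rightarrow> complex" and \<rho> R M L \<delta> :: real
  assumes hol: "hol2_on F (ball 0 R \<times> ball 0 R)"
    and \<rho>: "0 < \<rho>" "\<rho> < R" and \<delta>: "0 < \<delta>" "3 * \<delta> \<le> \<rho>" "2 * \<delta> * M \<le> \<rho> / 8" "2 * \<delta> * L \<le> 1 / 2"
    and M: "M \<ge> 0" and L: "L \<ge> 0"
    and bound: "\<And>z w. norm z \<le> \<rho> \<Longrightarrow> norm w \<le> \<rho> \<Longrightarrow> norm (F (z, w)) \<le> M"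
    and lip: "\<And>z w w'. norm z \<le> \<rho> \<Longrightarrow> norm w \<le> \<rho> \<Longrightarrow> norm w' \<le> \<rho> \<Longrightarrow>
      norm (F (z, w) - F (z, w')) \<le> L * norm (w - w')"
    and real: "\<And>x y. norm (complex_of_real x) \<le> \<rho> \<Longrightarrow> norm (complex_of_real y) \<le> \<rho> \<Longrightarrow>
      F (of_real x, of_real y) \<in> \<real>"
begin

text \<open>
  Picard iteration for \<open>y' = F(x, y)\<close>; \<open>W x l y\<close> is the value at \<open>x + l\<close> of the solution with the
  value \<open>y\<close> at \<open>x\<close>.
\<close>

fun picard :: "nat \<Rightarrow> complex \<Rightarrow> complex \<Rightarrow> complex \<Rightarrow> complex" where
  "picard 0 x l y = y"
| "picard (Suc n) x l y =
     y + l * integral {0..1} (\<lambda>r. F (x + of_real r * l, picard n x (of_real r * l) y))"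

definition W :: "complex \<Rightarrow> complex \<Rightarrow> complex \<Rightarrow> complex" where
  "W x l y = y + (\<Sum>n. picard (Suc n) x l y - picard n x l y)"

text \<open>The length l ranges over twice the radius of x because in the applications it is a
  difference of two points of (-\<delta>, \<delta>).\<close>

definition dom :: "(complex \<times> complex \<times> complex) set" where
  "dom = ball 0 \<delta> \<times> ball 0 (2 * \<delta>) \<times> ball 0 (\<rho>/2)"

lemma dom_scale: "(x, l, y) \<in> dom \<Longrightarrow> r \<in> {0..1} \<Longrightarrow> (x, of_real r * l, y) \<in> dom"
proof -
  assume a: "(x, l, y) \<in> dom" "r \<in> {0..1}"
  have "r * norm l \<le> 1 * norm l" using a by (intro mult_right_mono) auto
  then show ?thesis using a by (auto simp: dom_def norm_mult)
qed

lemma dom_x: "(x, l, y) \<in> dom \<Longrightarrow> norm (x + l) \<le> \<rho>"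
  using norm_triangle_ineq[of x l] \<delta> by (auto simp: dom_def)

lemma dom_y: "(x, l, y) \<in> dom \<Longrightarrow> norm (v - y) \<le> \<rho>/8 \<Longrightarrow> norm v \<le> \<rho>"
  using norm_triangle_ineq[of "v - y" y] \<rho> by (auto simp: dom_def)

text \<open>Stated for any v close to the initial value, since it is applied to the iterates and to
  their limit \<open>W\<close>. The parameter r runs along the segment from x to x + l, which makes
  sense for complex l.\<close>

lemma continuous_integrand:
  assumes c: "continuous_on dom (\<lambda>(x, l, y). v x l y)"
    and b: "\<And>x l y. (x, l, y) \<in> dom \<Longrightarrow> norm (v x l y - y) \<le> \<rho>/8"
  shows "continuous_on (dom \<times> {0..1})
    (\<lambda>((x, l, y), r). F (x + of_real r * l, v x (of_real r * l) y))"
proof -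
  have 1: "continuous_on (dom \<times> {0..1}) (\<lambda>q. case (fst (fst q), of_real (snd q) * fst (snd (fst q)), snd (snd (fst q))) of (x, l, y) \<Rightarrow> v x l y)"
    by (rule continuous_on_compose2[OF c]) (use dom_scale in \<open>auto intro!: continuous_intros\<close>)
  show ?thesis
    unfolding case_prod_unfold
  proof (rule continuous_on_compose2[OF hol2_on_continuous[OF hol]])
    show "continuous_on (dom \<times> {0..1}) (\<lambda>p. (fst (fst p) + complex_of_real (snd p) * fst (snd (fst p)),
         v (fst (fst p)) (complex_of_real (snd p) * fst (snd (fst p))) (snd (snd (fst p)))))"
      using 1 by (intro continuous_intros) simp_all
    have "norm (x + of_real r * l) < R \<and> norm (v x (of_real r * l) y) < R"
      if d: "(x, l, y) \<in> dom" and r: "r \<in> {0..1}" for x l y r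
      using dom_x[OF dom_scale[OF d r]] dom_y[OF dom_scale[OF d r] b[OF dom_scale[OF d r]]] \<rho> by auto
    then show "(\<lambda>p. (fst (fst p) + complex_of_real (snd p) * fst (snd (fst p)),
         v (fst (fst p)) (complex_of_real (snd p) * fst (snd (fst p))) (snd (snd (fst p))))) ` (dom \<times> {0..1})
         \<subseteq> ball 0 R \<times> ball 0 R"
      by force
  qed
qed

lemma continuous_integrand_at:
  assumes c: "continuous_on dom (\<lambda>(x, l, y). v x l y)"
    and b: "\<And>x l y. (x, l, y) \<in> dom \<Longrightarrow> norm (v x l y - y) \<le> \<rho>/8" and d: "(x, l, y) \<in> dom"
  shows "continuous_on {0..1} (\<lambda>r. F (x + of_real r * l, v x (of_real r * l) y))"
proof -
  have "continuous_on {0..1::real} (\<lambda>r. ((x, l, y), r))" by (intro continuous_intros)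
  from continuous_on_compose2[OF continuous_integrand[OF c b] this] show ?thesis
    using d by (simp add: image_subset_iff)
qed

lemma picard_continuous_bound:
  "continuous_on dom (\<lambda>(x, l, y). picard n x l y) \<and>
   (\<forall>x l y. (x, l, y) \<in> dom \<longrightarrow> norm (picard n x l y - y) \<le> \<rho>/8)"
proof (induction n)
  case 0
  then show ?case using \<rho> by (auto simp: case_prod_unfold intro!: continuous_intros)
next
  case (Suc n)
  then have c: "continuous_on dom (\<lambda>(x, l, y). picard n x l y)"
    and b: "\<And>x l y. (x, l, y) \<in> dom \<Longrightarrow> norm (picard n x l y - y) \<le> \<rho>/8" by auto
  have "continuous_on dom (\<lambda>p. integral (cbox 0 1)
     (\<lambda>r. F (fst p + of_real r * fst (snd p), picard n (fst p) (of_real r * fst (snd p)) (snd (snd p)))))"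
    by (rule integral_continuous_on_param) (use continuous_integrand[OF c b] in \<open>simp add: case_prod_unfold\<close>)
  then have "continuous_on dom (\<lambda>(x, l, y). picard (Suc n) x l y)"
    unfolding case_prod_unfold picard.simps box_real by (intro continuous_intros)
  moreover have "norm (picard (Suc n) x l y - y) \<le> \<rho>/8" if d: "(x, l, y) \<in> dom" for x l y
  proof -
    have "norm (integral {0..1} (\<lambda>r. F (x + of_real r * l, picard n x (of_real r * l) y))) \<le> M * (1 - 0)"
    proof (rule integral_bound)
      show "norm (F (x + of_real r * l, picard n x (of_real r * l) y)) \<le> M" if r: "r \<in> {0..1}" for r
        using dom_x[OF dom_scale[OF d r]] dom_y[OF dom_scale[OF d r] b[OF dom_scale[OF d r]]] by (rule bound)
    qed (use continuous_integrand_at[OF c b d] in auto)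
    then have "norm (picard (Suc n) x l y - y) \<le> (2 * \<delta>) * M"
      using d M \<delta>(1) by (auto simp: norm_mult dom_def intro!: mult_mono)
    then show ?thesis using \<delta> by linarith
  qed
  ultimately show ?case by blast
qed

lemmas picard_continuous = picard_continuous_bound[THEN conjunct1]
lemmas picard_bound = picard_continuous_bound[THEN conjunct2, rule_format]

text \<open>One Picard step halves distances that are uniform on \<open>dom\<close>, because |l| < 2
  \<delta> and 2 \<delta> L \<le> 1/2. This serves both the convergence of the iterates and the
  passage to the limit in the integral equation.\<close>

lemma integral_difference_bound:
  assumes v: "continuous_on dom (\<lambda>(x, l, y). v x l y)"
    "\<And>x l y. (x, l, y) \<in> dom \<Longrightarrow> norm (v x l y - y) \<le> \<rho>/8"
    and v': "continuous_on dom (\<lambda>(x, l, y). v' x l y)"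
    "\<And>x l y. (x, l, y) \<in> dom \<Longrightarrow> norm (v' x l y - y) \<le> \<rho>/8"
    and B: "\<And>x l y. (x, l, y) \<in> dom \<Longrightarrow> norm (v x l y - v' x l y) \<le> B" and d: "(x, l, y) \<in> dom"
  shows "norm (l * integral {0..1} (\<lambda>r. F (x + of_real r * l, v x (of_real r * l) y)) -
    l * integral {0..1} (\<lambda>r. F (x + of_real r * l, v' x (of_real r * l) y))) \<le> B / 2"
proof -
  have B0: "0 \<le> B" using B[OF d] norm_ge_zero order_trans by blast
  note c = continuous_integrand_at[OF v d] continuous_integrand_at[OF v' d]
  have "norm (integral {0..1} (\<lambda>r. F (x + of_real r * l, v x (of_real r * l) y) -
     F (x + of_real r * l, v' x (of_real r * l) y))) \<le> L * B * (1 - 0)"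
  proof (rule integral_bound)
    fix r :: real assume r: "r \<in> {0..1}"
    note d' = dom_scale[OF d r]
    have "norm (F (x + of_real r * l, v x (of_real r * l) y) - F (x + of_real r * l, v' x (of_real r * l) y))
       \<le> L * norm (v x (of_real r * l) y - v' x (of_real r * l) y)"
      using dom_x[OF d'] dom_y[OF d' v(2)[OF d']] dom_y[OF d' v'(2)[OF d']] by (rule lip)
    also have "\<dots> \<le> L * B" using B[OF d'] L by (rule mult_left_mono)
    finally show "norm (F (x + of_real r * l, v x (of_real r * l) y) - F (x + of_real r * l, v' x (of_real r * l) y)) \<le> L * B" .
  qed (use c in \<open>auto intro!: continuous_intros\<close>)
  then have "norm (l * (integral {0..1} (\<lambda>r. F (x + of_real r * l, v x (of_real r * l) y)) -
    integral {0..1} (\<lambda>r. F (x + of_real r * l, v' x (of_real r * l) y)))) \<le> 2 * \<delta> * (L * B)"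
    unfolding norm_mult using d L B0 c \<delta>(1)
    by (intro mult_mono) (auto simp: dom_def integral_diff integrable_continuous_real)
  also have "\<dots> \<le> 1 / 2 * B" using mult_right_mono[OF \<delta>(4) B0] by (simp add: mult_ac)
  finally show ?thesis by (simp add: right_diff_distrib)
qed

lemma picard_step:
  "(x, l, y) \<in> dom \<Longrightarrow> norm (picard (Suc n) x l y - picard n x l y) \<le> (1/2) ^ n * (\<rho>/8)"
proof (induction n arbitrary: x l y)
  case 0
  then show ?case using picard_bound[of x l y 1] by simp
next
  case (Suc n)
  show ?case
    using integral_difference_bound[OF picard_continuous picard_bound picard_continuous picard_bound Suc.IH Suc.prems]
    by (simp add: mult.commute)
qed

lemma picard_sum: "picard n x l y = y + (\<Sum>i<n. picard (Suc i) x l y - picard i x l y)"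
  by (subst sum_lessThan_telescope) simp

text \<open>Consecutive iterates differ by at most a geometric sequence, so the telescoping series
  converges uniformly on all of \<open>dom\<close>.\<close>

lemma W_limit: "uniform_limit dom (\<lambda>n (x, l, y). picard n x l y) (\<lambda>(x, l, y). W x l y) sequentially"
proof -
  have "uniform_limit dom (\<lambda>n p. \<Sum>i<n. (\<lambda>(x, l, y). picard (Suc i) x l y - picard i x l y) p)
      (\<lambda>p. suminf (\<lambda>i. (\<lambda>(x, l, y). picard (Suc i) x l y - picard i x l y) p)) sequentially"
  proof (rule Weierstrass_m_test)
    show "summable (\<lambda>n. (1/2::real) ^ n * (\<rho>/8))" by (intro summable_mult2 summable_geometric) simp
    show "norm (case p of (x, l, y) \<Rightarrow> picard (Suc n) x l y - picard n x l y) \<le> (1/2) ^ n * (\<rho>/8)" if "p \<in> dom" for n p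
      using picard_step that by (cases p) auto
  qed
  then have "uniform_limit dom (\<lambda>n p. snd (snd p) + (\<Sum>i<n. (\<lambda>(x, l, y). picard (Suc i) x l y - picard i x l y) p))
      (\<lambda>p. snd (snd p) + suminf (\<lambda>i. (\<lambda>(x, l, y). picard (Suc i) x l y - picard i x l y) p)) sequentially"
    by (intro uniform_limit_intros)
  moreover have "(\<lambda>(x, l, y). picard n x l y) =
      (\<lambda>p. snd (snd p) + (\<Sum>i<n. (\<lambda>(x, l, y). picard (Suc i) x l y - picard i x l y) p))" for n
    by (rule ext) (simp only: case_prod_unfold picard_sum[of n])
  ultimately show ?thesis
    by (simp add: W_def case_prod_unfold)
qed

lemma W_tendsto: "(x, l, y) \<in> dom \<Longrightarrow> (\<lambda>n. picard n x l y) \<longlonglongrightarrow> W x l y"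
  using tendsto_uniform_limitI[OF W_limit] by fastforce

lemma W_continuous: "continuous_on dom (\<lambda>(x, l, y). W x l y)"
  by (rule uniform_limit_theorem[OF _ W_limit]) (use picard_continuous in auto)

lemma W_bound: "(x, l, y) \<in> dom \<Longrightarrow> norm (W x l y - y) \<le> \<rho>/8"
  by (rule LIMSEQ_le_const2[OF tendsto_norm[OF tendsto_diff[OF W_tendsto tendsto_const]]])
     (use picard_bound in auto)

lemma W_equation:
  assumes d: "(x, l, y) \<in> dom"
  shows "W x l y = y + l * integral {0..1} (\<lambda>r. F (x + of_real r * l, W x (of_real r * l) y))"
proof (rule LIMSEQ_unique)
  show "(\<lambda>n. picard (Suc n) x l y) \<longlonglongrightarrow> W x l y"
    using W_tendsto[OF d] by (rule LIMSEQ_Suc)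
  show "(\<lambda>n. picard (Suc n) x l y) \<longlonglongrightarrow> y + l * integral {0..1} (\<lambda>r. F (x + of_real r * l, W x (of_real r * l) y))"
  proof (rule LIMSEQ_I)
    fix e :: real assume "e > 0"
    then have "\<forall>\<^sub>F n in sequentially. \<forall>p\<in>dom. dist ((\<lambda>(x, l, y). picard n x l y) p) ((\<lambda>(x, l, y). W x l y) p) < e"
      using W_limit unfolding uniform_limit_iff by blast
    then obtain N where N: "\<And>n x l y. n \<ge> N \<Longrightarrow> (x, l, y) \<in> dom \<Longrightarrow> norm (picard n x l y - W x l y) \<le> e"
      unfolding eventually_sequentially dist_norm by fastforce
    show "\<exists>no. \<forall>n\<ge>no. norm (picard (Suc n) x l y - (y + l * integral {0..1} (\<lambda>r. F (x + of_real r * l, W x (of_real r * l) y)))) < e"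
    proof (intro exI allI impI)
      fix n assume "n \<ge> N"
      then show "norm (picard (Suc n) x l y - (y + l * integral {0..1} (\<lambda>r. F (x + of_real r * l, W x (of_real r * l) y)))) < e"
        using integral_difference_bound[OF picard_continuous picard_bound W_continuous W_bound N d, of n] \<open>e > 0\<close>
        by simp
    qed
  qed
qed

lemma W_0: "norm x < \<delta> \<Longrightarrow> norm y < \<rho>/2 \<Longrightarrow> W x 0 y = y"
  using W_equation[of x 0 y] \<delta> by (simp add: dom_def)

text \<open>The path g2 is generalised in the induction because the inner iterate is taken at the
  shortened length r g2.\<close>

lemma picard_holomorphic:
  "open Z \<Longrightarrow> g1 holomorphic_on Z \<Longrightarrow> g2 holomorphic_on Z \<Longrightarrow> g3 holomorphic_on Z \<Longrightarrow>
   (\<And>z. z \<in> Z \<Longrightarrow> (g1 z, g2 z, g3 z) \<in> dom) \<Longrightarrow>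
   (\<lambda>z. picard n (g1 z) (g2 z) (g3 z)) holomorphic_on Z"
proof (induction n arbitrary: g2)
  case 0
  then show ?case by simp
next
  case (Suc n)
  note g = Suc.prems(2-4) and dom = Suc.prems(5)
  have hol_r: "(\<lambda>z. picard n (g1 z) (of_real r * g2 z) (g3 z)) holomorphic_on Z" if "r \<in> {0..1}" for r
    by (rule Suc.IH[OF Suc.prems(1)]) (use g dom_scale[OF dom that] in \<open>auto intro!: holomorphic_intros\<close>)
  have "(\<lambda>z. integral {0..1} (\<lambda>r. F (g1 z + of_real r * g2 z, picard n (g1 z) (of_real r * g2 z) (g3 z)))) holomorphic_on Z"
  proof (rule holomorphic_on_param_integral[OF Suc.prems(1)])
    show "(\<lambda>z. F (g1 z + of_real r * g2 z, picard n (g1 z) (of_real r * g2 z) (g3 z))) holomorphic_on Z"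
      if r: "r \<in> {0..1}" for r
    proof (rule hol2_on_compose[OF hol Suc.prems(1)])
      fix z assume "z \<in> Z"
      note d' = dom_scale[OF dom[OF this] r]
      show "(g1 z + of_real r * g2 z, picard n (g1 z) (of_real r * g2 z) (g3 z)) \<in> ball 0 R \<times> ball 0 R"
        using dom_x[OF d'] dom_y[OF d' picard_bound[OF d', of n]] \<rho> by auto
    qed (use g hol_r[OF r] in \<open>auto intro!: holomorphic_intros\<close>)
    have cg: "continuous_on Z g1" "continuous_on Z g2" "continuous_on Z g3"
      using g by (auto intro: holomorphic_on_imp_continuous_on)
    have "continuous_on (Z \<times> {0..1}) (\<lambda>q. ((g1 (fst q), g2 (fst q), g3 (fst q)), snd q))"
      by (intro continuous_intros continuous_on_compose2[OF cg(1)] continuous_on_compose2[OF cg(2)]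
            continuous_on_compose2[OF cg(3)]) auto
    from continuous_on_compose2[OF continuous_integrand[OF picard_continuous picard_bound] this]
    show "continuous_on (Z \<times> {0..1}) (\<lambda>(z, r). F (g1 z + of_real r * g2 z, picard n (g1 z) (of_real r * g2 z) (g3 z)))"
      using dom by (simp add: case_prod_unfold image_subset_iff)
  qed
  then show ?case using g by (auto intro!: holomorphic_intros)
qed

lemma W_holomorphic:
  assumes "open Z" "g1 holomorphic_on Z" "g2 holomorphic_on Z" "g3 holomorphic_on Z"
   "\<And>z. z \<in> Z \<Longrightarrow> (g1 z, g2 z, g3 z) \<in> dom"
  shows "(\<lambda>z. W (g1 z) (g2 z) (g3 z)) holomorphic_on Z"
proof (rule holomorphic_uniform_sequence[OF assms(1) picard_holomorphic[OF assms]])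
  fix z assume "z \<in> Z"
  then obtain d where d: "d > 0" "cball z d \<subseteq> Z"
    using assms(1) open_contains_cball by blast
  have "uniform_limit (cball z d) (\<lambda>n w. (\<lambda>(x, l, y). picard n x l y) (g1 w, g2 w, g3 w))
      (\<lambda>w. (\<lambda>(x, l, y). W x l y) (g1 w, g2 w, g3 w)) sequentially"
    by (rule uniform_limit_compose'[OF W_limit]) (use d assms(5) in auto)
  then show "\<exists>d>0. cball z d \<subseteq> Z \<and>
      uniform_limit (cball z d) (\<lambda>n w. picard n (g1 w) (g2 w) (g3 w)) (\<lambda>w. W (g1 w) (g2 w) (g3 w)) sequentially"
    using d by auto
qed

text \<open>For fixed x and y the integrand G is holomorphic on the convex disc of lengths and has a
  primitive P there; the integral equation then reads W = y + P l - P 0. This replaces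
  differentiation under the integral sign.\<close>

lemma W_derivative:
  assumes d: "(x, l, y) \<in> dom"
  shows "((\<lambda>l. W x l y) has_field_derivative F (x + l, W x l y)) (at l)"
proof -
  define B where "B = ball (0::complex) (2 * \<delta>)"
  have l: "l \<in> B" and dB: "\<And>l. l \<in> B \<Longrightarrow> (x, l, y) \<in> dom" using d by (auto simp: B_def dom_def)
  define G where "G = (\<lambda>l. F (x + l, W x l y))"
  have "G holomorphic_on B"
    unfolding G_def
  proof (rule hol2_on_compose[OF hol])
    show "(\<lambda>l. W x l y) holomorphic_on B"
      by (rule W_holomorphic) (use dB in \<open>auto simp: B_def\<close>)
    show "(x + l, W x l y) \<in> ball 0 R \<times> ball 0 R" if "l \<in> B" for l
      using dom_x[OF dB[OF that]] dom_y[OF dB[OF that] W_bound[OF dB[OF that]]] \<rho> by simp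
  qed (auto simp: B_def intro!: holomorphic_intros)
  then obtain P where P: "\<And>l. l \<in> B \<Longrightarrow> (P has_field_derivative G l) (at l within B)"
    using holomorphic_convex_primitive'[of B G] by (auto simp: B_def)
  have P': "(P has_field_derivative G l) (at l)" if "l \<in> B" for l
    using P[OF that] that at_within_open[of l B] by (simp add: B_def)
  have W: "W x l y = y + (P l - P 0)" if "l \<in> B" for l
  proof -
    have "((\<lambda>r. l * G (of_real r * l)) has_integral P (of_real 1 * l) - P (of_real 0 * l)) {0..1}"
    proof (rule fundamental_theorem_of_calculus)
      fix r :: real assume r: "r \<in> {0..1}"
      have rl: "of_real r * l \<in> B" using dom_scale[OF dB[OF that] r] by (simp add: dom_def B_def)
      have "((\<lambda>r. P (r * l)) has_field_derivative G (of_real r * l) * l) (at (of_real r))"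
        by (rule DERIV_chain2[where f = P and g = "\<lambda>r. r * l", OF P'[OF rl]]) (auto intro!: derivative_eq_intros)
      then show "((\<lambda>r. P (of_real r * l)) has_vector_derivative l * G (of_real r * l)) (at r within {0..1})"
        by (subst mult.commute) (rule has_vector_derivative_real_field)
    qed simp
    from integral_unique[OF this] have "l * integral {0..1} (\<lambda>r. G (of_real r * l)) = P l - P 0"
      by simp
    then show ?thesis
      using W_equation[OF dB[OF that]] by (simp add: G_def)
  qed
  have "((\<lambda>l. y + (P l - P 0)) has_field_derivative G l) (at l)"
    by (rule derivative_eq_intros P'[OF l] refl)+ simp
  then have "((\<lambda>l. W x l y) has_field_derivative G l) (at l)"
    by (rule has_field_derivative_transform_within_open[of _ _ _ B]) (use l W in \<open>auto simp: B_def\<close>)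
  then show ?thesis by (simp add: G_def)
qed

text \<open>Each iterate is real since F is real at real points, and the reals are closed in the
  complex plane.\<close>

lemma W_real:
  assumes "(complex_of_real x, of_real l, of_real y) \<in> dom"
  shows "W (of_real x) (of_real l) (of_real y) \<in> \<real>"
proof -
  have "picard n (of_real x) (of_real l) (of_real y) \<in> \<real>"
    if "(complex_of_real x, of_real l, of_real y) \<in> dom" for n l
    using that
  proof (induction n arbitrary: l)
    case (Suc n)
    have "F (of_real x + of_real r * of_real l, picard n (of_real x) (of_real r * of_real l) (of_real y)) \<in> \<real>"
      if r: "r \<in> {0..1}" for r
    proof -
      note d' = dom_scale[OF Suc.prems r]
      have "picard n (of_real x) (of_real (r * l)) (of_real y) \<in> \<real>"
        by (rule Suc.IH) (use d' in simp)
      then obtain v where v: "picard n (of_real x) (of_real r * of_real l) (of_real y) = of_real v"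
        by (auto elim!: Reals_cases)
      show ?thesis
        using real[of "x + r * l" v] dom_x[OF d'] dom_y[OF d' picard_bound[OF d', of n]] v by simp
    qed
    then show ?case
      using integral_in_Reals[OF continuous_integrand_at[OF picard_continuous picard_bound Suc.prems]]
      by (auto intro!: Reals_add Reals_mult)
  qed simp
  then show ?thesis
    using closed_sequentially[OF closed_complex_Reals _ W_tendsto[OF assms]] assms by blast
qed

end

section \<open>Straightening a planar analytic field\<close>

lemma has_real_derivative_dominated_zero:
  fixes e k :: "real \<Rightarrow> real"
  assumes e: "(e has_real_derivative E) (at 0)" and k: "(k has_real_derivative 0) (at 0)"
    and le: "\<forall>\<^sub>F t in at 0. \<bar>e t - e 0\<bar> \<le> \<bar>k t - k 0\<bar> * K"
  shows "E = 0"
proof -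
  have "((\<lambda>t. (k t - k 0) / t) \<longlongrightarrow> 0) (at 0)"
    using k by (simp add: has_field_derivative_iff)
  then have "((\<lambda>t. (e t - e 0) / t) \<longlongrightarrow> 0) (at 0)"
  proof (rule tendsto_0_le)
    show "\<forall>\<^sub>F t in at 0. norm ((e t - e 0) / t) \<le> norm ((k t - k 0) / t) * K"
      using le by eventually_elim (simp add: divide_right_mono)
  qed
  moreover have "((\<lambda>t. (e t - e 0) / t) \<longlongrightarrow> E) (at 0)"
    using e by (simp add: has_field_derivative_iff)
  ultimately show ?thesis using tendsto_unique[OF trivial_limit_at] by blast
qed

text \<open>In the orthogonal frame formed by w and its rotation by a right angle, centred at p, the
  field is a positive multiple \<kappa> of (1, f). Its trajectories are therefore graphs of
  solutions of y' = f(x, y), run through in the direction of growing x; the bounds on \<kappa>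
  control the change of time.\<close>

locale planar_box = complex_ode F \<rho> R M L \<delta>
  for F \<rho> R M L \<delta> +
  fixes X :: "real \<times> real \<Rightarrow> real \<times> real" and p w :: "real \<times> real" and V :: "(real \<times> real) set"
  assumes w: "w \<noteq> 0" and V: "open V" and contX: "continuous_on V X"
    and field: "\<And>x y. \<bar>x\<bar> \<le> \<rho> \<Longrightarrow> \<bar>y\<bar> \<le> \<rho> \<Longrightarrow>
      p + x *\<^sub>R w + y *\<^sub>R (- snd w, fst w) \<in> V \<and>
      (\<exists>\<kappa>. 1/2 \<le> \<kappa> \<and> \<kappa> \<le> 2 \<and> X (p + x *\<^sub>R w + y *\<^sub>R (- snd w, fst w)) =
         \<kappa> *\<^sub>R (w + Re (F (of_real x, of_real y)) *\<^sub>R (- snd w, fst w)))"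
begin

definition w' where "w' = (- snd w, fst w)"
definition A where "A x y = p + x *\<^sub>R w + y *\<^sub>R w'"
definition \<xi> where "\<xi> q = ((q - p) \<bullet> w) / (w \<bullet> w)"
definition \<eta> where "\<eta> q = ((q - p) \<bullet> w') / (w \<bullet> w)"
definition f where "f x y = Re (F (complex_of_real x, complex_of_real y))"
definition sol where "sol x0 y0 x = Re (W (complex_of_real x0) (of_real (x - x0)) (of_real y0))"
text \<open>The height at which the solution through q crosses the line \<xi> = 0; being constant on
  solutions, it is the first integral of the box.\<close>

definition h where "h q = sol (\<xi> q) (\<eta> q) 0"
definition g where "g = (\<lambda>(a, b). A a (sol 0 b a))"
text \<open>A solution drifts by at most \<rho>/8, so solutions with |h| < \<rho>/4 stay below
  height \<rho>/2 and the box corresponds under (\<xi>, h) to a full rectangle.\<close>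

definition U where "U = {q. \<bar>\<xi> q\<bar> < \<delta> \<and> \<bar>\<eta> q\<bar> < \<rho>/2 \<and> \<bar>h q\<bar> < \<rho>/4}"

lemma ww: "w \<bullet> w > 0" using w by simp

lemma w'w: "w' \<bullet> w = 0" "w \<bullet> w' = 0" "w' \<bullet> w' = w \<bullet> w"
  by (auto simp: w'_def inner_prod_def)

lemma \<xi>_A: "\<xi> (A x y) = x" and \<eta>_A: "\<eta> (A x y) = y"
  using ww by (simp_all add: \<xi>_def \<eta>_def A_def inner_add_left w'w)

lemma A_\<xi>\<eta>: "A (\<xi> q) (\<eta> q) = q"
proof -
  define a b c d where abcd: "a = fst (q - p)" "b = snd (q - p)" "c = fst w" "d = snd w"
  define D where "D = c * c + d * d"
  have "D > 0" using ww by (simp add: abcd inner_prod_def D_def)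
  then have n: "D \<noteq> 0" by linarith
  have "(a * c + b * d) / D * c + (b * c - a * d) / D * (- d) = a * D / D"
    "(a * c + b * d) / D * d + (b * c - a * d) / D * c = b * D / D"
    unfolding times_divide_eq_left add_divide_distrib[symmetric]
    by (rule arg_cong2[where f = "(/)"]; simp add: D_def algebra_simps)+
  then have "(a * c + b * d) / D * c + (b * c - a * d) / D * (- d) = a"
    "(a * c + b * d) / D * d + (b * c - a * d) / D * c = b"
    using n by simp_all
  moreover have "\<xi> q = (a * c + b * d) / D" "\<eta> q = (b * c - a * d) / D"
    by (simp_all add: \<xi>_def \<eta>_def w'_def inner_prod_def D_def abcd)
  ultimately have "\<xi> q *\<^sub>R w + \<eta> q *\<^sub>R w' = q - p"
    by (intro prod_eqI) (simp_all only: w'_def fst_add snd_add fst_scaleR snd_scaleR fst_conv snd_conv real_scaleR_def abcd)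
  then show ?thesis by (simp add: A_def add.assoc)
qed

lemma decompose: "v = ((v \<bullet> w) / (w \<bullet> w)) *\<^sub>R w + ((v \<bullet> w') / (w \<bullet> w)) *\<^sub>R w'"
  using A_\<xi>\<eta>[of "p + v"] by (simp add: A_def \<xi>_def \<eta>_def add.assoc)

lemma field_A:
  assumes "\<bar>x\<bar> \<le> \<rho>" "\<bar>y\<bar> \<le> \<rho>"
  obtains \<kappa> where "1/2 \<le> \<kappa>" "\<kappa> \<le> 2" "X (A x y) = \<kappa> *\<^sub>R (w + f x y *\<^sub>R w')" "A x y \<in> V"
    "(X (A x y) \<bullet> w) / (w \<bullet> w) = \<kappa>" "(X (A x y) \<bullet> w') / (w \<bullet> w) = \<kappa> * f x y"
  using field[OF assms] ww that by (fastforce simp: A_def w'_def[symmetric] f_def inner_add_left w'w)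

lemma f_lip: "\<bar>x\<bar> \<le> \<rho> \<Longrightarrow> \<bar>y\<bar> \<le> \<rho> \<Longrightarrow> \<bar>y'\<bar> \<le> \<rho> \<Longrightarrow> \<bar>f x y - f x y'\<bar> \<le> L * \<bar>y - y'\<bar>"
  using lip[of "of_real x" "of_real y" "of_real y'"]
    order_trans[OF abs_Re_le_cmod[of "F (of_real x, of_real y) - F (of_real x, of_real y')"]]
  by (simp add: f_def of_real_diff[symmetric] del: of_real_diff)

lemma in_dom: "\<bar>x0\<bar> < \<delta> \<Longrightarrow> \<bar>y0\<bar> < \<rho>/2 \<Longrightarrow> \<bar>x\<bar> < \<delta> \<Longrightarrow>
    (complex_of_real x0, of_real (x - x0), of_real y0) \<in> dom"
  by (simp add: dom_def del: of_real_diff)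

lemma W_sol:
  assumes "\<bar>x0\<bar> < \<delta>" "\<bar>y0\<bar> < \<rho>/2" "\<bar>x\<bar> < \<delta>"
  shows "W (of_real x0) (of_real (x - x0)) (of_real y0) = of_real (sol x0 y0 x)"
  using W_real[OF in_dom[OF assms]] by (simp add: sol_def del: of_real_diff)

lemma sol_bound:
  assumes "\<bar>x0\<bar> < \<delta>" "\<bar>y0\<bar> < \<rho>/2" "\<bar>x\<bar> < \<delta>"
  shows "\<bar>sol x0 y0 x - y0\<bar> \<le> \<rho>/8" "\<bar>sol x0 y0 x\<bar> \<le> \<rho>"
proof -
  show "\<bar>sol x0 y0 x - y0\<bar> \<le> \<rho>/8"
    using W_bound[OF in_dom[OF assms]] unfolding W_sol[OF assms] by (simp add: of_real_diff[symmetric] del: of_real_diff)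
  then show "\<bar>sol x0 y0 x\<bar> \<le> \<rho>" using assms \<rho> by linarith
qed

lemma sol_start: "\<bar>x0\<bar> < \<delta> \<Longrightarrow> \<bar>y0\<bar> < \<rho>/2 \<Longrightarrow> sol x0 y0 x0 = y0"
  by (simp add: sol_def W_0)

lemma sol_derivative:
  assumes "\<bar>x0\<bar> < \<delta>" "\<bar>y0\<bar> < \<rho>/2" "\<bar>x\<bar> < \<delta>"
  shows "(sol x0 y0 has_real_derivative f x (sol x0 y0 x)) (at x)"
proof -
  have "((\<lambda>t. Re (W (of_real x0) (of_real t) (of_real y0))) has_real_derivative
      Re (F (of_real x0 + of_real (x - x0), W (of_real x0) (of_real (x - x0)) (of_real y0)))) (at (x - x0))"
    by (rule has_real_derivative_Re_of_real[OF W_derivative[OF in_dom[OF assms]]])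
  then have "((\<lambda>t. Re (W (of_real x0) (of_real t) (of_real y0))) has_real_derivative f x (sol x0 y0 x)) (at (x + - x0))"
    unfolding W_sol[OF assms] by (simp add: f_def)
  then show ?thesis
    unfolding DERIV_shift by (simp add: sol_def[abs_def])
qed

text \<open>The interval [-m, m] contains both s and t, so the estimate runs in either direction; in
  particular solutions that agree at one point agree everywhere.\<close>

lemma sol_gronwall:
  assumes "\<bar>x0\<bar> < \<delta>" "\<bar>y0\<bar> < \<rho>/2" "\<bar>x1\<bar> < \<delta>" "\<bar>y1\<bar> < \<rho>/2" "\<bar>s\<bar> < \<delta>" "\<bar>t\<bar> < \<delta>"
  shows "\<bar>sol x0 y0 t - sol x1 y1 t\<bar> \<le> exp (L * \<bar>t - s\<bar>) * \<bar>sol x0 y0 s - sol x1 y1 s\<bar>"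
proof -
  define m where "m = max \<bar>s\<bar> \<bar>t\<bar>"
  have m: "\<bar>x\<bar> < \<delta>" "\<bar>x\<bar> \<le> \<rho>" if "x \<in> {- m..m}" for x
  proof -
    have "\<bar>x\<bar> \<le> m" using that by (auto simp: abs_le_iff)
    moreover have "m < \<delta>" using assms by (simp add: m_def)
    ultimately show "\<bar>x\<bar> < \<delta>" "\<bar>x\<bar> \<le> \<rho>" using \<delta> by linarith+
  qed
  have "norm (sol x0 y0 t - sol x1 y1 t) \<le> exp (L * \<bar>t - s\<bar>) * norm (sol x0 y0 s - sol x1 y1 s)"
  proof (rule gronwall[of "- m" m _ "\<lambda>x. f x (sol x0 y0 x) - f x (sol x1 y1 x)"])
    fix x assume x: "x \<in> {- m..m}"
    show "((\<lambda>x. sol x0 y0 x - sol x1 y1 x) has_vector_derivative f x (sol x0 y0 x) - f x (sol x1 y1 x))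
        (at x within {- m..m})"
      using sol_derivative[OF assms(1,2) m(1)[OF x]] sol_derivative[OF assms(3,4) m(1)[OF x]]
      by (intro has_vector_derivative_diff)
         (auto simp: has_real_derivative_iff_has_vector_derivative intro: has_vector_derivative_at_within)
    show "norm (f x (sol x0 y0 x) - f x (sol x1 y1 x)) \<le> L * norm (sol x0 y0 x - sol x1 y1 x)"
      using f_lip[OF m(2)[OF x] sol_bound(2)[OF assms(1,2) m(1)[OF x]] sol_bound(2)[OF assms(3,4) m(1)[OF x]]] by simp
  qed (auto simp: m_def)
  then show ?thesis by simp
qed

text \<open>Both solutions have the value \<open>h q\<close> at 0, and uniqueness carries the
  equality to \<xi> q. The converse below starts from equality at \<xi> q and carries it to
  0.\<close>

lemma leaf_h:
  assumes "\<bar>\<xi> q\<bar> < \<delta>" "\<bar>\<eta> q\<bar> < \<rho>/2" "\<bar>h q\<bar> < \<rho>/2"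
  shows "sol 0 (h q) (\<xi> q) = \<eta> q"
  using sol_gronwall[of 0 "h q" "\<xi> q" "\<eta> q" 0 "\<xi> q"] assms \<delta> by (simp add: sol_start h_def)

lemma h_leaf:
  assumes "\<bar>\<xi> q\<bar> < \<delta>" "\<bar>\<eta> q\<bar> < \<rho>/2" "\<bar>b\<bar> < \<rho>/2" "sol 0 b (\<xi> q) = \<eta> q"
  shows "h q = b"
  using sol_gronwall[of 0 b "\<xi> q" "\<eta> q" "\<xi> q" 0] assms \<delta> by (simp add: sol_start h_def)

lemma continuous_\<xi>[continuous_intros]: "continuous_on S \<xi>" and continuous_\<eta>[continuous_intros]: "continuous_on S \<eta>"
  unfolding \<xi>_def[abs_def] \<eta>_def[abs_def] using ww by (auto intro!: continuous_intros)

lemma continuous_sol: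
  assumes "continuous_on S a" "continuous_on S b" "continuous_on S c"
    "\<And>q. q \<in> S \<Longrightarrow> \<bar>a q\<bar> < \<delta> \<and> \<bar>b q\<bar> < \<rho>/2 \<and> \<bar>c q\<bar> < \<delta>"
  shows "continuous_on S (\<lambda>q. sol (a q) (b q) (c q))"
proof -
  have "continuous_on S (\<lambda>q. (complex_of_real (a q), complex_of_real (c q - a q), complex_of_real (b q)))"
    using assms(1-3) by (intro continuous_intros)
  from continuous_on_compose2[OF W_continuous this]
  have "continuous_on S (\<lambda>q. W (of_real (a q)) (of_real (c q - a q)) (of_real (b q)))"
    using in_dom assms(4) by (simp add: image_subset_iff del: of_real_diff)
  then show ?thesis unfolding sol_def by (intro continuous_intros)
qed

lemma continuous_h: "continuous_on {q. \<bar>\<xi> q\<bar> < \<delta> \<and> \<bar>\<eta> q\<bar> < \<rho>/2} h"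
  unfolding h_def[abs_def] using \<delta> by (intro continuous_sol continuous_intros) auto

lemma open_U: "open U"
proof -
  define U0 where "U0 = {q. \<bar>\<xi> q\<bar> < \<delta> \<and> \<bar>\<eta> q\<bar> < \<rho>/2}"
  have "open U0"
    unfolding U0_def Collect_conj_eq by (intro open_Int open_Collect_less continuous_intros)
  moreover have "continuous_on U0 h" using continuous_h by (simp add: U0_def)
  ultimately have "open (U0 \<inter> h -` ball 0 (\<rho>/4))"
    using continuous_on_open_vimage[of U0 h] by (metis Int_commute open_ball)
  moreover have "U = U0 \<inter> h -` ball 0 (\<rho>/4)" by (auto simp: U_def U0_def)
  ultimately show ?thesis by simp
qed

lemma p_in_U: "p \<in> U"
  using \<delta> \<rho> sol_start[of 0 0] by (simp add: U_def \<xi>_def \<eta>_def h_def)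

lemma U_bounds: "q \<in> U \<Longrightarrow> \<bar>\<xi> q\<bar> \<le> \<rho> \<and> \<bar>\<eta> q\<bar> \<le> \<rho>"
  using \<delta> \<rho> by (auto simp: U_def)

lemma U_subset: "U \<subseteq> V"
  using field_A[OF U_bounds[THEN conjunct1] U_bounds[THEN conjunct2]] by (metis A_\<xi>\<eta> subsetI)

lemma g_inverse: "q \<in> U \<Longrightarrow> g (\<xi> q, h q) = q"
  using leaf_h[of q] \<rho> by (auto simp: g_def U_def A_\<xi>\<eta>)

lemma g_box:
  assumes "\<bar>a\<bar> < \<delta>" "\<bar>b\<bar> < \<rho>/4"
  shows "\<xi> (g (a, b)) = a" "h (g (a, b)) = b" "g (a, b) \<in> U"
proof -
  show 1: "\<xi> (g (a, b)) = a" by (simp add: g_def \<xi>_A)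
  have b: "\<bar>b\<bar> < \<rho>/2" using assms \<rho> by linarith
  have 2: "\<eta> (g (a, b)) = sol 0 b a" by (simp add: g_def \<eta>_A)
  have 3: "\<bar>sol 0 b a\<bar> < \<rho>/2" using sol_bound(1)[of 0 b a] b assms \<delta> \<rho> by linarith
  show 4: "h (g (a, b)) = b" by (rule h_leaf) (use 1 2 3 assms b in auto)
  show "g (a, b) \<in> U" using 1 2 3 4 assms by (simp add: U_def)
qed

lemma continuous_g: "continuous_on ({-\<delta><..<\<delta>} \<times> {-(\<rho>/4)<..<\<rho>/4}) g"
  unfolding g_def case_prod_unfold A_def
  using \<delta> \<rho> by (intro continuous_intros continuous_sol) auto

lemma has_vector_derivative_\<xi>:
  assumes "(u has_vector_derivative v) Q"
  shows "((\<lambda>t. \<xi> (u t)) has_real_derivative (v \<bullet> w) / (w \<bullet> w)) Q"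
    "((\<lambda>t. \<eta> (u t)) has_real_derivative (v \<bullet> w') / (w \<bullet> w)) Q"
proof -
  have "((\<lambda>t. ((u t - p) \<bullet> z) / (w \<bullet> w)) has_vector_derivative (v \<bullet> z) / (w \<bullet> w)) Q" for z
  proof -
    have "bounded_linear (\<lambda>q. (q \<bullet> z) / (w \<bullet> w))" by (rule bounded_linear_compose[OF bounded_linear_divide bounded_linear_inner_left])
    moreover have "((\<lambda>t. u t - p) has_vector_derivative v) Q"
      using has_vector_derivative_diff[OF assms has_vector_derivative_const[of p]] by simp
    ultimately show ?thesis by (rule bounded_linear.has_vector_derivative)
  qed
  then show "((\<lambda>t. \<xi> (u t)) has_real_derivative (v \<bullet> w) / (w \<bullet> w)) Q"
    "((\<lambda>t. \<eta> (u t)) has_real_derivative (v \<bullet> w') / (w \<bullet> w)) Q"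
    by (simp_all add: \<xi>_def \<eta>_def has_real_derivative_iff_has_vector_derivative)
qed

text \<open>The deviation e of the curve from the solution through its point at time s satisfies
  Gronwall's inequality with constant 2 L, the 2 coming from \<kappa> \<le> 2; starting at zero it
  stays zero. Growth of \<xi> is positivity of \<kappa>.\<close>

lemma curve_in_leaf:
  assumes u: "\<And>t. t \<in> {0..T} \<Longrightarrow> (u has_vector_derivative X (u t)) (at t within {0..T}) \<and> u t \<in> U"
    and st: "0 \<le> s" "s < t" "t \<le> T"
  shows "h (u s) = h (u t)" "\<xi> (u s) < \<xi> (u t)"
proof -
  define b where "b = h (u s)"
  have b: "\<bar>b\<bar> < \<rho>/2" using u[of s] st \<rho> by (auto simp: b_def U_def)
  have dX: "\<exists>\<kappa>. 1/2 \<le> \<kappa> \<and> \<kappa> \<le> 2 \<and> ((\<lambda>t. \<xi> (u t)) has_real_derivative \<kappa>) (at r within {0..T}) \<and>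
     ((\<lambda>t. \<eta> (u t)) has_real_derivative \<kappa> * f (\<xi> (u r)) (\<eta> (u r))) (at r within {0..T})" if r: "r \<in> {0..T}" for r
  proof -
    obtain \<kappa> where k: "1/2 \<le> \<kappa>" "\<kappa> \<le> 2"
      "(X (A (\<xi> (u r)) (\<eta> (u r))) \<bullet> w) / (w \<bullet> w) = \<kappa>" "(X (A (\<xi> (u r)) (\<eta> (u r))) \<bullet> w') / (w \<bullet> w) = \<kappa> * f (\<xi> (u r)) (\<eta> (u r))"
      using field_A[of "\<xi> (u r)" "\<eta> (u r)"] U_bounds[of "u r"] u[OF r] by metis
    then show ?thesis
      using has_vector_derivative_\<xi>[of u "X (u r)" "at r within {0..T}"] u[OF r] by (auto simp: A_\<xi>\<eta>)
  qed
  then obtain \<kappa> where k: "\<And>r. r \<in> {0..T} \<Longrightarrow> 1/2 \<le> \<kappa> r \<and> \<kappa> r \<le> 2"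
    and d\<xi>: "\<And>r. r \<in> {0..T} \<Longrightarrow> ((\<lambda>t. \<xi> (u t)) has_real_derivative \<kappa> r) (at r within {0..T})"
    and d\<eta>: "\<And>r. r \<in> {0..T} \<Longrightarrow> ((\<lambda>t. \<eta> (u t)) has_real_derivative \<kappa> r * f (\<xi> (u r)) (\<eta> (u r))) (at r within {0..T})"
    by metis
  have in_U: "\<bar>\<xi> (u r)\<bar> < \<delta>" "\<bar>\<eta> (u r)\<bar> < \<rho>/2" if "r \<in> {0..T}" for r
    using u[OF that] by (auto simp: U_def)
  define e where "e = (\<lambda>r. \<eta> (u r) - sol 0 b (\<xi> (u r)))"
  have "norm (e t) \<le> exp (2 * L * \<bar>t - s\<bar>) * norm (e s)"
  proof (rule gronwall)
    fix r assume r: "r \<in> {0..T}"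
    have "((\<lambda>r. sol 0 b (\<xi> (u r))) has_real_derivative f (\<xi> (u r)) (sol 0 b (\<xi> (u r))) * \<kappa> r) (at r within {0..T})"
      by (rule DERIV_chain2[OF sol_derivative d\<xi>[OF r]]) (use in_U[OF r] b \<delta> in auto)
    then have "(e has_real_derivative \<kappa> r * f (\<xi> (u r)) (\<eta> (u r)) - f (\<xi> (u r)) (sol 0 b (\<xi> (u r))) * \<kappa> r) (at r within {0..T})"
      unfolding e_def by (rule DERIV_diff[OF d\<eta>[OF r]])
    then show "(e has_vector_derivative \<kappa> r * f (\<xi> (u r)) (\<eta> (u r)) - f (\<xi> (u r)) (sol 0 b (\<xi> (u r))) * \<kappa> r) (at r within {0..T})"
      by (simp add: has_real_derivative_iff_has_vector_derivative)
    have "\<bar>f (\<xi> (u r)) (\<eta> (u r)) - f (\<xi> (u r)) (sol 0 b (\<xi> (u r)))\<bar> \<le> L * \<bar>e r\<bar>"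
      unfolding e_def
      by (rule f_lip) (use U_bounds u r sol_bound(2)[of 0 b "\<xi> (u r)"] in_U[OF r] b \<delta> in auto)
    then have "\<kappa> r * \<bar>f (\<xi> (u r)) (\<eta> (u r)) - f (\<xi> (u r)) (sol 0 b (\<xi> (u r)))\<bar> \<le> 2 * (L * \<bar>e r\<bar>)"
      using k[OF r] by (intro mult_mono) auto
    moreover have "norm (\<kappa> r * f (\<xi> (u r)) (\<eta> (u r)) - f (\<xi> (u r)) (sol 0 b (\<xi> (u r))) * \<kappa> r) =
        \<kappa> r * \<bar>f (\<xi> (u r)) (\<eta> (u r)) - f (\<xi> (u r)) (sol 0 b (\<xi> (u r)))\<bar>"
      using k[OF r] by (simp add: mult.commute[of _ "\<kappa> r"] right_diff_distrib[symmetric] abs_mult)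
    ultimately show "norm (\<kappa> r * f (\<xi> (u r)) (\<eta> (u r)) - f (\<xi> (u r)) (sol 0 b (\<xi> (u r))) * \<kappa> r) \<le> 2 * L * norm (e r)"
      by simp
  qed (use st in auto)
  moreover have "e s = 0"
    unfolding e_def b_def using leaf_h[of "u s"] u[of s] st in_U[of s] b by (simp add: b_def)
  ultimately have "sol 0 b (\<xi> (u t)) = \<eta> (u t)" by (simp add: e_def)
  then have "h (u t) = b" using h_leaf[OF in_U[of t] b] st by auto
  then show "h (u s) = h (u t)" by (simp add: b_def)
  show "\<xi> (u s) < \<xi> (u t)"
  proof (rule DERIV_pos_imp_increasing_open[OF st(2)])
    show "\<exists>y. ((\<lambda>t. \<xi> (u t)) has_real_derivative y) (at x) \<and> 0 < y" if "s < x" "x < t" for x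
      using d\<xi>[of x] k[of x] at_within_Icc_at[of 0 x T] that st by (intro exI[of _ "\<kappa> x"]) auto
    have "continuous_on {0..T} (\<lambda>t. \<xi> (u t))" by (rule DERIV_continuous_on[OF d\<xi>])
    then show "continuous_on {s..t} (\<lambda>t. \<xi> (u t))" by (rule continuous_on_subset) (use st in auto)
  qed
qed

text \<open>Parametrised by x, the leaf has to be run through in the right time: the time spent is
  the integral of 1 / lam, where lam is the component of the field along w. Inverting this time
  function turns the leaf into a solution of the field.\<close>

lemma leaf_is_orbit:
  assumes a: "\<bar>a1\<bar> < \<delta>" "\<bar>a2\<bar> < \<delta>" "a1 < a2" and b: "\<bar>b\<bar> < \<rho>/4"
  shows "\<exists>u T \<theta>. (\<forall>t\<in>{0..T}. (u has_vector_derivative X (u t)) (at t within {0..T}) \<and> u t \<in> U) \<and>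
    continuous_on {a1..a2} \<theta> \<and> strict_mono_on {a1..a2} \<theta> \<and> \<theta> a1 = 0 \<and> \<theta> a2 = T \<and>
    (\<forall>x\<in>{a1..a2}. g (x, b) = u (\<theta> x))"
proof -
  \<comment> \<open>A slightly larger interval makes the derivatives at a1 and a2 two-sided.\<close>
  obtain c1 c2 where c: "-\<delta> < c1" "c1 < a1" "a2 < c2" "c2 < \<delta>"
    using a dense[of "-\<delta>" a1] dense[of a2 \<delta>] by (auto simp: abs_less_iff)
  have in_c: "\<bar>x\<bar> < \<delta>" if "x \<in> {c1..c2}" for x using that c by auto
  have b2: "\<bar>b\<bar> < \<rho>/2" using b \<rho> by linarith
  define l where "l = (\<lambda>x. g (x, b))"
  define lam where "lam = (\<lambda>x. (X (l x) \<bullet> w) / (w \<bullet> w))"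
  have l_eq: "l x = A x (sol 0 b x)" for x by (simp add: l_def g_def)
  have lamX: "1/2 \<le> lam x" "X (l x) = lam x *\<^sub>R (w + f x (sol 0 b x) *\<^sub>R w')" "l x \<in> V" if x: "x \<in> {c1..c2}" for x
  proof -
    have "\<bar>x\<bar> \<le> \<rho>" "\<bar>sol 0 b x\<bar> \<le> \<rho>" using in_c[OF x] sol_bound(2)[of 0 b x] b2 \<delta> by auto
    then obtain \<kappa> where "1/2 \<le> \<kappa>" "X (A x (sol 0 b x)) = \<kappa> *\<^sub>R (w + f x (sol 0 b x) *\<^sub>R w')" "A x (sol 0 b x) \<in> V"
      "(X (A x (sol 0 b x)) \<bullet> w) / (w \<bullet> w) = \<kappa>"
      using field_A by metis
    then show "1/2 \<le> lam x" "X (l x) = lam x *\<^sub>R (w + f x (sol 0 b x) *\<^sub>R w')" "l x \<in> V"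
      by (simp_all add: lam_def l_eq)
  qed
  have dl: "(l has_vector_derivative w + f x (sol 0 b x) *\<^sub>R w') (at x)" if x: "x \<in> {c1..c2}" for x
  proof -
    have d: "(sol 0 b has_vector_derivative f x (sol 0 b x)) (at x)"
      using sol_derivative[of 0 b x] in_c[OF x] b2 \<delta> by (simp add: has_real_derivative_iff_has_vector_derivative)
    have "((\<lambda>x. p + x *\<^sub>R w + sol 0 b x *\<^sub>R w') has_vector_derivative 0 + 1 *\<^sub>R w + f x (sol 0 b x) *\<^sub>R w') (at x)"
      by (intro has_vector_derivative_add has_vector_derivative_const
          bounded_linear.has_vector_derivative[OF bounded_linear_scaleR_left] d has_vector_derivative_id)
    then show ?thesis by (simp add: l_eq[abs_def] A_def)
  qed
  have contl: "continuous_on {c1..c2} l"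
    by (rule continuous_at_imp_continuous_on) (use dl has_vector_derivative_continuous in blast)
  have contlam: "continuous_on {c1..c2} lam"
    unfolding lam_def using ww
    by (intro continuous_intros continuous_on_compose2[OF contX contl]) (use lamX in auto)
  have cont1: "continuous_on {c1..c2} (\<lambda>x. 1 / lam x)"
    using lamX(1) by (intro continuous_intros contlam) force
  define S where "S = (\<lambda>x. integral {c1..x} (\<lambda>x. 1 / lam x))"
  have dS: "(S has_real_derivative 1 / lam x) (at x)" if "c1 < x" "x < c2" for x
    using integral_has_real_derivative[OF cont1, of x] that at_within_Icc_at[of c1 x c2] by (simp add: S_def)
  have contS: "continuous_on {c1..c2} S"
    unfolding S_def using cont1 by (intro indefinite_integral_continuous_1 integrable_continuous_real)
  have monoS: "S x < S y" if "x \<in> {c1..c2}" "y \<in> {c1..c2}" "x < y" for x y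
  proof (rule DERIV_pos_imp_increasing_open[OF that(3)])
    show "\<exists>d. (S has_real_derivative d) (at z) \<and> 0 < d" if "x < z" "z < y" for z
      using dS[of z] lamX(1)[of z] that \<open>x \<in> {c1..c2}\<close> \<open>y \<in> {c1..c2}\<close>
      by (intro exI[of _ "1 / lam z"]) (auto intro: less_le_trans[of _ "1/2"])
  qed (rule continuous_on_subset[OF contS], use that in auto)
  have injS: "inj_on S {c1..c2}"
    using monoS by (metis inj_onI less_irrefl neqE)
  define G where "G = inv_into {c1..c2} S"
  have GS: "G (S x) = x" if "x \<in> {c1..c2}" for x
    unfolding G_def using injS that by (rule inv_into_f_f)
  have SG: "S (G y) = y" "G y \<in> {c1..c2}" if "S c1 \<le> y" "y \<le> S c2" for y
  proof -
    have "\<exists>x. c1 \<le> x \<and> x \<le> c2 \<and> S x = y"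
      using IVT'[of S c1 y c2] that contS c a by auto
    then have y: "y \<in> S ` {c1..c2}" by auto
    show "S (G y) = y" unfolding G_def by (rule f_inv_into_f[OF y])
    show "G y \<in> {c1..c2}" unfolding G_def by (rule inv_into_into[OF y])
  qed
  have dG: "(G has_real_derivative lam x) (at (S x))" if x: "x \<in> {a1..a2}" for x
  proof -
    have x': "c1 < x" "x < c2" using x c by auto
    have "lam x > 0" using lamX(1)[of x] x' by auto
    have "isCont G (S x)"
    proof (rule isCont_inverse_function2[of "(c1 + x) / 2" x "(x + c2) / 2"])
      fix z assume "(c1 + x) / 2 \<le> z" "z \<le> (x + c2) / 2"
      then have z: "c1 < z" "z < c2" using x' by auto
      then show "G (S z) = z" using GS by simp
      show "isCont S z" using dS[OF z] DERIV_isCont by blast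
    qed (use x' in auto)
    moreover have "S c1 < S x" "S x < S c2" using monoS x' by auto
    moreover have "(S has_real_derivative 1 / lam x) (at (G (S x)))" using dS[OF x'] GS x' by simp
    ultimately have "(G has_real_derivative inverse (1 / lam x)) (at (S x))"
      using SG(1) \<open>lam x > 0\<close> by (intro DERIV_inverse_function[where f = S and a = "S c1" and b = "S c2"]) auto
    then show ?thesis by simp
  qed
  define T where "T = S a2 - S a1"
  define u where "u = (\<lambda>t. l (G (t + S a1)))"
  have pre: "\<exists>x\<in>{a1..a2}. t + S a1 = S x" if "t \<in> {0..T}" for t
  proof -
    have "continuous_on {a1..a2} S" by (rule continuous_on_subset[OF contS]) (use c in auto)
    moreover have "S a1 \<le> t + S a1" "t + S a1 \<le> S a2" using that by (auto simp: T_def)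
    ultimately obtain x where "a1 \<le> x" "x \<le> a2" "S x = t + S a1"
      using IVT'[of S a1 "t + S a1" a2] a(3) by auto
    then show ?thesis by (auto intro!: bexI[of _ x])
  qed
  show ?thesis
  proof (intro exI conjI ballI)
    fix t assume t: "t \<in> {0..T}"
    obtain x where x: "x \<in> {a1..a2}" "t + S a1 = S x" using pre[OF t] by blast
    have xc: "x \<in> {c1..c2}" using x c by auto
    have ut: "u t = l x" by (simp add: u_def x GS[OF xc])
    then show "u t \<in> U" using g_box(3)[OF in_c[OF xc] b] by (simp add: l_def)
    have "((\<lambda>t. G (t + S a1)) has_vector_derivative lam x) (at t)"
      using dG[OF x(1)] DERIV_shift[of G "lam x" t "S a1"] by (simp add: x(2)[symmetric] has_real_derivative_iff_has_vector_derivative)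
    moreover have "(l has_vector_derivative w + f x (sol 0 b x) *\<^sub>R w') (at (G (t + S a1)))"
      using dl[OF xc] by (simp add: x(2) GS[OF xc])
    ultimately have "(l \<circ> (\<lambda>t. G (t + S a1)) has_vector_derivative lam x *\<^sub>R (w + f x (sol 0 b x) *\<^sub>R w')) (at t)"
      by (rule vector_diff_chain_at)
    then show "(u has_vector_derivative X (u t)) (at t within {0..T})"
      unfolding ut lamX(2)[OF xc] by (simp add: u_def o_def has_vector_derivative_at_within)
  next
    show "continuous_on {a1..a2} (\<lambda>x. S x - S a1)"
      by (intro continuous_intros continuous_on_subset[OF contS]) (use c in auto)
    show "strict_mono_on {a1..a2} (\<lambda>x. S x - S a1)"
      by (rule strict_mono_onI) (use monoS c in auto)
    show "S a2 - S a1 = T" by (simp add: T_def)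
    show "g (x, b) = u (S x - S a1)" if "x \<in> {a1..a2}" for x
      using GS[of x] that c by (simp add: u_def l_def)
  qed simp
qed

text \<open>Along c the intercept is \<open>W\<close> at the complexified coordinates with length
  -\<xi>, which leads from \<xi> back to 0, and \<open>W\<close> is holomorphic along such
  curves.\<close>

lemma h_analytic:
  assumes c: "real_analytic_curve_at c 0" "c 0 \<in> U"
  shows "real_analytic_at (h \<circ> c) 0"
proof -
  obtain C1 r1 where C1: "r1 > 0" "C1 holomorphic_on ball 0 r1"
    "\<And>t. \<bar>t\<bar> < r1 \<Longrightarrow> C1 (of_real t) = of_real (fst (c t))"
    using real_analytic_complexify[of "fst \<circ> c" 0] c(1) unfolding real_analytic_curve_at_def by auto metis
  obtain C2 r2 where C2: "r2 > 0" "C2 holomorphic_on ball 0 r2"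
    "\<And>t. \<bar>t\<bar> < r2 \<Longrightarrow> C2 (of_real t) = of_real (snd (c t))"
    using real_analytic_complexify[of "snd \<circ> c" 0] c(1) unfolding real_analytic_curve_at_def by auto metis
  define r where "r = min r1 r2"
  have r: "r > 0" "r \<le> r1" "r \<le> r2" using C1 C2 by (auto simp: r_def)
  define X1 where "X1 = (\<lambda>z. ((C1 z - of_real (fst p)) * of_real (fst w) + (C2 z - of_real (snd p)) * of_real (snd w)) / of_real (w \<bullet> w))"
  define Y1 where "Y1 = (\<lambda>z. ((C1 z - of_real (fst p)) * of_real (fst w') + (C2 z - of_real (snd p)) * of_real (snd w')) / of_real (w \<bullet> w))"
  have hol: "X1 holomorphic_on ball 0 r" "Y1 holomorphic_on ball 0 r"
    unfolding X1_def Y1_def using C1(2) C2(2) r ww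
    by (auto intro!: holomorphic_intros intro: holomorphic_on_subset)
  have eq: "X1 (of_real t) = of_real (\<xi> (c t))" "Y1 (of_real t) = of_real (\<eta> (c t))" if "\<bar>t\<bar> < r" for t
    using C1(3)[of t] C2(3)[of t] that r by (simp_all add: X1_def Y1_def \<xi>_def \<eta>_def inner_prod_def)
  have "isCont X1 0" "isCont Y1 0"
    using hol[THEN holomorphic_on_imp_continuous_on] r by (simp_all add: continuous_on_eq_continuous_at)
  then have lim: "((\<lambda>z. norm (X1 z)) \<longlongrightarrow> norm (X1 0)) (nhds 0)" "((\<lambda>z. norm (Y1 z)) \<longlongrightarrow> norm (Y1 0)) (nhds 0)"
    by (auto simp: isCont_def tendsto_at_iff_tendsto_nhds intro!: tendsto_norm)
  have lt: "norm (X1 0) < \<delta>" "norm (Y1 0) < \<rho>/2"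
    using eq[of 0] r c(2) by (auto simp: U_def)
  have "\<forall>\<^sub>F z in nhds 0. norm (X1 z) < \<delta> \<and> norm (Y1 z) < \<rho>/2"
    by (intro eventually_conj order_tendstoD(2)[OF lim(1) lt(1)] order_tendstoD(2)[OF lim(2) lt(2)])
  then obtain d where d: "d > 0" "\<And>z. dist z 0 < d \<Longrightarrow> norm (X1 z) < \<delta> \<and> norm (Y1 z) < \<rho>/2"
    unfolding eventually_nhds_metric by blast
  define e where "e = min d r"
  have e: "e > 0" "e \<le> d" "e \<le> r" using d r by (auto simp: e_def)
  show ?thesis
  proof (rule real_analytic_atI[OF e(1)])
    show "(\<lambda>z. W (X1 z) (- X1 z) (Y1 z)) holomorphic_on ball 0 e"
    proof (rule W_holomorphic)
      show "(X1 z, - X1 z, Y1 z) \<in> dom" if "z \<in> ball 0 e" for z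
        using d(2)[of z] that e \<delta>(1) by (auto simp: dom_def)
    qed (use hol e in \<open>auto intro!: holomorphic_intros intro: holomorphic_on_subset\<close>)
    fix t assume t: "\<bar>t\<bar> < e"
    then have te: "\<bar>t\<bar> < r" using e by simp
    have bd: "\<bar>\<xi> (c t)\<bar> < \<delta>" "\<bar>\<eta> (c t)\<bar> < \<rho>/2"
      using d(2)[of "of_real t"] t e eq[OF te] by auto
    then show "W (X1 (of_real t)) (- X1 (of_real t)) (Y1 (of_real t)) = of_real ((h \<circ> c) (0 + t))"
      unfolding eq[OF te] using W_sol[OF bd, of 0] \<delta> by (simp add: h_def)
  qed
qed

text \<open>If h \<circ> c had derivative zero, Gronwall's inequality would bound the deviation of c
  from the leaf through c 0 by the increment of h. Then c would be tangent to that leaf and v a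
  multiple of the field. This replaces a computation with partial derivatives of h.\<close>

lemma h_transversal:
  assumes c: "real_analytic_curve_at c 0" "c 0 \<in> U" and v: "(c has_vector_derivative v) (at 0)"
    and nc: "\<not> collinear {0, v, X (c 0)}"
  shows "\<exists>D. D \<noteq> 0 \<and> ((h \<circ> c) has_real_derivative D) (at 0)"
proof -
  obtain k' where "\<forall>\<^sub>F y in nhds 0. ((h \<circ> c) has_real_derivative k' y) (at y)"
    using real_analytic_continuous_derivative[OF h_analytic[OF c]] by metis
  then have dk: "((h \<circ> c) has_real_derivative k' 0) (at 0)" by (rule eventually_nhds_x_imp_x)
  have False if "k' 0 = 0"
  proof -
    define b where "b = h (c 0)"
    have c0: "\<bar>\<xi> (c 0)\<bar> < \<delta>" "\<bar>\<eta> (c 0)\<bar> < \<rho>/2" "\<bar>b\<bar> < \<rho>/4"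
      using c(2) by (auto simp: U_def b_def)
    have b: "\<bar>b\<bar> < \<rho>/2" using c0 \<rho> by simp
    define e where "e = (\<lambda>t. \<eta> (c t) - sol 0 b (\<xi> (c t)))"
    have e0: "e 0 = 0" unfolding e_def b_def using leaf_h[of "c 0"] c0 b by (simp add: b_def)
    then have sol0: "sol 0 b (\<xi> (c 0)) = \<eta> (c 0)" by (simp add: e_def)
    define E where "E = (v \<bullet> w') / (w \<bullet> w) - f (\<xi> (c 0)) (\<eta> (c 0)) * ((v \<bullet> w) / (w \<bullet> w))"
    have "((\<lambda>t. sol 0 b (\<xi> (c t))) has_real_derivative f (\<xi> (c 0)) (sol 0 b (\<xi> (c 0))) * ((v \<bullet> w) / (w \<bullet> w))) (at 0)"
      by (rule DERIV_chain2[OF sol_derivative has_vector_derivative_\<xi>(1)[OF v]]) (use c0 b \<delta> in auto)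
    then have dE: "(e has_real_derivative E) (at 0)"
      unfolding e_def E_def sol0 by (rule DERIV_diff[OF has_vector_derivative_\<xi>(2)[OF v]])
    have "isCont c 0" using v has_vector_derivative_continuous by blast
    then have "(c \<longlongrightarrow> c 0) (at 0)" by (simp add: isCont_def)
    then have "\<forall>\<^sub>F t in at 0. c t \<in> U" using open_U c(2) topological_tendstoD by blast
    then have "\<forall>\<^sub>F t in at 0. \<bar>e t - e 0\<bar> \<le> \<bar>(h \<circ> c) t - (h \<circ> c) 0\<bar> * exp (L * \<delta>)"
    proof eventually_elim
      case (elim t)
      then have ct: "\<bar>\<xi> (c t)\<bar> < \<delta>" "\<bar>\<eta> (c t)\<bar> < \<rho>/2" "\<bar>h (c t)\<bar> < \<rho>/2" using \<rho> by (auto simp: U_def)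
      have "\<bar>sol 0 (h (c t)) (\<xi> (c t)) - sol 0 b (\<xi> (c t))\<bar> \<le>
          exp (L * \<bar>\<xi> (c t) - 0\<bar>) * \<bar>sol 0 (h (c t)) 0 - sol 0 b 0\<bar>"
        by (rule sol_gronwall) (use ct b \<delta> in auto)
      also have "\<dots> \<le> exp (L * \<delta>) * \<bar>sol 0 (h (c t)) 0 - sol 0 b 0\<bar>"
        using ct L by (intro mult_right_mono) (auto intro: mult_left_mono)
      finally show ?case
        using leaf_h[OF ct] sol_start[of 0 "h (c t)"] sol_start[of 0 b] ct b \<delta>
        unfolding e0 by (simp add: e_def b_def mult.commute)
    qed
    moreover have "((h \<circ> c) has_real_derivative 0) (at 0)" using dk that by simp
    ultimately have "E = 0"
      using has_real_derivative_dominated_zero[OF dE] by blast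
    define K where "K = (v \<bullet> w) / (w \<bullet> w)"
    have "(v \<bullet> w') / (w \<bullet> w) = K * f (\<xi> (c 0)) (\<eta> (c 0))"
      using \<open>E = 0\<close> by (simp add: E_def K_def mult.commute)
    then have "v = K *\<^sub>R w + (K * f (\<xi> (c 0)) (\<eta> (c 0))) *\<^sub>R w'"
      using decompose[of v] by (simp only: K_def)
    then have v_eq: "v = K *\<^sub>R (w + f (\<xi> (c 0)) (\<eta> (c 0)) *\<^sub>R w')"
      by (simp only: scaleR_add_right scaleR_scaleR)
    obtain \<kappa> where k: "1/2 \<le> \<kappa>" "X (c 0) = \<kappa> *\<^sub>R (w + f (\<xi> (c 0)) (\<eta> (c 0)) *\<^sub>R w')"
      using field_A[of "\<xi> (c 0)" "\<eta> (c 0)"] U_bounds[OF c(2)] A_\<xi>\<eta> by metis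
    have "v = (K / \<kappa>) *\<^sub>R X (c 0)"
      unfolding k(2) using k(1) by (subst v_eq) simp
    then have "collinear {0, X (c 0), v}" unfolding collinear_lemma by metis
    then show False using nc by (simp add: insert_commute)
  qed
  then show ?thesis using dk by blast
qed

end

section \<open>Existence of planar boxes around regular points\<close>

lemma real_analytic_map_differentiable:
  assumes "real_analytic_map_on X V" "x \<in> V"
  shows "X differentiable (at x)"
proof -
  have "(fst \<circ> X) differentiable (at x)" "(snd \<circ> X) differentiable (at x)"
    using assms real_analytic2_differentiable unfolding real_analytic_map_on_def by blast+
  then obtain D1 D2 where "((fst \<circ> X) has_derivative D1) (at x)" "((snd \<circ> X) has_derivative D2) (at x)"
    unfolding differentiable_def by blast
  from has_derivative_Pair[OF this] have "(X has_derivative (\<lambda>h. (D1 h, D2 h))) (at x)"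
    by simp
  then show ?thesis unfolding differentiable_def by blast
qed

lemma real_analytic_map_continuous:
  assumes "real_analytic_map_on X V"
  shows "continuous_on V X"
  using real_analytic_map_differentiable[OF assms] differentiable_imp_continuous_within
  by (intro continuous_at_imp_continuous_on) blast

lemma real_analytic2_Lipschitz:
  assumes "real_analytic2_at f x"
  obtains r L where "r > 0" "L \<ge> 0"
    "\<And>y z. y \<in> ball x r \<Longrightarrow> z \<in> ball x r \<Longrightarrow> \<bar>f y - f z\<bar> \<le> L * norm (y - z)"
proof -
  obtain F r where r: "r > 0" and F: "hol2_on F (ball 0 r \<times> ball 0 r)"
    and eq: "\<And>h k. \<bar>h\<bar> < r \<Longrightarrow> \<bar>k\<bar> < r \<Longrightarrow> F (of_real h, of_real k) = of_real (f (x + (h, k)))"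
    using real_analytic2_complexify[OF assms] by metis
  obtain L where L: "L \<ge> 0" "\<And>z w z' w'. z \<in> cball 0 (r/4) \<Longrightarrow> w \<in> cball 0 (r/4) \<Longrightarrow>
    z' \<in> cball 0 (r/4) \<Longrightarrow> w' \<in> cball 0 (r/4) \<Longrightarrow>
    norm (F (z, w) - F (z', w')) \<le> L * (norm (z - z') + norm (w - w'))"
    using hol2_on_Lipschitz[OF F r] by metis
  show ?thesis
  proof (rule that[of "r/4" "2 * L"])
    fix y z assume yz: "y \<in> ball x (r/4)" "z \<in> ball x (r/4)"
    obtain a b where ab: "y - x = (a, b)" by force
    obtain c d where cd: "z - x = (c, d)" by force
    have n: "\<bar>a\<bar> < r/4" "\<bar>b\<bar> < r/4" "\<bar>c\<bar> < r/4" "\<bar>d\<bar> < r/4"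
    proof -
      have "norm (a, b) < r/4" "norm (c, d) < r/4"
        using yz by (simp_all add: ab[symmetric] cd[symmetric] dist_norm[symmetric] dist_commute)
      then show "\<bar>a\<bar> < r/4" "\<bar>b\<bar> < r/4" "\<bar>c\<bar> < r/4" "\<bar>d\<bar> < r/4"
        using norm_fst_le[of a b] norm_snd_le[of b a] norm_fst_le[of c d] norm_snd_le[of d c] by auto
    qed
    have "\<bar>a - c\<bar> \<le> norm (y - z)" "\<bar>b - d\<bar> \<le> norm (y - z)"
    proof -
      have "y - z = (a - c, b - d)" using ab cd by (metis diff_diff_eq2 diff_Pair diff_add_cancel add_diff_cancel)
      then show "\<bar>a - c\<bar> \<le> norm (y - z)" "\<bar>b - d\<bar> \<le> norm (y - z)"
        using norm_fst_le[of "a - c" "b - d"] norm_snd_le[of "b - d" "a - c"] by auto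
    qed
    have "y = x + (a, b)" "z = x + (c, d)" using ab cd by (auto simp: algebra_simps)
    then have "complex_of_real (f y - f z) = F (of_real a, of_real b) - F (of_real c, of_real d)"
      using eq[of a b] eq[of c d] n r by simp
    then have "\<bar>f y - f z\<bar> = norm (F (of_real a, of_real b) - F (of_real c, of_real d))"
      by (metis norm_of_real)
    also have "\<dots> \<le> L * (norm (complex_of_real a - of_real c) + norm (complex_of_real b - of_real d))"
      by (rule L(2)) (use n in auto)
    also have "\<dots> = L * (\<bar>a - c\<bar> + \<bar>b - d\<bar>)" by (simp add: of_real_diff[symmetric] del: of_real_diff)
    also have "\<dots> \<le> L * (norm (y - z) + norm (y - z))"
      using \<open>\<bar>a - c\<bar> \<le> norm (y - z)\<close> \<open>\<bar>b - d\<bar> \<le> norm (y - z)\<close> L(1) by (intro mult_left_mono) auto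
    finally show "\<bar>f y - f z\<bar> \<le> 2 * L * norm (y - z)" by simp
  qed (use r L in auto)
qed

lemma real_analytic2_compose_curve:
  assumes f: "real_analytic2_at f (c 0)" and c: "real_analytic_curve_at c 0"
  shows "real_analytic_at (\<lambda>t. f (c t)) 0"
proof -
  obtain F r where r: "r > 0" and F: "hol2_on F (ball 0 r \<times> ball 0 r)"
    and eq: "\<And>h k. \<bar>h\<bar> < r \<Longrightarrow> \<bar>k\<bar> < r \<Longrightarrow> F (of_real h, of_real k) = of_real (f (c 0 + (h, k)))"
    using real_analytic2_complexify[OF f] by metis
  obtain C1 r1 where C1: "r1 > 0" "C1 holomorphic_on ball 0 r1"
    "\<And>t. \<bar>t\<bar> < r1 \<Longrightarrow> C1 (of_real t) = of_real (fst (c t))"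
    using real_analytic_complexify[of "fst \<circ> c" 0] c unfolding real_analytic_curve_at_def by auto metis
  obtain C2 r2 where C2: "r2 > 0" "C2 holomorphic_on ball 0 r2"
    "\<And>t. \<bar>t\<bar> < r2 \<Longrightarrow> C2 (of_real t) = of_real (snd (c t))"
    using real_analytic_complexify[of "snd \<circ> c" 0] c unfolding real_analytic_curve_at_def by auto metis
  have "isCont C1 0" "isCont C2 0"
    using C1(2)[THEN holomorphic_on_imp_continuous_on] C2(2)[THEN holomorphic_on_imp_continuous_on] C1(1) C2(1)
    by (simp_all add: continuous_on_eq_continuous_at)
  then obtain d1 d2 where d1: "d1 > 0" "\<And>z. dist z 0 < d1 \<Longrightarrow> dist (C1 z) (C1 0) < r"
    and d2: "d2 > 0" "\<And>z. dist z 0 < d2 \<Longrightarrow> dist (C2 z) (C2 0) < r"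
    unfolding continuous_at_eps_delta using r by metis
  define e where "e = min (min d1 d2) (min r1 r2)"
  have e: "e > 0" "e \<le> d1" "e \<le> d2" "e \<le> r1" "e \<le> r2" using d1 d2 C1 C2 by (auto simp: e_def)
  have c0: "C1 0 = of_real (fst (c 0))" "C2 0 = of_real (snd (c 0))" using C1(3)[of 0] C2(3)[of 0] C1(1) C2(1) by auto
  have small: "norm (C1 z - of_real (fst (c 0))) < r" "norm (C2 z - of_real (snd (c 0))) < r" if "norm z < e" for z
    using d1(2)[of z] d2(2)[of z] that e by (auto simp: dist_norm c0)
  show ?thesis
  proof (rule real_analytic_atI[OF e(1)])
    show "(\<lambda>z. F (C1 z - of_real (fst (c 0)), C2 z - of_real (snd (c 0)))) holomorphic_on ball 0 e"
      by (rule hol2_on_compose[OF F])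
         (use C1(2) C2(2) e small in \<open>auto intro!: holomorphic_intros intro: holomorphic_on_subset\<close>)
    fix t assume t: "\<bar>t\<bar> < e"
    have eqs: "C1 (of_real t) - of_real (fst (c 0)) = of_real (fst (c t - c 0))"
      "C2 (of_real t) - of_real (snd (c 0)) = of_real (snd (c t - c 0))"
      using C1(3)[of t] C2(3)[of t] t e by auto
    have c_eq: "c 0 + (fst (c t - c 0), snd (c t - c 0)) = c t"
      by (simp add: prod_eq_iff)
    have "\<bar>fst (c t - c 0)\<bar> < r" "\<bar>snd (c t - c 0)\<bar> < r"
      using small[of "of_real t"] t unfolding eqs by (simp_all del: of_real_diff)
    from eq[OF this] show "F (C1 (of_real t) - of_real (fst (c 0)), C2 (of_real t) - of_real (snd (c 0))) = of_real (f (c (0 + t)))"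
      unfolding eqs by (simp only: c_eq add_0)
  qed
qed

lemma real_analytic_at_cong:
  assumes f: "real_analytic_at f x" and eq: "\<forall>\<^sub>F t in nhds x. f t = g t"
  shows "real_analytic_at g x"
proof -
  obtain a r where r: "r > 0" "\<And>h. \<bar>h\<bar> < r \<Longrightarrow> (\<lambda>n. a n * h ^ n) sums f (x + h)"
    using f unfolding real_analytic_at_def by blast
  obtain d where d: "d > 0" "\<And>t. dist t x < d \<Longrightarrow> f t = g t"
    using eq unfolding eventually_nhds_metric by blast
  show ?thesis
    unfolding real_analytic_at_def
  proof (intro exI conjI allI impI)
    show "min d r > 0" using d r by simp
    fix h assume "\<bar>h\<bar> < min d r"
    then show "(\<lambda>n. a n * h ^ n) sums g (x + h)"
      using r(2)[of h] d(2)[of "x + h"] by (simp add: dist_real_def)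
  qed
qed

text \<open>\<open>N1\<close> and \<open>N2\<close> are the components of the complexified field
  along w and the rotated w, divided by |w|^2. Since \<open>N1\<close> is 1 at the centre, the slope
  N2 / N1 is holomorphic nearby, and the factor \<kappa> is the value of \<open>N1\<close> at real
  points.\<close>

lemma planar_box_exists:
  assumes X: "real_analytic_map_on X V" and V: "open V" "p \<in> V" and nz: "X p \<noteq> 0"
  obtains F \<rho> R M L \<delta> where "planar_box F \<rho> R M L \<delta> X p (X p) V"
proof -
  define w1 w2 where w12: "w1 = fst (X p)" "w2 = snd (X p)"
  define N where "N = w1 * w1 + w2 * w2"
  have N: "N > 0"
    using nz by (auto simp: N_def w12 prod_eq_iff sum_squares_gt_zero_iff)
  obtain F1 r1 where F1: "r1 > 0" "hol2_on F1 (ball 0 r1 \<times> ball 0 r1)"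
    "\<And>h k. \<bar>h\<bar> < r1 \<Longrightarrow> \<bar>k\<bar> < r1 \<Longrightarrow> F1 (of_real h, of_real k) = of_real (fst (X (p + (h, k))))"
    using real_analytic2_complexify[of "fst \<circ> X" p] X V unfolding real_analytic_map_on_def by auto metis
  obtain F2 r2 where F2: "r2 > 0" "hol2_on F2 (ball 0 r2 \<times> ball 0 r2)"
    "\<And>h k. \<bar>h\<bar> < r2 \<Longrightarrow> \<bar>k\<bar> < r2 \<Longrightarrow> F2 (of_real h, of_real k) = of_real (snd (X (p + (h, k))))"
    using real_analytic2_complexify[of "snd \<circ> X" p] X V unfolding real_analytic_map_on_def by auto metis
  obtain s where s: "s > 0" "ball p s \<subseteq> V" using V open_contains_ball by blast
  define r where "r = min (min r1 r2) (s/2)"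
  have r: "r > 0" "r \<le> r1" "r \<le> r2" "r \<le> s/2" using F1 F2 s by (auto simp: r_def)
  \<comment> \<open>With |z| and |v| below R0 the combinations \<open>c1\<close> and
    \<open>c2\<close> have modulus below r, so the complexified components can be evaluated
    there.\<close>
  define R0 where "R0 = r / (\<bar>w1\<bar> + \<bar>w2\<bar> + 1)"
  have R0: "R0 > 0" using r by (auto simp: R0_def)
  define c1 :: "complex \<Rightarrow> complex \<Rightarrow> complex" where "c1 = (\<lambda>z v. z * of_real w1 - v * of_real w2)"
  define c2 :: "complex \<Rightarrow> complex \<Rightarrow> complex" where "c2 = (\<lambda>z v. z * of_real w2 + v * of_real w1)"
  have c12: "norm (c1 z v) < r" "norm (c2 z v) < r" if zv: "norm z < R0" "norm v < R0" for z v
  proof -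
    have "norm (c1 z v) \<le> norm (z * of_real w1) + norm (v * of_real w2)"
      unfolding c1_def by (rule norm_triangle_ineq4)
    moreover have "norm (c2 z v) \<le> norm (z * of_real w2) + norm (v * of_real w1)"
      unfolding c2_def by (rule norm_triangle_ineq)
    moreover have "norm (z * of_real a) \<le> R0 * \<bar>a\<bar>" "norm (v * of_real a) \<le> R0 * \<bar>a\<bar>" for a
      using zv by (auto simp: norm_mult intro!: mult_right_mono)
    moreover have "R0 * \<bar>w1\<bar> + R0 * \<bar>w2\<bar> < r"
    proof -
      have "R0 * (\<bar>w1\<bar> + \<bar>w2\<bar> + 1) = r" by (simp add: R0_def)
      then have "R0 * \<bar>w1\<bar> + R0 * \<bar>w2\<bar> + R0 = r" by (simp add: distrib_left)
      then show ?thesis using R0 by linarith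
    qed
    ultimately show "norm (c1 z v) < r" "norm (c2 z v) < r" by (smt (verit))+
  qed
  define N1 where "N1 = (\<lambda>(z, v). (F1 (c1 z v, c2 z v) * of_real w1 + F2 (c1 z v, c2 z v) * of_real w2) / of_real N)"
  define N2 where "N2 = (\<lambda>(z, v). (F2 (c1 z v, c2 z v) * of_real w1 - F1 (c1 z v, c2 z v) * of_real w2) / of_real N)"
  define B0 where "B0 = ball (0::complex) R0 \<times> ball (0::complex) R0"
  have cc: "continuous_on B0 (\<lambda>p. (c1 (fst p) (snd p), c2 (fst p) (snd p)))"
    unfolding c1_def c2_def by (intro continuous_intros)
  have "continuous_on B0 (\<lambda>p. F1 (c1 (fst p) (snd p), c2 (fst p) (snd p)))"
    "continuous_on B0 (\<lambda>p. F2 (c1 (fst p) (snd p), c2 (fst p) (snd p)))"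
    by (rule continuous_on_compose2[OF hol2_on_continuous[OF F1(2)] cc],
        use c12 r in \<open>fastforce simp: B0_def\<close>)
       (rule continuous_on_compose2[OF hol2_on_continuous[OF F2(2)] cc],
        use c12 r in \<open>fastforce simp: B0_def\<close>)
  then have cN: "continuous_on B0 N1" "continuous_on B0 N2"
    unfolding N1_def N2_def case_prod_unfold using N by (auto intro!: continuous_intros)
  have Xp: "F1 (0, 0) = of_real w1" "F2 (0, 0) = of_real w2"
    using F1(3)[of 0 0] F2(3)[of 0 0] F1(1) F2(1) by (auto simp: w12 zero_prod_def[symmetric])
  have N10: "N1 (0, 0) = 1"
    using N by (simp add: N1_def c1_def c2_def Xp of_real_mult[symmetric] of_real_add[symmetric] N_def[symmetric]
        del: of_real_mult of_real_add)
  have "open B0" by (simp add: B0_def open_Times)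
  moreover have "(0, 0) \<in> B0" using R0 by (simp add: B0_def)
  ultimately have "isCont N1 (0, 0)" using cN(1) by (simp add: continuous_on_eq_continuous_at)
  then obtain d where d: "d > 0" "\<And>q. dist q (0, 0) < d \<Longrightarrow> dist (N1 q) (N1 (0, 0)) < 1/2"
    unfolding continuous_at_eps_delta by (metis half_gt_zero_iff zero_less_one)
  define R where "R = min R0 (d/2)"
  have R: "R > 0" "R \<le> R0" "R \<le> d/2" using R0 d by (auto simp: R_def)
  define B where "B = ball (0::complex) R \<times> ball (0::complex) R"
  have BB: "B \<subseteq> B0" using R by (auto simp: B_def B0_def)
  have N1_near: "norm (N1 q - 1) < 1/2" if "q \<in> B" for q
  proof -
    obtain z v where q: "q = (z, v)" by force
    have "norm q \<le> norm z + norm v" unfolding q by (rule norm_Pair_le)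
    also have "\<dots> < d" using that R by (auto simp: q B_def)
    finally show ?thesis using d(2)[of q] by (simp add: dist_norm N10[folded zero_prod_def] zero_prod_def[symmetric])
  qed
  have N1_nz: "N1 q \<noteq> 0" if "q \<in> B" for q using N1_near[OF that] by auto
  define F where "F = (\<lambda>q. N2 q / N1 q)"
  have hF: "hol2_on F (ball 0 R \<times> ball 0 R)"
    unfolding hol2_on_def B_def[symmetric]
  proof (intro conjI allI impI)
    show "continuous_on B F"
      unfolding F_def using cN BB N1_nz by (auto intro!: continuous_intros intro: continuous_on_subset)
    fix g1 g2 :: "complex \<Rightarrow> complex" and Z
    assume Z: "open Z" and g: "g1 holomorphic_on Z" "g2 holomorphic_on Z" and in_B: "\<forall>z\<in>Z. (g1 z, g2 z) \<in> B"
    have hc: "(\<lambda>z. c1 (g1 z) (g2 z)) holomorphic_on Z" "(\<lambda>z. c2 (g1 z) (g2 z)) holomorphic_on Z"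
      unfolding c1_def c2_def using g by (auto intro!: holomorphic_intros)
    have sm: "norm (c1 (g1 z) (g2 z)) < r" "norm (c2 (g1 z) (g2 z)) < r" if "z \<in> Z" for z
      using c12[of "g1 z" "g2 z"] in_B that R by (auto simp: B_def)
    have "(\<lambda>z. F1 (c1 (g1 z) (g2 z), c2 (g1 z) (g2 z))) holomorphic_on Z"
      by (rule hol2_on_compose[OF F1(2) Z hc]) (use sm r in fastforce)
    moreover have "(\<lambda>z. F2 (c1 (g1 z) (g2 z), c2 (g1 z) (g2 z))) holomorphic_on Z"
      by (rule hol2_on_compose[OF F2(2) Z hc]) (use sm r in fastforce)
    ultimately have "(\<lambda>z. N1 (g1 z, g2 z)) holomorphic_on Z" "(\<lambda>z. N2 (g1 z, g2 z)) holomorphic_on Z"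
      unfolding N1_def N2_def using N by (auto intro!: holomorphic_intros)
    then show "(\<lambda>z. F (g1 z, g2 z)) holomorphic_on Z"
      unfolding F_def using in_B N1_nz by (auto intro!: holomorphic_intros)
  qed
  obtain L where L: "L \<ge> 0" "\<And>z w z' w'. z \<in> cball 0 (R/4) \<Longrightarrow> w \<in> cball 0 (R/4) \<Longrightarrow>
    z' \<in> cball 0 (R/4) \<Longrightarrow> w' \<in> cball 0 (R/4) \<Longrightarrow>
    norm (F (z, w) - F (z', w')) \<le> L * (norm (z - z') + norm (w - w'))"
    using hol2_on_Lipschitz[OF hF R(1)] by metis
  define \<rho> where "\<rho> = R / 4"
  have \<rho>: "\<rho> > 0" "\<rho> < R" using R by (auto simp: \<rho>_def)
  have sub: "cball 0 \<rho> \<times> cball 0 \<rho> \<subseteq> B" using \<rho> by (auto simp: B_def)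
  have "compact (F ` (cball 0 \<rho> \<times> cball 0 \<rho>))"
    using continuous_on_subset[OF hol2_on_continuous[OF hF, folded B_def] sub]
    by (intro compact_continuous_image compact_Times compact_cball)
  then have "bounded (F ` (cball 0 \<rho> \<times> cball 0 \<rho>))" by (rule compact_imp_bounded)
  then obtain M where M: "\<And>p. p \<in> F ` (cball 0 \<rho> \<times> cball 0 \<rho>) \<Longrightarrow> norm p \<le> M"
    unfolding bounded_iff by blast
  have M': "norm (F (z, v)) \<le> M" if "norm z \<le> \<rho>" "norm v \<le> \<rho>" for z v
    by (rule M, rule imageI) (use that in auto)
  have M0: "M \<ge> 0" using M'[of 0 0] \<rho> norm_ge_zero[of "F (0, 0)"] by (simp del: norm_ge_zero)
  \<comment> \<open>Each of the three terms serves one of the conditions that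
    \<open>complex_ode\<close> puts on \<delta>; adding 1 to M and L keeps the denominators
    positive.\<close>
  define \<delta> where "\<delta> = min (\<rho>/3) (min (\<rho> / (16 * (M + 1))) (1 / (4 * (L + 1))))"
  have \<delta>: "\<delta> > 0" "\<delta> \<le> \<rho>/3" "\<delta> \<le> \<rho> / (16 * (M + 1))" "\<delta> \<le> 1 / (4 * (L + 1))"
  proof -
    show "\<delta> > 0" using \<rho>(1) M0 L(1) by (simp add: \<delta>_def)
    show "\<delta> \<le> \<rho>/3" unfolding \<delta>_def by (rule min.cobounded1)
    show "\<delta> \<le> \<rho> / (16 * (M + 1))" unfolding \<delta>_def by (rule min.coboundedI2[OF min.cobounded1])
    show "\<delta> \<le> 1 / (4 * (L + 1))" unfolding \<delta>_def by (rule min.coboundedI2[OF min.cobounded2])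
  qed
  have dM: "2 * \<delta> * M \<le> \<rho>/8"
  proof -
    have "\<delta> * (16 * (M + 1)) \<le> \<rho>" using \<delta>(3) M0 by (simp add: pos_le_divide_eq)
    then show ?thesis using \<delta>(1) by (simp add: algebra_simps)
  qed
  have dL: "2 * \<delta> * L \<le> 1/2"
  proof -
    have "\<delta> * (4 * (L + 1)) \<le> 1" using \<delta>(4) L(1) by (simp add: pos_le_divide_eq)
    then show ?thesis using \<delta>(1) by (simp add: algebra_simps)
  qed
  have field: "F (of_real x, of_real y) \<in> \<real> \<and> p + x *\<^sub>R X p + y *\<^sub>R (- w2, w1) \<in> V \<and>
      (\<exists>\<kappa>. 1/2 \<le> \<kappa> \<and> \<kappa> \<le> 2 \<and> X (p + x *\<^sub>R X p + y *\<^sub>R (- w2, w1)) =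
         \<kappa> *\<^sub>R (X p + Re (F (of_real x, of_real y)) *\<^sub>R (- w2, w1)))"
    if xy: "\<bar>x\<bar> \<le> \<rho>" "\<bar>y\<bar> \<le> \<rho>" for x y
  proof -
    define h k where hk: "h = x * w1 - y * w2" "k = x * w2 + y * w1"
    define q where "q = p + (h, k)"
    have q: "p + x *\<^sub>R X p + y *\<^sub>R (- w2, w1) = q"
      by (simp add: q_def hk prod_eq_iff w12)
    have c: "c1 (of_real x) (of_real y) = of_real h" "c2 (of_real x) (of_real y) = of_real k"
      by (simp_all add: c1_def c2_def hk)
    have inB: "(complex_of_real x, complex_of_real y) \<in> B" using xy \<rho> by (simp add: B_def)
    have hk_r: "\<bar>h\<bar> < r" "\<bar>k\<bar> < r"
      using c12[of "of_real x" "of_real y"] inB BB unfolding c by (auto simp: B0_def)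
    have "norm (h, k) < s" using norm_Pair_le[of h k] hk_r r by simp
    then have "norm (q - p) < s" by (simp add: q_def)
    then have "dist p q < s" by (simp add: dist_norm norm_minus_commute)
    then have qV: "q \<in> V" using s(2) by auto
    define a b where ab: "a = fst (X q)" "b = snd (X q)"
    have Fq: "F1 (of_real h, of_real k) = of_real a" "F2 (of_real h, of_real k) = of_real b"
      using F1(3)[of h k] F2(3)[of h k] hk_r r by (auto simp: ab q_def)
    define \<kappa> where "\<kappa> = (a * w1 + b * w2) / N"
    have n1: "N1 (of_real x, of_real y) = of_real \<kappa>" and n2: "N2 (of_real x, of_real y) = of_real ((b * w1 - a * w2) / N)"
      by (simp_all add: N1_def N2_def c Fq \<kappa>_def)
    have "norm (complex_of_real (\<kappa> - 1)) < 1/2" using N1_near[OF inB] unfolding n1 by simp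
    then have "\<bar>\<kappa> - 1\<bar> < 1/2" by (simp only: norm_of_real)
    then have "1 - 1/2 < \<kappa> \<and> \<kappa> < 1 + 1/2" by (simp only: abs_diff_less_iff)
    then have \<kappa>: "1/2 \<le> \<kappa>" "\<kappa> \<le> 2" "\<kappa> \<noteq> 0" by auto
    have Fxy: "F (of_real x, of_real y) = of_real ((b * w1 - a * w2) / N / \<kappa>)"
      unfolding F_def n1 n2 by simp
    have "(a * w1 + b * w2) / N * w1 - (b * w1 - a * w2) / N * w2 = a * N / N"
      "(a * w1 + b * w2) / N * w2 + (b * w1 - a * w2) / N * w1 = b * N / N"
      unfolding times_divide_eq_left add_divide_distrib[symmetric] diff_divide_distrib[symmetric]
      by (rule arg_cong2[where f = "(/)"]; simp add: N_def algebra_simps)+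
    then have "\<kappa> * w1 - (b * w1 - a * w2) / N * w2 = a" "\<kappa> * w2 + (b * w1 - a * w2) / N * w1 = b"
      using N by (simp_all add: \<kappa>_def)
    then have "X q = \<kappa> *\<^sub>R (X p + Re (F (of_real x, of_real y)) *\<^sub>R (- w2, w1))"
      unfolding Fxy using \<kappa>(3) by (simp add: prod_eq_iff ab w12 distrib_left right_diff_distrib)
    then show ?thesis using qV \<kappa> Fxy unfolding q by auto
  qed
  have "planar_box F \<rho> R M L \<delta> X p (X p) V"
  proof
    show "norm (F (z, w) - F (z, w')) \<le> L * norm (w - w')" if "norm z \<le> \<rho>" "norm w \<le> \<rho>" "norm w' \<le> \<rho>" for z w w'
      using L(2)[of z w z w'] that by (simp add: \<rho>_def)
    show "continuous_on V X" by (rule real_analytic_map_continuous[OF X])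
  qed (use hF \<rho> \<delta> dM dL M0 L(1) M' V nz field[unfolded w12] in auto)
  then show ?thesis using that by blast
qed

section \<open>Trajectories of analytic vector fields on surfaces\<close>

text \<open>The determinant is continuous in both vectors, which makes transversality stable under
  small shifts of the base point.\<close>

lemma collinear_0_iff_det:
  fixes a b :: "real \<times> real"
  shows "collinear {0, a, b} \<longleftrightarrow> fst a * snd b - snd a * fst b = 0"
proof
  assume "collinear {0, a, b}"
  then have "a = 0 \<or> b = 0 \<or> (\<exists>c. b = c *\<^sub>R a)" by (simp add: collinear_lemma)
  then show "fst a * snd b - snd a * fst b = 0" by auto
next
  assume det: "fst a * snd b - snd a * fst b = 0"
  show "collinear {0, a, b}"
  proof (cases "fst a = 0")
    case True
    show ?thesis
    proof (cases "snd a = 0")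
      case True
      then have "a = 0" using \<open>fst a = 0\<close> by (simp add: prod_eq_iff)
      then show ?thesis by (simp add: collinear_lemma)
    next
      case False
      then have "b = (snd b / snd a) *\<^sub>R a" using det \<open>fst a = 0\<close> by (simp add: prod_eq_iff)
      then show ?thesis unfolding collinear_lemma by blast
    qed
  next
    case False
    then have "b = (fst b / fst a) *\<^sub>R a" using det by (simp add: prod_eq_iff field_simps)
    then show ?thesis unfolding collinear_lemma by blast
  qed
qed

lemma eventually_at_within_openin:
  assumes "openin (top_of_set I) A" "t \<in> A"
  shows "\<forall>\<^sub>F s in at t within I. s \<in> A"
proof -
  obtain T where T: "open T" "A = I \<inter> T" using assms(1) by (auto simp: openin_open)
  then have "\<forall>\<^sub>F s in at t within I. s \<in> T" using assms(2) by (intro topological_tendstoD[OF tendsto_ident_at]) auto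
  moreover have "\<forall>\<^sub>F s in at t within I. s \<in> I" by (simp add: eventually_at_filter)
  ultimately show ?thesis by eventually_elim (simp add: T)
qed

lemma has_vector_derivative_Un:
  assumes "(f has_vector_derivative D) (at t within A)" "(f has_vector_derivative D) (at t within B)"
  shows "(f has_vector_derivative D) (at t within (A \<union> B))"
  using assms unfolding has_vector_derivative_def has_derivative_within
  unfolding at_within_union
  by (auto intro: filterlim_sup)

lemma has_vector_derivative_bot: "(f has_vector_derivative D) bot"
  unfolding has_vector_derivative_def has_derivative_def
  by (auto intro: bounded_linear_intros)

section \<open>Charts and changes of coordinates\<close>

locale surface =
  fixes S :: "('m, 'z) surface_field_scheme"
  assumes surface: "analytic_surface S" and field: "analytic_vector_field S"
begin

abbreviation M where "M \<equiv> surf S"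

lemma Hausdorff: "Hausdorff_space M"
  using surface by (simp add: analytic_surface_def)

lemma topspace_charts: "p \<in> topspace M \<longleftrightarrow> (\<exists>C\<in>charts S. p \<in> fst C)"
  using surface by (auto simp: analytic_surface_def)

context
  fixes C assumes C: "C \<in> charts S"
begin

lemma chart_openin: "openin M (fst C)" and chart_image_open: "open (snd C ` fst C)"
  and chart_homeo: "homeomorphic_map (subtopology M (fst C)) (top_of_set (snd C ` fst C)) (snd C)"
  using surface C by (auto simp: analytic_surface_def)

lemma chart_subset: "fst C \<subseteq> topspace M"
  using chart_openin openin_subset by blast

lemma chart_inj: "inj_on (snd C) (fst C)"
  using homeomorphic_imp_injective_map[OF chart_homeo] chart_subset by (simp add: Int_absorb1)

lemma chart_continuous: "continuous_map (subtopology M (fst C)) euclidean (snd C)"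
  using homeomorphic_imp_continuous_map[OF chart_homeo] continuous_map_into_fulltopology by blast

lemma open_chart_image:
  assumes "openin M A" "A \<subseteq> fst C"
  shows "open (snd C ` A)"
proof -
  have "open_map (subtopology M (fst C)) (top_of_set (snd C ` fst C)) (snd C)"
    by (rule homeomorphic_imp_open_map[OF chart_homeo])
  moreover have "openin (subtopology M (fst C)) A"
    using assms by (auto simp: openin_subtopology)
  ultimately have "openin (top_of_set (snd C ` fst C)) (snd C ` A)"
    by (simp add: open_map_def)
  then show ?thesis using openin_open_eq[OF chart_image_open] by blast
qed

lemma openin_chart_preimage:
  assumes "open O'"
  shows "openin M {q \<in> fst C. snd C q \<in> O'}"
proof -
  have "openin (subtopology M (fst C)) {q \<in> topspace (subtopology M (fst C)). snd C q \<in> O'}"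
    using openin_continuous_map_preimage[OF chart_continuous] assms by auto
  then have "openin (subtopology M (fst C)) {q \<in> fst C. snd C q \<in> O'}"
    using chart_subset by (simp add: Int_absorb1)
  then show ?thesis using openin_open_subtopology[OF chart_openin] by auto
qed

lemma chart_inverse_continuous:
  "continuous_map (top_of_set (snd C ` fst C)) M (inv_into (fst C) (snd C))"
proof -
  obtain g where g: "homeomorphic_maps (subtopology M (fst C)) (top_of_set (snd C ` fst C)) (snd C) g"
    using chart_homeo homeomorphic_map_maps by blast
  then have "continuous_map (top_of_set (snd C ` fst C)) (subtopology M (fst C)) g"
    by (simp add: homeomorphic_maps_def)
  then have "continuous_map (top_of_set (snd C ` fst C)) M g"
    using continuous_map_into_fulltopology by blast
  moreover have "g y = inv_into (fst C) (snd C) y" if "y \<in> snd C ` fst C" for y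
    using g that chart_inj chart_subset by (auto simp: homeomorphic_maps_def)
  ultimately show ?thesis
    by (auto intro: continuous_map_eq)
qed

end

lemma vfield_analytic: "C \<in> charts S \<Longrightarrow> real_analytic_map_on (vfield S C) (snd C ` fst C)"
  using field by (simp add: analytic_vector_field_def)

context
  fixes C C' assumes C: "C \<in> charts S" and C': "C' \<in> charts S"
begin

lemma transition_eq: "p \<in> fst C \<Longrightarrow> transition C C' (snd C p) = snd C' p"
  using chart_inj[OF C] by (simp add: transition_def)

lemma overlap_open: "open (snd C ` (fst C \<inter> fst C'))"
  using open_chart_image[OF C] chart_openin[OF C] chart_openin[OF C'] by (simp add: openin_Int)

lemma transition_analytic: "real_analytic_map_on (transition C C') (snd C ` (fst C \<inter> fst C'))"
  using surface C C' by (simp add: analytic_surface_def)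

lemma transition_derivative:
  assumes "p \<in> fst C" "p \<in> fst C'"
  shows "(transition C C' has_derivative frechet_derivative (transition C C') (at (snd C p))) (at (snd C p))"
  using real_analytic_map_differentiable[OF transition_analytic] assms frechet_derivative_works by blast

lemma transition_field:
  "p \<in> fst C \<Longrightarrow> p \<in> fst C' \<Longrightarrow> vfield S C' (snd C' p) =
     frechet_derivative (transition C C') (at (snd C p)) (vfield S C (snd C p))"
  by (rule field[unfolded analytic_vector_field_def, THEN conjunct2, rule_format, OF C C' IntI])

end

lemma transition_derivative_inverse:
  assumes C: "C \<in> charts S" "C' \<in> charts S" and p: "p \<in> fst C" "p \<in> fst C'"
  shows "frechet_derivative (transition C' C) (at (snd C' p)) (frechet_derivative (transition C C') (at (snd C p)) v) = v"
proof -
  define D where "D = frechet_derivative (transition C C') (at (snd C p))"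
  define D' where "D' = frechet_derivative (transition C' C) (at (snd C' p))"
  have "(transition C C' has_derivative D) (at (snd C p))"
    "(transition C' C has_derivative D') (at (transition C C' (snd C p)))"
    using transition_derivative[OF C p] transition_derivative[OF C(2,1) p(2,1)] transition_eq[OF C p(1)]
    by (simp_all add: D_def D'_def)
  then have "(transition C' C \<circ> transition C C' has_derivative D' \<circ> D) (at (snd C p))"
    by (rule diff_chain_at)
  then have "((\<lambda>x. x) has_derivative D' \<circ> D) (at (snd C p))"
  proof (rule has_derivative_transform_within_open[OF _ overlap_open[OF C]])
    show "snd C p \<in> snd C ` (fst C \<inter> fst C')" using p by blast
    show "(transition C' C \<circ> transition C C') x = x" if "x \<in> snd C ` (fst C \<inter> fst C')" for x
      using that transition_eq[OF C] transition_eq[OF C(2,1)] by auto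
  qed
  then have "D' \<circ> D = (\<lambda>x. x)" using has_derivative_unique has_derivative_ident by blast
  then show ?thesis unfolding D_def D'_def by (metis comp_apply)
qed

text \<open>The definition asks for a zero in some chart; linearity of the derivative of the
  transition map carries it to every chart.\<close>

lemma equilibrium_iff:
  assumes C: "C \<in> charts S" and p: "p \<in> fst C"
  shows "equilibrium S p \<longleftrightarrow> vfield S C (snd C p) = 0"
proof
  assume "equilibrium S p"
  then obtain C' where C': "C' \<in> charts S" "p \<in> fst C'" "vfield S C' (snd C' p) = 0"
    by (auto simp: equilibrium_def)
  then show "vfield S C (snd C p) = 0"
    using transition_field[OF C'(1) C C'(2) p] has_derivative_linear[OF transition_derivative[OF C'(1) C C'(2) p]]
    by (simp add: linear_0)
next
  assume "vfield S C (snd C p) = 0"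
  then show "equilibrium S p" unfolding equilibrium_def using assms by blast
qed

section \<open>Integral curves: independence of charts, uniqueness, gluing\<close>

lemma eventually_curve:
  assumes "continuous_map (top_of_set I) M u" "openin M A" "t \<in> I" "u t \<in> A"
  shows "\<forall>\<^sub>F s in at t within I. u s \<in> A"
proof -
  have "openin (top_of_set I) {s \<in> topspace (top_of_set I). u s \<in> A}"
    by (rule openin_continuous_map_preimage[OF assms(1,2)])
  then have "openin (top_of_set I) {s \<in> I. u s \<in> A}" by simp
  from eventually_at_within_openin[OF this, of t] assms(3,4) have "\<forall>\<^sub>F s in at t within I. s \<in> {s \<in> I. u s \<in> A}"
    by simp
  then show ?thesis by eventually_elim simp
qed

lemma integral_curve_continuous: "integral_curve S u I \<Longrightarrow> continuous_map (top_of_set I) M u"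
  by (simp add: integral_curve_def)

lemma integral_curve_in_chart:
  assumes "integral_curve S u I" "t \<in> I"
  obtains C where "C \<in> charts S" "u t \<in> fst C"
  using assms unfolding integral_curve_def by blast

text \<open>By definition the velocity is right in one chart around each point; the transformation
  rule of the field gives it in any other.\<close>

lemma integral_curve_chart:
  assumes u: "integral_curve S u I" "t \<in> I" and C: "C \<in> charts S" "u t \<in> fst C"
  shows "((snd C \<circ> u) has_vector_derivative vfield S C (snd C (u t))) (at t within I)"
proof -
  obtain C' where C': "C' \<in> charts S" "u t \<in> fst C'"
    and d: "((snd C' \<circ> u) has_vector_derivative vfield S C' (snd C' (u t))) (at t within I)"
    using u by (auto simp: integral_curve_def)
  define D where "D = frechet_derivative (transition C' C) (at (snd C' (u t)))"
  have "(transition C' C has_derivative D) (at (snd C' (u t)))"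
    unfolding D_def by (rule transition_derivative[OF C'(1) C(1) C'(2) C(2)])
  then have "(transition C' C \<circ> (snd C' \<circ> u) has_vector_derivative D (vfield S C' (snd C' (u t)))) (at t within I)"
    by (intro vector_derivative_diff_chain_within[OF d]) (auto intro: has_derivative_at_withinI)
  then have 1: "(transition C' C \<circ> (snd C' \<circ> u) has_vector_derivative vfield S C (snd C (u t))) (at t within I)"
    using transition_field[OF C'(1) C(1) C'(2) C(2)] by (simp add: D_def)
  have "\<forall>\<^sub>F s in at t within I. u s \<in> fst C'"
    using u eventually_curve[OF _ chart_openin[OF C'(1)]] C'(2) by (auto simp: integral_curve_def)
  then have ev: "\<forall>\<^sub>F s in at t within I. (transition C' C \<circ> (snd C' \<circ> u)) s = (snd C \<circ> u) s"
    by eventually_elim (simp add: transition_eq[OF C'(1) C(1)])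
  have "(transition C' C \<circ> (snd C' \<circ> u)) t = (snd C \<circ> u) t"
    by (simp add: transition_eq[OF C'(1) C(1) C'(2)])
  from has_derivative_transform_eventually[OF 1[unfolded has_vector_derivative_def] ev this u(2)]
  show ?thesis unfolding has_vector_derivative_def .
qed

lemma vfield_Lipschitz:
  assumes C: "C \<in> charts S" and x: "x \<in> snd C ` fst C"
  obtains r L where "r > 0" "ball x r \<subseteq> snd C ` fst C"
    "\<And>y z. y \<in> ball x r \<Longrightarrow> z \<in> ball x r \<Longrightarrow> norm (vfield S C y - vfield S C z) \<le> L * norm (y - z)"
proof -
  have an: "real_analytic2_at (fst \<circ> vfield S C) x" "real_analytic2_at (snd \<circ> vfield S C) x"
    using vfield_analytic[OF C] x by (auto simp: real_analytic_map_on_def)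
  obtain r1 L1 where 1: "r1 > 0" "\<And>y z. y \<in> ball x r1 \<Longrightarrow> z \<in> ball x r1 \<Longrightarrow>
      \<bar>(fst \<circ> vfield S C) y - (fst \<circ> vfield S C) z\<bar> \<le> L1 * norm (y - z)"
    using real_analytic2_Lipschitz[OF an(1)] by metis
  obtain r2 L2 where 2: "r2 > 0" "\<And>y z. y \<in> ball x r2 \<Longrightarrow> z \<in> ball x r2 \<Longrightarrow>
      \<bar>(snd \<circ> vfield S C) y - (snd \<circ> vfield S C) z\<bar> \<le> L2 * norm (y - z)"
    using real_analytic2_Lipschitz[OF an(2)] by metis
  obtain r3 where 3: "r3 > 0" "ball x r3 \<subseteq> snd C ` fst C"
    using chart_image_open[OF C] x open_contains_ball by blast
  define r where "r = min r3 (min r1 r2)"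
  have r: "r > 0" "r \<le> r3" "r \<le> r1" "r \<le> r2" using 1 2 3 by (auto simp: r_def)
  show ?thesis
  proof (rule that[of r "L1 + L2"])
    fix y z assume yz: "y \<in> ball x r" "z \<in> ball x r"
    have "norm (vfield S C y - vfield S C z) \<le>
        norm (fst (vfield S C y - vfield S C z)) + norm (snd (vfield S C y - vfield S C z))"
      by (metis norm_Pair_le prod.collapse)
    also have "\<dots> \<le> L1 * norm (y - z) + L2 * norm (y - z)"
      using 1(2)[of y z] 2(2)[of y z] yz r by auto
    finally show "norm (vfield S C y - vfield S C z) \<le> (L1 + L2) * norm (y - z)" by (simp add: distrib_right)
  qed (use r 3 in auto)
qed

text \<open>The coincidence set is closed because the surface is Hausdorff, open by Gronwall's
  inequality in a chart, and the interval is connected.\<close>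

lemma integral_curve_unique:
  assumes u: "integral_curve S u {a..b}" and v: "integral_curve S v {a..b}"
    and t0: "t0 \<in> {a..b}" "u t0 = v t0" and t: "t \<in> {a..b}"
  shows "u t = v t"
proof -
  define I where "I = {a..b}"
  have cu: "continuous_map (top_of_set I) M u" and cv: "continuous_map (top_of_set I) M v"
    using integral_curve_continuous[OF u] integral_curve_continuous[OF v] by (auto simp: I_def)
  define A where "A = {s \<in> I. u s = v s}"
  have "closedin (top_of_set I) A"
    using closedin_continuous_maps_eq[OF Hausdorff cu cv] by (simp add: A_def)
  moreover have "openin (top_of_set I) A"
  proof (subst openin_subopen, intro ballI)
    fix s assume s: "s \<in> A"
    have sI: "s \<in> I" and uv: "u s = v s" using s by (auto simp: A_def)
    obtain C where C: "C \<in> charts S" "u s \<in> fst C"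
      using integral_curve_in_chart[OF u] sI unfolding I_def by blast
    define x where "x = snd C (u s)"
    have "x \<in> snd C ` fst C" using C by (simp add: x_def)
    then obtain r L where r: "r > 0" "ball x r \<subseteq> snd C ` fst C"
      and L: "\<And>y z. y \<in> ball x r \<Longrightarrow> z \<in> ball x r \<Longrightarrow> norm (vfield S C y - vfield S C z) \<le> L * norm (y - z)"
      using vfield_Lipschitz[OF C(1)] by metis
    define N where "N = {q \<in> fst C. snd C q \<in> ball x r}"
    have N: "openin M N" unfolding N_def by (rule openin_chart_preimage[OF C(1) open_ball])
    have "u s \<in> N" "v s \<in> N" using C r uv by (auto simp: N_def x_def)
    have "openin (top_of_set I) ({s \<in> topspace (top_of_set I). u s \<in> N} \<inter> {s \<in> topspace (top_of_set I). v s \<in> N})"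
      using openin_continuous_map_preimage[OF cu N] openin_continuous_map_preimage[OF cv N] by (rule openin_Int)
    then obtain T where T: "open T" "{s \<in> I. u s \<in> N} \<inter> {s \<in> I. v s \<in> N} = I \<inter> T"
      by (auto simp: openin_open)
    then have "s \<in> T" using \<open>u s \<in> N\<close> \<open>v s \<in> N\<close> sI by blast
    then obtain d where d: "d > 0" "cball s d \<subseteq> T" using T(1) open_contains_cball by blast
    \<comment> \<open>Cutting at a and b keeps the interval inside the domain of both curves, so end
      points are treated like interior points.\<close>
    define a' b' where ab': "a' = max a (s - d)" "b' = min b (s + d)"
    have sub: "{a'..b'} \<subseteq> I" and s': "s \<in> {a'..b'}" using sI d by (auto simp: ab' I_def)
    have inN: "u q \<in> N" "v q \<in> N" if "q \<in> {a'..b'}" for q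
    proof -
      have "q \<in> cball s d" using that by (auto simp: ab' dist_real_def)
      then show "u q \<in> N" "v q \<in> N" using T(2) d(2) that sub by blast+
    qed
    have eq: "u q = v q" if q: "q \<in> {a'..b'}" for q
    proof -
      have "norm ((snd C \<circ> u) q - (snd C \<circ> v) q) \<le> exp (L * \<bar>q - s\<bar>) * norm ((snd C \<circ> u) s - (snd C \<circ> v) s)"
      proof (rule gronwall)
        fix z assume z: "z \<in> {a'..b'}"
        have zI: "z \<in> I" using z sub by blast
        have zC: "u z \<in> fst C" "v z \<in> fst C" "snd C (u z) \<in> ball x r" "snd C (v z) \<in> ball x r"
          using inN[OF z] by (auto simp: N_def)
        show "((\<lambda>q. (snd C \<circ> u) q - (snd C \<circ> v) q) has_vector_derivative
            vfield S C (snd C (u z)) - vfield S C (snd C (v z))) (at z within {a'..b'})"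
          by (intro has_vector_derivative_diff has_vector_derivative_within_subset[OF _ sub]
              integral_curve_chart C(1) zI zC u[folded I_def] v[folded I_def])
        show "norm (vfield S C (snd C (u z)) - vfield S C (snd C (v z))) \<le> L * norm ((snd C \<circ> u) z - (snd C \<circ> v) z)"
          using L[OF zC(3,4)] by simp
      qed (use q s' in auto)
      then have "snd C (u q) = snd C (v q)" using uv by simp
      then show ?thesis using inN[OF q] chart_inj[OF C(1)] by (auto simp: N_def inj_on_def)
    qed
    have "I \<inter> ball s d \<subseteq> A"
    proof
      fix q assume "q \<in> I \<inter> ball s d"
      then have "q \<in> {a'..b'}" by (auto simp: ab' I_def dist_real_def)
      then show "q \<in> A" using eq sub by (auto simp: A_def)
    qed
    moreover have "openin (top_of_set I) (I \<inter> ball s d)" by (simp add: openin_open_Int)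
    ultimately show "\<exists>T. openin (top_of_set I) T \<and> s \<in> T \<and> T \<subseteq> A"
      using sI d(1) by (intro exI[of _ "I \<inter> ball s d"]) auto
  qed
  moreover have "connected I" by (simp add: I_def)
  moreover have "A \<noteq> {}" using t0 by (auto simp: A_def I_def)
  ultimately have "A = I" by (auto simp: connected_clopen)
  then have "t \<in> A" using t by (simp only: I_def)
  then show ?thesis by (simp add: A_def)
qed

lemma integral_curve_const:
  assumes "equilibrium S p"
  shows "integral_curve S (\<lambda>_. p) I"
proof -
  obtain C where C: "C \<in> charts S" "p \<in> fst C" "vfield S C (snd C p) = 0"
    using assms by (auto simp: equilibrium_def)
  then have "p \<in> topspace M" using topspace_charts by blast
  then show ?thesis
    using C unfolding integral_curve_def by (auto simp: o_def intro!: bexI[of _ C])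
qed

text \<open>By uniqueness, a curve through an equilibrium coincides with the constant curve.\<close>

lemma integral_curve_regular:
  assumes u: "integral_curve S u {a..b}" and s: "s \<in> {a..b}" "\<not> equilibrium S (u s)" and t: "t \<in> {a..b}"
  shows "\<not> equilibrium S (u t)"
proof
  assume e: "equilibrium S (u t)"
  have "u s = u t"
    using integral_curve_unique[OF u integral_curve_const[OF e] t refl s(1)] .
  then show False using e s by simp
qed

lemma integral_curve_subset:
  assumes u: "integral_curve S u I" and J: "J \<subseteq> I"
  shows "integral_curve S u J"
  unfolding integral_curve_def
proof (intro conjI ballI)
  show "continuous_map (top_of_set J) M u"
    using continuous_map_from_subtopology_mono[OF integral_curve_continuous[OF u] J] .
  fix t assume "t \<in> J"
  then have t: "t \<in> I" using J by blast
  obtain C where C: "C \<in> charts S" "u t \<in> fst C" using integral_curve_in_chart[OF u t] .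
  have "((snd C \<circ> u) has_vector_derivative vfield S C (snd C (u t))) (at t within J)"
    using integral_curve_chart[OF u t C] J by (rule has_vector_derivative_within_subset)
  then show "\<exists>C\<in>charts S. u t \<in> fst C \<and> ((snd C \<circ> u) has_vector_derivative vfield S C (snd C (u t))) (at t within J)"
    using C by blast
qed

lemma integral_curve_shift:
  assumes "integral_curve S u {a + k..b + k}"
  shows "integral_curve S (\<lambda>t. u (t + k)) {a..b}"
  unfolding integral_curve_def
proof (intro conjI ballI)
  have "continuous_map (top_of_set {a..b}) (top_of_set {a + k..b + k}) (\<lambda>t. t + k)"
    by (auto intro!: continuous_intros)
  then show "continuous_map (top_of_set {a..b}) M (\<lambda>t. u (t + k))"
    using continuous_map_compose[OF _ integral_curve_continuous[OF assms], of _ "\<lambda>t. t + k"] by (simp add: o_def)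
  fix t assume t: "t \<in> {a..b}"
  then have tk: "t + k \<in> {a + k..b + k}" by simp
  obtain C where C: "C \<in> charts S" "u (t + k) \<in> fst C" using integral_curve_in_chart[OF assms tk] .
  note d = integral_curve_chart[OF assms tk C]
  have "((snd C \<circ> u) \<circ> (\<lambda>t. t + k) has_vector_derivative 1 *\<^sub>R vfield S C (snd C (u (t + k)))) (at t within {a..b})"
  proof (rule vector_diff_chain_within)
    show "((\<lambda>t. t + k) has_vector_derivative 1) (at t within {a..b})"
      by (auto intro!: derivative_eq_intros)
    show "((snd C \<circ> u) has_vector_derivative vfield S C (snd C (u (t + k)))) (at (t + k) within (\<lambda>t. t + k) ` {a..b})"
      using d by simp
  qed
  then show "\<exists>C\<in>charts S. u (t + k) \<in> fst C \<and>
      ((snd C \<circ> (\<lambda>t. u (t + k))) has_vector_derivative vfield S C (snd C (u (t + k)))) (at t within {a..b})"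
    using C by (auto simp: o_def)
qed

text \<open>At the junction the derivative is assembled from the two one-sided ones. For a time
  outside one of the pieces the corresponding filter is trivial, so the same assembly works at every
  time.\<close>

lemma integral_curve_glue:
  assumes u: "integral_curve S u {a..b}" and v: "integral_curve S v {b..c}" and eq: "u b = v b" and ab: "a \<le> b" "b \<le> c"
  shows "integral_curve S (\<lambda>t. if t \<le> b then u t else v t) {a..c}" (is "integral_curve S ?w _")
  unfolding integral_curve_def
proof (intro conjI ballI)
  have un: "{a..c} = {a..b} \<union> {b..c}" using ab by auto
  have cu: "continuous_map (top_of_set {a..b}) M u" and cv: "continuous_map (top_of_set {b..c}) M v"
    using integral_curve_continuous u v by blast+
  have "{a..c} \<inter> {x \<in> {a..c}. x \<le> b} = {a..b}" "{a..c} \<inter> {x \<in> {a..c}. b \<le> x} = {b..c}" using ab by auto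
  then have sub: "subtopology (top_of_set {a..c}) {x \<in> topspace (top_of_set {a..c}). x \<le> b} = top_of_set {a..b}"
    "subtopology (top_of_set {a..c}) {x \<in> topspace (top_of_set {a..c}). b \<le> x} = top_of_set {b..c}"
    by (simp_all add: subtopology_subtopology)
  show "continuous_map (top_of_set {a..c}) M ?w"
  proof (rule continuous_map_cases_le)
    show "continuous_map (subtopology (top_of_set {a..c}) {x \<in> topspace (top_of_set {a..c}). x \<le> b}) M u"
      unfolding sub by (rule cu)
    show "continuous_map (subtopology (top_of_set {a..c}) {x \<in> topspace (top_of_set {a..c}). b \<le> x}) M v"
      unfolding sub by (rule cv)
  qed (use eq in auto)
  fix t assume t: "t \<in> {a..c}"
  have w: "?w q = u q" if "q \<in> {a..b}" for q using that by simp
  have w': "?w q = v q" if "q \<in> {b..c}" for q using that eq by auto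
  obtain C where C: "C \<in> charts S" "?w t \<in> fst C"
  proof (cases "t \<in> {a..b}")
    case True
    then show ?thesis using integral_curve_in_chart[OF u True] that w[OF True] by metis
  next
    case False
    then have "t \<in> {b..c}" using t by auto
    then show ?thesis using integral_curve_in_chart[OF v] that w' by metis
  qed
  have 1: "((snd C \<circ> ?w) has_vector_derivative vfield S C (snd C (?w t))) (at t within {a..b})"
  proof (cases "t \<in> {a..b}")
    case True
    have "((snd C \<circ> u) has_vector_derivative vfield S C (snd C (?w t))) (at t within {a..b})"
      using integral_curve_chart[OF u True C(1)] C(2) w[OF True] by simp
    then show ?thesis by (rule has_vector_derivative_transform[OF True, rotated]) (use w in auto)
  next
    case False
    then have "at t within {a..b} = bot" by (simp add: at_within_eq_bot_iff)
    then show ?thesis by (simp add: has_vector_derivative_bot)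
  qed
  have 2: "((snd C \<circ> ?w) has_vector_derivative vfield S C (snd C (?w t))) (at t within {b..c})"
  proof (cases "t \<in> {b..c}")
    case True
    have "((snd C \<circ> v) has_vector_derivative vfield S C (snd C (?w t))) (at t within {b..c})"
      using integral_curve_chart[OF v True C(1)] C(2) w'[OF True] by simp
    then show ?thesis by (rule has_vector_derivative_transform[OF True, rotated]) (use w' in auto)
  next
    case False
    then have "at t within {b..c} = bot" by (simp add: at_within_eq_bot_iff)
    then show ?thesis by (simp add: has_vector_derivative_bot)
  qed
  show "\<exists>C\<in>charts S. ?w t \<in> fst C \<and> ((snd C \<circ> ?w) has_vector_derivative vfield S C (snd C (?w t))) (at t within {a..c})"
    using C has_vector_derivative_Un[OF 1 2] unfolding un by blast
qed

section \<open>Orbit segments and their reparametrisation\<close>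

lemma orbit_segment_continuous:
  assumes "orbit_segment S c a b"
  shows "continuous_map (top_of_set {a..b}) M c"
proof -
  obtain u T h where u: "integral_curve S u {0..T}" and h: "continuous_on {a..b} h" "strict_mono_on {a..b} h" "h a = 0" "h b = T"
    and c: "\<forall>s\<in>{a..b}. c s = u (h s)"
    using assms by (auto simp: orbit_segment_def)
  have "continuous_map (top_of_set {a..b}) (top_of_set {0..T}) h"
    using h strict_mono_on_imp_mono_on[OF h(2)] by (fastforce simp: mono_on_def continuous_map_in_subtopology)
  then have "continuous_map (top_of_set {a..b}) M (u \<circ> h)"
    by (rule continuous_map_compose[OF _ integral_curve_continuous[OF u]])
  then show ?thesis by (rule continuous_map_eq) (use c in auto)
qed

lemma orbit_segment_subset:
  assumes "orbit_segment S c a b" "a \<le> a'" "a' \<le> b'" "b' \<le> b"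
  shows "orbit_segment S c a' b'"
proof -
  obtain u T h where u: "integral_curve S u {0..T}" and h: "continuous_on {a..b} h" "strict_mono_on {a..b} h" "h a = 0" "h b = T"
    and c: "\<forall>s\<in>{a..b}. c s = u (h s)"
    using assms(1) by (auto simp: orbit_segment_def)
  have m: "h s \<le> h t" if "a \<le> s" "s \<le> t" "t \<le> b" for s t
    using strict_mono_on_imp_mono_on[OF h(2)] that by (auto simp: mono_on_def)
  show ?thesis
    unfolding orbit_segment_def
  proof (intro exI conjI)
    show "integral_curve S (\<lambda>t. u (t + h a')) {0..h b' - h a'}"
      by (rule integral_curve_shift, rule integral_curve_subset[OF u]) (use m[of a a'] m[of b' b] assms h in auto)
    show "continuous_on {a'..b'} (\<lambda>s. h s - h a')"
      by (intro continuous_intros continuous_on_subset[OF h(1)]) (use assms in auto)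
    show "strict_mono_on {a'..b'} (\<lambda>s. h s - h a')"
      by (rule strict_mono_onI) (use assms strict_mono_onD[OF h(2)] in auto)
    show "\<forall>s\<in>{a'..b'}. c s = u (h s - h a' + h a')" using c assms by auto
  qed auto
qed

lemma orbit_segment_reparam:
  assumes "orbit_segment S c a b" and \<phi>: "continuous_on {a'..b'} \<phi>" "strict_mono_on {a'..b'} \<phi>" "\<phi> a' = a" "\<phi> b' = b"
    and le: "a' \<le> b'"
  shows "orbit_segment S (\<lambda>s. c (\<phi> s)) a' b'"
proof -
  obtain u T h where u: "integral_curve S u {0..T}" and h: "continuous_on {a..b} h" "strict_mono_on {a..b} h" "h a = 0" "h b = T"
    and c: "\<forall>s\<in>{a..b}. c s = u (h s)"
    using assms(1) by (auto simp: orbit_segment_def)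
  have in_ab: "\<phi> s \<in> {a..b}" if "s \<in> {a'..b'}" for s
    using strict_mono_on_imp_mono_on[OF \<phi>(2)] that le \<phi>(3,4) by (fastforce simp: mono_on_def)
  show ?thesis
    unfolding orbit_segment_def
  proof (intro exI conjI)
    show "continuous_on {a'..b'} (\<lambda>s. h (\<phi> s))"
      using continuous_on_compose2[OF h(1) \<phi>(1)] in_ab by blast
    show "strict_mono_on {a'..b'} (\<lambda>s. h (\<phi> s))"
      using in_ab strict_mono_onD[OF h(2)] strict_mono_onD[OF \<phi>(2)] by (intro strict_mono_onI) blast
    show "\<forall>s\<in>{a'..b'}. c (\<phi> s) = u (h (\<phi> s))" using c in_ab by blast
  qed (use u h \<phi> in auto)
qed

text \<open>The second curve is delayed by the duration T of the first; since k is positive behind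
  b, the case distinction on time agrees with the one on the parameter.\<close>

lemma orbit_segment_glue:
  assumes c: "orbit_segment S c a b" and d: "orbit_segment S d b e" and eq: "c b = d b" and ab: "a \<le> b" "b \<le> e"
  shows "orbit_segment S (\<lambda>s. if s \<le> b then c s else d s) a e"
proof -
  obtain u T h where u: "integral_curve S u {0..T}" and h: "continuous_on {a..b} h" "strict_mono_on {a..b} h" "h a = 0" "h b = T"
    and cu: "\<forall>s\<in>{a..b}. c s = u (h s)"
    using c by (auto simp: orbit_segment_def)
  obtain v T' k where v: "integral_curve S v {0..T'}" and k: "continuous_on {b..e} k" "strict_mono_on {b..e} k" "k b = 0" "k e = T'"
    and dv: "\<forall>s\<in>{b..e}. d s = v (k s)"
    using d by (auto simp: orbit_segment_def)
  have hm: "h s \<le> T" if "s \<in> {a..b}" for s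
    using strict_mono_on_imp_mono_on[OF h(2)] that h by (auto simp: mono_on_def)
  have T: "0 \<le> T" using hm[of a] ab h by auto
  have km: "0 < k s" if "s \<in> {b..e}" "b < s" for s
    using strict_mono_onD[OF k(2), of b s] that k by auto
  have T': "0 \<le> T'" using km[of e] ab k by (cases "b = e") auto
  have v': "integral_curve S (\<lambda>t. v (t + - T)) {T..T + T'}"
    by (rule integral_curve_shift) (use v in simp)
  have uv: "u T = v (T + - T)" using eq cu dv h k ab by auto
  define g where "g = (\<lambda>s. if s \<le> b then h s else T + k s)"
  show ?thesis
    unfolding orbit_segment_def
  proof (intro exI conjI)
    show "integral_curve S (\<lambda>t. if t \<le> T then u t else v (t + - T)) {0..T + T'}"
      by (rule integral_curve_glue[OF u v' uv]) (use T T' in auto)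
    have "{a..e} = {a..b} \<union> {b..e}" using ab by auto
    moreover have "continuous_on ({a..b} \<union> {b..e}) g"
      unfolding g_def by (rule continuous_on_cases) (use h k in \<open>auto intro!: continuous_intros\<close>)
    ultimately show "continuous_on {a..e} g" by simp
    show "strict_mono_on {a..e} g"
    proof (rule strict_mono_onI)
      fix r s assume rs: "r \<in> {a..e}" "s \<in> {a..e}" "r < s"
      show "g r < g s"
        using rs strict_mono_onD[OF h(2), of r s] strict_mono_onD[OF k(2), of r s] hm[of r] km[of s]
        by (auto simp: g_def)
    qed
    show "g a = 0" "g e = T + T'" using ab h k by (auto simp: g_def)
    show "\<forall>s\<in>{a..e}. (if s \<le> b then c s else d s) = (if g s \<le> T then u (g s) else v (g s + - T))"
    proof
      fix s assume s: "s \<in> {a..e}"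
      show "(if s \<le> b then c s else d s) = (if g s \<le> T then u (g s) else v (g s + - T))"
      proof (cases "s \<le> b")
        case True
        then show ?thesis using s hm[of s] cu by (simp add: g_def)
      next
        case False
        then show ?thesis using s km[of s] dv by (simp add: g_def)
      qed
    qed
  qed
qed

end

section \<open>Transversals and flow boxes\<close>

lemma real_analytic_affine: "real_analytic_at (\<lambda>z. a + z * b) x"
proof (rule real_analytic_atI[of 1 "\<lambda>z. of_real (a + x * b) + z * of_real b"])
  show "(\<lambda>z. complex_of_real (a + x * b) + z * of_real b) holomorphic_on ball 0 1"
    by (intro holomorphic_intros)
qed (simp_all add: algebra_simps)

lemma real_analytic_shift:
  "real_analytic_at f (a + x) \<Longrightarrow> real_analytic_at (\<lambda>z. f (a + z)) x"
  unfolding real_analytic_at_def by (simp add: add.assoc)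

lemma isCont_tendsto_nhds: "isCont f a \<Longrightarrow> (f \<longlongrightarrow> f a) (nhds a)"
  by (simp only: isCont_def tendsto_at_iff_tendsto_nhds)

lemma eventually_nhds_shift:
  assumes "\<forall>\<^sub>F z in nhds (a :: real). P z"
  shows "\<forall>\<^sub>F z in nhds 0. P (a + z)"
proof (rule eventually_compose_filterlim[OF assms])
  have "((\<lambda>z. a + z) \<longlongrightarrow> a + 0) (nhds 0)"
    by (rule isCont_tendsto_nhds) (intro continuous_intros)
  then show "filterlim (\<lambda>z. a + z) (nhds a) (nhds 0)" by simp
qed

context surface
begin

text \<open>By definition a transversal is regular only in its chart expression; that charts are
  open maps carries its continuity to the surface.\<close>

lemma half_transversal_eventually_aux:
  assumes C: "C \<in> charts S" "\<forall>\<^sub>F z in nhds 0. \<sigma> z \<in> fst C" "isCont (snd C \<circ> \<sigma>) 0"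
    and A: "openin M A" "\<sigma> 0 \<in> A"
  shows "\<forall>\<^sub>F z in nhds 0. \<sigma> z \<in> A"
proof -
  define N where "N = A \<inter> fst C"
  have N: "openin M N" "N \<subseteq> fst C" unfolding N_def using A chart_openin[OF C(1)] by auto
  have "\<sigma> 0 \<in> N" using A eventually_nhds_x_imp_x[OF C(2)] by (simp add: N_def)
  then have "snd C (\<sigma> 0) \<in> snd C ` N" by blast
  moreover have "open (snd C ` N)" by (rule open_chart_image[OF C(1) N])
  moreover have "((snd C \<circ> \<sigma>) \<longlongrightarrow> (snd C \<circ> \<sigma>) 0) (nhds 0)"
    by (rule isCont_tendsto_nhds[OF C(3)])
  ultimately have "\<forall>\<^sub>F z in nhds 0. (snd C \<circ> \<sigma>) z \<in> snd C ` N"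
    by (auto dest: topological_tendstoD)
  with C(2) show ?thesis
  proof eventually_elim
    case (elim z)
    then show ?case using N(2) inj_onD[OF chart_inj[OF C(1)]] by (auto simp: N_def)
  qed
qed

lemma half_transversal_eventually:
  assumes "half_transversal S \<sigma>" "openin M A" "\<sigma> 0 \<in> A"
  shows "\<forall>\<^sub>F z in nhds 0. \<sigma> z \<in> A"
  using assms half_transversal_eventually_aux has_vector_derivative_continuous
  unfolding half_transversal_def by blast

text \<open>Composition with the transition map preserves analyticity, and its derivative is
  injective, so linear independence of velocity and field survives the change of chart.\<close>

lemma half_transversal_chart:
  assumes \<sigma>: "half_transversal S \<sigma>" and C: "C \<in> charts S" "\<sigma> 0 \<in> fst C"
  obtains w where "\<forall>\<^sub>F z in nhds 0. \<sigma> z \<in> fst C" "real_analytic_curve_at (snd C \<circ> \<sigma>) 0"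
    "((snd C \<circ> \<sigma>) has_vector_derivative w) (at 0)" "\<not> collinear {0, w, vfield S C (snd C (\<sigma> 0))}"
proof -
  obtain C' w where C': "C' \<in> charts S" "\<forall>\<^sub>F z in nhds 0. \<sigma> z \<in> fst C'"
    and an: "real_analytic_curve_at (snd C' \<circ> \<sigma>) 0"
    and w: "((snd C' \<circ> \<sigma>) has_vector_derivative w) (at 0)"
    and nc: "\<not> collinear {0, w, vfield S C' (snd C' (\<sigma> 0))}"
    using \<sigma> unfolding half_transversal_def by blast
  have C'0: "\<sigma> 0 \<in> fst C'" by (rule eventually_nhds_x_imp_x[OF C'(2)])
  define T where "T = transition C' C"
  define c where "c = snd C' \<circ> \<sigma>"
  define D where "D = frechet_derivative T (at (snd C' (\<sigma> 0)))"
  define D' where "D' = frechet_derivative (transition C C') (at (snd C (\<sigma> 0)))"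
  have evC: "\<forall>\<^sub>F z in nhds 0. \<sigma> z \<in> fst C"
    by (rule half_transversal_eventually[OF \<sigma> chart_openin[OF C(1)] C(2)])
  have eq: "\<forall>\<^sub>F z in nhds 0. T (c z) = (snd C \<circ> \<sigma>) z"
    using C'(2) by eventually_elim (simp add: T_def c_def transition_eq[OF C'(1) C(1)])
  have in_ov: "c 0 \<in> snd C' ` (fst C' \<inter> fst C)" using C C'0 by (simp add: c_def)
  have anT: "real_analytic2_at (fst \<circ> T) (c 0)" "real_analytic2_at (snd \<circ> T) (c 0)"
    using transition_analytic[OF C'(1) C(1)] in_ov by (auto simp: real_analytic_map_on_def T_def)
  have an': "real_analytic_curve_at (snd C \<circ> \<sigma>) 0"
    unfolding real_analytic_curve_at_def
  proof
    show "real_analytic_at (fst \<circ> (snd C \<circ> \<sigma>)) 0"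
      by (rule real_analytic_at_cong[OF real_analytic2_compose_curve[OF anT(1) an[folded c_def]]])
         (use eq in eventually_elim, simp)
    show "real_analytic_at (snd \<circ> (snd C \<circ> \<sigma>)) 0"
      by (rule real_analytic_at_cong[OF real_analytic2_compose_curve[OF anT(2) an[folded c_def]]])
         (use eq in eventually_elim, simp)
  qed
  have dT: "(T has_derivative D) (at (c 0))"
    unfolding T_def D_def c_def using transition_derivative[OF C'(1) C(1) C'0 C(2)] by simp
  have "(T \<circ> c has_vector_derivative D w) (at 0)"
    by (rule vector_derivative_diff_chain_within[OF w[folded c_def]]) (use dT has_derivative_at_withinI in blast)
  moreover obtain A where A: "open A" "0 \<in> A" "\<forall>z\<in>A. T (c z) = (snd C \<circ> \<sigma>) z"
    using eq unfolding eventually_nhds by blast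
  ultimately have dw: "((snd C \<circ> \<sigma>) has_vector_derivative D w) (at 0)"
    by (auto intro: has_vector_derivative_transform_within_open[of _ _ _ A])
  have "\<not> collinear {0, D w, vfield S C (snd C (\<sigma> 0))}"
  proof
    define v where "v = vfield S C' (snd C' (\<sigma> 0))"
    have Dv: "vfield S C (snd C (\<sigma> 0)) = D v"
      unfolding D_def T_def v_def by (rule transition_field[OF C'(1) C(1) C'0 C(2)])
    have inv: "D' (D x) = x" for x
      unfolding D_def D'_def T_def by (rule transition_derivative_inverse[OF C'(1) C(1) C'0 C(2)])
    have lin: "linear D'" unfolding D'_def
      by (rule has_derivative_linear[OF transition_derivative[OF C(1) C'(1) C(2) C'0]])
    assume "collinear {0, D w, vfield S C (snd C (\<sigma> 0))}"
    then have "D w = 0 \<or> D v = 0 \<or> (\<exists>k. D v = k *\<^sub>R D w)" unfolding Dv collinear_lemma .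
    then have "w = 0 \<or> v = 0 \<or> (\<exists>k. v = k *\<^sub>R w)"
      using inv[of w] inv[of v] linear_0[OF lin] linear_cmul[OF lin] by metis
    then show False using nc unfolding collinear_lemma v_def by blast
  qed
  then show ?thesis using that evC an' dw by blast
qed

lemma half_transversal_topspace: "half_transversal S \<sigma> \<Longrightarrow> \<sigma> 0 \<in> topspace M"
  unfolding half_transversal_def topspace_charts using eventually_nhds_x_imp_x by fast

lemma half_transversal_regular:
  assumes "half_transversal S \<sigma>"
  shows "\<not> equilibrium S (\<sigma> 0)"
proof
  obtain C where C: "C \<in> charts S" "\<sigma> 0 \<in> fst C"
    using half_transversal_topspace[OF assms] topspace_charts by blast
  assume "equilibrium S (\<sigma> 0)"
  then have "vfield S C (snd C (\<sigma> 0)) = 0" using equilibrium_iff[OF C] by simp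
  then show False using half_transversal_chart[OF assms C] by (auto simp: collinear_lemma)
qed

text \<open>Recentring serves to differentiate transit maps at points z > 0. The determinant of
  velocity and field depends continuously on the base point and stays nonzero.\<close>

lemma half_transversal_shift:
  assumes "half_transversal S \<sigma>"
  shows "\<forall>\<^sub>F a in nhds 0. half_transversal S (\<lambda>z. \<sigma> (a + z))"
proof -
  obtain C where C: "C \<in> charts S" "\<sigma> 0 \<in> fst C"
    using half_transversal_topspace[OF assms] topspace_charts by blast
  obtain w where ev: "\<forall>\<^sub>F z in nhds 0. \<sigma> z \<in> fst C" and an: "real_analytic_curve_at (snd C \<circ> \<sigma>) 0"
    and w: "((snd C \<circ> \<sigma>) has_vector_derivative w) (at 0)" "\<not> collinear {0, w, vfield S C (snd C (\<sigma> 0))}"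
    using half_transversal_chart[OF assms C] .
  define c where "c = snd C \<circ> \<sigma>"
  have an1: "real_analytic_at (\<lambda>z. fst (c z)) 0" and an2: "real_analytic_at (\<lambda>z. snd (c z)) 0"
    using an by (auto simp: real_analytic_curve_at_def c_def o_def)
  obtain c1 where c1: "\<forall>\<^sub>F y in nhds 0. ((\<lambda>z. fst (c z)) has_real_derivative c1 y) (at y)" "isCont c1 0"
    using real_analytic_continuous_derivative[OF an1] .
  obtain c2 where c2: "\<forall>\<^sub>F y in nhds 0. ((\<lambda>z. snd (c z)) has_real_derivative c2 y) (at y)" "isCont c2 0"
    using real_analytic_continuous_derivative[OF an2] .
  have dc: "\<forall>\<^sub>F y in nhds 0. (c has_vector_derivative (c1 y, c2 y)) (at y)"
    using c1(1) c2(1)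
  proof eventually_elim
    case (elim y)
    then have "((\<lambda>z. (fst (c z), snd (c z))) has_vector_derivative (c1 y, c2 y)) (at y)"
      by (intro has_vector_derivative_Pair) (simp_all add: has_real_derivative_iff_has_vector_derivative)
    then show ?case by simp
  qed
  have "w = (c1 0, c2 0)"
    using vector_derivative_unique_at[OF w(1)[folded c_def] eventually_nhds_x_imp_x[OF dc]] .
  define X where "X = vfield S C"
  define det where "det = (\<lambda>a. c1 a * snd (X (c a)) - c2 a * fst (X (c a)))"
  have contc: "isCont c 0" using w(1) has_vector_derivative_continuous by (auto simp: c_def)
  have "c 0 \<in> snd C ` fst C" using C by (simp add: c_def)
  then have "isCont X (c 0)"
    unfolding X_def
    by (rule differentiable_imp_continuous_within[OF real_analytic_map_differentiable[OF vfield_analytic[OF C(1)]]])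
  then have "isCont (\<lambda>a. X (c a)) 0" using isCont_o2[OF contc] by blast
  then have "isCont det 0" unfolding det_def using c1(2) c2(2) by (intro continuous_intros)
  moreover have "det 0 \<noteq> 0"
    using w(2) \<open>w = (c1 0, c2 0)\<close> by (simp add: collinear_0_iff_det det_def X_def c_def)
  ultimately have "\<forall>\<^sub>F a in nhds 0. det a \<noteq> 0"
    by (simp add: isCont_def tendsto_at_iff_tendsto_nhds tendsto_imp_eventually_ne)
  with eventually_eventually[of "\<lambda>z. \<sigma> z \<in> fst C" 0, THEN iffD2, OF ev] dc
    real_analytic_at_eventually[OF an1] real_analytic_at_eventually[OF an2]
  show ?thesis
  proof eventually_elim
    case (elim a)
    have "((snd C \<circ> \<sigma>) \<circ> (\<lambda>z. a + z) has_vector_derivative 1 *\<^sub>R (c1 a, c2 a)) (at 0)"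
      by (rule vector_diff_chain_at) (use elim in \<open>auto simp: c_def intro!: derivative_eq_intros\<close>)
    moreover have "\<not> collinear {0, (c1 a, c2 a), vfield S C (snd C (\<sigma> (a + 0)))}"
      using elim by (simp add: collinear_0_iff_det det_def X_def c_def)
    moreover have "real_analytic_curve_at (snd C \<circ> (\<lambda>z. \<sigma> (a + z))) 0"
      using real_analytic_shift[of "\<lambda>z. fst (c z)" a 0] real_analytic_shift[of "\<lambda>z. snd (c z)" a 0] elim
      by (simp add: real_analytic_curve_at_def o_def c_def)
    moreover have "\<forall>\<^sub>F z in nhds 0. \<sigma> (a + z) \<in> fst C"
      using elim by (intro eventually_nhds_shift)
    ultimately show ?case
      unfolding half_transversal_def using C(1) by (intro bexI[of _ C]) (auto simp: o_def)
  qed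
qed

text \<open>A straight line perpendicular to the field, drawn in a chart.\<close>

lemma half_transversal_exists:
  assumes p: "p \<in> topspace M" "\<not> equilibrium S p"
  obtains \<sigma> where "half_transversal S \<sigma>" "\<sigma> 0 = p"
proof -
  obtain C where C: "C \<in> charts S" "p \<in> fst C" using p topspace_charts by blast
  define w where "w = vfield S C (snd C p)"
  have w: "w \<noteq> 0" using equilibrium_iff[OF C] p by (simp add: w_def)
  define w' where "w' = (- snd w, fst w)"
  define c where "c = (\<lambda>z. snd C p + z *\<^sub>R w')"
  define \<sigma> where "\<sigma> = (\<lambda>z. inv_into (fst C) (snd C) (c z))"
  have "open (snd C ` fst C)" by (rule chart_image_open[OF C(1)])
  moreover have "c 0 \<in> snd C ` fst C" using C by (simp add: c_def)
  moreover have "(c \<longlongrightarrow> c 0) (nhds 0)"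
  proof -
    have "((\<lambda>z. snd C p + z *\<^sub>R w') \<longlongrightarrow> snd C p + 0 *\<^sub>R w') (nhds 0)"
      by (rule isCont_tendsto_nhds) (intro continuous_intros)
    then show ?thesis by (simp add: c_def)
  qed
  ultimately have ev: "\<forall>\<^sub>F z in nhds 0. c z \<in> snd C ` fst C" by (auto dest: topological_tendstoD)
  have ev1: "\<forall>\<^sub>F z in nhds 0. \<sigma> z \<in> fst C"
    using ev by eventually_elim (simp add: \<sigma>_def inv_into_into)
  have ev2: "\<forall>\<^sub>F z in nhds 0. c z = (snd C \<circ> \<sigma>) z"
    using ev by eventually_elim (simp add: \<sigma>_def f_inv_into_f)
  have \<sigma>0: "\<sigma> 0 = p" using chart_inj[OF C(1)] C(2) by (simp add: \<sigma>_def c_def)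
  have "real_analytic_at (fst \<circ> (snd C \<circ> \<sigma>)) 0"
    by (rule real_analytic_at_cong[OF real_analytic_affine[of "fst (snd C p)" "fst w'"]])
       (use ev2 in \<open>eventually_elim, metis c_def comp_apply fst_add fst_scaleR real_scaleR_def\<close>)
  moreover have "real_analytic_at (snd \<circ> (snd C \<circ> \<sigma>)) 0"
    by (rule real_analytic_at_cong[OF real_analytic_affine[of "snd (snd C p)" "snd w'"]])
       (use ev2 in \<open>eventually_elim, metis c_def comp_apply snd_add snd_scaleR real_scaleR_def\<close>)
  moreover have "((snd C \<circ> \<sigma>) has_vector_derivative w') (at 0)"
  proof -
    obtain A where A: "open A" "0 \<in> A" "\<forall>z\<in>A. c z = (snd C \<circ> \<sigma>) z"
      using ev2 unfolding eventually_nhds by blast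
    have "(c has_vector_derivative w') (at 0)"
      unfolding c_def by (auto intro!: derivative_eq_intros)
    then show ?thesis by (rule has_vector_derivative_transform_within_open[OF _ A(1,2)]) (use A in auto)
  qed
  moreover have "\<not> collinear {0, w', vfield S C (snd C (\<sigma> 0))}"
  proof -
    have "- snd w * snd w - fst w * fst w \<noteq> 0"
      using w sum_squares_gt_zero_iff[of "fst w" "snd w"] by (auto simp: prod_eq_iff)
    then show ?thesis by (simp add: collinear_0_iff_det \<sigma>0 w_def[symmetric] w'_def)
  qed
  ultimately have "half_transversal S \<sigma>"
    unfolding half_transversal_def real_analytic_curve_at_def using C(1) ev1 by blast
  then show ?thesis using that \<sigma>0 by blast
qed

text \<open>
  \<open>x\<close> increases along the flow, \<open>h\<close> is a first integral, and \<open>g\<close> is the inverse of \<open>(x, h)\<close>.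
\<close>

definition flow_box ::
  "'m set \<Rightarrow> ('m \<Rightarrow> real) \<Rightarrow> ('m \<Rightarrow> real) \<Rightarrow> (real \<times> real \<Rightarrow> 'm) \<Rightarrow> real \<Rightarrow> real \<Rightarrow> bool" where
  "flow_box U x h g d e \<longleftrightarrow>
     openin M U \<and>
     continuous_map (subtopology M U) euclidean x \<and> continuous_map (subtopology M U) euclidean h \<and>
     continuous_map (top_of_set ({-d<..<d} \<times> {-e<..<e})) M g \<and>
     (\<forall>q\<in>U. x q \<in> {-d<..<d} \<and> h q \<in> {-e<..<e} \<and> g (x q, h q) = q) \<and>
     (\<forall>a\<in>{-d<..<d}. \<forall>b\<in>{-e<..<e}. g (a, b) \<in> U \<and> x (g (a, b)) = a \<and> h (g (a, b)) = b) \<and>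
     (\<forall>u T. integral_curve S u {0..T} \<longrightarrow> (\<forall>t\<in>{0..T}. u t \<in> U) \<longrightarrow>
        (\<forall>s t. 0 \<le> s \<and> s < t \<and> t \<le> T \<longrightarrow> h (u s) = h (u t) \<and> x (u s) < x (u t))) \<and>
     (\<forall>a1\<in>{-d<..<d}. \<forall>a2\<in>{-d<..<d}. \<forall>b\<in>{-e<..<e}. a1 < a2 \<longrightarrow> orbit_segment S (\<lambda>a. g (a, b)) a1 a2) \<and>
     (\<forall>\<sigma>. half_transversal S \<sigma> \<longrightarrow> \<sigma> 0 \<in> U \<longrightarrow>
        real_analytic_at (\<lambda>z. h (\<sigma> z)) 0 \<and> (\<exists>D. D \<noteq> 0 \<and> ((\<lambda>z. h (\<sigma> z)) has_real_derivative D) (at 0)))"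

text \<open>The planar box is carried over by one chart around p. A transversal may come with a
  chart of its own and is first rewritten in the chosen one.\<close>

lemma flow_box_exists:
  assumes p: "p \<in> topspace M" "\<not> equilibrium S p"
  obtains U x h g d e where "flow_box U x h g d e" "p \<in> U"
proof -
  obtain C where C: "C \<in> charts S" "p \<in> fst C" using p topspace_charts by blast
  define V where "V = snd C ` fst C"
  define q where "q = snd C p"
  define i where "i = inv_into (fst C) (snd C)"
  have V: "open V" "q \<in> V" using chart_image_open[OF C(1)] C(2) by (auto simp: V_def q_def)
  have nz: "vfield S C q \<noteq> 0" using equilibrium_iff[OF C] p by (simp add: q_def)
  obtain F \<rho> R M' L \<delta> where "planar_box F \<rho> R M' L \<delta> (vfield S C) q (vfield S C q) V"
    using planar_box_exists[OF vfield_analytic[OF C(1), folded V_def] V nz] .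
  then interpret P: planar_box F \<rho> R M' L \<delta> "vfield S C" q "vfield S C q" V .
  have iC: "i (snd C r) = r" if "r \<in> fst C" for r
    unfolding i_def using chart_inj[OF C(1)] that by simp
  have Ci: "i y \<in> fst C" "snd C (i y) = y" if "y \<in> V" for y
    using that unfolding V_def i_def by (auto intro: inv_into_into f_inv_into_f)
  define U where "U = {r \<in> fst C. snd C r \<in> P.U}"
  define B where "B = {-\<delta><..<\<delta>} \<times> {-(\<rho>/4)<..<\<rho>/4}"
  have UC: "U \<subseteq> fst C" by (auto simp: U_def)
  have cU: "continuous_map (subtopology M U) (top_of_set P.U) (snd C)"
    using continuous_map_from_subtopology_mono[OF chart_continuous[OF C(1)] UC]
    by (auto simp: continuous_map_in_subtopology U_def)
  have gU: "P.g ab \<in> P.U" if "ab \<in> B" for ab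
    using P.g_box(3)[of "fst ab" "snd ab"] that by (auto simp: B_def abs_less_iff)
  have gV: "P.g ab \<in> V" if "ab \<in> B" for ab using gU[OF that] P.U_subset by blast
  have "flow_box U (P.\<xi> \<circ> snd C) (P.h \<circ> snd C) (i \<circ> P.g) \<delta> (\<rho>/4)"
    unfolding flow_box_def
  proof (intro conjI)
    show "openin M U" unfolding U_def by (rule openin_chart_preimage[OF C(1) P.open_U])
    show "continuous_map (subtopology M U) euclidean (P.\<xi> \<circ> snd C)"
      by (rule continuous_map_compose[OF cU]) (simp add: P.continuous_\<xi>)
    show "continuous_map (subtopology M U) euclidean (P.h \<circ> snd C)"
      by (rule continuous_map_compose[OF cU])
         (simp, rule continuous_on_subset[OF P.continuous_h], auto simp: P.U_def)
    show "continuous_map (top_of_set ({-\<delta><..<\<delta>} \<times> {-(\<rho>/4)<..<\<rho>/4})) M (i \<circ> P.g)"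
    proof (rule continuous_map_compose)
      show "continuous_map (top_of_set ({-\<delta><..<\<delta>} \<times> {-(\<rho>/4)<..<\<rho>/4})) (top_of_set V) P.g"
        using P.continuous_g gV by (auto simp: continuous_map_in_subtopology B_def)
      show "continuous_map (top_of_set V) M i"
        unfolding V_def i_def by (rule chart_inverse_continuous[OF C(1)])
    qed
    show "\<forall>r\<in>U. (P.\<xi> \<circ> snd C) r \<in> {-\<delta><..<\<delta>} \<and> (P.h \<circ> snd C) r \<in> {-(\<rho>/4)<..<\<rho>/4} \<and>
        (i \<circ> P.g) ((P.\<xi> \<circ> snd C) r, (P.h \<circ> snd C) r) = r"
      using P.g_inverse iC by (auto simp: U_def P.U_def abs_less_iff)
    show "\<forall>a\<in>{-\<delta><..<\<delta>}. \<forall>b\<in>{-(\<rho>/4)<..<\<rho>/4}. (i \<circ> P.g) (a, b) \<in> U \<and>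
        (P.\<xi> \<circ> snd C) ((i \<circ> P.g) (a, b)) = a \<and> (P.h \<circ> snd C) ((i \<circ> P.g) (a, b)) = b"
      using Ci gV gU P.g_box(1,2) by (auto simp: U_def B_def abs_less_iff)
    show "\<forall>u T. integral_curve S u {0..T} \<longrightarrow> (\<forall>t\<in>{0..T}. u t \<in> U) \<longrightarrow>
        (\<forall>s t. 0 \<le> s \<and> s < t \<and> t \<le> T \<longrightarrow> (P.h \<circ> snd C) (u s) = (P.h \<circ> snd C) (u t) \<and>
          (P.\<xi> \<circ> snd C) (u s) < (P.\<xi> \<circ> snd C) (u t))"
    proof (intro allI impI)
      fix u T s t assume u: "integral_curve S u {0..T}" "\<forall>t\<in>{0..T}. u t \<in> U" and st: "0 \<le> s \<and> s < t \<and> t \<le> T"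
      have "((snd C \<circ> u) has_vector_derivative vfield S C ((snd C \<circ> u) t)) (at t within {0..T}) \<and> (snd C \<circ> u) t \<in> P.U"
        if "t \<in> {0..T}" for t
        using integral_curve_chart[OF u(1) that C(1)] u(2) that by (auto simp: U_def)
      from P.curve_in_leaf[OF this] st
      show "(P.h \<circ> snd C) (u s) = (P.h \<circ> snd C) (u t) \<and> (P.\<xi> \<circ> snd C) (u s) < (P.\<xi> \<circ> snd C) (u t)"
        by simp
    qed
    show "\<forall>a1\<in>{-\<delta><..<\<delta>}. \<forall>a2\<in>{-\<delta><..<\<delta>}. \<forall>b\<in>{-(\<rho>/4)<..<\<rho>/4}. a1 < a2 \<longrightarrow> orbit_segment S (\<lambda>a. (i \<circ> P.g) (a, b)) a1 a2"
    proof (intro ballI impI)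
      fix a1 a2 b assume ab: "a1 \<in> {-\<delta><..<\<delta>}" "a2 \<in> {-\<delta><..<\<delta>}" "b \<in> {-(\<rho>/4)<..<\<rho>/4}" "a1 < a2"
      have "\<bar>a1\<bar> < \<delta>" "\<bar>a2\<bar> < \<delta>" "\<bar>b\<bar> < \<rho>/4" using ab by (auto simp: abs_less_iff)
      from P.leaf_is_orbit[OF this(1,2) ab(4) this(3)] obtain u T \<theta> where u: "\<forall>t\<in>{0..T}. (u has_vector_derivative vfield S C (u t)) (at t within {0..T}) \<and> u t \<in> P.U"
        and \<theta>: "continuous_on {a1..a2} \<theta>" "strict_mono_on {a1..a2} \<theta>" "\<theta> a1 = 0" "\<theta> a2 = T"
        and gu: "\<forall>x\<in>{a1..a2}. P.g (x, b) = u (\<theta> x)"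
        by blast
      have uV: "u t \<in> V" if "t \<in> {0..T}" for t using u that P.U_subset by blast
      have "integral_curve S (i \<circ> u) {0..T}"
        unfolding integral_curve_def
      proof (intro conjI ballI)
        have "continuous_on {0..T} u"
          unfolding continuous_on_eq_continuous_within using u has_vector_derivative_continuous by blast
        then have "continuous_map (top_of_set {0..T}) (top_of_set V) u"
          using uV by (auto simp: continuous_map_in_subtopology)
        then show "continuous_map (top_of_set {0..T}) M (i \<circ> u)"
          by (rule continuous_map_compose) (unfold V_def i_def, rule chart_inverse_continuous[OF C(1)])
        fix t assume t: "t \<in> {0..T}"
        have "((snd C \<circ> (i \<circ> u)) has_vector_derivative vfield S C (u t)) (at t within {0..T})"
          by (rule has_vector_derivative_transform[OF t, of _ u]) (use Ci(2)[OF uV] u t in auto)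
        then show "\<exists>C\<in>charts S. (i \<circ> u) t \<in> fst C \<and>
            ((snd C \<circ> (i \<circ> u)) has_vector_derivative vfield S C (snd C ((i \<circ> u) t))) (at t within {0..T})"
          using C(1) Ci[OF uV[OF t]] by (intro bexI[of _ C]) auto
      qed
      then show "orbit_segment S (\<lambda>a. (i \<circ> P.g) (a, b)) a1 a2"
        unfolding orbit_segment_def using \<theta> gu by (intro exI[of _ "i \<circ> u"] exI[of _ T] exI[of _ \<theta>]) auto
    qed
    show "\<forall>\<sigma>. half_transversal S \<sigma> \<longrightarrow> \<sigma> 0 \<in> U \<longrightarrow>
        real_analytic_at (\<lambda>z. (P.h \<circ> snd C) (\<sigma> z)) 0 \<and>
        (\<exists>D. D \<noteq> 0 \<and> ((\<lambda>z. (P.h \<circ> snd C) (\<sigma> z)) has_real_derivative D) (at 0))"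
    proof (intro allI impI)
      fix \<sigma> assume \<sigma>: "half_transversal S \<sigma>" "\<sigma> 0 \<in> U"
      then have \<sigma>0: "\<sigma> 0 \<in> fst C" "(snd C \<circ> \<sigma>) 0 \<in> P.U" by (auto simp: U_def)
      obtain w where an: "real_analytic_curve_at (snd C \<circ> \<sigma>) 0"
        and w: "((snd C \<circ> \<sigma>) has_vector_derivative w) (at 0)" "\<not> collinear {0, w, vfield S C (snd C (\<sigma> 0))}"
        using half_transversal_chart[OF \<sigma>(1) C(1) \<sigma>0(1)] by metis
      show "real_analytic_at (\<lambda>z. (P.h \<circ> snd C) (\<sigma> z)) 0 \<and>
        (\<exists>D. D \<noteq> 0 \<and> ((\<lambda>z. (P.h \<circ> snd C) (\<sigma> z)) has_real_derivative D) (at 0))"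
        using P.h_analytic[OF an \<sigma>0(2)] P.h_transversal[OF an \<sigma>0(2) w(1)] w(2) by (simp add: o_def)
    qed
  qed
  moreover have "p \<in> U" using C(2) P.p_in_U by (simp add: U_def q_def)
  ultimately show ?thesis using that by blast
qed

text \<open>The reparametrisation takes all values in [0, T], so the underlying integral curve stays
  in U throughout and the clause on integral curves applies to it.\<close>

lemma orbit_in_flow_box:
  assumes box: "flow_box U x h g d e" and c: "orbit_segment S c a b" "\<And>s. s \<in> {a..b} \<Longrightarrow> c s \<in> U"
    and st: "a \<le> s" "s < t" "t \<le> b"
  shows "h (c s) = h (c t)" "x (c s) < x (c t)"
proof -
  obtain u T k where u: "integral_curve S u {0..T}" and k: "continuous_on {a..b} k" "strict_mono_on {a..b} k" "k a = 0" "k b = T"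
    and cu: "\<forall>s\<in>{a..b}. c s = u (k s)"
    using c(1) by (auto simp: orbit_segment_def)
  have uU: "\<forall>t\<in>{0..T}. u t \<in> U"
  proof
    fix t assume that: "t \<in> {0..T}"
    have "k a \<le> t" "t \<le> k b" "a \<le> b" using k st that by auto
    then obtain s where "a \<le> s" "s \<le> b" "k s = t" using IVT'[of k a t b] k(1) by auto
    then show "u t \<in> U" using c(2)[of s] cu by auto
  qed
  have mono: "\<forall>s t. 0 \<le> s \<and> s < t \<and> t \<le> T \<longrightarrow> h (u s) = h (u t) \<and> x (u s) < x (u t)"
    using box u uU unfolding flow_box_def by simp
  have "0 \<le> k s" "k s < k t" "k t \<le> T"
    using mono_onD[OF strict_mono_on_imp_mono_on[OF k(2)], of a s] mono_onD[OF strict_mono_on_imp_mono_on[OF k(2)], of t b]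
      strict_mono_onD[OF k(2), of s t] st k(3,4) by auto
  with mono have "h (u (k s)) = h (u (k t)) \<and> x (u (k s)) < x (u (k t))" by blast
  then show "h (c s) = h (c t)" "x (c s) < x (c t)"
    using cu st by auto
qed

end

section \<open>Transit along regular pieces of trajectories\<close>

context surface
begin

text \<open>The neighbourhood condition of \<open>follows\<close>, with the filter left free:
  regular pieces are controlled for z on both sides of 0, passages of saddles only for z >
  0.\<close>

definition graph_near :: "(real \<Rightarrow> 'm) \<Rightarrow> real \<Rightarrow> real \<Rightarrow> (real \<Rightarrow> real \<Rightarrow> 'm) \<Rightarrow> real filter \<Rightarrow> bool" where
  "graph_near c a b d Q \<longleftrightarrow>
     (\<forall>W. openin (prod_topology euclidean M) W \<and> (\<forall>s\<in>{a..b}. (s, c s) \<in> W) \<longrightarrow>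
        (\<forall>\<^sub>F z in Q. \<forall>s\<in>{a..b}. (s, d z s) \<in> W))"

definition analytic_diffeo :: "(real \<Rightarrow> real) \<Rightarrow> bool" where
  "analytic_diffeo P \<longleftrightarrow> real_analytic_at P 0 \<and> P 0 = 0 \<and> (\<exists>D. D \<noteq> 0 \<and> (P has_real_derivative D) (at 0))"

lemma analytic_diffeo_comp:
  assumes "analytic_diffeo P" "analytic_diffeo Q"
  shows "analytic_diffeo (\<lambda>z. P (Q z))"
proof -
  obtain D E where "D \<noteq> 0" "(P has_real_derivative D) (at 0)" "E \<noteq> 0" "(Q has_real_derivative E) (at 0)"
    using assms by (auto simp: analytic_diffeo_def)
  then have "((\<lambda>z. P (Q z)) has_real_derivative D * E) (at 0)"
    using assms by (intro DERIV_chain2) (auto simp: analytic_diffeo_def)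
  then show ?thesis
    using assms real_analytic_compose[of Q 0 P] \<open>D \<noteq> 0\<close> \<open>E \<noteq> 0\<close> unfolding analytic_diffeo_def
    by (intro conjI exI[of _ "D * E"]) auto
qed

lemma analytic_diffeo_tendsto: "analytic_diffeo P \<Longrightarrow> (P \<longlongrightarrow> 0) (nhds 0)"
  using DERIV_isCont isCont_tendsto_nhds unfolding analytic_diffeo_def by metis

lemma analytic_diffeo_inverse:
  assumes "analytic_diffeo P"
  obtains Q where "analytic_diffeo Q" "\<forall>\<^sub>F z in nhds 0. P (Q z) = z" "\<forall>\<^sub>F z in nhds 0. Q (P z) = z"
proof -
  obtain D where D: "D \<noteq> 0" "(P has_real_derivative D) (at 0)" and P: "real_analytic_at P 0" "P 0 = 0"
    using assms by (auto simp: analytic_diffeo_def)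
  obtain Q where "real_analytic_at Q (P 0)" "Q (P 0) = 0" "(Q has_real_derivative inverse D) (at (P 0))"
    "\<forall>\<^sub>F y in nhds (P 0). P (Q y) = y" "\<forall>\<^sub>F t in nhds 0. Q (P t) = t"
    using real_analytic_inverse[OF P(1) D(2,1)] .
  then have Q: "real_analytic_at Q 0" "Q 0 = 0" "(Q has_real_derivative inverse D) (at 0)"
    and ev: "\<forall>\<^sub>F y in nhds 0. P (Q y) = y" "\<forall>\<^sub>F t in nhds 0. Q (P t) = t" by (simp_all add: P(2))
  have "analytic_diffeo Q"
    unfolding analytic_diffeo_def using Q D(1) by (intro conjI exI[of _ "inverse D"]) auto
  then show ?thesis using that ev by blast
qed

lemma flow_box_section:
  assumes "flow_box U x h g d e" "half_transversal S \<sigma>" "\<sigma> 0 \<in> U"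
  obtains D where "real_analytic_at (\<lambda>z. h (\<sigma> z)) 0" "D \<noteq> 0" "((\<lambda>z. h (\<sigma> z)) has_real_derivative D) (at 0)"
    "\<forall>\<^sub>F z in nhds 0. \<sigma> z \<in> U" "((\<lambda>z. x (\<sigma> z)) \<longlongrightarrow> x (\<sigma> 0)) (nhds 0)"
proof -
  have U: "openin M U" and cx: "continuous_map (subtopology M U) euclidean x"
    using assms(1) by (auto simp: flow_box_def)
  have ev: "\<forall>\<^sub>F z in nhds 0. \<sigma> z \<in> U" by (rule half_transversal_eventually[OF assms(2) U assms(3)])
  have "((\<lambda>z. x (\<sigma> z)) \<longlongrightarrow> x (\<sigma> 0)) (nhds 0)"
  proof (rule topological_tendstoI)
    fix O' assume O: "open O'" "x (\<sigma> 0) \<in> O'"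
    have "openin (subtopology M U) {q \<in> topspace (subtopology M U). x q \<in> O'}"
      by (rule openin_continuous_map_preimage[OF cx]) (use O in simp)
    then have "openin M {q \<in> topspace (subtopology M U). x q \<in> O'}"
      using openin_open_subtopology[OF U] by blast
    from half_transversal_eventually[OF assms(2) this]
    show "\<forall>\<^sub>F z in nhds 0. x (\<sigma> z) \<in> O'"
      using O assms(3) half_transversal_topspace[OF assms(2)] by (auto elim: eventually_mono)
  qed
  then show ?thesis using that assms ev unfolding flow_box_def by blast
qed

text \<open>In the coordinates (x, h) trajectories are horizontal, so the transit solves h (\<tau>
  (P z)) = h (\<sigma> z). Both sections cross the level lines of h with nonzero derivative, which
  makes P an analytic diffeomorphism.\<close>

lemma local_flow:
  assumes box: "flow_box U x h g d e" and c: "orbit_segment S c a b" "\<And>s. s \<in> {a..b} \<Longrightarrow> c s \<in> U" and ab: "a < b"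
    and \<sigma>: "half_transversal S \<sigma>" "\<sigma> 0 = c a" and \<tau>: "half_transversal S \<tau>" "\<tau> 0 = c b"
  shows "\<exists>P cz. analytic_diffeo P \<and>
    (\<forall>\<^sub>F z in nhds 0. orbit_segment S (cz z) a b \<and> cz z a = \<sigma> z \<and> cz z b = \<tau> (P z)) \<and>
    graph_near c a b cz (nhds 0)"
proof -
  have in_U: "\<sigma> 0 \<in> U" "\<tau> 0 \<in> U" using c(2) ab \<sigma>(2) \<tau>(2) by auto
  define k where "k = (\<lambda>z. h (\<sigma> z))"
  define l where "l = (\<lambda>z. h (\<tau> z))"
  obtain D where k: "real_analytic_at k 0" "D \<noteq> 0" "(k has_real_derivative D) (at 0)"
    and ev\<sigma>: "\<forall>\<^sub>F z in nhds 0. \<sigma> z \<in> U" and lim\<sigma>: "((\<lambda>z. x (\<sigma> z)) \<longlongrightarrow> x (\<sigma> 0)) (nhds 0)"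
    using flow_box_section[OF box \<sigma>(1) in_U(1)] unfolding k_def .
  obtain E where l: "real_analytic_at l 0" "E \<noteq> 0" "(l has_real_derivative E) (at 0)"
    and ev\<tau>: "\<forall>\<^sub>F z in nhds 0. \<tau> z \<in> U" and lim\<tau>: "((\<lambda>z. x (\<tau> z)) \<longlongrightarrow> x (\<tau> 0)) (nhds 0)"
    using flow_box_section[OF box \<tau>(1) in_U(2)] unfolding l_def .
  note orb = orbit_in_flow_box[OF box c(1) c(2)]
  have kl: "k 0 = l 0" using orb(1)[of a b] ab \<sigma>(2) \<tau>(2) by (simp add: k_def l_def)
  obtain Li where Li: "real_analytic_at Li (l 0)" "Li (l 0) = 0" "(Li has_real_derivative inverse E) (at (l 0))"
    "\<forall>\<^sub>F y in nhds (l 0). l (Li y) = y"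
    using real_analytic_inverse[OF l(1,3,2)] by metis
  define P where "P = (\<lambda>z. Li (k z))"
  have "(P has_real_derivative inverse E * D) (at 0)"
    unfolding P_def by (rule DERIV_chain2[OF Li(3)[folded kl] k(3)])
  moreover have "real_analytic_at P 0" unfolding P_def
    by (rule real_analytic_compose[OF k(1)]) (simp add: kl Li(1))
  ultimately have P: "analytic_diffeo P"
    using k(2) l(2) kl Li(2) by (auto simp: analytic_diffeo_def P_def intro!: exI[of _ "inverse E * D"])
  have limk: "(k \<longlongrightarrow> k 0) (nhds 0)" using DERIV_isCont[OF k(3)] by (rule isCont_tendsto_nhds)
  have limP: "filterlim P (nhds 0) (nhds 0)" by (rule analytic_diffeo_tendsto[OF P])
  have evl: "\<forall>\<^sub>F z in nhds 0. l (P z) = k z"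
    using eventually_compose_filterlim[OF Li(4) limk[unfolded kl]] by (simp add: P_def)
  have ev\<tau>P: "\<forall>\<^sub>F z in nhds 0. \<tau> (P z) \<in> U" by (rule eventually_compose_filterlim[OF ev\<tau> limP])
  define X1 X2 where X: "X1 = x (c a)" "X2 = x (c b)"
  have X12: "X1 < X2" using orb(2)[of a b] ab by (simp add: X)
  define x1 where "x1 = (\<lambda>z. x (\<sigma> z))"
  define x2 where "x2 = (\<lambda>z. x (\<tau> (P z)))"
  have lim1: "(x1 \<longlongrightarrow> X1) (nhds 0)" using lim\<sigma> by (simp add: x1_def X \<sigma>(2))
  have lim2: "(x2 \<longlongrightarrow> X2) (nhds 0)"
    unfolding x2_def using filterlim_compose[OF lim\<tau> limP] by (simp add: X \<tau>(2))
  have ev12: "\<forall>\<^sub>F z in nhds 0. x1 z < x2 z"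
  proof -
    have "((\<lambda>z. x2 z - x1 z) \<longlongrightarrow> X2 - X1) (nhds 0)" by (intro tendsto_diff lim1 lim2)
    from order_tendstoD(1)[OF this, of 0] show ?thesis using X12 by simp
  qed
  \<comment> \<open>The affine map of [X1, X2] onto [\<alpha>, \<beta>]. The orbit from \<sigma> z
    to \<tau> (P z) is run through at x values rescaled from those of c, so that it is close to c at
    the same parameter.\<close>
  define Af :: "real \<times> real \<times> real \<Rightarrow> real \<Rightarrow> real" where "Af = (\<lambda>(\<alpha>, \<beta>, \<kappa>) y. \<alpha> + (y - X1) * (\<beta> - \<alpha>) / (X2 - X1))"
  define Y where "Y = (\<lambda>s. x (c s))"
  have cY: "continuous_on {a..b} Y"
  proof -
    have "continuous_map (top_of_set {a..b}) (subtopology M U) c"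
      using orbit_segment_continuous[OF c(1)] c(2) by (auto simp: continuous_map_in_subtopology)
    moreover have "continuous_map (subtopology M U) euclidean x" using box by (simp add: flow_box_def)
    ultimately have "continuous_map (top_of_set {a..b}) euclidean (x \<circ> c)" by (rule continuous_map_compose)
    then show ?thesis by (simp add: Y_def o_def)
  qed
  have mY: "strict_mono_on {a..b} Y" using orb(2) by (auto simp: strict_mono_on_def Y_def)
  define cz where "cz = (\<lambda>z s. g (Af (x1 z, x2 z, k z) (Y s), k z))"
  have Box: "\<And>q. q \<in> U \<Longrightarrow> x q \<in> {-d<..<d} \<and> h q \<in> {-e<..<e} \<and> g (x q, h q) = q"
    and orb_g: "\<And>a1 a2 b. a1 \<in> {-d<..<d} \<Longrightarrow> a2 \<in> {-d<..<d} \<Longrightarrow> b \<in> {-e<..<e} \<Longrightarrow> a1 < a2 \<Longrightarrow> orbit_segment S (\<lambda>a. g (a, b)) a1 a2"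
    and cg: "continuous_map (top_of_set ({-d<..<d} \<times> {-e<..<e})) M g"
    using box by (auto simp: flow_box_def)
  have Af1: "Af (\<alpha>, \<beta>, \<kappa>) X1 = \<alpha>" and Af2: "Af (\<alpha>, \<beta>, \<kappa>) X2 = \<beta>" for \<alpha> \<beta> \<kappa>
    using X12 by (simp_all add: Af_def)
  have "\<forall>\<^sub>F z in nhds 0. orbit_segment S (cz z) a b \<and> cz z a = \<sigma> z \<and> cz z b = \<tau> (P z)"
    using ev\<sigma> ev\<tau>P evl ev12
  proof eventually_elim
    case (elim z)
    have 1: "x1 z \<in> {-d<..<d}" "x2 z \<in> {-d<..<d}" "k z \<in> {-e<..<e}"
      using Box[OF elim(1)] Box[OF elim(2)] by (auto simp: x1_def x2_def k_def)
    define \<phi> where "\<phi> = (\<lambda>s. Af (x1 z, x2 z, k z) (Y s))"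
    have "orbit_segment S (\<lambda>s. (\<lambda>a. g (a, k z)) (\<phi> s)) a b"
    proof (rule orbit_segment_reparam[OF orb_g[OF 1 elim(4)]])
      show "continuous_on {a..b} \<phi>" unfolding \<phi>_def Af_def using X12 by (auto intro!: continuous_intros cY)
      show "strict_mono_on {a..b} \<phi>"
      proof (rule strict_mono_onI)
        fix r s assume "r \<in> {a..b}" "s \<in> {a..b}" "r < s"
        then have "Y r - X1 < Y s - X1" using strict_mono_onD[OF mY] by simp
        then show "\<phi> r < \<phi> s" unfolding \<phi>_def Af_def using X12 elim(4)
          by (auto intro!: divide_strict_right_mono mult_strict_right_mono)
      qed
      show "\<phi> a = x1 z" "\<phi> b = x2 z" by (simp_all add: \<phi>_def Y_def X[symmetric] Af1 Af2)
    qed (use ab in simp)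
    moreover have "cz z a = \<sigma> z"
      using Box[OF elim(1)] by (simp add: cz_def Y_def X[symmetric] Af1 x1_def k_def)
    moreover have "cz z b = \<tau> (P z)"
      using Box[OF elim(2)] elim(3) by (simp add: cz_def Y_def X[symmetric] Af2 x2_def l_def)
    ultimately show ?case by (simp add: cz_def \<phi>_def)
  qed
  moreover have "graph_near c a b cz (nhds 0)"
    unfolding graph_near_def
  proof (intro allI impI)
    fix W assume W: "openin (prod_topology euclidean M) W \<and> (\<forall>s\<in>{a..b}. (s, c s) \<in> W)"
    \<comment> \<open>The data depending on z are kept apart from (s, Y s), which ranges over a
      compact set; the tube lemma then gives one neighbourhood of the data that is good for all
      s.\<close>
    define \<Phi> where "\<Phi> = (\<lambda>p :: (real \<times> real \<times> real) \<times> (real \<times> real). (Af (fst p) (snd (snd p)), snd (snd (fst p))))"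
    have c\<Phi>: "continuous_on UNIV \<Phi>"
      unfolding \<Phi>_def Af_def case_prod_unfold using X12 by (auto intro!: continuous_intros)
    define Bx where "Bx = {-d<..<d} \<times> {-e<..<e}"
    define V where "V = \<Phi> -` Bx"
    have oV: "open V" unfolding V_def Bx_def
      by (rule open_vimage[OF _ c\<Phi>]) (intro open_Times open_greaterThanLessThan)
    have "continuous_map (top_of_set V) (prod_topology euclidean M) (\<lambda>p. (fst (snd p), g (\<Phi> p)))"
    proof (rule continuous_map_pairedI)
      show "continuous_map (top_of_set V) euclidean (\<lambda>p. fst (snd p))" by (auto intro!: continuous_intros)
      have "continuous_map (top_of_set V) (top_of_set Bx) \<Phi>"
        using continuous_on_subset[OF c\<Phi>] by (auto simp: continuous_map_in_subtopology V_def)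
      from continuous_map_compose[OF this cg[folded Bx_def]]
      show "continuous_map (top_of_set V) M (\<lambda>p. g (\<Phi> p))" by (simp add: o_def)
    qed
    from openin_continuous_map_preimage[OF this, of W] W
    have "openin (top_of_set V) {p \<in> V. (fst (snd p), g (\<Phi> p)) \<in> W}" by simp
    then have oE: "open {p \<in> V. (fst (snd p), g (\<Phi> p)) \<in> W}"
      using openin_open_eq[OF oV] by blast
    define q0 where "q0 = (X1, X2, k 0)"
    have Af0: "Af q0 y = y" for y using X12 by (simp add: Af_def q0_def)
    define K where "K = (\<lambda>s. (s, Y s)) ` {a..b}"
    have cK: "compact K" unfolding K_def by (intro compact_continuous_image continuous_intros cY compact_Icc)
    have sK: "{q0} \<times> K \<subseteq> {p \<in> V. (fst (snd p), g (\<Phi> p)) \<in> W}"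
    proof
      fix p assume "p \<in> {q0} \<times> K"
      then obtain s where s: "s \<in> {a..b}" "p = (q0, (s, Y s))" by (auto simp: K_def)
      have "h (c s) = k 0"
        using orb(1)[of a s] s(1) by (cases "s = a") (auto simp: k_def \<sigma>(2))
      then have \<Phi>p: "\<Phi> p = (x (c s), h (c s))"
        by (simp add: \<Phi>_def s(2) Af0) (simp add: q0_def Y_def)
      have "(s, c s) \<in> W" using W s(1) by blast
      then show "p \<in> {p \<in> V. (fst (snd p), g (\<Phi> p)) \<in> W}"
        using Box[OF c(2)[OF s(1)]] s(2) \<Phi>p by (simp add: V_def Bx_def)
    qed
    from Elementary_Topology.tube_lemma[OF cK oE sK]
    obtain N where N: "q0 \<in> N" "open N" "N \<times> K \<subseteq> {p \<in> V. (fst (snd p), g (\<Phi> p)) \<in> W}"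
      by (elim exE conjE)
    have "((\<lambda>z. (x1 z, x2 z, k z)) \<longlongrightarrow> q0) (nhds 0)"
      unfolding q0_def by (intro tendsto_Pair lim1 lim2 limk)
    then have "\<forall>\<^sub>F z in nhds 0. (x1 z, x2 z, k z) \<in> N" using N topological_tendstoD by blast
    then show "\<forall>\<^sub>F z in nhds 0. \<forall>s\<in>{a..b}. (s, cz z s) \<in> W"
    proof eventually_elim
      case (elim z)
      show ?case
      proof
        fix s assume "s \<in> {a..b}"
        then have "((x1 z, x2 z, k z), (s, Y s)) \<in> N \<times> K" using elim by (auto simp: K_def)
        then have "((x1 z, x2 z, k z), (s, Y s)) \<in> {p \<in> V. (fst (snd p), g (\<Phi> p)) \<in> W}" using N(3) by blast
        then show "(s, cz z s) \<in> W" by (simp add: cz_def \<Phi>_def)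
      qed
    qed
  qed
  ultimately show ?thesis using P by blast
qed

section \<open>Flow along long regular pieces\<close>

lemma graph_near_glue:
  assumes "graph_near c a b d Q" "graph_near c b e d' Q" "a \<le> b" "b \<le> e"
  shows "graph_near c a e (\<lambda>z s. if s \<le> b then d z s else d' z s) Q"
  unfolding graph_near_def
proof (intro allI impI)
  fix W assume W: "openin (prod_topology euclidean M) W \<and> (\<forall>s\<in>{a..e}. (s, c s) \<in> W)"
  have "\<forall>\<^sub>F z in Q. \<forall>s\<in>{a..b}. (s, d z s) \<in> W" "\<forall>\<^sub>F z in Q. \<forall>s\<in>{b..e}. (s, d' z s) \<in> W"
    using assms W unfolding graph_near_def by auto
  then show "\<forall>\<^sub>F z in Q. \<forall>s\<in>{a..e}. (s, if s \<le> b then d z s else d' z s) \<in> W"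
    by eventually_elim auto
qed

lemma graph_near_compose:
  assumes "graph_near c a b d Q" "filterlim P Q Q'"
  shows "graph_near c a b (\<lambda>z. d (P z)) Q'"
  using assms eventually_compose_filterlim[OF _ assms(2)] unfolding graph_near_def by blast

text \<open>Bisection reduces the claim to pieces inside one flow box. \<open>link\<close>
  quantifies over all transversals at both ends, so that two pieces can be joined at any transversal
  placed at the division point.\<close>

lemma long_flow:
  assumes c: "orbit_segment S c a b" and reg: "\<And>s. s \<in> {a..b} \<Longrightarrow> \<not> equilibrium S (c s)" and ab: "a < b"
    and \<sigma>: "half_transversal S \<sigma>" "\<sigma> 0 = c a" and \<tau>: "half_transversal S \<tau>" "\<tau> 0 = c b"
  obtains P cz where "analytic_diffeo P"
    "\<forall>\<^sub>F z in nhds 0. orbit_segment S (cz z) a b \<and> cz z a = \<sigma> z \<and> cz z b = \<tau> (P z)"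
    "graph_near c a b cz (nhds 0)"
proof -
  define link where "link = (\<lambda>s1 s2. a \<le> s1 \<and> s1 < s2 \<and> s2 \<le> b \<longrightarrow> (\<forall>\<sigma> \<tau>. half_transversal S \<sigma> \<longrightarrow> \<sigma> 0 = c s1 \<longrightarrow>
    half_transversal S \<tau> \<longrightarrow> \<tau> 0 = c s2 \<longrightarrow> (\<exists>P cz. analytic_diffeo P \<and>
    (\<forall>\<^sub>F z in nhds 0. orbit_segment S (cz z) s1 s2 \<and> cz z s1 = \<sigma> z \<and> cz z s2 = \<tau> (P z)) \<and>
    graph_near c s1 s2 cz (nhds 0))))"
  have cc: "continuous_map (top_of_set {a..b}) M c" by (rule orbit_segment_continuous[OF c])
  have ct: "c s \<in> topspace M" if "s \<in> {a..b}" for s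
    using continuous_map_image_subset_topspace[OF cc] that by auto
  have "link a b"
  proof (rule Bolzano)
    show "a \<le> b" using ab by simp
    fix s1 s2 s3 assume L: "link s1 s2" "link s2 s3" and le: "s1 \<le> s2" "s2 \<le> s3"
    show "link s1 s3"
    proof (cases "s1 = s2 \<or> s2 = s3")
      case True
      then show ?thesis using L by auto
    next
      case False
      then have lt: "s1 < s2" "s2 < s3" using le by auto
      show ?thesis
        unfolding link_def
      proof (intro impI allI)
        fix \<sigma> \<tau> assume s: "a \<le> s1 \<and> s1 < s3 \<and> s3 \<le> b"
          and \<sigma>: "half_transversal S \<sigma>" "\<sigma> 0 = c s1" and \<tau>: "half_transversal S \<tau>" "\<tau> 0 = c s3"
        have "s2 \<in> {a..b}" using s lt by auto
        then obtain \<mu> where \<mu>: "half_transversal S \<mu>" "\<mu> 0 = c s2"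
          using half_transversal_exists[OF ct reg] by metis
        have s12: "a \<le> s1 \<and> s1 < s2 \<and> s2 \<le> b" "a \<le> s2 \<and> s2 < s3 \<and> s3 \<le> b" using s lt by auto
        obtain P1 d1 where 1: "analytic_diffeo P1"
          "\<forall>\<^sub>F z in nhds 0. orbit_segment S (d1 z) s1 s2 \<and> d1 z s1 = \<sigma> z \<and> d1 z s2 = \<mu> (P1 z)"
          "graph_near c s1 s2 d1 (nhds 0)"
          using L(1)[unfolded link_def, rule_format, OF s12(1) \<sigma> \<mu>] by blast
        obtain P2 d2 where 2: "analytic_diffeo P2"
          "\<forall>\<^sub>F z in nhds 0. orbit_segment S (d2 z) s2 s3 \<and> d2 z s2 = \<mu> z \<and> d2 z s3 = \<tau> (P2 z)"
          "graph_near c s2 s3 d2 (nhds 0)"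
          using L(2)[unfolded link_def, rule_format, OF s12(2) \<mu> \<tau>] by blast
        have lim: "filterlim P1 (nhds 0) (nhds 0)" by (rule analytic_diffeo_tendsto[OF 1(1)])
        define d where "d = (\<lambda>z s. if s \<le> s2 then d1 z s else d2 (P1 z) s)"
        have "graph_near c s1 s3 d (nhds 0)"
          unfolding d_def by (rule graph_near_glue[OF 1(3) graph_near_compose[OF 2(3) lim]]) (use lt in auto)
        moreover have "\<forall>\<^sub>F z in nhds 0. orbit_segment S (d z) s1 s3 \<and> d z s1 = \<sigma> z \<and> d z s3 = \<tau> (P2 (P1 z))"
          using 1(2) eventually_compose_filterlim[OF 2(2) lim]
        proof eventually_elim
          case (elim z)
          have "orbit_segment S (d z) s1 s3"
            unfolding d_def by (rule orbit_segment_glue) (use elim lt in auto)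
          then show ?case using elim lt by (simp add: d_def)
        qed
        ultimately show "\<exists>P cz. analytic_diffeo P \<and>
            (\<forall>\<^sub>F z in nhds 0. orbit_segment S (cz z) s1 s3 \<and> cz z s1 = \<sigma> z \<and> cz z s3 = \<tau> (P z)) \<and>
            graph_near c s1 s3 cz (nhds 0)"
          using analytic_diffeo_comp[OF 2(1) 1(1)] by blast
      qed
    qed
  next
    fix s assume s: "a \<le> s" "s \<le> b"
    then have s': "s \<in> {a..b}" by simp
    obtain U x h g d e where box: "flow_box U x h g d e" "c s \<in> U"
      using flow_box_exists[OF ct[OF s'] reg[OF s']] .
    have "openin M U" using box by (simp add: flow_box_def)
    from openin_continuous_map_preimage[OF cc this]
    have "openin (top_of_set {a..b}) {t \<in> {a..b}. c t \<in> U}" by simp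
    then obtain T where T: "open T" "{t \<in> {a..b}. c t \<in> U} = {a..b} \<inter> T" by (auto simp: openin_open)
    then have "s \<in> T" using s' box(2) by blast
    then obtain r where r: "r > 0" "ball s r \<subseteq> T" using T(1) open_contains_ball by blast
    have "link s1 s2" if "s1 \<le> s" "s \<le> s2" "s2 - s1 < r" for s1 s2
      unfolding link_def
    proof (intro impI allI)
      fix \<sigma> \<tau> assume le: "a \<le> s1 \<and> s1 < s2 \<and> s2 \<le> b"
        and \<sigma>: "half_transversal S \<sigma>" "\<sigma> 0 = c s1" and \<tau>: "half_transversal S \<tau>" "\<tau> 0 = c s2"
      have "c t \<in> U" if t: "t \<in> {s1..s2}" for t
      proof -
        have "t \<in> ball s r" using t \<open>s1 \<le> s\<close> \<open>s \<le> s2\<close> \<open>s2 - s1 < r\<close> by (auto simp: dist_real_def abs_if)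
        then have "t \<in> {a..b} \<inter> T" using r t le by auto
        then show ?thesis using T(2) by blast
      qed
      then show "\<exists>P cz. analytic_diffeo P \<and>
            (\<forall>\<^sub>F z in nhds 0. orbit_segment S (cz z) s1 s2 \<and> cz z s1 = \<sigma> z \<and> cz z s2 = \<tau> (P z)) \<and>
            graph_near c s1 s2 cz (nhds 0)"
        using local_flow[OF box(1) orbit_segment_subset[OF c] _ _ \<sigma> \<tau>] le by auto
    qed
    then show "\<exists>r>0. \<forall>s1 s2. s1 \<le> s \<and> s \<le> s2 \<and> s2 - s1 < r \<longrightarrow> link s1 s2" using r(1) by blast
  qed
  then show ?thesis using that ab \<sigma> \<tau> unfolding link_def by blast
qed

text \<open>Of two orbits from the same point the one of shorter duration is an initial piece of the
  other, which therefore meets \<tau> at some parameter s. If s < b, then s lies in the first or the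
  last stretch, where the flow box applies, since in the middle stretch orbits avoid \<tau>.\<close>

lemma unique_transit_aux:
  assumes box: "flow_box U x h g d e"
    and inj: "\<And>w w'. \<bar>w\<bar> < \<delta> \<Longrightarrow> \<bar>w'\<bar> < \<delta> \<Longrightarrow> h (\<tau> w) = h (\<tau> w') \<Longrightarrow> w = w'"
    and ab: "a < b" "\<eta> > 0"
    and c: "orbit_segment S c a b" "orbit_segment S c' a b" "c a = c' a"
    and ends: "c b = \<tau> w" "c' b = \<tau> w'" "\<bar>w\<bar> < \<delta>" "\<bar>w'\<bar> < \<delta>"
    and start: "m > a \<Longrightarrow> c a = \<tau> z \<and> \<bar>z\<bar> < \<delta>"
    and late: "\<And>s. s \<in> {a..b} \<Longrightarrow> b - \<eta> \<le> s \<Longrightarrow> c s \<in> U \<and> c' s \<in> U"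
    and mid: "\<And>s v. s \<in> {a..b} \<Longrightarrow> m \<le> s \<Longrightarrow> s \<le> b - \<eta> \<Longrightarrow> \<bar>v\<bar> < \<delta> \<Longrightarrow> c s \<noteq> \<tau> v \<and> c' s \<noteq> \<tau> v"
    and early: "\<And>s. s \<in> {a..b} \<Longrightarrow> s < m \<Longrightarrow> c s \<in> U \<and> c' s \<in> U"
  shows "w = w'"
proof -
  \<comment> \<open>The two orbits play symmetric parts apart from the comparison of their
    durations, so the argument is stated for T \<le> T' and applied twice.\<close>
  have *: "w = w'" if c: "orbit_segment S c a b" "orbit_segment S c' a b" "c a = c' a"
    and ends: "c b = \<tau> w" "c' b = \<tau> w'" "\<bar>w\<bar> < \<delta>" "\<bar>w'\<bar> < \<delta>"
    and start: "m > a \<Longrightarrow> c a = \<tau> z \<and> \<bar>z\<bar> < \<delta>"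
    and late: "\<And>s. s \<in> {a..b} \<Longrightarrow> b - \<eta> \<le> s \<Longrightarrow> c' s \<in> U"
    and mid: "\<And>s v. s \<in> {a..b} \<Longrightarrow> m \<le> s \<Longrightarrow> s \<le> b - \<eta> \<Longrightarrow> \<bar>v\<bar> < \<delta> \<Longrightarrow> c' s \<noteq> \<tau> v"
    and early: "\<And>s. s \<in> {a..b} \<Longrightarrow> s < m \<Longrightarrow> c' s \<in> U"
    and u: "integral_curve S u {0..T}" "continuous_on {a..b} k" "strict_mono_on {a..b} k" "k a = 0" "k b = T"
      "\<forall>s\<in>{a..b}. c s = u (k s)"
    and u': "integral_curve S u' {0..T'}" "continuous_on {a..b} k'" "strict_mono_on {a..b} k'" "k' a = 0" "k' b = T'"
      "\<forall>s\<in>{a..b}. c' s = u' (k' s)" and TT': "T \<le> T'"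
    for c c' w w' u k T u' k' T'
  proof -
    have T0: "0 < T" using strict_mono_onD[OF u(3), of a b] ab u(4,5) by auto
    have "u T = u' T"
    proof (rule integral_curve_unique[OF u(1) integral_curve_subset[OF u'(1)]])
      show "u 0 = u' 0" using c(3) u(4,6) u'(4,6) ab by auto
    qed (use T0 TT' in auto)
    have "k' a \<le> T" "T \<le> k' b" "a \<le> b" using u'(4,5) T0 TT' ab by auto
    then obtain s where s: "a \<le> s" "s \<le> b" "k' s = T" using IVT'[of k' a T b] u'(2) by auto
    have sa: "a < s" using s T0 u'(4) by (cases "s = a") auto
    have c's: "c' s = \<tau> w" using s u'(6) \<open>u T = u' T\<close> u(5,6) ends(1) ab by auto
    show "w = w'"
    proof (cases "s = b")
      case True
      then show ?thesis using c's ends inj by simp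
    next
      case False
      then have sb: "s < b" using s by simp
      have "s < m \<or> b - \<eta> < s" using mid[of s w] c's ends(3) s by force
      then show ?thesis
      proof
        \<comment> \<open>Here the orbit starts on \<tau> and returns to \<tau> with the same value
          of h, hence to the same point, while x has strictly increased: a contradiction.\<close>
        assume "s < m"
        then have "a < m" using s by simp
        then obtain z where z: "c a = \<tau> z" "\<bar>z\<bar> < \<delta>" using start by blast
        have in_U: "c' t \<in> U" if "t \<in> {a..s}" for t using early[of t] that s \<open>s < m\<close> by auto
        have "h (c' a) = h (c' s)" "x (c' a) < x (c' s)"
          using orbit_in_flow_box[OF box orbit_segment_subset[OF c(2), of a s] in_U, of a s] s sa by auto
        moreover have "z = w" using inj[of z w] z ends(3) c(3) c's calculation(1) by simp
        ultimately show ?thesis using z(1) c(3) c's by simp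
      next
        \<comment> \<open>In the last stretch h is constant along the orbit, and h separates the
          points of \<tau>.\<close>
        assume lt: "b - \<eta> < s"
        have in_U: "c' t \<in> U" if "t \<in> {s..b}" for t using late[of t] that s lt by auto
        have "h (c' s) = h (c' b)"
          using orbit_in_flow_box(1)[OF box orbit_segment_subset[OF c(2), of s b] in_U, of s b] s sb by auto
        then show ?thesis using inj ends c's by simp
      qed
    qed
  qed
  obtain u T k where u: "integral_curve S u {0..T}" "continuous_on {a..b} k" "strict_mono_on {a..b} k" "k a = 0" "k b = T"
      "\<forall>s\<in>{a..b}. c s = u (k s)"
    using c(1) by (auto simp: orbit_segment_def)
  obtain u' T' k' where u': "integral_curve S u' {0..T'}" "continuous_on {a..b} k'" "strict_mono_on {a..b} k'" "k' a = 0" "k' b = T'"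
      "\<forall>s\<in>{a..b}. c' s = u' (k' s)"
    using c(2) by (auto simp: orbit_segment_def)
  show ?thesis
  proof (cases "T \<le> T'")
    case True
    show ?thesis by (rule *[OF c ends start _ _ _ u u' True]) (use late mid early in auto)
  next
    case False
    then have le: "T' \<le> T" by simp
    have "w' = w"
      by (rule *[OF c(2,1) c(3)[symmetric] ends(2,1,4,3) _ _ _ _ u' u le]) (use start c(3) late mid early in auto)
    then show ?thesis by simp
  qed
qed

text \<open>
  The transit along \<open>\<gamma>\<close> is well defined.  When \<open>\<gamma>\<close> is closed, orbits leaving \<open>\<tau>\<close> are near the end
  point of \<open>\<gamma>\<close> also at the beginning, which is dealt with by the monotonicity of \<open>x\<close> in a flow box.
\<close>

definition transit_unique ::
  "(real \<Rightarrow> 'm) \<Rightarrow> real \<Rightarrow> real \<Rightarrow> (real \<Rightarrow> 'm) \<Rightarrow> (real \<times> 'm) set \<Rightarrow> real \<Rightarrow> bool" where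
  "transit_unique \<gamma> a b \<tau> W \<delta> \<longleftrightarrow>
     (\<forall>c c' w w' z. orbit_segment S c a b \<longrightarrow> orbit_segment S c' a b \<longrightarrow> c a = c' a \<longrightarrow>
       c b = \<tau> w \<longrightarrow> c' b = \<tau> w' \<longrightarrow> \<bar>w\<bar> < \<delta> \<longrightarrow> \<bar>w'\<bar> < \<delta> \<longrightarrow>
       (\<gamma> a = \<gamma> b \<longrightarrow> c a = \<tau> z \<and> \<bar>z\<bar> < \<delta>) \<longrightarrow>
       (\<forall>s\<in>{a..b}. (s, c s) \<in> W) \<longrightarrow> (\<forall>s\<in>{a..b}. (s, c' s) \<in> W) \<longrightarrow> w = w')"

lemma transit_uniqueD:
  assumes "transit_unique \<gamma> a b \<tau> W \<delta>" "orbit_segment S c a b" "orbit_segment S c' a b" "c a = c' a"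
    "c b = \<tau> w" "c' b = \<tau> w'" "\<bar>w\<bar> < \<delta>" "\<bar>w'\<bar> < \<delta>"
    "\<gamma> a = \<gamma> b \<Longrightarrow> c a = \<tau> z \<and> \<bar>z\<bar> < \<delta>"
    "\<forall>s\<in>{a..b}. (s, c s) \<in> W" "\<forall>s\<in>{a..b}. (s, c' s) \<in> W"
  shows "w = w'"
  using assms unfolding transit_unique_def by blast

text \<open>W prescribes the three stretches: near b orbits stay in the flow box, in the middle they
  stay in A, which is disjoint from an open set B containing the small part of \<tau>, and near a
  they stay in the box if \<gamma> is closed.\<close>

lemma unique_transit:
  assumes \<gamma>: "continuous_map (top_of_set {a..b}) M \<gamma>" and ab: "a < b"
    and ne: "\<And>s. a < s \<Longrightarrow> s < b \<Longrightarrow> \<gamma> s \<noteq> \<gamma> b"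
    and \<tau>: "half_transversal S \<tau>" "\<tau> 0 = \<gamma> b"
  obtains W \<delta> where "openin (prod_topology euclidean M) W" "\<forall>s\<in>{a..b}. (s, \<gamma> s) \<in> W" "\<delta> > 0"
    "transit_unique \<gamma> a b \<tau> W \<delta>"
proof -
  have top: "\<gamma> s \<in> topspace M" if "s \<in> {a..b}" for s
    using continuous_map_image_subset_topspace[OF \<gamma>] that by auto
  have "\<gamma> b \<in> topspace M" "\<not> equilibrium S (\<gamma> b)"
    using half_transversal_topspace[OF \<tau>(1)] half_transversal_regular[OF \<tau>(1)] \<tau>(2) by auto
  then obtain U x h g d e where box: "flow_box U x h g d e" "\<gamma> b \<in> U" using flow_box_exists by metis
  have U: "openin M U" using box by (simp add: flow_box_def)
  obtain D where l: "real_analytic_at (\<lambda>z. h (\<tau> z)) 0" "D \<noteq> 0" "((\<lambda>z. h (\<tau> z)) has_real_derivative D) (at 0)"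
    using flow_box_section[OF box(1) \<tau>(1)] box(2) \<tau>(2) by metis
  obtain Li where "\<forall>\<^sub>F t in nhds 0. Li (h (\<tau> t)) = t"
    using real_analytic_inverse[OF l(1,3,2)] by metis
  then obtain \<delta>1 where \<delta>1: "\<delta>1 > 0" "\<And>t. \<bar>t\<bar> < \<delta>1 \<Longrightarrow> Li (h (\<tau> t)) = t"
    unfolding eventually_nhds_metric by (auto simp: dist_real_def)
  have "openin (top_of_set {a..b}) {s \<in> {a..b}. \<gamma> s \<in> U}"
    using openin_continuous_map_preimage[OF \<gamma> U] by simp
  then obtain T where T: "open T" "{s \<in> {a..b}. \<gamma> s \<in> U} = {a..b} \<inter> T" by (auto simp: openin_open)
  have "b \<in> {s \<in> {a..b}. \<gamma> s \<in> U}" using box(2) ab by simp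
  then have "b \<in> T" unfolding T(2) by simp
  then obtain r1 where r1: "r1 > 0" "ball b r1 \<subseteq> T" using T(1) open_contains_ball by blast
  have "\<exists>r2>0. \<gamma> a = \<gamma> b \<longrightarrow> ball a r2 \<subseteq> T"
  proof (cases "\<gamma> a = \<gamma> b")
    case True
    then have "a \<in> {s \<in> {a..b}. \<gamma> s \<in> U}" using box(2) ab by simp
    then have "a \<in> T" unfolding T(2) by simp
    then show ?thesis using T(1) open_contains_ball by blast
  next
    case False
    then show ?thesis using zero_less_one by blast
  qed
  then obtain r2 where r2: "r2 > 0" "\<gamma> a = \<gamma> b \<Longrightarrow> ball a r2 \<subseteq> T" by blast
  \<comment> \<open>A third of the length leaves room for a middle stretch between [a, a + \<eta>]
    and [b - \<eta>, b].\<close>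
  define \<eta> where "\<eta> = min (min r1 r2) (b - a) / 3"
  have \<eta>: "\<eta> > 0" "\<eta> < r1" "\<eta> < r2" "\<eta> < b - a" using r1 r2 ab by (auto simp: \<eta>_def)
  \<comment> \<open>If \<gamma> is not closed, m = a makes the first stretch empty.\<close>
  define m where "m = (if \<gamma> a = \<gamma> b then a + \<eta> else a)"
  have ma: "a \<le> m" "m > a \<longleftrightarrow> \<gamma> a = \<gamma> b" using \<eta> by (auto simp: m_def)
  have late: "\<gamma> s \<in> U" if "s \<in> {a..b}" "b - \<eta> \<le> s" for s
  proof -
    have "s \<in> ball b r1" using that \<eta> by (auto simp: dist_real_def)
    then have "s \<in> {a..b} \<inter> T" using r1(2) that by blast
    then show ?thesis using T(2) by blast
  qed
  have early: "\<gamma> s \<in> U" if "s \<in> {a..b}" "s \<le> m" "m > a" for s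
  proof -
    have "s \<in> ball a r2" using that \<eta> by (auto simp: dist_real_def m_def split: if_splits)
    then have "s \<in> {a..b} \<inter> T" using r2(2) ma that by blast
    then show ?thesis using T(2) by blast
  qed
  define K where "K = \<gamma> ` {m..b - \<eta>}"
  have "compactin M K"
    unfolding K_def
  proof (rule image_compactin)
    show "compactin (top_of_set {m..b - \<eta>}) {m..b - \<eta>}" by (simp add: compactin_subtopology)
    show "continuous_map (top_of_set {m..b - \<eta>}) M \<gamma>"
      by (rule continuous_map_from_subtopology_mono[OF \<gamma>]) (use ma \<eta> in auto)
  qed
  moreover have "disjnt K {\<gamma> b}"
  proof -
    have ne': "\<gamma> s \<noteq> \<gamma> b" if "s \<in> {m..b - \<eta>}" for s
      using that ne[of s] \<eta> ma by (cases "s = a") (auto simp: m_def split: if_splits)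
    have "\<gamma> b \<notin> K" unfolding K_def using ne' by (metis imageE)
    then show ?thesis by simp
  qed
  ultimately obtain A B where AB: "openin M A" "openin M B" "K \<subseteq> A" "\<gamma> b \<in> B" "disjnt A B"
    using Hausdorff_space_compact_separation[OF Hausdorff, of K "{\<gamma> b}"] \<open>\<gamma> b \<in> topspace M\<close> by auto
  have "\<forall>\<^sub>F z in nhds 0. \<tau> z \<in> B" using half_transversal_eventually[OF \<tau>(1) AB(2)] AB(4) \<tau>(2) by simp
  then obtain \<delta>2 where \<delta>2: "\<delta>2 > 0" "\<And>t. \<bar>t\<bar> < \<delta>2 \<Longrightarrow> \<tau> t \<in> B"
    unfolding eventually_nhds_metric by (auto simp: dist_real_def)
  define \<delta> where "\<delta> = min \<delta>1 \<delta>2"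
  define W1 where "W1 = {..<b - \<eta>} \<times> topspace M \<union> UNIV \<times> U"
  define W2 where "W2 = ({..<m} \<union> {b - \<eta><..}) \<times> topspace M \<union> UNIV \<times> A"
  define W3 where "W3 = (if m > a then {m<..} \<times> topspace M \<union> UNIV \<times> U else UNIV \<times> topspace M)"
  have oW: "openin (prod_topology euclidean M) (W1 \<inter> (W2 \<inter> W3))"
    unfolding W1_def W2_def W3_def using U AB(1)
    by (auto intro!: openin_Int openin_Un simp: openin_prod_Times_iff open_Un)
  show ?thesis
  proof (rule that[OF oW])
    show "\<forall>s\<in>{a..b}. (s, \<gamma> s) \<in> W1 \<inter> (W2 \<inter> W3)"
    proof
      fix s assume s: "s \<in> {a..b}"
      have "(s, \<gamma> s) \<in> W1" using late[OF s] top[OF s] by (cases "b - \<eta> \<le> s") (auto simp: W1_def)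
      moreover have "(s, \<gamma> s) \<in> W2"
        using top[OF s] subsetD[OF AB(3), of "\<gamma> s"]
        by (cases "s < m"; cases "b - \<eta> < s") (auto simp: W2_def K_def)
      moreover have "(s, \<gamma> s) \<in> W3"
        using early[OF s] top[OF s] by (cases "s \<le> m") (auto simp: W3_def)
      ultimately show "(s, \<gamma> s) \<in> W1 \<inter> (W2 \<inter> W3)" by blast
    qed
    show "\<delta> > 0" using \<delta>1 \<delta>2 by (simp add: \<delta>_def)
    show "transit_unique \<gamma> a b \<tau> (W1 \<inter> (W2 \<inter> W3)) \<delta>"
      unfolding transit_unique_def
    proof (intro allI impI)
    fix c c' w w' z assume c: "orbit_segment S c a b" "orbit_segment S c' a b" "c a = c' a"
      and ends: "c b = \<tau> w" "c' b = \<tau> w'" "\<bar>w\<bar> < \<delta>" "\<bar>w'\<bar> < \<delta>"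
      and start: "\<gamma> a = \<gamma> b \<longrightarrow> c a = \<tau> z \<and> \<bar>z\<bar> < \<delta>"
      and W: "\<forall>s\<in>{a..b}. (s, c s) \<in> W1 \<inter> (W2 \<inter> W3)" "\<forall>s\<in>{a..b}. (s, c' s) \<in> W1 \<inter> (W2 \<inter> W3)"
    show "w = w'"
    proof (rule unique_transit_aux[where m = m and z = z, OF box(1) _ ab \<eta>(1) c ends])
      show "v = v'" if "\<bar>v\<bar> < \<delta>" "\<bar>v'\<bar> < \<delta>" "h (\<tau> v) = h (\<tau> v')" for v v'
      proof -
        have "\<bar>v\<bar> < \<delta>1" "\<bar>v'\<bar> < \<delta>1" using that(1,2) by (auto simp: \<delta>_def)
        then show ?thesis using \<delta>1(2) that(3) by metis
      qed
      show "c a = \<tau> z \<and> \<bar>z\<bar> < \<delta>" if "m > a" using start ma(2) that by blast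
      show "c s \<in> U \<and> c' s \<in> U" if "s \<in> {a..b}" "b - \<eta> \<le> s" for s
        using W[rule_format, OF that(1)] that(2) by (auto simp: W1_def)
      show "c s \<noteq> \<tau> v \<and> c' s \<noteq> \<tau> v" if "s \<in> {a..b}" "m \<le> s" "s \<le> b - \<eta>" "\<bar>v\<bar> < \<delta>" for s v
        using W[rule_format, OF that(1)] that(2-4) \<delta>2(2)[of v] AB(5) by (auto simp: W2_def \<delta>_def disjnt_iff)
      show "c s \<in> U \<and> c' s \<in> U" if "s \<in> {a..b}" "s < m" for s
        using W[rule_format, OF that(1)] that by (auto simp: W3_def split: if_splits)
    qed
    qed
  qed
qed

end

section \<open>Invertibility of transit maps and types of equilibria\<close>

text \<open>Pairing e with its own derivative E reduces the claim to a real difference quotient,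
  whose limit is both |E|^2 and 0.\<close>

lemma has_vector_derivative_dominated_zero:
  fixes e :: "real \<Rightarrow> 'a::real_inner" and k :: "real \<Rightarrow> 'b::real_normed_vector"
  assumes e: "(e has_vector_derivative E) (at 0)" "e 0 = 0"
    and k: "(k has_vector_derivative 0) (at 0)" "k 0 = 0"
    and le: "\<forall>\<^sub>F t in at 0. norm (e t) \<le> L * norm (k t)"
  shows "E = 0"
proof -
  have "((\<lambda>t. e t \<bullet> E) has_real_derivative E \<bullet> E) (at 0)"
    unfolding has_real_derivative_iff_has_vector_derivative
    by (rule bounded_linear.has_vector_derivative[OF bounded_linear_inner_left e(1)])
  then have lim: "((\<lambda>t. (e t \<bullet> E) / t) \<longlongrightarrow> E \<bullet> E) (at 0)"
    by (simp add: has_field_derivative_iff e(2))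
  have "((\<lambda>t. norm (k t) / norm t) \<longlongrightarrow> 0) (at 0)"
    using k unfolding has_vector_derivative_def has_derivative_at by simp
  then have "((\<lambda>t. (e t \<bullet> E) / t) \<longlongrightarrow> 0) (at 0)"
  proof (rule tendsto_0_le)
    show "\<forall>\<^sub>F t in at 0. norm ((e t \<bullet> E) / t) \<le> norm (norm (k t) / norm t) * (L * norm E)"
      using le
    proof eventually_elim
      case (elim t)
      have "\<bar>e t \<bullet> E\<bar> \<le> norm (e t) * norm E" by (rule Cauchy_Schwarz_ineq2)
      also have "\<dots> \<le> L * norm (k t) * norm E" using elim by (intro mult_right_mono) auto
      finally have "\<bar>e t \<bullet> E\<bar> / \<bar>t\<bar> \<le> L * norm (k t) * norm E / \<bar>t\<bar>" by (intro divide_right_mono) auto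
      then show ?case by (simp add: mult_ac)
    qed
  qed
  with lim have "E \<bullet> E = 0" using tendsto_unique[OF trivial_limit_at] by blast
  then show ?thesis by simp
qed

lemma has_vector_derivative_norm_bound:
  assumes d: "(f has_vector_derivative D) (at 0)" and le: "\<forall>\<^sub>F s in at 0. norm (f s - f 0) \<le> K * \<bar>s\<bar>"
  shows "norm D \<le> K"
proof -
  define rem where "rem = (\<lambda>s. norm (f s - f 0 - s *\<^sub>R D) / norm s)"
  have "(rem \<longlongrightarrow> 0) (at 0)"
    using d unfolding has_vector_derivative_def has_derivative_at rem_def by simp
  then have lim: "((\<lambda>s. K + rem s) \<longlongrightarrow> K + 0) (at 0)" by (intro tendsto_add tendsto_const)
  have "\<forall>\<^sub>F s in at 0. norm D \<le> K + rem s"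
    using le eventually_neq_at_within[of 0]
  proof eventually_elim
    case (elim s)
    have "\<bar>s\<bar> * norm D = norm ((f s - f 0) - (f s - f 0 - s *\<^sub>R D))" by simp
    also have "\<dots> \<le> norm (f s - f 0) + norm (f s - f 0 - s *\<^sub>R D)" by (rule norm_triangle_ineq4)
    also have "\<dots> \<le> K * \<bar>s\<bar> + rem s * \<bar>s\<bar>" using elim by (simp add: rem_def)
    finally have "\<bar>s\<bar> * norm D \<le> \<bar>s\<bar> * (K + rem s)" by (simp add: algebra_simps)
    then show ?case using elim by simp
  qed
  from tendsto_lowerbound[OF lim this] show ?thesis by simp
qed

lemma eventually_at_right_0D:
  assumes "\<forall>\<^sub>F z in at_right (0::real). P z"
  obtains \<epsilon> where "\<epsilon> > 0" "\<And>z. 0 < z \<Longrightarrow> z < \<epsilon> \<Longrightarrow> P z"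
  using assms unfolding eventually_at_right_field by blast

lemma filterlim_at_right_0I:
  fixes f :: "real \<Rightarrow> real"
  assumes "(f \<longlongrightarrow> 0) F" "\<forall>\<^sub>F z in F. f z > 0"
  shows "filterlim f (at_right 0) F"
  using assms by (auto simp: filterlim_at elim: eventually_mono)

lemma filterlim_at_right_0_pos: "filterlim f (at_right 0) F \<Longrightarrow> \<forall>\<^sub>F z in F. (f z :: real) > 0"
  by (auto simp: filterlim_at elim: eventually_mono)

lemma filterlim_at_right_0_nhds: "filterlim f (at_right 0) F \<Longrightarrow> filterlim f (nhds (0::real)) F"
  by (auto simp: filterlim_at)

lemma finite_avoid_right:
  fixes F :: "real set"
  assumes "finite F"
  obtains r where "r > 0" "\<And>t. s < t \<Longrightarrow> t \<le> s + r \<Longrightarrow> t \<notin> F"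
proof -
  obtain d where d: "d > 0" "\<And>t. t \<in> F \<Longrightarrow> t \<noteq> s \<Longrightarrow> d \<le> dist s t"
    using finite_set_avoid[OF assms, of s] by blast
  show ?thesis
  proof (rule that[of "d / 2"])
    fix t assume t: "s < t" "t \<le> s + d / 2"
    then have "dist s t < d" using d(1) by (simp add: dist_real_def)
    then show "t \<notin> F" using d(2)[of t] t by auto
  qed (use d in simp)
qed

text \<open>A germ whose derivative does not vanish on the right of \<open>0\<close> is injective there.\<close>

lemma inverse_germ_exists:
  assumes lim: "filterlim D (at_right 0) (at_right 0)"
    and der: "\<forall>\<^sub>F z in at_right 0. \<exists>D'. D' \<noteq> 0 \<and> (D has_real_derivative D') (at z)"
  shows "\<exists>E. inverse_germs_at_0 D E"
proof -
  have "\<forall>\<^sub>F z in at_right 0. D z > 0 \<and> (\<exists>D'. D' \<noteq> 0 \<and> (D has_real_derivative D') (at z))"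
    using filterlim_at_right_0_pos[OF lim] der by (rule eventually_conj)
  then obtain \<epsilon> where \<epsilon>: "\<epsilon> > 0" and D: "\<And>z. 0 < z \<Longrightarrow> z < \<epsilon> \<Longrightarrow> D z > 0 \<and> (\<exists>D'. D' \<noteq> 0 \<and> (D has_real_derivative D') (at z))"
    by (rule eventually_at_right_0D) blast
  have cont: "isCont D z" if "0 < z" "z < \<epsilon>" for z using D[OF that] DERIV_isCont by blast
  have less_ne: "D x \<noteq> D y" if xy: "0 < x" "x < y" "y < \<epsilon>" for x y
  proof
    assume eq: "D x = D y"
    have "continuous_on {x..y} D" by (rule continuous_at_imp_continuous_on) (use cont xy in auto)
    moreover have "D differentiable (at z)" if "x < z" "z < y" for z
      using D[of z] xy that real_differentiable_def by auto
    ultimately obtain l z where z: "x < z" "z < y" "(D has_real_derivative l) (at z)" "D y - D x = (y - x) * l"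
      using MVT[OF xy(2), of D] by blast
    then have l: "l = 0" using eq xy by simp
    obtain D' where "D' \<noteq> 0" "(D has_real_derivative D') (at z)" using D[of z] xy z by auto
    then show False using DERIV_unique[OF z(3)] l by blast
  qed
  have inj: "x = y" if "0 < x" "x < \<epsilon>" "0 < y" "y < \<epsilon>" "D x = D y" for x y
    using less_ne[of x y] less_ne[of y x] that by (cases x y rule: linorder_cases) auto
  have surj: "\<exists>z. 0 < z \<and> z \<le> y \<and> D z = w" if y: "0 < y" "y < \<epsilon>" and w: "0 < w" "w < D y" for y w
  proof -
    have "\<forall>\<^sub>F z in at_right 0. D z < w"
      using filterlim_at_right_0_nhds[OF lim] w order_tendstoD(2) by blast
    then obtain d where d: "d > 0" "\<And>z. 0 < z \<Longrightarrow> z < d \<Longrightarrow> D z < w" by (rule eventually_at_right_0D) blast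
    define x where "x = min (d / 2) (y / 2)"
    have x: "0 < x" "x < d" "x \<le> y" using d y by (auto simp: x_def)
    have "continuous_on {x..y} D" by (rule continuous_at_imp_continuous_on) (use cont x y in auto)
    moreover have "D x \<le> w" "w \<le> D y" using d(2)[OF x(1,2)] w by auto
    ultimately obtain z where "x \<le> z" "z \<le> y" "D z = w" using IVT'[of D x w y] x(3) by auto
    then show ?thesis using x by (intro exI[of _ z]) auto
  qed
  \<comment> \<open>D is injective on (0, \<epsilon>) and, since it tends to 0, takes all small
    positive values there by the intermediate value theorem; so for small w > 0 the description
    singles out one number.\<close>
  define E where "E = (\<lambda>w. THE z. 0 < z \<and> z < \<epsilon> \<and> D z = w)"
  have ED: "E (D z) = z" if "0 < z" "z < \<epsilon>" for z
    unfolding E_def using that inj by (intro the_equality) auto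
  have E: "0 < E w \<and> E w \<le> y \<and> D (E w) = w" if "0 < y" "y < \<epsilon>" "0 < w" "w < D y" for y w
    using surj[OF that] ED that by force
  have ev: "\<forall>\<^sub>F w in at_right 0. 0 < E w \<and> E w \<le> y \<and> D (E w) = w" if y: "0 < y" "y < \<epsilon>" for y
    unfolding eventually_at_right_field using E[OF y] D[OF y] by blast
  have "\<forall>\<^sub>F w in at_right 0. 0 < E w" using ev[of "\<epsilon>/2"] \<epsilon> by (auto elim: eventually_mono)
  moreover have "(E \<longlongrightarrow> 0) (at_right 0)"
  proof (rule order_tendstoI)
    fix a :: real assume "a < 0"
    then show "\<forall>\<^sub>F w in at_right 0. a < E w" using ev[of "\<epsilon>/2"] \<epsilon> by (auto elim: eventually_mono)
  next
    fix a :: real assume a: "0 < a"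
    define y where "y = min a \<epsilon> / 2"
    have "0 < y" "y < \<epsilon>" "y < a" using a \<epsilon> by (auto simp: y_def min_def)
    then show "\<forall>\<^sub>F w in at_right 0. E w < a" using ev[of y] by (auto elim: eventually_mono)
  qed
  ultimately have "filterlim E (at_right 0) (at_right 0)" by (intro filterlim_at_right_0I)
  moreover have "\<forall>\<^sub>F z in at_right 0. E (D z) = z \<and> D (E z) = z"
  proof (rule eventually_conj)
    show "\<forall>\<^sub>F z in at_right 0. E (D z) = z"
      unfolding eventually_at_right_field using ED \<epsilon> by blast
    show "\<forall>\<^sub>F z in at_right 0. D (E z) = z" using ev[of "\<epsilon>/2"] \<epsilon> by (auto elim: eventually_mono)
  qed
  ultimately show ?thesis using lim unfolding inverse_germs_at_0_def by blast
qed

context surface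
begin

lemma follows_iff:
  "follows S c a b \<sigma> \<tau> D d \<longleftrightarrow>
    (\<forall>\<^sub>F z in at_right 0. orbit_segment S (d z) a b \<and> d z a = \<sigma> z \<and> d z b = \<tau> (D z)) \<and>
    graph_near c a b d (at_right 0)"
  by (simp add: follows_def graph_near_def)

lemma orbit_segment_regular:
  assumes c: "orbit_segment S c a b" "\<not> equilibrium S (c a)" and s: "s \<in> {a..b}"
  shows "\<not> equilibrium S (c s)"
proof -
  obtain u T h where u: "integral_curve S u {0..T}" and h: "strict_mono_on {a..b} h" "h a = 0" "h b = T"
    and cu: "\<forall>s\<in>{a..b}. c s = u (h s)"
    using c(1) by (auto simp: orbit_segment_def)
  have "0 \<le> h s" "h s \<le> T"
    using mono_onD[OF strict_mono_on_imp_mono_on[OF h(1)], of a s] mono_onD[OF strict_mono_on_imp_mono_on[OF h(1)], of s b] s h(2,3)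
    by auto
  then show ?thesis
    using integral_curve_regular[OF u, of 0 "h s"] c(2) cu s h(2) by auto
qed

text \<open>
  Near a point \<open>z > 0\<close> the transit map is the transit map along the orbit through \<open>\<sigma> z\<close>, which is
  regular even if \<open>\<gamma>\<close> passes through equilibria.
\<close>

lemma transit_map_invertible:
  assumes D: "transit_map S \<gamma> a b \<sigma> \<tau> D" and \<gamma>: "continuous_map (top_of_set {a..b}) M \<gamma>" and ab: "a < b"
    and ne: "\<And>s. a \<le> s \<Longrightarrow> s < b \<Longrightarrow> \<gamma> s \<noteq> \<gamma> b"
  shows "\<exists>E. inverse_germs_at_0 D E"
proof (rule inverse_germ_exists)
  have \<sigma>: "half_transversal S \<sigma>" "\<sigma> 0 = \<gamma> a" and \<tau>: "half_transversal S \<tau>" "\<tau> 0 = \<gamma> b"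
    and lim: "filterlim D (at_right 0) (at_right 0)"
    using D by (auto simp: transit_map_def)
  show "filterlim D (at_right 0) (at_right 0)" by fact
  obtain c where c: "\<forall>\<^sub>F z in at_right 0. orbit_segment S (c z) a b \<and> c z a = \<sigma> z \<and> c z b = \<tau> (D z)"
    and near: "graph_near \<gamma> a b c (at_right 0)"
    using D by (auto simp: transit_map_def follows_iff)
  obtain W \<delta> where W: "openin (prod_topology euclidean M) W" "\<forall>s\<in>{a..b}. (s, \<gamma> s) \<in> W" "\<delta> > 0"
    and unique: "transit_unique \<gamma> a b \<tau> W \<delta>"
    using unique_transit[OF \<gamma> ab ne[OF less_imp_le] \<tau>] .
  have nearW: "\<forall>\<^sub>F z in at_right 0. \<forall>s\<in>{a..b}. (s, c z s) \<in> W"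
    using near W unfolding graph_near_def by blast
  have lim0: "(D \<longlongrightarrow> 0) (at_right 0)" by (rule filterlim_at_right_0_nhds[OF lim])
  have small: "\<forall>\<^sub>F z in at_right 0. \<bar>D z\<bar> < \<delta>"
    using order_tendstoD(2)[OF tendsto_rabs_zero[OF lim0] W(3)] .
  have ht\<sigma>: "\<forall>\<^sub>F z in at_right 0. half_transversal S (\<lambda>y. \<sigma> (z + y))"
    using half_transversal_shift[OF \<sigma>(1)] by (auto simp: eventually_at_filter elim: eventually_mono)
  have ht\<tau>: "\<forall>\<^sub>F z in at_right 0. half_transversal S (\<lambda>y. \<tau> (D z + y))"
    by (rule eventually_compose_filterlim[OF half_transversal_shift[OF \<tau>(1)] lim0])
  have "\<forall>\<^sub>F z in at_right 0. (orbit_segment S (c z) a b \<and> c z a = \<sigma> z \<and> c z b = \<tau> (D z)) \<and>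
      (\<forall>s\<in>{a..b}. (s, c z s) \<in> W) \<and> \<bar>D z\<bar> < \<delta> \<and>
      half_transversal S (\<lambda>y. \<sigma> (z + y)) \<and> half_transversal S (\<lambda>y. \<tau> (D z + y))"
    by (intro eventually_conj c nearW small ht\<sigma> ht\<tau>)
  then obtain \<epsilon> where \<epsilon>: "\<epsilon> > 0" and all: "\<And>z. 0 < z \<Longrightarrow> z < \<epsilon> \<Longrightarrow>
      (orbit_segment S (c z) a b \<and> c z a = \<sigma> z \<and> c z b = \<tau> (D z)) \<and>
      (\<forall>s\<in>{a..b}. (s, c z s) \<in> W) \<and> \<bar>D z\<bar> < \<delta> \<and>
      half_transversal S (\<lambda>y. \<sigma> (z + y)) \<and> half_transversal S (\<lambda>y. \<tau> (D z + y))"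
    by (rule eventually_at_right_0D) blast
  have "\<exists>D'. D' \<noteq> 0 \<and> (D has_real_derivative D') (at z)" if z: "0 < z" "z < \<epsilon>" for z
  proof -
    note az = all[OF z]
    have ht: "half_transversal S (\<lambda>y. \<sigma> (z + y))" "half_transversal S (\<lambda>y. \<tau> (D z + y))" using az by blast+
    have orb: "orbit_segment S (c z) a b" "c z a = \<sigma> z" "c z b = \<tau> (D z)" using az by blast+
    have "\<not> equilibrium S (c z a)" using half_transversal_regular[OF ht(1)] orb(2) by simp
    then have reg: "\<not> equilibrium S (c z s)" if "s \<in> {a..b}" for s
      using orbit_segment_regular[OF orb(1) _ that] by blast
    \<comment> \<open>The orbit starting at \<sigma> z meets no equilibrium, so transits along it
      between the transversals recentred at z and at D z form an analytic diffeomorphism.\<close>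
    obtain P d where P: "analytic_diffeo P"
      and d: "\<forall>\<^sub>F y in nhds 0. orbit_segment S (d y) a b \<and> d y a = \<sigma> (z + y) \<and> d y b = \<tau> (D z + P y)"
      and neard: "graph_near (c z) a b d (nhds 0)"
      using long_flow[OF orb(1) reg ab ht(1) _ ht(2)] orb(2,3) by auto
    have "\<forall>\<^sub>F y in nhds 0. \<forall>s\<in>{a..b}. (s, d y s) \<in> W"
      using neard W(1) az unfolding graph_near_def by blast
    moreover have "\<forall>\<^sub>F y in nhds 0. \<bar>D z + P y\<bar> < \<delta>"
    proof -
      have "((\<lambda>y. \<bar>D z + P y\<bar>) \<longlongrightarrow> \<bar>D z + 0\<bar>) (nhds 0)"
        by (intro tendsto_rabs tendsto_add tendsto_const analytic_diffeo_tendsto[OF P])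
      moreover have "\<bar>D z + 0\<bar> < \<delta>" using az by simp
      ultimately show ?thesis by (rule order_tendstoD(2))
    qed
    moreover have "\<forall>\<^sub>F y in nhds 0. z + y \<in> {0<..<\<epsilon>}"
      by (rule eventually_nhds_shift) (use eventually_nhds_in_open[of "{0<..<\<epsilon>}" z] z in auto)
    \<comment> \<open>The given family and the flow along this one orbit start at the same points
      and both stay in W, so uniqueness identifies D near z with a translate of P.\<close>
    ultimately have ev: "\<forall>\<^sub>F y in nhds 0. D (z + y) = D z + P y"
      using d
    proof eventually_elim
      case (elim y)
      note ay = all[of "z + y"]
      show ?case
        by (rule transit_uniqueD[OF unique, of "c (z + y)" "d y"]) (use elim ay ne[of a] ab in auto)
    qed
    obtain D' where D': "D' \<noteq> 0" "(P has_real_derivative D') (at 0)" using P by (auto simp: analytic_diffeo_def)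
    have "((\<lambda>y. D z + P y) has_real_derivative D') (at 0)"
      using DERIV_add[OF DERIV_const[of "D z"] D'(2)] by simp
    then have "((\<lambda>y. D (z + y)) has_real_derivative D') (at 0)"
      using DERIV_cong_ev[OF refl ev refl] by simp
    then have "(D has_real_derivative D') (at z)"
      using DERIV_shift[of D D' 0 z] by (simp add: add.commute)
    then show ?thesis using D'(1) by blast
  qed
  then show "\<forall>\<^sub>F z in at_right 0. \<exists>D'. D' \<noteq> 0 \<and> (D has_real_derivative D') (at z)"
    unfolding eventually_at_right_field using \<epsilon> by blast
qed

text \<open>The derivative of the transition map T is bounded by a Lipschitz constant of T, so the
  field at T(x0 + t v) is bounded by a multiple of the field at x0 + t v. The latter is o(t) for v
  in the kernel, and hence the image of v is in the kernel of the other linear part.\<close>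

lemma kernel_transfer:
  assumes C: "C \<in> charts S" "C' \<in> charts S" and p: "p \<in> fst C" "p \<in> fst C'" "equilibrium S p"
    and v: "frechet_derivative (vfield S C) (at (snd C p)) v = 0"
  shows "frechet_derivative (vfield S C') (at (snd C' p)) (frechet_derivative (transition C C') (at (snd C p)) v) = 0"
proof -
  define T where "T = transition C C'"
  define x0 where "x0 = snd C p"
  define D where "D = frechet_derivative T (at x0)"
  define A where "A = frechet_derivative (vfield S C) (at x0)"
  define A' where "A' = frechet_derivative (vfield S C') (at (snd C' p))"
  define V where "V = snd C ` (fst C \<inter> fst C')"
  have V: "open V" "x0 \<in> V" using overlap_open[OF C] p by (auto simp: V_def x0_def)
  have dA: "(vfield S C has_derivative A) (at x0)" "(vfield S C' has_derivative A') (at (snd C' p))"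
    unfolding A_def A'_def x0_def
    using real_analytic_map_differentiable[OF vfield_analytic[OF C(1)]] p(1)
      real_analytic_map_differentiable[OF vfield_analytic[OF C(2)]] p(2) frechet_derivative_works by blast+
  have dT: "(T has_derivative frechet_derivative T (at x)) (at x)" if "x \<in> V" for x
    using that transition_derivative[OF C] unfolding V_def T_def by blast
  have Tx0: "T x0 = snd C' p" by (simp add: T_def x0_def transition_eq[OF C p(1)])
  have line: "((\<lambda>t. x0 + t *\<^sub>R v) has_vector_derivative v) (at 0)"
    by (auto intro!: derivative_eq_intros)
  have dk: "((vfield S C \<circ> (\<lambda>t. x0 + t *\<^sub>R v)) has_vector_derivative A v) (at 0)"
    by (rule vector_derivative_diff_chain_within[OF line]) (use dA(1) has_derivative_at_withinI in auto)
  have "((T \<circ> (\<lambda>t. x0 + t *\<^sub>R v)) has_vector_derivative D v) (at 0)"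
    by (rule vector_derivative_diff_chain_within[OF line]) (use dT[OF V(2)] has_derivative_at_withinI in \<open>auto simp: D_def\<close>)
  then have de: "((vfield S C' \<circ> (T \<circ> (\<lambda>t. x0 + t *\<^sub>R v))) has_vector_derivative A' (D v)) (at 0)"
    by (rule vector_derivative_diff_chain_within) (use dA(2) Tx0 has_derivative_at_withinI in auto)
  have anT: "real_analytic2_at (fst \<circ> T) x0" "real_analytic2_at (snd \<circ> T) x0"
    using transition_analytic[OF C] V(2) by (auto simp: real_analytic_map_on_def T_def V_def)
  obtain r1 L1 where 1: "r1 > 0" "L1 \<ge> 0" "\<And>y z. y \<in> ball x0 r1 \<Longrightarrow> z \<in> ball x0 r1 \<Longrightarrow> \<bar>(fst \<circ> T) y - (fst \<circ> T) z\<bar> \<le> L1 * norm (y - z)"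
    using real_analytic2_Lipschitz[OF anT(1)] by metis
  obtain r2 L2 where 2: "r2 > 0" "L2 \<ge> 0" "\<And>y z. y \<in> ball x0 r2 \<Longrightarrow> z \<in> ball x0 r2 \<Longrightarrow> \<bar>(snd \<circ> T) y - (snd \<circ> T) z\<bar> \<le> L2 * norm (y - z)"
    using real_analytic2_Lipschitz[OF anT(2)] by metis
  define B where "B = V \<inter> ball x0 (min r1 r2)"
  have B: "open B" "x0 \<in> B" using V 1 2 by (auto simp: B_def)
  have bd: "norm (frechet_derivative T (at x) u) \<le> (L1 + L2) * norm u" if x: "x \<in> B" for x u
  proof -
    have xV: "x \<in> V" using x by (simp add: B_def)
    have ln: "((\<lambda>s. x + s *\<^sub>R u) has_vector_derivative u) (at 0)" by (auto intro!: derivative_eq_intros)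
    have "((T \<circ> (\<lambda>s. x + s *\<^sub>R u)) has_vector_derivative frechet_derivative T (at x) u) (at 0)"
      by (rule vector_derivative_diff_chain_within[OF ln]) (use dT[OF xV] has_derivative_at_withinI in auto)
    then show ?thesis
    proof (rule has_vector_derivative_norm_bound)
      have "isCont (\<lambda>s. x + s *\<^sub>R u) 0" by (intro continuous_intros)
      then have "((\<lambda>s. x + s *\<^sub>R u) \<longlongrightarrow> x) (at 0)" by (simp add: isCont_def)
      then have "\<forall>\<^sub>F s in at 0. x + s *\<^sub>R u \<in> B" using topological_tendstoD B(1) x by blast
      then show "\<forall>\<^sub>F s in at 0. norm ((T \<circ> (\<lambda>s. x + s *\<^sub>R u)) s - (T \<circ> (\<lambda>s. x + s *\<^sub>R u)) 0) \<le> (L1 + L2) * norm u * \<bar>s\<bar>"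
      proof eventually_elim
        case (elim s)
        have "norm (T (x + s *\<^sub>R u) - T x) \<le> norm (fst (T (x + s *\<^sub>R u) - T x)) + norm (snd (T (x + s *\<^sub>R u) - T x))"
          by (metis norm_Pair_le prod.collapse)
        also have "\<dots> \<le> L1 * norm (s *\<^sub>R u) + L2 * norm (s *\<^sub>R u)"
          using 1(3)[of "x + s *\<^sub>R u" x] 2(3)[of "x + s *\<^sub>R u" x] elim(1) x by (auto simp: B_def)
        also have "\<dots> = (L1 + L2) * norm u * \<bar>s\<bar>" by (simp add: algebra_simps)
        finally show ?case by simp
      qed
    qed
  qed
  have eq0: "vfield S C x0 = 0" "vfield S C' (T x0) = 0"
    using equilibrium_iff[OF C(1) p(1)] equilibrium_iff[OF C(2) p(2)] p(3) Tx0 by (simp_all add: x0_def)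
  have "\<forall>\<^sub>F t in at 0. norm ((vfield S C' \<circ> (T \<circ> (\<lambda>t. x0 + t *\<^sub>R v))) t) \<le> (L1 + L2) * norm ((vfield S C \<circ> (\<lambda>t. x0 + t *\<^sub>R v)) t)"
  proof -
    have "isCont (\<lambda>s. x0 + s *\<^sub>R v) 0" by (intro continuous_intros)
    then have "((\<lambda>s. x0 + s *\<^sub>R v) \<longlongrightarrow> x0) (at 0)" by (simp add: isCont_def)
    then have "\<forall>\<^sub>F s in at 0. x0 + s *\<^sub>R v \<in> B" using topological_tendstoD B by blast
    then show ?thesis
    proof eventually_elim
      case (elim t)
      then obtain q where q: "q \<in> fst C" "q \<in> fst C'" "snd C q = x0 + t *\<^sub>R v" by (auto simp: B_def V_def)
      have "vfield S C' (T (x0 + t *\<^sub>R v)) = frechet_derivative T (at (x0 + t *\<^sub>R v)) (vfield S C (x0 + t *\<^sub>R v))"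
        using transition_field[OF C q(1,2)] transition_eq[OF C q(1)] q(3) by (simp add: T_def)
      then show ?case using bd[OF elim] by simp
    qed
  qed
  moreover have "A v = 0" using v by (simp add: A_def x0_def)
  ultimately have "A' (D v) = 0"
    using has_vector_derivative_dominated_zero[OF de _ dk[unfolded \<open>A v = 0\<close>]] eq0 by simp
  then show ?thesis by (simp add: A'_def D_def T_def x0_def)
qed

lemma kernel_transfer_nonzero:
  assumes C: "C \<in> charts S" "C' \<in> charts S" and p: "p \<in> fst C" "p \<in> fst C'" and v: "v \<noteq> 0"
  shows "frechet_derivative (transition C C') (at (snd C p)) v \<noteq> 0"
  using transition_derivative_inverse[OF C p, of v] v
    linear_0[OF has_derivative_linear[OF transition_derivative[OF C(2,1) p(2,1)]]] by auto

text \<open>The zero eigenvector may be given in another chart than the eigenvectors of the saddle,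
  so it is transported first. There two eigenvectors with eigenvalues of opposite sign form a basis,
  which leaves no kernel.\<close>

lemma hyperbolic_not_semihyperbolic:
  assumes h: "hyperbolic_saddle S p" and C: "C \<in> charts S" "p \<in> fst C" and e: "eigenpair S C p 0 v"
  shows False
proof -
  obtain C' \<nu> \<mu> w1 w2 where C': "C' \<in> charts S" "p \<in> fst C'" and nm: "\<nu> < 0" "0 < \<mu>"
    and e1: "eigenpair S C' p \<nu> w1" and e2: "eigenpair S C' p \<mu> w2" and eq: "equilibrium S p"
    using h by (auto simp: hyperbolic_saddle_def)
  define A where "A = frechet_derivative (vfield S C') (at (snd C' p))"
  define y where "y = frechet_derivative (transition C C') (at (snd C p)) v"
  have v: "v \<noteq> 0" "frechet_derivative (vfield S C) (at (snd C p)) v = 0" using e by (auto simp: eigenpair_def)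
  have y: "y \<noteq> 0" "A y = 0"
    using kernel_transfer_nonzero[OF C(1) C'(1) C(2) C'(2) v(1)] kernel_transfer[OF C(1) C'(1) C(2) C'(2) eq v(2)]
    by (auto simp: y_def A_def)
  have w: "w1 \<noteq> 0" "A w1 = \<nu> *\<^sub>R w1" "w2 \<noteq> 0" "A w2 = \<mu> *\<^sub>R w2" using e1 e2 by (auto simp: eigenpair_def A_def)
  have "vfield S C' differentiable at (snd C' p)"
    by (rule real_analytic_map_differentiable[OF vfield_analytic[OF C'(1)]]) (use C' in blast)
  then have lin: "linear A" unfolding A_def using frechet_derivative_works has_derivative_linear by blast
  define det where "det = (\<lambda>a b :: real \<times> real. fst a * snd b - snd a * fst b)"
  have scal: "det a (k *\<^sub>R b) = k * det a b" "det (k *\<^sub>R a) b = k * det a b" for a b k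
    by (simp_all add: det_def algebra_simps)
  have dep: "\<exists>k. b = k *\<^sub>R a" if "a \<noteq> 0" "det a b = 0" for a b
    using that collinear_0_iff_det[of a b] unfolding collinear_lemma det_def
    by (metis scaleR_zero_left)
  \<comment> \<open>Cramer's rule in the plane, with denominators cleared.\<close>
  have cramer: "det a b *\<^sub>R c = det c b *\<^sub>R a + det a c *\<^sub>R b" for a b c
    by (simp add: det_def prod_eq_iff algebra_simps)
  have n12: "det w1 w2 \<noteq> 0"
  proof
    assume "det w1 w2 = 0"
    then obtain k where k: "w2 = k *\<^sub>R w1" using dep w(1) by blast
    then have "\<mu> *\<^sub>R w2 = \<nu> *\<^sub>R w2" using w(2,4) linear_cmul[OF lin, of k w1] by auto
    then show False using nm w(3) by auto
  qed
  have "0 = A (det w1 w2 *\<^sub>R y)" using y(2) linear_cmul[OF lin] by simp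
  also have "\<dots> = (det y w2 * \<nu>) *\<^sub>R w1 + (det w1 y * \<mu>) *\<^sub>R w2"
    unfolding cramer[of w1 w2 y] using w by (simp add: linear_add[OF lin] linear_cmul[OF lin])
  finally have z: "(det y w2 * \<nu>) *\<^sub>R w1 + (det w1 y * \<mu>) *\<^sub>R w2 = 0" by simp
  have "det y w2 * \<nu> * det w1 w2 = 0"
  proof -
    have "det ((det y w2 * \<nu>) *\<^sub>R w1 + (det w1 y * \<mu>) *\<^sub>R w2) w2 = det y w2 * \<nu> * det w1 w2"
      by (simp add: det_def algebra_simps)
    then show ?thesis unfolding z by (simp add: det_def)
  qed
  moreover have "det w1 y * \<mu> * det w1 w2 = 0"
  proof -
    have "det w1 ((det y w2 * \<nu>) *\<^sub>R w1 + (det w1 y * \<mu>) *\<^sub>R w2) = det w1 y * \<mu> * det w1 w2"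
      by (simp add: det_def algebra_simps)
    then show ?thesis unfolding z by (simp add: det_def)
  qed
  ultimately have "det y w2 = 0" "det w1 y = 0" using n12 nm by auto
  then have "det w1 w2 *\<^sub>R y = 0" using cramer[of w1 w2 y] by simp
  then show False using n12 y(1) by simp
qed

text \<open>Divided by |y|, the increment of the transition map is D (sgn y) up to a vanishing
  remainder, so after normalisation D carries unit tangent directions.\<close>

lemma tangent_transfer:
  assumes C: "C \<in> charts S" "C' \<in> charts S" and p: "\<gamma> s \<in> fst C" "\<gamma> s \<in> fst C'"
    and cont: "\<And>O'. openin M O' \<Longrightarrow> \<gamma> s \<in> O' \<Longrightarrow> \<forall>\<^sub>F t in Q. \<gamma> t \<in> O'"
    and t: "tangent_to C \<gamma> s Q v" and v: "v \<noteq> 0"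
  shows "tangent_to C' \<gamma> s Q (frechet_derivative (transition C C') (at (snd C (\<gamma> s))) v)"
proof -
  define T where "T = transition C C'"
  define x0 where "x0 = snd C (\<gamma> s)"
  define D where "D = frechet_derivative T (at x0)"
  have dT: "(T has_derivative D) (at x0)"
    unfolding T_def D_def x0_def by (rule transition_derivative[OF C p])
  have lin: "linear D" by (rule has_derivative_linear[OF dT])
  have bl: "bounded_linear D" using lin by (rule linear_conv_bounded_linear[THEN iffD1])
  define y where "y = (\<lambda>t. snd C (\<gamma> t) - x0)"
  have ty: "((\<lambda>t. sgn (y t)) \<longlongrightarrow> sgn v) Q" using t by (simp add: tangent_to_def y_def x0_def)
  have "sgn v \<noteq> 0" using v by (simp add: sgn_zero_iff)
  have ne: "\<forall>\<^sub>F t in Q. y t \<noteq> 0"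
    using tendsto_imp_eventually_ne[OF ty \<open>sgn v \<noteq> 0\<close>] by eventually_elim (auto simp: sgn_zero_iff)
  have lim_y: "(y \<longlongrightarrow> 0) Q"
  proof (rule topological_tendstoI)
    fix O' :: "(real \<times> real) set" assume O: "open O'" "0 \<in> O'"
    have "open ((\<lambda>q. q - x0) -` O')" by (intro open_vimage O continuous_intros)
    from cont[OF openin_chart_preimage[OF C(1) this]] p(1) O(2)
    show "\<forall>\<^sub>F t in Q. y t \<in> O'" by (auto simp: y_def x0_def elim: eventually_mono)
  qed
  have lim_at: "filterlim (\<lambda>t. y t) (at 0) Q" using lim_y ne by (simp add: filterlim_at)
  have "((\<lambda>h. norm (T (x0 + h) - T x0 - D h) / norm h) \<longlongrightarrow> 0) (at 0)"
    using dT by (simp add: has_derivative_at)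
  from filterlim_compose[OF this lim_at]
  have "((\<lambda>t. norm (T (x0 + y t) - T x0 - D (y t)) / norm (y t)) \<longlongrightarrow> 0) Q" .
  then have "((\<lambda>t. norm ((T (x0 + y t) - T x0 - D (y t)) /\<^sub>R norm (y t))) \<longlongrightarrow> 0) Q"
    by (simp add: divide_inverse mult.commute)
  then have rem: "((\<lambda>t. (T (x0 + y t) - T x0 - D (y t)) /\<^sub>R norm (y t)) \<longlongrightarrow> 0) Q"
    by (rule tendsto_norm_zero_cancel)
  have "((\<lambda>t. D (sgn (y t)) + (T (x0 + y t) - T x0 - D (y t)) /\<^sub>R norm (y t)) \<longlongrightarrow> D (sgn v) + 0) Q"
    by (intro tendsto_add bounded_linear.tendsto[OF bl ty] rem)
  moreover have "(\<lambda>t. D (sgn (y t)) + (T (x0 + y t) - T x0 - D (y t)) /\<^sub>R norm (y t)) =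
      (\<lambda>t. (T (x0 + y t) - T x0) /\<^sub>R norm (y t))"
    by (rule ext) (simp add: sgn_div_norm linear_cmul[OF lin] scaleR_diff_right)
  ultimately have lim: "((\<lambda>t. (T (x0 + y t) - T x0) /\<^sub>R norm (y t)) \<longlongrightarrow> D (sgn v)) Q" by simp
  have Dv: "D v \<noteq> 0" unfolding D_def T_def x0_def by (rule kernel_transfer_nonzero[OF C p v])
  then have "D (sgn v) \<noteq> 0" using v by (simp add: sgn_div_norm linear_cmul[OF lin])
  from tendsto_sgn[OF lim this]
  have "((\<lambda>t. sgn ((T (x0 + y t) - T x0) /\<^sub>R norm (y t))) \<longlongrightarrow> sgn (D (sgn v))) Q" .
  moreover have "sgn (D (sgn v)) = sgn (D v)"
    using v by (simp add: sgn_div_norm[of v] linear_cmul[OF lin] sgn_scaleR)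
  moreover have "\<forall>\<^sub>F t in Q. sgn ((T (x0 + y t) - T x0) /\<^sub>R norm (y t)) = sgn (snd C' (\<gamma> t) - snd C' (\<gamma> s))"
    using ne cont[OF chart_openin[OF C(1)] p(1)]
  proof eventually_elim
    case (elim t)
    have "T (x0 + y t) = snd C' (\<gamma> t)" "T x0 = snd C' (\<gamma> s)"
      using transition_eq[OF C] elim(2) p(1) by (simp_all add: T_def x0_def y_def)
    then show ?case using elim(1) by (simp add: sgn_scaleR)
  qed
  ultimately have "((\<lambda>t. sgn (snd C' (\<gamma> t) - snd C' (\<gamma> s))) \<longlongrightarrow> sgn (D v)) Q"
    by (simp add: tendsto_cong)
  then show ?thesis by (simp add: tangent_to_def D_def T_def x0_def)
qed

text \<open>The incoming direction at s is unique. It would lie in the kernel of the linear part and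
  also be an eigenvector for a nonzero eigenvalue.\<close>

lemma centre_hyperbolic_exclusive:
  assumes c: "passes_from_centre S \<gamma> s" and h: "passes_from_hyperbolic S \<gamma> s"
    and cont: "\<And>O'. openin M O' \<Longrightarrow> \<gamma> s \<in> O' \<Longrightarrow> \<forall>\<^sub>F t in at_left s. \<gamma> t \<in> O'"
  shows False
proof -
  obtain C v where C: "C \<in> charts S" "\<gamma> s \<in> fst C" and v: "eigenpair S C (\<gamma> s) 0 v"
    and t: "tangent_to C \<gamma> s (at_left s) v" and eq: "equilibrium S (\<gamma> s)"
    using c by (auto simp: passes_from_centre_def)
  obtain C' \<nu> w where C': "C' \<in> charts S" "\<gamma> s \<in> fst C'" and w: "\<nu> \<noteq> 0" "eigenpair S C' (\<gamma> s) \<nu> w"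
    and t': "tangent_to C' \<gamma> s (at_left s) w"
    using h by (auto simp: passes_from_hyperbolic_def)
  define A where "A = frechet_derivative (vfield S C') (at (snd C' (\<gamma> s)))"
  define y where "y = frechet_derivative (transition C C') (at (snd C (\<gamma> s))) v"
  have v': "v \<noteq> 0" "frechet_derivative (vfield S C) (at (snd C (\<gamma> s))) v = 0" using v by (auto simp: eigenpair_def)
  have Ay: "A y = 0" using kernel_transfer[OF C(1) C'(1) C(2) C'(2) eq v'(2)] by (simp add: A_def y_def)
  have y0: "y \<noteq> 0" unfolding y_def by (rule kernel_transfer_nonzero[OF C(1) C'(1) C(2) C'(2) v'(1)])
  have "tangent_to C' \<gamma> s (at_left s) y"
    unfolding y_def by (rule tangent_transfer[OF C(1) C'(1) C(2) C'(2) cont t v'(1)])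
  then have "sgn w = sgn y"
    using t' tendsto_unique[of "at_left s"] unfolding tangent_to_def by (metis trivial_limit_at_left_real)
  then have "w = (norm w / norm y) *\<^sub>R y"
    by (metis divide_inverse scaleR_scaleR sgn_div_norm norm_sgn scaleR_one scaleR_zero_left mult.commute real_scaleR_def right_inverse norm_eq_zero sgn_zero_iff)
  moreover have "linear A"
  proof -
    have "vfield S C' differentiable at (snd C' (\<gamma> s))"
      by (rule real_analytic_map_differentiable[OF vfield_analytic[OF C'(1)]]) (use C' in blast)
    then show ?thesis unfolding A_def using frechet_derivative_works has_derivative_linear by blast
  qed
  ultimately have "A w = 0" using Ay by (metis linear_cmul scaleR_zero_right)
  then show False using w by (auto simp: eigenpair_def A_def)
qed

end

section \<open>Groups of germs\<close>

lemma germ_of_eqI: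
  assumes f: "filterlim f at_top at_top" and eq: "\<forall>\<^sub>F x in at_top. f x = g x"
  shows "germ_of f = germ_of g"
proof -
  have "filterlim g at_top at_top" using f filterlim_cong[OF refl refl eq] by simp
  then show ?thesis
    using f eq Quotient3_rel_abs[OF Quotient3_germ] by (simp add: germ_rel_def)
qed

lemma germ_comp_of:
  assumes "filterlim f at_top at_top" "filterlim g at_top at_top"
  shows "germ_comp (germ_of f) (germ_of g) = germ_of (\<lambda>x. f (g x))"
  using assms by (intro germ_comp.abs_eq) (auto simp: germ_rel_def)

lemma conj_exp_of: "filterlim f at_top at_top \<Longrightarrow> conj_exp (germ_of f) = germ_of (\<lambda>x. ln (f (exp x)))"
  by (intro conj_exp.abs_eq) (auto simp: germ_rel_def)

lemma germ_of_cases: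
  obtains f where "filterlim f at_top at_top" "F = germ_of f"
  by (rule germ.abs_induct[of "\<lambda>F. (\<forall>f. filterlim f at_top at_top \<longrightarrow> F = germ_of f \<longrightarrow> thesis) \<longrightarrow> thesis" F, rule_format])
     (auto simp: germ_rel_def)

lemma germ_id_of: "germ_id = germ_of (\<lambda>x. x)"
  by (rule germ_id.abs_eq)

lemma germ_monoid_simps [simp]:
  "carrier germ_monoid = UNIV" "mult germ_monoid = germ_comp" "one germ_monoid = germ_id"
  by (simp_all add: germ_monoid_def)

lemma germ_group_simps [simp]:
  "carrier germ_group = Units germ_monoid" "mult germ_group = germ_comp" "one germ_group = germ_id"
  by (simp_all add: germ_group_def units_of_def)

interpretation gm: monoid germ_monoid
  rewrites "carrier germ_monoid = UNIV" and "mult germ_monoid = germ_comp" and "one germ_monoid = germ_id"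
  by (simp_all add: monoid_germ_monoid)

interpretation gg: Group.group germ_group
  rewrites "carrier germ_group = Units germ_monoid" and "mult germ_group = germ_comp" and "one germ_group = germ_id"
  by (simp_all add: group_germ_group)

lemma germ_comp_assoc: "germ_comp (germ_comp f g) h = germ_comp f (germ_comp g h)"
  using gm.m_assoc by simp

lemma germ_id_left [simp]: "germ_comp germ_id f = f" and germ_id_right [simp]: "germ_comp f germ_id = f"
  by (simp_all add: gm.l_one gm.r_one)

lemma germ_UnitI: "germ_comp f g = germ_id \<Longrightarrow> germ_comp g f = germ_id \<Longrightarrow> f \<in> Units germ_monoid"
  unfolding Units_def by auto

lemma germ_UnitE:
  assumes "f \<in> Units germ_monoid"
  obtains g where "germ_comp f g = germ_id" "germ_comp g f = germ_id" "g \<in> Units germ_monoid"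
  using assms unfolding Units_def by auto

abbreviation exp_germ where "exp_germ \<equiv> germ_of exp"
abbreviation ln_germ where "ln_germ \<equiv> germ_of ln"

lemma exp_ln_germ: "germ_comp exp_germ ln_germ = germ_id" "germ_comp ln_germ exp_germ = germ_id"
proof -
  have "germ_of (\<lambda>x. exp (ln x)) = germ_of (\<lambda>x::real. x)"
  proof (rule sym, rule germ_of_eqI[OF filterlim_ident])
    show "\<forall>\<^sub>F x::real in at_top. x = exp (ln x)"
      using eventually_gt_at_top[of "0::real"] by eventually_elim simp
  qed
  then show "germ_comp exp_germ ln_germ = germ_id"
    by (simp add: germ_comp_of exp_at_top ln_at_top germ_id_of)
  show "germ_comp ln_germ exp_germ = germ_id"
    by (simp add: germ_comp_of exp_at_top ln_at_top germ_id_of)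
qed

lemma exp_germ_Unit: "exp_germ \<in> Units germ_monoid" and ln_germ_Unit: "ln_germ \<in> Units germ_monoid"
  using exp_ln_germ by (auto intro: germ_UnitI)

text \<open>Expresses A inside the monoid of germs, so that everything after it is algebra with exp
  and ln as mutually inverse units.\<close>

lemma conj_exp_eq: "conj_exp h = germ_comp ln_germ (germ_comp h exp_germ)"
proof (cases h rule: germ_of_cases)
  case (1 f)
  then show ?thesis
    using filterlim_compose[OF 1(1) exp_at_top] by (simp add: conj_exp_of germ_comp_of exp_at_top ln_at_top)
qed

lemma conj_exp_comp: "conj_exp (germ_comp f g) = germ_comp (conj_exp f) (conj_exp g)"
proof -
  have "germ_comp exp_germ (germ_comp ln_germ k) = k" for k
    using exp_ln_germ(1) by (metis germ_comp_assoc germ_id_left)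
  then show ?thesis by (simp add: conj_exp_eq germ_comp_assoc)
qed

lemma conj_exp_pow_comp: "(conj_exp ^^ i) (germ_comp f g) = germ_comp ((conj_exp ^^ i) f) ((conj_exp ^^ i) g)"
  by (induction i) (simp_all add: conj_exp_comp)

lemma comp_exp_germ: "germ_comp h exp_germ = germ_comp exp_germ (conj_exp h)"
  using exp_ln_germ(1) by (metis conj_exp_eq germ_comp_assoc germ_id_left)

lemma conj_exp_Unit: "h \<in> Units germ_monoid \<Longrightarrow> conj_exp h \<in> Units germ_monoid"
  unfolding conj_exp_eq using gm.Units_m_closed exp_germ_Unit ln_germ_Unit by blast

lemma conj_exp_pow_Unit: "h \<in> Units germ_monoid \<Longrightarrow> (conj_exp ^^ i) h \<in> Units germ_monoid"
  by (induction i) (simp_all add: conj_exp_Unit)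

definition exp_pow :: "nat \<Rightarrow> germ" where "exp_pow d = (germ_comp exp_germ ^^ d) germ_id"

lemma exp_pow_0 [simp]: "exp_pow 0 = germ_id" and exp_pow_Suc: "exp_pow (Suc d) = germ_comp exp_germ (exp_pow d)"
  by (simp_all add: exp_pow_def)

lemma comp_exp_pow: "germ_comp h (exp_pow d) = germ_comp (exp_pow d) ((conj_exp ^^ d) h)"
proof (induction d arbitrary: h)
  case (Suc d)
  have "germ_comp h (exp_pow (Suc d)) = germ_comp exp_germ (germ_comp (conj_exp h) (exp_pow d))"
    unfolding exp_pow_Suc by (metis comp_exp_germ germ_comp_assoc)
  also have "germ_comp (conj_exp h) (exp_pow d) = germ_comp (exp_pow d) ((conj_exp ^^ d) (conj_exp h))"
    by (rule Suc)
  finally show ?case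
    by (simp add: exp_pow_Suc germ_comp_assoc funpow_swap1)
qed simp

section \<open>The generated group and its translates by iterated exp\<close>

lemma affine_at_top:
  assumes "\<alpha> > 0"
  shows "filterlim (\<lambda>x. \<alpha> * x + \<beta> :: real) at_top at_top"
  using filterlim_tendsto_add_at_top[OF tendsto_const[of \<beta>]
      filterlim_tendsto_pos_mult_at_top[OF tendsto_const assms filterlim_ident]]
  by (simp add: add.commute)

lemma Aff_I: "\<alpha> > 0 \<Longrightarrow> germ_of (\<lambda>x. \<alpha> * x + \<beta>) \<in> Aff"
  by (auto simp: Aff_def)

locale admissible =
  fixes R NC :: "germ set" and n :: nat
  assumes admissible: "admissible_pair R NC"
begin

lemma R_subgroup: "subgroup R germ_group"
  and Aff_R: "Aff \<subseteq> R"
  and log_analytic_R: "real_analytic_at p 0 \<Longrightarrow> p 0 = 0 \<Longrightarrow> eventually (\<lambda>x. p x > 0) (at_right 0) \<Longrightarrow>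
        germ_of (log_chart p) \<in> R"
  and shift_R: "germ_of (\<lambda>\<zeta>. \<zeta> + ln (1 + \<beta> * exp (- \<zeta>))) \<in> R"
  and R_asymptotic: "f \<in> R \<Longrightarrow> f \<in> Aff \<or> (\<exists>\<nu> \<mu>. \<nu> > \<mu> \<and> \<mu> > 0 \<and> (\<exists>a\<in>Aff. exp_close \<nu> \<mu> f a))"
  using admissible unfolding admissible_pair_def by blast+

lemma R_comp: "f \<in> R \<Longrightarrow> g \<in> R \<Longrightarrow> germ_comp f g \<in> R"
  using subgroup.m_closed[OF R_subgroup] by simp

lemma R_Unit: "f \<in> R \<Longrightarrow> f \<in> Units germ_monoid"
  using subgroup.mem_carrier[OF R_subgroup] by simp

lemma id_R: "germ_id \<in> R"
  using subgroup.one_closed[OF R_subgroup] by simp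

text \<open>With b the inverse of the affine part a, the germ b \<circ> f differs from the identity
  by |f - a| / \<alpha>. The factor 1 / \<alpha> is absorbed by weakening the exponents to \<nu> + 1
  and \<mu> / 2.\<close>

lemma R_decompose:
  assumes f: "f \<in> R"
  obtains a g where "a \<in> Aff" "g \<in> R0 R" "f = germ_comp a g"
proof (cases "f \<in> Aff")
  case True
  then show ?thesis using that[of f germ_id] id_R by (simp add: R0_def)
next
  case False
  then obtain \<nu> \<mu> a where \<nu>\<mu>: "\<nu> > \<mu>" "\<mu> > 0" and a: "a \<in> Aff" "exp_close \<nu> \<mu> f a"
    using R_asymptotic[OF f] by blast
  obtain \<alpha> \<beta> where ab: "a = germ_of (\<lambda>x. \<alpha> * x + \<beta>)" "\<alpha> > 0" using a(1) by (auto simp: Aff_def)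
  define b where "b = (\<lambda>x. 1 / \<alpha> * x + - \<beta> / \<alpha>)"
  have lb: "filterlim b at_top at_top" unfolding b_def by (rule affine_at_top) (use ab in simp)
  have bA: "germ_of b \<in> Aff" unfolding b_def by (rule Aff_I) (use ab in simp)
  obtain f' where f': "filterlim f' at_top at_top" "f = germ_of f'" by (rule germ_of_cases)
  have la: "filterlim (\<lambda>x. \<alpha> * x + \<beta>) at_top at_top" by (rule affine_at_top[OF ab(2)])
  have "\<forall>\<^sub>F x in at_top. exp (- \<nu> * x) < \<bar>f' x - (\<alpha> * x + \<beta>)\<bar> \<and> \<bar>f' x - (\<alpha> * x + \<beta>)\<bar> < exp (- \<mu> * x)"
    using a(2) f' la exp_close.abs_eq[of f' "\<lambda>x. \<alpha> * x + \<beta>" \<nu> \<mu>] unfolding ab(1) f'(2) by (simp add: germ_rel_def)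
  moreover have "\<forall>\<^sub>F x in at_top. \<alpha> < exp x"
    using exp_at_top by (rule filterlim_at_top_dense[THEN iffD1, rule_format])
  moreover have "\<forall>\<^sub>F x in at_top. 1 / \<alpha> < exp (\<mu> / 2 * x)"
    using filterlim_compose[OF exp_at_top filterlim_tendsto_pos_mult_at_top[OF tendsto_const _ filterlim_ident, of "\<mu>/2"]] \<nu>\<mu>
    by (simp add: filterlim_at_top_dense)
  ultimately have "\<forall>\<^sub>F x in at_top. exp (- (\<nu> + 1) * x) < \<bar>b (f' x) - x\<bar> \<and> \<bar>b (f' x) - x\<bar> < exp (- (\<mu> / 2) * x)"
  proof eventually_elim
    case (elim x)
    have "b (f' x) - x = (f' x - (\<alpha> * x + \<beta>)) / \<alpha>"
      using ab(2) by (simp add: b_def field_simps)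
    then have eq: "\<bar>b (f' x) - x\<bar> = \<bar>f' x - (\<alpha> * x + \<beta>)\<bar> / \<alpha>" using ab(2) by simp
    have "exp (- (\<nu> + 1) * x) * \<alpha> < exp (- (\<nu> + 1) * x) * exp x"
      using elim by simp
    also have "\<dots> = exp (- \<nu> * x)" by (simp add: exp_add[symmetric] algebra_simps)
    finally have 1: "exp (- (\<nu> + 1) * x) < \<bar>f' x - (\<alpha> * x + \<beta>)\<bar> / \<alpha>"
      using elim ab(2) by (simp add: pos_less_divide_eq)
    have "exp (- \<mu> * x) * (1 / \<alpha>) < exp (- \<mu> * x) * exp (\<mu> / 2 * x)"
      using elim by (intro mult_strict_left_mono) auto
    also have "\<dots> = exp (- (\<mu> / 2) * x)" by (simp add: exp_add[symmetric] algebra_simps)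
    finally have "exp (- \<mu> * x) / \<alpha> < exp (- (\<mu> / 2) * x)" by simp
    moreover have "\<bar>f' x - (\<alpha> * x + \<beta>)\<bar> / \<alpha> < exp (- \<mu> * x) / \<alpha>"
      using elim ab(2) by (intro divide_strict_right_mono) auto
    ultimately show ?case using 1 eq by simp
  qed
  moreover have lbf: "filterlim (\<lambda>x. b (f' x)) at_top at_top" using filterlim_compose[OF lb f'(1)] .
  ultimately have cl: "exp_close (\<nu> + 1) (\<mu> / 2) (germ_of (\<lambda>x. b (f' x))) germ_id"
    unfolding germ_id_of by (subst exp_close.abs_eq) (auto simp: germ_rel_def filterlim_ident)
  have g: "germ_comp (germ_of b) f = germ_of (\<lambda>x. b (f' x))"
    unfolding f'(2) by (rule germ_comp_of[OF lb f'(1)])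
  have "germ_comp (germ_of b) f \<in> R" using R_comp Aff_R bA f by blast
  moreover have "\<exists>\<nu>' \<mu>'. \<nu>' > \<mu>' \<and> \<mu>' > 0 \<and> exp_close \<nu>' \<mu>' (germ_comp (germ_of b) f) germ_id"
    using cl \<nu>\<mu> unfolding g by (intro exI[of _ "\<nu> + 1"] exI[of _ "\<mu> / 2"]) auto
  ultimately have "germ_comp (germ_of b) f \<in> R0 R"
    unfolding R0_def by blast
  moreover have "f = germ_comp a (germ_comp (germ_of b) f)"
  proof -
    have "germ_comp a (germ_of b) = germ_id"
      unfolding ab(1) germ_comp_of[OF la lb] germ_id_of using ab(2) by (simp add: b_def field_simps)
    then show ?thesis by (simp add: germ_comp_assoc[symmetric])
  qed
  ultimately show ?thesis using that a(1) by blast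
qed

text \<open>Landing in \<open>R\<close> again, rather than merely in the generated group, is what
  allows A to be applied repeatedly in the induction below.\<close>

lemma conj_exp_Aff:
  assumes "a \<in> Aff"
  shows "conj_exp a \<in> R"
proof -
  obtain \<alpha> \<beta> where ab: "a = germ_of (\<lambda>x. \<alpha> * x + \<beta>)" "\<alpha> > 0" using assms by (auto simp: Aff_def)
  define k where "k = (\<lambda>x::real. x + ln (1 + \<beta> / \<alpha> * exp (- x)))"
  have "((\<lambda>x::real. exp (- x)) \<longlongrightarrow> 0) at_top"
    using filterlim_compose[OF exp_at_bot filterlim_uminus_at_bot_at_top] .
  then have lim: "((\<lambda>x. 1 + \<beta> / \<alpha> * exp (- x)) \<longlongrightarrow> 1 + \<beta> / \<alpha> * 0) at_top"
    by (intro tendsto_intros)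
  then have "((\<lambda>x. ln (1 + \<beta> / \<alpha> * exp (- x))) \<longlongrightarrow> ln (1 + \<beta> / \<alpha> * 0)) at_top"
    by (rule tendsto_ln) simp
  then have lk: "filterlim k at_top at_top"
    unfolding k_def using filterlim_tendsto_add_at_top[OF _ filterlim_ident] by (simp add: add.commute)
  have ls: "filterlim (\<lambda>x. 1 * x + ln \<alpha>) at_top at_top" by (rule affine_at_top) simp
  have "\<forall>\<^sub>F x in at_top. 0 < 1 + \<beta> / \<alpha> * exp (- x)"
    using order_tendstoD(1)[OF lim, of 0] by simp
  then have "\<forall>\<^sub>F x in at_top. 1 * k x + ln \<alpha> = ln (\<alpha> * exp x + \<beta>)"
  proof eventually_elim
    case (elim x)
    have "\<alpha> * exp x + \<beta> = \<alpha> * (exp x * (1 + \<beta> / \<alpha> * exp (- x)))"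
      using ab(2) by (simp add: distrib_left exp_minus field_simps)
    then have "ln (\<alpha> * exp x + \<beta>) = ln \<alpha> + (ln (exp x) + ln (1 + \<beta> / \<alpha> * exp (- x)))"
      using elim ab(2) by (simp only: ln_mult_pos exp_gt_zero mult_pos_pos)
    then show ?case by (simp add: k_def)
  qed
  then have "germ_of (\<lambda>x. 1 * k x + ln \<alpha>) = germ_of (\<lambda>x. ln (\<alpha> * exp x + \<beta>))"
    by (intro germ_of_eqI filterlim_compose[OF ls lk])
  then have "conj_exp a = germ_comp (germ_of (\<lambda>x. 1 * x + ln \<alpha>)) (germ_of k)"
    unfolding ab(1) by (simp only: germ_comp_of[OF ls lk] conj_exp_of[OF affine_at_top[OF ab(2)]])
  moreover have "germ_of (\<lambda>x. 1 * x + ln \<alpha>) \<in> R" using Aff_I[of 1] Aff_R by auto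
  moreover have "germ_of k \<in> R" unfolding k_def by (rule shift_R)
  ultimately show ?thesis using R_comp by simp
qed

definition H where "H = Aff \<union> (\<Union>i\<in>{..n}. (conj_exp ^^ i) ` R0 R) \<union> (\<Union>j\<in>{..<n}. (conj_exp ^^ j) ` NC)"
definition G where "G = generated_group H"

lemma G_subgroup: "subgroup G germ_group"
  unfolding G_def generated_group_def using gg.generate_is_subgroup by simp

lemma G_comp: "f \<in> G \<Longrightarrow> g \<in> G \<Longrightarrow> germ_comp f g \<in> G"
  using subgroup.m_closed[OF G_subgroup] by simp

lemma id_G: "germ_id \<in> G"
  using subgroup.one_closed[OF G_subgroup] by simp

lemma G_inverse:
  assumes "g \<in> G"
  obtains g' where "g' \<in> G" "germ_comp g g' = germ_id"
  using subgroup.m_inv_closed[OF G_subgroup assms] gg.r_inv subgroup.mem_carrier[OF G_subgroup assms] by simp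

text \<open>Invertibility is a separate premise because the generators are cut down to units; for
  elements of \<open>NC\<close> it has to come from elsewhere.\<close>

lemma H_G: "h \<in> H \<Longrightarrow> h \<in> Units germ_monoid \<Longrightarrow> h \<in> G"
  unfolding G_def generated_group_def by (auto intro: generate.incl)

text \<open>Induction with f arbitrary: for f = a \<circ> g the affine part satisfies A^(i+1) a =
  A^i (A a) with A a in \<open>R\<close>, so it is handled one level lower, while A^(i+1) g is
  itself a generator.\<close>

lemma conj_exp_pow_R: "i \<le> n \<Longrightarrow> f \<in> R \<Longrightarrow> (conj_exp ^^ i) f \<in> G"
proof (induction i arbitrary: f)
  case 0
  obtain a g where ag: "a \<in> Aff" "g \<in> R0 R" "f = germ_comp a g" using R_decompose[OF 0(2)] .
  have "a \<in> G" using ag Aff_R R_Unit by (intro H_G) (auto simp: H_def)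
  moreover have "g \<in> G" using ag R_Unit by (intro H_G) (auto simp: H_def R0_def intro!: bexI[of _ 0])
  ultimately show ?case using ag G_comp by simp
next
  case (Suc i)
  obtain a g where ag: "a \<in> Aff" "g \<in> R0 R" "f = germ_comp a g" using R_decompose[OF Suc(3)] .
  have "(conj_exp ^^ i) (conj_exp a) \<in> G" using Suc conj_exp_Aff[OF ag(1)] by simp
  then have "(conj_exp ^^ Suc i) a \<in> G" by (simp add: funpow_swap1)
  moreover have "(conj_exp ^^ Suc i) g \<in> G"
  proof (rule H_G)
    show "(conj_exp ^^ Suc i) g \<in> H" using ag Suc(2) unfolding H_def by blast
    show "(conj_exp ^^ Suc i) g \<in> Units germ_monoid"
      by (rule conj_exp_pow_Unit) (use ag R_Unit in \<open>auto simp: R0_def\<close>)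
  qed
  ultimately show ?case unfolding ag(3) conj_exp_pow_comp by (rule G_comp)
qed

text \<open>The shape of a partial transit with d exponentials still to be compensated by later
  saddles.\<close>

definition level where "level d = germ_comp (exp_pow d) ` G"

lemma level_0: "level 0 = G" by (simp add: level_def)

lemma level_R:
  assumes "f \<in> R" "d \<le> n" "F \<in> level d"
  shows "germ_comp f F \<in> level d"
proof -
  obtain g where g: "g \<in> G" "F = germ_comp (exp_pow d) g" using assms(3) by (auto simp: level_def)
  have "germ_comp f F = germ_comp (exp_pow d) (germ_comp ((conj_exp ^^ d) f) g)"
    unfolding g(2) by (metis comp_exp_pow germ_comp_assoc)
  moreover have "germ_comp ((conj_exp ^^ d) f) g \<in> G"
    using G_comp conj_exp_pow_R assms g by blast
  ultimately show ?thesis unfolding level_def by blast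
qed

lemma semihyperbolic_decompose:
  assumes "f \<in> semihyperbolic_germs R NC"
  obtains r0 r1 c a where "r0 \<in> R" "r1 \<in> R" "c \<in> NC" "a \<in> R"
    "f = germ_comp r0 (germ_comp exp_germ (germ_comp r1 (germ_comp c a)))"
  using assms Aff_R unfolding semihyperbolic_germs_def set_mult_def R0_def by auto

text \<open>The \<open>NC\<close> factor acts on a germ of level d, before the new exp is added, so
  A^d is applied to it with d \<le> n - 1, within the range of the generators.\<close>

lemma level_hyperbolic_to_centre:
  assumes f: "f \<in> semihyperbolic_germs R NC" "f \<in> Units germ_monoid" and d: "Suc d \<le> n" and F: "F \<in> level d"
  shows "germ_comp f F \<in> level (Suc d)"
proof -
  obtain r0 r1 c a where rs: "r0 \<in> R" "r1 \<in> R" "c \<in> NC" "a \<in> R"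
    and f_eq: "f = germ_comp r0 (germ_comp exp_germ (germ_comp r1 (germ_comp c a)))"
    using semihyperbolic_decompose[OF f(1)] by metis
  \<comment> \<open>All other factors of f are units; cancelling them recovers c from f, and c
    inherits the invertibility of f.\<close>
  have "c \<in> Units germ_monoid"
  proof -
    obtain r0' where r0': "germ_comp r0' r0 = germ_id" "r0' \<in> Units germ_monoid"
      using R_Unit[OF rs(1)] by (metis germ_UnitE)
    obtain r1' where r1': "germ_comp r1' r1 = germ_id" "r1' \<in> Units germ_monoid"
      using R_Unit[OF rs(2)] by (metis germ_UnitE)
    obtain a' where a': "germ_comp a a' = germ_id" "a' \<in> Units germ_monoid"
      using R_Unit[OF rs(4)] by (metis germ_UnitE)
    have "germ_comp r1' (germ_comp ln_germ (germ_comp r0' (germ_comp f a'))) =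
        germ_comp (germ_comp r1' (germ_comp (germ_comp ln_germ (germ_comp (germ_comp r0' r0) exp_germ)) r1)) (germ_comp c (germ_comp a a'))"
      unfolding f_eq by (simp add: germ_comp_assoc)
    also have "\<dots> = c" by (simp add: r0' r1' a' exp_ln_germ)
    finally show ?thesis
      using r0'(2) r1'(2) a'(2) f(2) ln_germ_Unit gm.Units_m_closed by metis
  qed
  then have "(conj_exp ^^ d) c \<in> Units germ_monoid" by (rule conj_exp_pow_Unit)
  then have cG: "(conj_exp ^^ d) c \<in> G"
    by (rule H_G[rotated]) (use d rs(3) in \<open>auto simp: H_def\<close>)
  have aF: "germ_comp a F \<in> level d" using level_R rs d F by simp
  have "germ_comp c (germ_comp a F) \<in> level d"
  proof -
    obtain g where g: "g \<in> G" "germ_comp a F = germ_comp (exp_pow d) g" using aF by (auto simp: level_def)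
    have "germ_comp c (germ_comp a F) = germ_comp (exp_pow d) (germ_comp ((conj_exp ^^ d) c) g)"
      unfolding g(2) by (metis comp_exp_pow germ_comp_assoc)
    then show ?thesis unfolding level_def using G_comp[OF cG g(1)] by blast
  qed
  then have "germ_comp r1 (germ_comp c (germ_comp a F)) \<in> level d" using level_R rs d by simp
  then have "germ_comp exp_germ (germ_comp r1 (germ_comp c (germ_comp a F))) \<in> level (Suc d)"
    by (auto simp: level_def exp_pow_Suc germ_comp_assoc)
  then have "germ_comp r0 (germ_comp exp_germ (germ_comp r1 (germ_comp c (germ_comp a F)))) \<in> level (Suc d)"
    using level_R rs d by blast
  then show ?thesis by (simp add: f_eq germ_comp_assoc)
qed

text \<open>Applied to exp^d, the preceding step gives f \<circ> exp^d = exp^(d+1) \<circ> k with k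
  in \<open>G\<close>. Solving for exp^(d+1) puts f at the far left, where its inverse f' cancels
  it.\<close>

lemma level_centre_to_hyperbolic:
  assumes f: "f \<in> semihyperbolic_germs R NC" "germ_comp f f' = germ_id" "germ_comp f' f = germ_id"
    and d: "Suc d \<le> n" and F: "F \<in> level (Suc d)"
  shows "germ_comp f' F \<in> level d"
proof -
  have "f \<in> Units germ_monoid" using f by (auto intro: germ_UnitI)
  moreover have "exp_pow d \<in> level d" unfolding level_def using id_G by force
  ultimately have "germ_comp f (exp_pow d) \<in> level (Suc d)"
    using level_hyperbolic_to_centre[OF f(1) _ d] by blast
  then obtain k where k: "k \<in> G" "germ_comp f (exp_pow d) = germ_comp (exp_pow (Suc d)) k" by (auto simp: level_def)
  obtain k' where k': "k' \<in> G" "germ_comp k k' = germ_id" using G_inverse[OF k(1)] .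
  obtain g where g: "g \<in> G" "F = germ_comp (exp_pow (Suc d)) g" using F by (auto simp: level_def)
  have "exp_pow (Suc d) = germ_comp f (germ_comp (exp_pow d) k')"
    using k k' by (metis germ_comp_assoc germ_id_right)
  then have "germ_comp f' F = germ_comp (germ_comp f' f) (germ_comp (exp_pow d) (germ_comp k' g))"
    unfolding g(2) by (simp add: germ_comp_assoc)
  then show ?thesis unfolding level_def using f(3) G_comp[OF k'(1) g(1)] by simp
qed

end

section \<open>Germs at 0 in the logarithmic chart\<close>

lemma log_chart_at_top:
  assumes "filterlim D (at_right 0) (at_right 0)"
  shows "filterlim (log_chart D) at_top at_top"
proof -
  have "filterlim (\<lambda>x::real. exp (- x)) (at_right 0) at_top"
    unfolding filterlim_at
    using filterlim_compose[OF exp_at_bot filterlim_uminus_at_bot_at_top] by simp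
  from filterlim_compose[OF assms this] have "filterlim (\<lambda>x. D (exp (- x))) (at_right 0) at_top" .
  from filterlim_compose[OF ln_at_0 this] have "filterlim (\<lambda>x. ln (D (exp (- x)))) at_bot at_top" .
  then show ?thesis unfolding log_chart_def by (simp add: filterlim_uminus_at_top)
qed

lemma exp_minus_at_right_0: "filterlim (\<lambda>x::real. exp (- x)) (at_right 0) at_top"
  unfolding filterlim_at
  using filterlim_compose[OF exp_at_bot filterlim_uminus_at_bot_at_top] by simp

lemma germ_log_chart_cong:
  assumes "filterlim D (at_right 0) (at_right 0)" "\<forall>\<^sub>F z in at_right 0. D z = E z"
  shows "germ_of (log_chart D) = germ_of (log_chart E)"
  by (rule germ_of_eqI[OF log_chart_at_top[OF assms(1)]])
     (use eventually_compose_filterlim[OF assms(2) exp_minus_at_right_0] in \<open>simp add: log_chart_def eventually_mono\<close>)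

lemma germ_log_chart_comp:
  assumes "filterlim D (at_right 0) (at_right 0)" "filterlim E (at_right 0) (at_right 0)"
  shows "germ_comp (germ_of (log_chart D)) (germ_of (log_chart E)) = germ_of (log_chart (\<lambda>z. D (E z)))"
proof -
  have "filterlim (\<lambda>z. D (E z)) (at_right 0) (at_right 0)" using filterlim_compose[OF assms] .
  note l = log_chart_at_top[OF assms(1)] log_chart_at_top[OF assms(2)] log_chart_at_top[OF this]
  have "\<forall>\<^sub>F x in at_right 0. E x > 0"
    using assms(2) by (auto simp: filterlim_at elim: eventually_mono)
  from eventually_compose_filterlim[OF this exp_minus_at_right_0]
  have "\<forall>\<^sub>F x in at_top. log_chart (\<lambda>z. D (E z)) x = log_chart D (log_chart E x)"
    by eventually_elim (simp add: log_chart_def)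
  then show ?thesis
    unfolding germ_comp_of[OF l(1,2)] by (intro germ_of_eqI[OF l(3), symmetric])
qed

lemma inverse_germs_log_chart:
  assumes "inverse_germs_at_0 D E"
  shows "germ_comp (germ_of (log_chart D)) (germ_of (log_chart E)) = germ_id"
    "germ_comp (germ_of (log_chart E)) (germ_of (log_chart D)) = germ_id"
proof -
  have DE: "filterlim D (at_right 0) (at_right 0)" "filterlim E (at_right 0) (at_right 0)"
    and ev: "\<forall>\<^sub>F z in at_right 0. E (D z) = z \<and> D (E z) = z"
    using assms by (auto simp: inverse_germs_at_0_def)
  have id: "germ_of (log_chart (\<lambda>z. z)) = germ_id"
    by (simp add: log_chart_def[abs_def] germ_id_of)
  have "germ_of (log_chart (\<lambda>z. D (E z))) = germ_id" "germ_of (log_chart (\<lambda>z. E (D z))) = germ_id"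
    using germ_log_chart_cong[OF filterlim_compose[OF DE(1) DE(2)], of "\<lambda>z. z"]
      germ_log_chart_cong[OF filterlim_compose[OF DE(2) DE(1)], of "\<lambda>z. z"] ev id
    by (auto simp: eventually_conj_iff)
  then show "germ_comp (germ_of (log_chart D)) (germ_of (log_chart E)) = germ_id"
    "germ_comp (germ_of (log_chart E)) (germ_of (log_chart D)) = germ_id"
    using germ_log_chart_comp DE by simp_all
qed

section \<open>Monodromy maps of polycycles\<close>

locale polycycle_side = surface S for S :: "('m, 'z) surface_field_scheme" +
  fixes \<Gamma> :: "'m set" and \<gamma> \<sigma> :: "real \<Rightarrow> 'm"
  assumes poly: "polycycle S \<Gamma>" and param: "flow_parametrization S \<Gamma> \<gamma>"
    and \<sigma>: "half_transversal S \<sigma>" "\<sigma> 0 = \<gamma> 0"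
begin

lemma \<gamma>_continuous: "continuous_map (top_of_set {0..1}) M \<gamma>" and \<gamma>_image: "\<gamma> ` {0..1} = \<Gamma>"
  and \<gamma>_closed: "\<gamma> 0 = \<gamma> 1" and \<gamma>_0: "\<not> equilibrium S (\<gamma> 0)" and \<gamma>_inj: "inj_on \<gamma> {0<..<1}"
  and \<gamma>_orbit: "0 \<le> a \<Longrightarrow> a < b \<Longrightarrow> b \<le> 1 \<Longrightarrow> (\<And>t. t \<in> {a..b} \<Longrightarrow> \<not> equilibrium S (\<gamma> t)) \<Longrightarrow> orbit_segment S \<gamma> a b"
  using param unfolding flow_parametrization_def by blast+

lemma \<gamma>_continuous_sub: "0 \<le> a \<Longrightarrow> b \<le> 1 \<Longrightarrow> continuous_map (top_of_set {a..b}) M \<gamma>"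
  by (rule continuous_map_from_subtopology_mono[OF \<gamma>_continuous]) auto

definition eqs where "eqs = {s \<in> {0..1}. equilibrium S (\<gamma> s)}"

lemma eqs_interior: "s \<in> eqs \<Longrightarrow> 0 < s \<and> s < 1"
  using \<gamma>_0 \<gamma>_closed by (cases "s = 0"; cases "s = 1") (auto simp: eqs_def)

text \<open>The connecting trajectories contain no equilibria, so those on \<Gamma> are among the
  finitely many vertices, and \<gamma> is injective on the open interval, where all these parameters
  lie.\<close>

lemma finite_eqs: "finite eqs"
proof -
  obtain m p u where mpu: "\<Gamma> = (\<Union>i<(m::nat). insert (p i) (range (u i)))"
    and all: "\<forall>i<m. equilibrium S (p i) \<and> integral_curve S (u i) UNIV \<and> (\<forall>t. \<not> equilibrium S (u i t)) \<and>
      limitin M (u i) (p i) at_bot \<and> limitin M (u i) (p (Suc i mod m)) at_top"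
    using poly unfolding polycycle_def by (elim exE conjE) (rule that; assumption)
  have "\<gamma> ` eqs \<subseteq> p ` {..<m}"
  proof
    fix q assume "q \<in> \<gamma> ` eqs"
    then have q: "equilibrium S q" "q \<in> \<Gamma>" using \<gamma>_image by (auto simp: eqs_def)
    then obtain i where i: "i < m" "q = p i \<or> q \<in> range (u i)" using mpu by auto
    then have "\<forall>t. \<not> equilibrium S (u i t)" using all by simp
    then show "q \<in> p ` {..<m}" using i q(1) by auto
  qed
  then have "finite (\<gamma> ` eqs)" using finite_subset by blast
  moreover have "inj_on \<gamma> eqs" by (rule inj_on_subset[OF \<gamma>_inj]) (use eqs_interior in auto)
  ultimately show ?thesis using finite_imageD by blast
qed

lemma not_eqs: "0 \<le> s \<Longrightarrow> s \<le> 1 \<Longrightarrow> s \<notin> eqs \<Longrightarrow> \<not> equilibrium S (\<gamma> s)"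
  by (simp add: eqs_def)

lemma not_eqs_Icc: "0 \<le> a \<Longrightarrow> b \<le> 1 \<Longrightarrow> eqs \<inter> {a..b} = {} \<Longrightarrow> t \<in> {a..b} \<Longrightarrow> \<not> equilibrium S (\<gamma> t)"
  using not_eqs[of t] by force

lemma \<gamma>_orbit_eqs: "0 \<le> a \<Longrightarrow> a < b \<Longrightarrow> b \<le> 1 \<Longrightarrow> eqs \<inter> {a..b} = {} \<Longrightarrow> orbit_segment S \<gamma> a b"
  using \<gamma>_orbit[of a b] not_eqs_Icc[of a b] by blast

text \<open>Two pieces of \<open>\<gamma>\<close> leaving the same point would overlap, contradicting injectivity.\<close>

lemma no_return:
  assumes "0 < s" "s < 1"
  shows "\<gamma> s \<noteq> \<gamma> 0"
proof
  assume eq: "\<gamma> s = \<gamma> 0"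
  obtain r1 where r1: "r1 > 0" "\<And>t. 0 < t \<Longrightarrow> t \<le> 0 + r1 \<Longrightarrow> t \<notin> eqs" using finite_avoid_right[OF finite_eqs] by metis
  obtain r2 where r2: "r2 > 0" "\<And>t. s < t \<Longrightarrow> t \<le> s + r2 \<Longrightarrow> t \<notin> eqs" using finite_avoid_right[OF finite_eqs] by metis
  define r where "r = min (min r1 r2) (min s (1 - s)) / 2"
  have r: "r > 0" "r \<le> r1" "r \<le> r2" "r < s" "r < 1 - s" using r1 r2 assms by (auto simp: r_def)
  have s_eqs: "s \<notin> eqs" "0 \<notin> eqs" using eq \<gamma>_0 by (auto simp: eqs_def)
  have reg: "t \<notin> eqs" if "t \<in> {0..r} \<union> {s..s + r}" for t
    using that r1(2)[of t] r2(2)[of t] r s_eqs by (cases "t = 0"; cases "t = s") auto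
  have o1: "orbit_segment S \<gamma> 0 r" by (rule \<gamma>_orbit_eqs) (use r assms reg in auto)
  have o2: "orbit_segment S \<gamma> s (s + r)" by (rule \<gamma>_orbit_eqs) (use r assms reg in auto)
  obtain u T k where u: "integral_curve S u {0..T}" "continuous_on {0..r} k" "strict_mono_on {0..r} k" "k 0 = 0" "k r = T"
    "\<forall>t\<in>{0..r}. \<gamma> t = u (k t)"
    using o1 by (auto simp: orbit_segment_def)
  obtain u' T' k' where u': "integral_curve S u' {0..T'}" "continuous_on {s..s + r} k'" "strict_mono_on {s..s + r} k'" "k' s = 0" "k' (s + r) = T'"
    "\<forall>t\<in>{s..s + r}. \<gamma> t = u' (k' t)"
    using o2 by (auto simp: orbit_segment_def)
  define T0 where "T0 = min T T'"
  have "0 < T" "0 < T'" using strict_mono_onD[OF u(3), of 0 r] strict_mono_onD[OF u'(3), of s "s + r"] u(4,5) u'(4,5) r by auto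
  then have T0: "0 < T0" "T0 \<le> T" "T0 \<le> T'" by (auto simp: T0_def)
  have "u T0 = u' T0"
  proof (rule integral_curve_unique)
    show "integral_curve S u {0..T0}" by (rule integral_curve_subset[OF u(1)]) (use T0 in auto)
    show "integral_curve S u' {0..T0}" by (rule integral_curve_subset[OF u'(1)]) (use T0 in auto)
    show "u 0 = u' 0" using eq u(4,6) u'(4,6) r by auto
  qed (use T0 in auto)
  have "k 0 \<le> T0" "T0 \<le> k r" "0 \<le> r" "k' s \<le> T0" "T0 \<le> k' (s + r)" "s \<le> s + r" using u(4,5) u'(4,5) T0 r by auto
  then obtain t t' where t: "0 \<le> t" "t \<le> r" "k t = T0" and t': "s \<le> t'" "t' \<le> s + r" "k' t' = T0"
    using IVT'[of k 0 T0 r] IVT'[of k' s T0 "s + r"] u(2) u'(2) by auto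
  have "0 < t" using t u(4) T0 by (cases "t = 0") auto
  moreover have "\<gamma> t = \<gamma> t'" using t t' u(6) u'(6) \<open>u T0 = u' T0\<close> by auto
  ultimately have "t = t'" using inj_onD[OF \<gamma>_inj] t t' r assms by auto
  then show False using t t' r by simp
qed

lemma \<gamma>_distinct:
  assumes "0 \<le> s" "s < t" "t \<le> 1" "s = 0 \<Longrightarrow> t < 1"
  shows "\<gamma> s \<noteq> \<gamma> t"
proof (cases "s = 0")
  case True
  then show ?thesis using no_return[of t] assms by force
next
  case False
  show ?thesis
  proof (cases "t = 1")
    case True
    then show ?thesis using no_return[of s] \<gamma>_closed assms False by auto
  next
    case t1: False
    then show ?thesis using inj_onD[OF \<gamma>_inj, of s t] assms False by auto
  qed
qed

text \<open>A partial transit from the base point, with F required only to tend to 0. Compared with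
  \<open>transit_map\<close>, positivity is dropped because an auxiliary transversal may be oriented
  so that its coordinate is negative along the orbits.\<close>

definition reaches :: "real \<Rightarrow> (real \<Rightarrow> 'm) \<Rightarrow> (real \<Rightarrow> real) \<Rightarrow> bool" where
  "reaches t \<tau> F \<longleftrightarrow> half_transversal S \<tau> \<and> \<tau> 0 = \<gamma> t \<and> (F \<longlongrightarrow> 0) (at_right 0) \<and>
     (\<exists>c. (\<forall>\<^sub>F z in at_right 0. orbit_segment S (c z) 0 t \<and> c z 0 = \<sigma> z \<and> c z t = \<tau> (F z)) \<and>
       graph_near \<gamma> 0 t c (at_right 0))"

lemma reachesE:
  assumes "reaches t \<tau> F"
  obtains c where "\<forall>\<^sub>F z in at_right 0. orbit_segment S (c z) 0 t \<and> c z 0 = \<sigma> z \<and> c z t = \<tau> (F z)"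
    "graph_near \<gamma> 0 t c (at_right 0)"
  using assms unfolding reaches_def by blast

lemma transit_reaches: "transit_map S \<gamma> 0 t \<sigma> \<tau> F \<Longrightarrow> reaches t \<tau> F"
  unfolding transit_map_def reaches_def follows_iff using filterlim_at_right_0_nhds by blast

text \<open>The filter Q is \<open>nhds 0\<close> for a regular piece and \<open>at_right 0\<close>
  for the passage of a saddle, where the transit is known on one side only.\<close>

lemma reaches_glue:
  assumes E: "reaches a \<tau> E" and ab: "0 \<le> a" "a \<le> b"
    and \<tau>': "half_transversal S \<tau>'" "\<tau>' 0 = \<gamma> b"
    and lim: "filterlim E Q (at_right 0)" "filterlim D (nhds 0) Q"
    and d: "\<forall>\<^sub>F z in Q. orbit_segment S (d z) a b \<and> d z a = \<tau> z \<and> d z b = \<tau>' (D z)"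
    and near: "graph_near \<gamma> a b d Q"
  shows "reaches b \<tau>' (\<lambda>z. D (E z))"
proof -
  obtain c where c: "\<forall>\<^sub>F z in at_right 0. orbit_segment S (c z) 0 a \<and> c z 0 = \<sigma> z \<and> c z a = \<tau> (E z)"
    and nearc: "graph_near \<gamma> 0 a c (at_right 0)" using reachesE[OF E] .
  define e where "e = (\<lambda>z s. if s \<le> a then c z s else d (E z) s)"
  have "graph_near \<gamma> 0 b e (at_right 0)"
    unfolding e_def by (rule graph_near_glue[OF nearc graph_near_compose[OF near lim(1)] ab])
  moreover have "\<forall>\<^sub>F z in at_right 0. orbit_segment S (e z) 0 b \<and> e z 0 = \<sigma> z \<and> e z b = \<tau>' (D (E z))"
    using c eventually_compose_filterlim[OF d lim(1)]
  proof eventually_elim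
    case (elim z)
    have "orbit_segment S (e z) 0 b"
      unfolding e_def by (rule orbit_segment_glue) (use elim ab in auto)
    moreover have "e z b = \<tau>' (D (E z))"
      using elim ab by (cases "a = b") (auto simp: e_def)
    ultimately show ?case using elim ab by (simp add: e_def)
  qed
  moreover have "((\<lambda>z. D (E z)) \<longlongrightarrow> 0) (at_right 0)" using filterlim_compose[OF lim(2,1)] .
  ultimately show ?thesis unfolding reaches_def using \<tau>' by blast
qed

lemma reaches_transit:
  assumes "reaches a \<tau> E" "filterlim E (at_right 0) (at_right 0)" "transit_map S \<gamma> a b \<tau> \<tau>' D" "0 \<le> a" "a \<le> b"
  shows "reaches b \<tau>' (\<lambda>z. D (E z))"
proof -
  obtain d where d: "\<forall>\<^sub>F z in at_right 0. orbit_segment S (d z) a b \<and> d z a = \<tau> z \<and> d z b = \<tau>' (D z)"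
    "graph_near \<gamma> a b d (at_right 0)"
    using assms(3) by (auto simp: transit_map_def follows_iff)
  show ?thesis
  proof (rule reaches_glue[where D = D and d = d and Q = "at_right 0", OF assms(1,4,5) _ _ assms(2) _ d])
  qed (use assms(3) filterlim_at_right_0_nhds in \<open>auto simp: transit_map_def\<close>)
qed

lemma reaches_extend:
  assumes F: "reaches t \<tau> F" and t: "0 \<le> t" "t < t'" "t' \<le> 1" and reg: "eqs \<inter> {t..t'} = {}"
    and \<tau>': "half_transversal S \<tau>'" "\<tau>' 0 = \<gamma> t'"
  obtains P where "analytic_diffeo P" "reaches t' \<tau>' (\<lambda>z. P (F z))"
proof -
  have orb: "orbit_segment S \<gamma> t t'" by (rule \<gamma>_orbit_eqs[OF t reg])
  have \<tau>: "half_transversal S \<tau>" "\<tau> 0 = \<gamma> t" "(F \<longlongrightarrow> 0) (at_right 0)" using F by (auto simp: reaches_def)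
  have nr: "\<not> equilibrium S (\<gamma> s)" if "s \<in> {t..t'}" for s by (rule not_eqs_Icc[OF t(1,3) reg that])
  obtain P d where P: "analytic_diffeo P"
    and d: "\<forall>\<^sub>F z in nhds 0. orbit_segment S (d z) t t' \<and> d z t = \<tau> z \<and> d z t' = \<tau>' (P z)"
    and near: "graph_near \<gamma> t t' d (nhds 0)"
    using long_flow[OF orb nr t(2) \<tau>(1,2) \<tau>'] .
  have "reaches t' \<tau>' (\<lambda>z. P (F z))"
    by (rule reaches_glue[OF F t(1) _ \<tau>' \<tau>(3) analytic_diffeo_tendsto[OF P] d near]) (use t in simp)
  then show ?thesis using that P by blast
qed

lemma reaches_start:
  assumes t: "0 < t" "t \<le> 1" and reg: "eqs \<inter> {0..t} = {}" and \<tau>: "half_transversal S \<tau>" "\<tau> 0 = \<gamma> t"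
  obtains P where "analytic_diffeo P" "reaches t \<tau> P"
proof -
  have orb: "orbit_segment S \<gamma> 0 t" by (rule \<gamma>_orbit_eqs) (use t reg in auto)
  have nr: "\<not> equilibrium S (\<gamma> s)" if "s \<in> {0..t}" for s by (rule not_eqs_Icc[OF _ t(2) reg that]) simp
  obtain P d where P: "analytic_diffeo P"
    and d: "\<forall>\<^sub>F z in nhds 0. orbit_segment S (d z) 0 t \<and> d z 0 = \<sigma> z \<and> d z t = \<tau> (P z)"
    and near: "graph_near \<gamma> 0 t d (nhds 0)"
    using long_flow[OF orb nr t(1) \<sigma> \<tau>] .
  have le: "at_right (0::real) \<le> nhds 0" by (simp add: at_within_def)
  have "reaches t \<tau> P"
    unfolding reaches_def
  proof (intro conjI exI[of _ d] \<tau>)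
    show "(P \<longlongrightarrow> 0) (at_right 0)" by (rule filterlim_mono[OF analytic_diffeo_tendsto[OF P] order_refl le])
    show "\<forall>\<^sub>F z in at_right 0. orbit_segment S (d z) 0 t \<and> d z 0 = \<sigma> z \<and> d z t = \<tau> (P z)"
      by (rule filter_leD[OF le d])
    show "graph_near \<gamma> 0 t d (at_right 0)"
      using near filter_leD[OF le] unfolding graph_near_def by blast
  qed
  then show ?thesis using that P by blast
qed

text \<open>At t = 1 the curve is closed, and the condition in \<open>transit_unique\<close> that
  orbits also start on \<tau> holds because \<tau> is then \<sigma>.\<close>

lemma reaches_unique:
  assumes F: "reaches t \<tau> F" and F': "reaches t \<tau> F'" and t: "0 < t" "t \<le> 1" "t = 1 \<Longrightarrow> \<tau> = \<sigma>"
  shows "\<forall>\<^sub>F z in at_right 0. F z = F' z"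
proof -
  have \<tau>: "half_transversal S \<tau>" "\<tau> 0 = \<gamma> t" and lim: "(F \<longlongrightarrow> 0) (at_right 0)" "(F' \<longlongrightarrow> 0) (at_right 0)"
    using F F' by (auto simp: reaches_def)
  obtain c where c: "\<forall>\<^sub>F z in at_right 0. orbit_segment S (c z) 0 t \<and> c z 0 = \<sigma> z \<and> c z t = \<tau> (F z)"
    and nearc: "graph_near \<gamma> 0 t c (at_right 0)" using reachesE[OF F] .
  obtain d where d: "\<forall>\<^sub>F z in at_right 0. orbit_segment S (d z) 0 t \<and> d z 0 = \<sigma> z \<and> d z t = \<tau> (F' z)"
    and neard: "graph_near \<gamma> 0 t d (at_right 0)" using reachesE[OF F'] .
  have ct: "continuous_map (top_of_set {0..t}) M \<gamma>" by (rule \<gamma>_continuous_sub) (use t in auto)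
  have ne: "\<gamma> s \<noteq> \<gamma> t" if "0 < s" "s < t" for s using \<gamma>_distinct[of s t] that t by auto
  obtain W \<delta> where W: "openin (prod_topology euclidean M) W" "\<forall>s\<in>{0..t}. (s, \<gamma> s) \<in> W" "\<delta> > 0"
    and unique: "transit_unique \<gamma> 0 t \<tau> W \<delta>"
    using unique_transit[OF ct t(1) ne \<tau>] .
  have "\<forall>\<^sub>F z in at_right 0. \<forall>s\<in>{0..t}. (s, c z s) \<in> W" "\<forall>\<^sub>F z in at_right 0. \<forall>s\<in>{0..t}. (s, d z s) \<in> W"
    using nearc neard W unfolding graph_near_def by blast+
  moreover have "\<forall>\<^sub>F z in at_right 0. \<bar>F z\<bar> < \<delta>" "\<forall>\<^sub>F z in at_right 0. \<bar>F' z\<bar> < \<delta>" "\<forall>\<^sub>F z in at_right (0::real). \<bar>z\<bar> < \<delta>"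
    using order_tendstoD(2)[OF tendsto_rabs_zero W(3)] lim tendsto_ident_at by auto
  ultimately show ?thesis
    using c d
  proof eventually_elim
    case (elim z)
    show ?case
    proof (rule transit_uniqueD[OF unique, of "c z" "d z" _ _ z])
      show "c z 0 = \<tau> z \<and> \<bar>z\<bar> < \<delta>" if "\<gamma> 0 = \<gamma> t"
      proof -
        have "t = 1" using \<gamma>_distinct[of 0 t] that t by force
        then show ?thesis using t(3) elim by simp
      qed
    qed (use elim in auto)
  qed
qed

text \<open>A negative derivative of Q at 0 would make Q (F z) negative for small z > 0, so the
  derivative is positive.\<close>

lemma analytic_diffeo_positive:
  fixes F :: "real \<Rightarrow> real"
  assumes Q: "analytic_diffeo Q" and F: "filterlim F (at_right 0) (at_right 0)"
    and pos: "\<forall>\<^sub>F z in at_right 0. Q (F z) > 0"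
  shows "\<forall>\<^sub>F z in at_right 0. Q z > 0"
proof -
  obtain D where D: "D \<noteq> 0" "(Q has_real_derivative D) (at 0)" and Q0: "Q 0 = 0"
    using Q by (auto simp: analytic_diffeo_def)
  show ?thesis
  proof (cases "D > 0")
    case True
    then show ?thesis
      using DERIV_pos_inc_right[OF D(2)] Q0 unfolding eventually_at_right_field by auto
  next
    case False
    then have "D < 0" using D by simp
    then have "\<forall>\<^sub>F z in at_right 0. Q z < 0"
      using DERIV_neg_dec_right[OF D(2)] Q0 unfolding eventually_at_right_field by auto
    from eventually_conj[OF eventually_compose_filterlim[OF this F] pos]
    have "\<forall>\<^sub>F z in at_right (0::real). False" by (rule eventually_mono) linarith
    then show ?thesis by simp
  qed
qed

text \<open>
  The section at \<open>\<gamma> e\<close>, behind both \<open>\<gamma> t\<close> and \<open>\<gamma> t'\<close>, is needed since \<open>t'\<close> may be smaller than \<open>t\<close>.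
\<close>

lemma reaches_link:
  assumes F: "reaches t \<tau> F" "filterlim F (at_right 0) (at_right 0)"
    and F': "reaches t' \<tau>' F'" "filterlim F' (at_right 0) (at_right 0)"
    and t: "0 < t" "t < 1" "0 < t'" "t' \<le> 1" "t' = 1 \<Longrightarrow> \<tau>' = \<sigma>"
    and reg: "eqs \<inter> {min t t'..max t t'} = {}"
  obtains Q where "analytic_diffeo Q" "\<forall>\<^sub>F z in at_right 0. F' z = Q (F z)" "\<forall>\<^sub>F z in at_right 0. Q z > 0"
proof -
  have "\<exists>Q. analytic_diffeo Q \<and> (\<forall>\<^sub>F z in at_right 0. F' z = Q (F z))"
  proof (cases "t < t'")
    case True
    obtain P where P: "analytic_diffeo P" "reaches t' \<tau>' (\<lambda>z. P (F z))"
      using reaches_extend[OF F(1) _ True t(4), of \<tau>'] reg True t F'(1) by (auto simp: reaches_def)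
    show ?thesis using reaches_unique[OF F'(1) P(2) t(3,4,5)] P(1) by blast
  next
    case False
    then have le: "t' \<le> t" by simp
    obtain r where r: "r > 0" "\<And>s. t < s \<Longrightarrow> s \<le> t + r \<Longrightarrow> s \<notin> eqs" using finite_avoid_right[OF finite_eqs] by metis
    \<comment> \<open>A point behind t, before the next equilibrium and before 1: the pieces from t'
      and from t to e are regular, and the two transits to e can be compared there.\<close>
    define e where "e = t + min r (1 - t) / 2"
    have e: "t < e" "e < 1" "e \<le> t + r" using r t by (auto simp: e_def min_def field_simps)
    have reg': "eqs \<inter> {t'..e} = {}"
    proof -
      have "s \<notin> eqs" if "s \<in> {t'..e}" for s using that reg r(2)[of s] e le by (cases "s \<le> t") auto
      then show ?thesis by blast
    qed
    have "e \<in> {0..1}" "\<not> equilibrium S (\<gamma> e)" using not_eqs_Icc[OF _ _ reg', of e] e le t by auto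
    moreover have "\<gamma> e \<in> topspace M" using continuous_map_image_subset_topspace[OF \<gamma>_continuous] \<open>e \<in> {0..1}\<close> by auto
    ultimately obtain \<mu> where \<mu>: "half_transversal S \<mu>" "\<mu> 0 = \<gamma> e" using half_transversal_exists by metis
    have "eqs \<inter> {t..e} = {}" using reg' le by (simp add: disjoint_iff)
    then obtain P where P: "analytic_diffeo P" "reaches e \<mu> (\<lambda>z. P (F z))"
      using reaches_extend[OF F(1) _ e(1) _ _ \<mu>] e t by auto
    obtain P' where P': "analytic_diffeo P'" "reaches e \<mu> (\<lambda>z. P' (F' z))"
      using reaches_extend[OF F'(1) _ _ _ reg' \<mu>] le e t by auto
    obtain Q where Q: "analytic_diffeo Q" "\<forall>\<^sub>F z in nhds 0. Q (P' z) = z" using analytic_diffeo_inverse[OF P'(1)] by metis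
    have "\<forall>\<^sub>F z in at_right 0. P (F z) = P' (F' z)"
      using reaches_unique[OF P(2) P'(2)] e t by auto
    moreover have "\<forall>\<^sub>F z in at_right 0. Q (P' (F' z)) = F' z"
      by (rule eventually_compose_filterlim[OF Q(2) filterlim_at_right_0_nhds[OF F'(2)]])
    ultimately have "\<forall>\<^sub>F z in at_right 0. F' z = Q (P (F z))" by eventually_elim simp
    then show ?thesis using analytic_diffeo_comp[OF Q(1) P(1)] by blast
  qed
  then obtain Q where Q: "analytic_diffeo Q" "\<forall>\<^sub>F z in at_right 0. F' z = Q (F z)" by blast
  have "\<forall>\<^sub>F z in at_right 0. Q (F z) > 0"
    using filterlim_at_right_0_pos[OF F'(2)] Q(2) by eventually_elim simp
  then show ?thesis using that Q analytic_diffeo_positive[OF Q(1) F(2)] by blast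
qed

abbreviation bal where "bal \<equiv> centre_balance S \<gamma>"

definition centres where "centres = {s. passes_from_centre S \<gamma> s}"
definition hyps where "hyps = {s. passes_from_hyperbolic S \<gamma> s}"

lemma centres_hyps_equilibrium: "s \<in> centres \<union> hyps \<Longrightarrow> equilibrium S (\<gamma> s)"
  by (auto simp: centres_def hyps_def passes_from_centre_def passes_from_hyperbolic_def)

text \<open>Injectivity of \<gamma> turns the count of points into a count of parameters, which
  grows by one element at a time.\<close>

lemma bal_eq:
  assumes "t \<le> 1"
  shows "bal t = int (card (eqs \<inter> {..t} \<inter> centres)) - int (card (eqs \<inter> {..t} \<inter> hyps))"
proof -
  have "card (\<gamma> ` {s. 0 < s \<and> s \<le> t \<and> s \<in> X}) = card (eqs \<inter> {..t} \<inter> X)" if X: "\<And>s. s \<in> X \<Longrightarrow> equilibrium S (\<gamma> s)" for X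
  proof -
    have "{s. 0 < s \<and> s \<le> t \<and> s \<in> X} = eqs \<inter> {..t} \<inter> X"
      using eqs_interior X assms by (auto simp: eqs_def)
    moreover have "inj_on \<gamma> (eqs \<inter> {..t} \<inter> X)" by (rule inj_on_subset[OF \<gamma>_inj]) (use eqs_interior in auto)
    ultimately show ?thesis by (simp add: card_image)
  qed
  from this[of centres] this[of hyps] show ?thesis
    using centres_hyps_equilibrium by (simp add: centre_balance_def centres_def hyps_def)
qed

lemma bal_cong:
  assumes "s \<le> 1" "t \<le> 1" "eqs \<inter> {..s} = eqs \<inter> {..t}"
  shows "bal s = bal t"
  using assms by (simp add: bal_eq)

lemma bal_step:
  assumes s: "s \<in> eqs" "a < s" "s < b" "b \<le> 1" and only: "eqs \<inter> {a..b} = {s}"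
  shows "bal b = bal a + (if s \<in> centres then 1 else 0) - (if s \<in> hyps then 1 else 0)"
proof -
  have e: "eqs \<inter> {..b} = insert s (eqs \<inter> {..a})"
  proof -
    have "x \<le> a \<or> x = s" if "x \<in> eqs" "x \<le> b" for x using only that by force
    then show ?thesis using s by auto
  qed
  have "card (eqs \<inter> {..b} \<inter> X) = card (eqs \<inter> {..a} \<inter> X) + (if s \<in> X then 1 else 0)" for X
    unfolding e using s finite_eqs by (simp add: Int_insert_left)
  then show ?thesis using s by (simp add: bal_eq)
qed

lemma \<gamma>_left_continuous:
  assumes "s \<in> eqs" "openin M A" "\<gamma> s \<in> A"
  shows "\<forall>\<^sub>F t in at_left s. \<gamma> t \<in> A"
proof -
  have s: "0 < s" "s < 1" using eqs_interior[OF assms(1)] by auto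
  have "\<forall>\<^sub>F t in at s within {0..1}. \<gamma> t \<in> A"
    using eventually_curve[OF \<gamma>_continuous assms(2) _ assms(3)] s by simp
  then have "\<forall>\<^sub>F t in at s. \<gamma> t \<in> A" using at_within_Icc_at[OF s] by simp
  then show ?thesis by (simp add: eventually_at_split)
qed

text \<open>Without exclusivity a saddle could cancel itself in the balance; with it, the jump at s
  is determined by the case in which the Dulac map is given.\<close>

lemma exclusive:
  assumes "s \<in> eqs"
  shows "hyperbolic_saddle S (\<gamma> s) \<Longrightarrow> s \<notin> centres \<and> s \<notin> hyps" "s \<in> centres \<Longrightarrow> s \<notin> hyps"
proof -
  assume "hyperbolic_saddle S (\<gamma> s)"
  then show "s \<notin> centres \<and> s \<notin> hyps"
    using hyperbolic_not_semihyperbolic unfolding centres_def hyps_def passes_from_centre_def passes_from_hyperbolic_def by blast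
next
  assume "s \<in> centres"
  then show "s \<notin> hyps"
    using centre_hyperbolic_exclusive[OF _ _ \<gamma>_left_continuous[OF assms]] by (auto simp: centres_def hyps_def)
qed

end

section \<open>Induction over the saddles passed\<close>

locale admissible_side = polycycle_side S \<Gamma> \<gamma> \<sigma> + admissible R NC n
  for S :: "('m, 'z) surface_field_scheme" and \<Gamma> \<gamma> \<sigma> R NC n +
  assumes adm: "admissible_polycycle R NC S \<gamma> \<sigma>"
    and nonpos: "\<And>t. t \<in> {0..1} \<Longrightarrow> centre_balance S \<gamma> t \<le> 0"
    and depth: "\<And>t. t \<in> {0..1} \<Longrightarrow> - centre_balance S \<gamma> t \<le> int n"
begin

text \<open>The number of pending exponentials. Truncation to naturals loses nothing on [0, 1],
  where the balance is nonpositive.\<close>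

definition lev where "lev t = nat (- bal t)"

lemma lev_le: "t \<in> {0..1} \<Longrightarrow> lev t \<le> n"
  using depth by (simp add: lev_def nat_le_iff)

lemma log_chart_diffeo:
  assumes "analytic_diffeo Q" "\<forall>\<^sub>F z in at_right 0. Q z > 0"
  shows "germ_of (log_chart Q) \<in> R" "filterlim Q (at_right 0) (at_right 0)"
proof -
  show "germ_of (log_chart Q) \<in> R" using assms log_analytic_R by (simp add: analytic_diffeo_def)
  have "(Q \<longlongrightarrow> 0) (at_right 0)"
    by (rule filterlim_mono[OF analytic_diffeo_tendsto[OF assms(1)] order_refl]) (simp add: at_within_def)
  then show "filterlim Q (at_right 0) (at_right 0)" using assms(2) by (rule filterlim_at_right_0I)
qed

lemma saddle_step:
  assumes s: "s \<in> eqs" and E: "germ_of (log_chart E) \<in> level (lev a)" "filterlim E (at_right 0) (at_right 0)"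
    and ab: "0 < a" "a < s" "s < b" "b < 1" "eqs \<inter> {a..b} = {s}"
    and D: "transit_map S \<gamma> a b \<tau> \<tau>' D"
    and cases: "(hyperbolic_saddle S (\<gamma> s) \<and> germ_of (log_chart D) \<in> R) \<or>
      (passes_from_hyperbolic S \<gamma> s \<and> germ_of (log_chart D) \<in> semihyperbolic_germs R NC) \<or>
      (passes_from_centre S \<gamma> s \<and> (\<exists>D'. inverse_germs_at_0 D' D \<and> germ_of (log_chart D') \<in> semihyperbolic_germs R NC))"
  shows "germ_of (log_chart (\<lambda>z. D (E z))) \<in> level (lev b)"
proof -
  have lim: "filterlim D (at_right 0) (at_right 0)" using D by (simp add: transit_map_def)
  have in01: "a \<in> {0..1}" "b \<in> {0..1}" using ab by auto
  have bal: "bal b = bal a + (if s \<in> centres then 1 else 0) - (if s \<in> hyps then 1 else 0)"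
    by (rule bal_step) (use s ab in auto)
  have np: "bal a \<le> 0" "bal b \<le> 0" using nonpos in01 by auto
  have comp: "germ_of (log_chart (\<lambda>z. D (E z))) = germ_comp (germ_of (log_chart D)) (germ_of (log_chart E))"
    using germ_log_chart_comp[OF lim E(2)] by simp
  consider (hyp) "hyperbolic_saddle S (\<gamma> s)" "germ_of (log_chart D) \<in> R"
    | (from_hyp) "s \<in> hyps" "germ_of (log_chart D) \<in> semihyperbolic_germs R NC"
    | (from_centre) D' where "s \<in> centres" "inverse_germs_at_0 D' D" "germ_of (log_chart D') \<in> semihyperbolic_germs R NC"
    using cases unfolding centres_def hyps_def by blast
  then show ?thesis
  proof cases
    case hyp
    then have "lev b = lev a" using exclusive(1)[OF s] bal by (simp add: lev_def)
    then show ?thesis using level_R[OF hyp(2) lev_le[OF in01(1)] E(1)] comp by simp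
  next
    case from_hyp
    have "s \<notin> centres" using exclusive(2)[OF s] from_hyp(1) by blast
    then have lb: "lev b = Suc (lev a)" using from_hyp(1) bal np by (simp add: lev_def nat_eq_iff)
    have ne: "\<gamma> r \<noteq> \<gamma> b" if "a \<le> r" "r < b" for r using \<gamma>_distinct[of r b] that ab by auto
    \<comment> \<open>Invertibility of the Dulac germ, which its \<open>NC\<close> factor inherits,
      comes from the dynamics: the arc from a to b reaches the point \<gamma> b only at its
      end.\<close>
    have "\<exists>D'. inverse_germs_at_0 D D'"
      by (rule transit_map_invertible[OF D \<gamma>_continuous_sub _ ne]) (use ab in auto)
    then have "germ_of (log_chart D) \<in> Units germ_monoid"
      using inverse_germs_log_chart germ_UnitI by blast
    then show ?thesis
      using level_hyperbolic_to_centre[OF from_hyp(2) _ _ E(1)] lev_le[OF in01(2)] lb comp by simp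
  next
    case from_centre
    have "s \<notin> hyps" using exclusive(2)[OF s] from_centre(1) by blast
    then have la: "lev a = Suc (lev b)" using from_centre(1) bal np by (simp add: lev_def nat_eq_iff)
    show ?thesis
      using level_centre_to_hyperbolic[OF from_centre(3) inverse_germs_log_chart[OF from_centre(2)], of "lev b"]
        E(1) lev_le[OF in01(1)] la comp by simp
  qed
qed

text \<open>Induction on the number of equilibria passed. The sections at a and b around the last
  one are those of its Dulac map; the transit to a passes fewer equilibria, and b is linked to t by
  an analytic diffeomorphism, whichever of them comes first.\<close>

lemma transit_level:
  assumes "transit_map S \<gamma> 0 t \<sigma> \<tau> F" "0 < t" "t \<le> 1" "t = 1 \<Longrightarrow> \<tau> = \<sigma>"
  shows "germ_of (log_chart F) \<in> level (lev t)"
  using assms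
proof (induction "card (eqs \<inter> {..t})" arbitrary: t \<tau> F rule: less_induct)
  case less
  note F = less.prems(1) and t = less.prems(2-4)
  have limF: "filterlim F (at_right 0) (at_right 0)" and \<tau>: "half_transversal S \<tau>" "\<tau> 0 = \<gamma> t"
    using F by (auto simp: transit_map_def)
  have reachF: "reaches t \<tau> F" by (rule transit_reaches[OF F])
  have t_reg: "t \<notin> eqs" using half_transversal_regular[OF \<tau>(1)] \<tau>(2) by (auto simp: eqs_def)
  show ?case
  proof (cases "eqs \<inter> {..t} = {}")
    case True
    then have reg: "eqs \<inter> {0..t} = {}" by auto
    obtain P where P: "analytic_diffeo P" "reaches t \<tau> P" using reaches_start[OF t(1,2) reg \<tau>] .
    have eq: "\<forall>\<^sub>F z in at_right 0. F z = P z" by (rule reaches_unique[OF reachF P(2) t])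
    then have "\<forall>\<^sub>F z in at_right 0. P z > 0"
      using filterlim_at_right_0_pos[OF limF] by eventually_elim simp
    then have "germ_of (log_chart P) \<in> R" using log_chart_diffeo(1)[OF P(1)] by blast
    then have "germ_of (log_chart F) \<in> R" using germ_log_chart_cong[OF limF eq] by simp
    moreover have "lev t = 0" using True t by (simp add: lev_def bal_eq)
    moreover have "germ_id \<in> level 0" by (simp add: level_0 id_G)
    ultimately show ?thesis using level_R[of "germ_of (log_chart F)" 0 germ_id] by simp
  next
    case False
    define s where "s = Max (eqs \<inter> {..t})"
    have fin: "finite (eqs \<inter> {..t})" using finite_eqs by simp
    have s: "s \<in> eqs" "s \<le> t" using Max_in[OF fin False] by (auto simp: s_def)
    have smax: "r \<le> s" if "r \<in> eqs" "r \<le> t" for r unfolding s_def using fin that by (intro Max_ge) auto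
    have st: "s < t" using s t_reg by (cases "s = t") auto
    have s01: "0 < s" "s < 1" using eqs_interior[OF s(1)] by auto
    have "admissible_saddle R NC S \<gamma> \<sigma> s" using adm s by (auto simp: admissible_polycycle_def eqs_def)
    then obtain D where tr: "transit_at_equilibrium S \<gamma> \<sigma> s D"
      and cases: "(hyperbolic_saddle S (\<gamma> s) \<and> germ_of (log_chart D) \<in> R) \<or>
      (passes_from_hyperbolic S \<gamma> s \<and> germ_of (log_chart D) \<in> semihyperbolic_germs R NC) \<or>
      (passes_from_centre S \<gamma> s \<and> (\<exists>D'. inverse_germs_at_0 D' D \<and> germ_of (log_chart D') \<in> semihyperbolic_germs R NC))"
      unfolding admissible_saddle_def by blast
    obtain a b \<mu> \<mu>' E where ab: "0 < a" "a < s" "s < b" "b < 1" and only': "\<forall>t\<in>{a..b}. equilibrium S (\<gamma> t) \<longrightarrow> t = s"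
      and E: "transit_map S \<gamma> 0 a \<sigma> \<mu> E" and D: "transit_map S \<gamma> a b \<mu> \<mu>' D"
      using tr unfolding transit_at_equilibrium_def by blast
    have only: "eqs \<inter> {a..b} = {s}" using only' s ab by (auto simp: eqs_def)
    have "s \<in> eqs \<inter> {..t}" "s \<notin> eqs \<inter> {..a}" "eqs \<inter> {..a} \<subseteq> eqs \<inter> {..t}" using ab st s by auto
    then have "eqs \<inter> {..a} \<subset> eqs \<inter> {..t}" by blast
    then have "card (eqs \<inter> {..a}) < card (eqs \<inter> {..t})" using fin psubset_card_mono by blast
    from less.hyps[OF this E] have lE: "germ_of (log_chart E) \<in> level (lev a)" using ab s01 by simp
    have limE: "filterlim E (at_right 0) (at_right 0)" and limD: "filterlim D (at_right 0) (at_right 0)"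
      using E D by (auto simp: transit_map_def)
    have lDE: "germ_of (log_chart (\<lambda>z. D (E z))) \<in> level (lev b)"
      by (rule saddle_step[OF s(1) lE limE ab only D cases])
    have limDE: "filterlim (\<lambda>z. D (E z)) (at_right 0) (at_right 0)" using filterlim_compose[OF limD limE] .
    have reachDE: "reaches b \<mu>' (\<lambda>z. D (E z))"
      by (rule reaches_transit[OF transit_reaches[OF E] limE D]) (use ab in auto)
    \<comment> \<open>An equilibrium there would lie behind s: if it is at most t, this contradicts
      the choice of s as the last one, and otherwise it lies in [a, b], where s is the only
      one.\<close>
    have reg: "r \<notin> eqs" if r: "r \<in> {min b t..max b t}" for r
    proof
      assume re: "r \<in> eqs"
      have "s < r" using r ab st by auto
      then have "\<not> r \<le> t" using smax[OF re] by auto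
      then have "r \<in> {a..b}" using r ab st by (auto simp: max_def split: if_splits)
      then show False using only re \<open>s < r\<close> by auto
    qed
    then have reg': "eqs \<inter> {min b t..max b t} = {}" by blast
    obtain Q where Q: "analytic_diffeo Q" "\<forall>\<^sub>F z in at_right 0. F z = Q (D (E z))" "\<forall>\<^sub>F z in at_right 0. Q z > 0"
      using reaches_link[OF reachDE limDE reachF limF _ ab(4) t reg'] ab s01 by (metis less_trans)
    have "germ_of (log_chart F) = germ_comp (germ_of (log_chart Q)) (germ_of (log_chart (\<lambda>z. D (E z))))"
      using germ_log_chart_cong[OF limF Q(2)] germ_log_chart_comp[OF log_chart_diffeo(2)[OF Q(1,3)] limDE] by simp
    moreover have "lev t = lev b"
    proof -
      have "eqs \<inter> {..b} = eqs \<inter> {..t}"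
      proof -
        have "r \<le> b \<longleftrightarrow> r \<le> t" if "r \<in> eqs" for r
          using reg[of r] that by (cases "r \<le> b"; cases "r \<le> t"; cases "b \<le> t") (auto simp: min_def max_def)
        then show ?thesis by blast
      qed
      then show ?thesis using bal_cong[of b t] ab t by (simp add: lev_def)
    qed
    ultimately show ?thesis
      using level_R[OF log_chart_diffeo(1)[OF Q(1,3)] lev_le lDE] ab by simp
  qed
qed

end

theorem theorem2p1:
  fixes R NC :: "germ set" and n :: nat
  assumes "admissible_pair R NC"
  shows "(\<lambda>\<Delta>. germ_of (log_chart \<Delta>)) ` monodromy_maps TYPE('m) R NC n \<subseteq>
    generated_group
      (Aff \<union> (\<Union>i\<in>{..n}. (conj_exp ^^ i) ` R0 R) \<union>
       (\<Union>j\<in>{..<n}. (conj_exp ^^ j) ` NC))"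
proof (intro image_subsetI)
  fix \<Delta> assume "\<Delta> \<in> monodromy_maps TYPE('m) R NC n"
  then obtain S :: "'m surface_field" and \<Gamma> \<gamma> \<sigma> where S: "analytic_surface S" "analytic_vector_field S"
    and poly: "polycycle S \<Gamma>" and param: "flow_parametrization S \<Gamma> \<gamma>" and \<Delta>: "monodromy_map S \<gamma> \<sigma> \<Delta>"
    and adm: "admissible_polycycle R NC S \<gamma> \<sigma>" and bal: "centre_balance S \<gamma> 1 = 0"
    "\<forall>t\<in>{0..1}. centre_balance S \<gamma> t \<le> 0" and n: "int n = - Min (centre_balance S \<gamma> ` {0..1})"
    unfolding monodromy_maps_def by blast
  have \<sigma>: "half_transversal S \<sigma>" "\<sigma> 0 = \<gamma> 0" using \<Delta> by (auto simp: monodromy_map_def)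
  interpret polycycle_side S \<Gamma> \<gamma> \<sigma>
    by unfold_locales (fact S poly param \<sigma>)+
  \<comment> \<open>The bound by \<open>Min\<close> needs a finite set of values; each value is
    determined by a subset of the finite set \<open>eqs\<close>.\<close>
  have fin: "finite (centre_balance S \<gamma> ` {0..1})"
  proof (rule finite_surj[of "Pow eqs" _ "\<lambda>X. int (card (X \<inter> centres)) - int (card (X \<inter> hyps))"])
    show "centre_balance S \<gamma> ` {0..1} \<subseteq> (\<lambda>X. int (card (X \<inter> centres)) - int (card (X \<inter> hyps))) ` Pow eqs"
      using bal_eq by (auto intro!: image_eqI[of _ _ "eqs \<inter> {.._}"])
  qed (simp add: finite_eqs)
  have depth: "- centre_balance S \<gamma> t \<le> int n" if "t \<in> {0..1}" for t
    using Min_le[OF fin, of "centre_balance S \<gamma> t"] that n by auto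
  interpret admissible_side S \<Gamma> \<gamma> \<sigma> R NC n
    by unfold_locales (use assms adm bal depth in auto)
  \<comment> \<open>The monodromy map is the partial transit for the full turn, ending on the
    section on which it starts; at t = 1 the balance is zero, so no exponential is left.\<close>
  have "transit_map S \<gamma> 0 1 \<sigma> \<sigma> \<Delta>"
    using \<Delta> \<gamma>_closed unfolding monodromy_map_def transit_map_def by auto
  from transit_level[OF this] have "germ_of (log_chart \<Delta>) \<in> level (lev 1)" by simp
  moreover have "lev 1 = 0" using bal by (simp add: lev_def)
  ultimately show "germ_of (log_chart \<Delta>) \<in> generated_group
      (Aff \<union> (\<Union>i\<in>{..n}. (conj_exp ^^ i) ` R0 R) \<union> (\<Union>j\<in>{..<n}. (conj_exp ^^ j) ` NC))"
    by (simp add: level_0 G_def H_def)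
qed

end
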